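(* Let $M$ be a favourable $\mathbb U$-module (with the ordered basis of $\mathfrak N$ and the homogeneous monomial order for which it is favourable fixed). i) There exists a flat degeneration of the affine cone $\hat{\mathcal F}_{\mathbb U}(M)$ into the affine cone $\hat{\mathcal F}_{\mathbb U^a}(M^a)$, and for both there exists a flat degeneration into the affine cone $\hat{\mathcal F}_{\mathbb U^a}(M^t)$. ii) There exists a flat degeneration of $\mathcal F_{\mathbb U}(M)$ into $\mathcal F_{\mathbb U^a}(M^a)$, and for both there exists a flat degeneration into $\mathcal F_{\mathbb U^a}(M^t)$. The corresponding flat families are equipped with a $\mathbb C^*$-action such that the projection onto $\mathbb A^1$ is equivariant with respect to the action of $\mathbb C^*$ on $\mathbb A^1$ in which $t\in\mathbb C^*$ acts by multiplication by $t^{-1}$.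
   Context: $\mathbb U$ is a complex algebraic unipotent group with Lie algebra $\mathfrak N$, acting on a finite dimensional complex vector space $M$ which is cyclic: $M=\mathrm U(\mathfrak N)v_M$, $v_M\neq0$. $\mathfrak N^a$ is the abelian Lie algebra with underlying vector space $\mathfrak N$, so $\mathrm U(\mathfrak N^a)=S(\mathfrak N)$, and $\mathbb U^a=\exp(\mathfrak N^a)$. Fix an ordered basis $f_1>\dots>f_N$ of $\mathfrak N$. For $\mathbf p\in\mathbb Z_{\ge0}^N$ put $\mathbf f^{\mathbf p}=f_1^{p_1}\cdots f_N^{p_N}$, $|\mathbf p|=\sum p_i$. An (induced) homogeneous monomial order is a total order on $\mathbb Z_{\ge 0}^N$, compatible with addition, with $\mathbf e_1>\dots>\mathbf e_N$, and such that $|\mathbf p|<|\mathbf q|$ implies $\mathbf p<\mathbf q$. $\mathrm{es}(M)$ is the set of $\mathbf p$ with $\mathbf f^{\mathbf p}v_M\notin\mathrm{span}\{\mathbf f^{\mathbf q}v_M:\mathbf q<\mathbf p\}$. $M^a=\bigoplus_{s\ge 0}M_s/M_{s-1}$ with $M_s=\mathrm{span}\{x_1\cdots x_lv_M: l\le s,\ x_i\in\mathfrak N\}$; $M^t=\bigoplus_{\mathbf p}F_{\mathbf p}/F_{<\mathbf p}$ with $F_{\mathbf p}=\mathrm{span}\{\mathbf f^{\mathbf q}v_M:\mathbf q\le\mathbf p\}$, $F_{<\mathbf p}=\mathrm{span}\{\mathbf f^{\mathbf q}v_M:\mathbf q<\mathbf p\}$. Both are cyclic modules over $S(\mathfrak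 N)=\mathbb C[f_1,\dots,f_N]$ (each $f_i$ acts by the induced map on graded pieces, of degree $1$, resp. $\mathbf e_i$), generated by the images $v_{M^a}$, $v_{M^t}$ of $v_M$; hence $\mathbb U^a$ acts on both. $\mathcal F_{\mathbb U}(M)=\overline{\mathbb U.[v_M]}\subseteq\mathbb P(M)$, $\mathcal F_{\mathbb U^a}(M^a)=\overline{\mathbb U^a.[v_{M^a}]}\subseteq\mathbb P(M^a)$, $\mathcal F_{\mathbb U^a}(M^t)=\overline{\mathbb U^a.[v_{M^t}]}\subseteq\mathbb P(M^t)$; a hat denotes the affine cone in $M$, $M^a$, $M^t$ respectively. A lattice polytope $P$ is normal if for every $n\ge1$ each lattice point of $nP$ is a sum of $n$ lattice points of $P$. $M^{\odot n}=\mathrm U(\mathfrak N)(v_M^{\otimes n})\subseteq M^{\otimes n}$. $M$ is favourable if there exist an ordered basis of $\mathfrak N$ and an induced homogeneous monomial order such that: (1) there is a normal polytope $P(M)\subset\mathbb R^N$ whose set of lattice points $S(M)$ equals $\mathrm{es}(M)$; (2) $\dim M^{\odot n}=\sharp\,nS(M)$ ($n$-fold Minkowski sum) for all $n\in\mathbb N$. A flat degeneration of $X$ into $X_0$ is a flat family over $\mathbb A^1$ whose fibres over all points $\neq0$ are isomorphic to $X$ and whose fibre over $0$ is isomorphic to $X_0$. *)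

theory Defs
  imports
    "HOL-Analysis.Analysis"
    "HOL-Algebra.Module"
    "HOL-Algebra.Ideal"
    "HOL-Algebra.Free_Abelian_Groups"
    "HOL-Library.Function_Algebras"
begin

section \<open>Complex vector spaces as module records\<close>

text \<open>
  Complex vector spaces with an explicit carrier are records of HOL-Algebra; the fields
  \<open>mult\<close> and \<open>one\<close> of a module record play no role.
\<close>

definition mk_space ::
    "'v set \<Rightarrow> 'v \<Rightarrow> ('v \<Rightarrow> 'v \<Rightarrow> 'v) \<Rightarrow> (complex \<Rightarrow> 'v \<Rightarrow> 'v) \<Rightarrow> (complex, 'v) module" where
  "mk_space C z a s =
     \<lparr>carrier = C, monoid.mult = (\<lambda>_ _. undefined), monoid.one = undefined,
      ring.zero = z, ring.add = a, module.smult = s\<rparr>"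

definition complex_line :: "(complex, complex) module" where
  "complex_line = mk_space UNIV 0 (+) (*)"

definition coord_space :: "nat \<Rightarrow> (complex, nat \<Rightarrow> complex) module" where
  "coord_space n =
     mk_space {x. \<forall>i\<ge>n. x i = 0} (\<lambda>_. 0) (\<lambda>x y i. x i + y i) (\<lambda>c x i. c * x i)"

definition vec_space :: "(complex, complex ^ 'm) module" where
  "vec_space = mk_space UNIV 0 (+) (*s)"

definition mat_scale :: "complex \<Rightarrow> complex ^ 'n ^ 'n \<Rightarrow> complex ^ 'n ^ 'n" where
  "mat_scale c A = (\<chi> i j. c * A $ i $ j)"

interpretation mats: vector_space "mat_scale :: complex \<Rightarrow> complex ^ 'n ^ 'n \<Rightarrow> complex ^ 'n ^ 'n"
  by unfold_locales (simp_all add: mat_scale_def vec_eq_iff algebra_simps)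

definition mat_space :: "(complex, complex ^ 'n ^ 'n) module" where
  "mat_space = mk_space UNIV 0 (+) mat_scale"

definition linear_form :: "(complex, 'v) module \<Rightarrow> ('v \<Rightarrow> complex) \<Rightarrow> bool" where
  "linear_form V l \<longleftrightarrow>
     (\<forall>x\<in>carrier V. \<forall>y\<in>carrier V. l (x \<oplus>\<^bsub>V\<^esub> y) = l x + l y) \<and>
     (\<forall>c. \<forall>x\<in>carrier V. l (c \<odot>\<^bsub>V\<^esub> x) = c * l x)"

inductive_set poly_funs :: "(complex, 'v) module \<Rightarrow> ('v \<Rightarrow> complex) set"
  for V :: "(complex, 'v) module" where
  const: "(\<lambda>_. c) \<in> poly_funs V"
| linear: "linear_form V l \<Longrightarrow> l \<in> poly_funs V"
| add: "p \<in> poly_funs V \<Longrightarrow> q \<in> poly_funs V \<Longrightarrow> (\<lambda>x. p x + q x) \<in> poly_funs V"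
| mult: "p \<in> poly_funs V \<Longrightarrow> q \<in> poly_funs V \<Longrightarrow> (\<lambda>x. p x * q x) \<in> poly_funs V"

definition hom_polys :: "(complex, 'v) module \<Rightarrow> nat \<Rightarrow> ('v \<Rightarrow> complex) set" where
  "hom_polys V d =
     {p \<in> poly_funs V. \<forall>c. \<forall>x\<in>carrier V. p (c \<odot>\<^bsub>V\<^esub> x) = c ^ d * p x}"


section \<open>Varieties as spaces with functions\<close>

text \<open>
  Complex varieties are spaces with functions: a topological space (of closed points) and for
  every open \<open>U\<close> a set of regular functions on \<open>U\<close>.  A regular function on \<open>U\<close> is any function on
  the whole type whose restriction to \<open>U\<close> is regular.
\<close>

record 'p funspace =
  zar :: "'p topology"
  regular :: "'p set \<Rightarrow> ('p \<Rightarrow> complex) set"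

definition morphism :: "'p funspace \<Rightarrow> 'q funspace \<Rightarrow> ('p \<Rightarrow> 'q) \<Rightarrow> bool" where
  "morphism X Y \<phi> \<longleftrightarrow>
     continuous_map (zar X) (zar Y) \<phi> \<and>
     (\<forall>W g. openin (zar Y) W \<longrightarrow> g \<in> regular Y W \<longrightarrow>
        g \<circ> \<phi> \<in> regular X {x \<in> topspace (zar X). \<phi> x \<in> W})"

definition isomorphic_spaces :: "'p funspace \<Rightarrow> 'q funspace \<Rightarrow> bool" where
  "isomorphic_spaces X Y \<longleftrightarrow>
     (\<exists>\<phi> \<psi>. morphism X Y \<phi> \<and> morphism Y X \<psi> \<and>
        (\<forall>x\<in>topspace (zar X). \<psi> (\<phi> x) = x) \<and> (\<forall>y\<in>topspace (zar Y). \<phi> (\<psi> y) = y))"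

definition open_subspace :: "'p funspace \<Rightarrow> 'p set \<Rightarrow> 'p funspace" where
  "open_subspace X U = \<lparr>zar = subtopology (zar X) U, regular = regular X\<rparr>"

text \<open>
  The (reduced) structure of a locally closed subset \<open>Z\<close> of an affine space \<open>V\<close>: the nonvanishing
  sets of polynomial functions form a basis of the topology, and regular functions are locally
  quotients of polynomial functions.
\<close>

definition affine_space_on :: "(complex, 'v) module \<Rightarrow> 'v set \<Rightarrow> 'v funspace" where
  "affine_space_on V Z =
     (let T = topology_generated_by {{x \<in> Z. p x \<noteq> 0} |p. p \<in> poly_funs V}
      in \<lparr>zar = T,
          regular = (\<lambda>U. {f. \<forall>x\<in>U. \<exists>W p q. openin T W \<and> x \<in> W \<and> W \<subseteq> U \<and>
             p \<in> poly_funs V \<and> q \<in> poly_funs V \<and>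
             (\<forall>y\<in>W. q y \<noteq> 0 \<and> f y = p y / q y)})\<rparr>)"

definition line :: "(complex, 'v) module \<Rightarrow> 'v \<Rightarrow> 'v set" where
  "line V x = {c \<odot>\<^bsub>V\<^esub> x |c. True}"

definition proj_points :: "(complex, 'v) module \<Rightarrow> 'v set set" where
  "proj_points V = line V ` (carrier V - {\<zero>\<^bsub>V\<^esub>})"

definition proj_space_on :: "(complex, 'v) module \<Rightarrow> 'v set set \<Rightarrow> 'v set funspace" where
  "proj_space_on V Z =
     (let T = topology_generated_by
            {{L \<in> Z. \<forall>x\<in>L - {\<zero>\<^bsub>V\<^esub>}. p x \<noteq> 0} |p d. p \<in> hom_polys V d}
      in \<lparr>zar = T,
          regular = (\<lambda>U. {f. \<forall>K\<in>U. \<exists>W p q d. openin T W \<and> K \<in> W \<and> W \<subseteq> U \<and>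
             p \<in> hom_polys V d \<and> q \<in> hom_polys V d \<and>
             (\<forall>L\<in>W. \<forall>x\<in>L - {\<zero>\<^bsub>V\<^esub>}. q x \<noteq> 0 \<and> f L = p x / q x)})\<rparr>)"

definition affine_cone :: "(complex, 'v) module \<Rightarrow> 'v set set \<Rightarrow> 'v set" where
  "affine_cone V Z = {x \<in> carrier V. x = \<zero>\<^bsub>V\<^esub> \<or> line V x \<in> Z}"

text \<open>
  The product of two varieties, with the usual basis of open sets given by nonvanishing of
  \<open>\<Sum> f\<^sub>i \<otimes> g\<^sub>i\<close> on open rectangles.
\<close>

definition tensor_funs ::
    "'p funspace \<Rightarrow> 'q funspace \<Rightarrow> 'p set \<Rightarrow> 'q set \<Rightarrow> ('p \<times> 'q \<Rightarrow> complex) set" where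
  "tensor_funs X Y U V =
     {(\<lambda>z. \<Sum>i<k. f i (fst z) * g i (snd z)) |(k::nat) f g.
        (\<forall>i<k. f i \<in> regular X U \<and> g i \<in> regular Y V)}"

definition prod_space :: "'p funspace \<Rightarrow> 'q funspace \<Rightarrow> ('p \<times> 'q) funspace" where
  "prod_space X Y =
     (let T = topology_generated_by
            {{z \<in> U \<times> V. h z \<noteq> 0} |U V h. openin (zar X) U \<and> openin (zar Y) V \<and>
               h \<in> tensor_funs X Y U V}
      in \<lparr>zar = T,
          regular = (\<lambda>D. {f. \<forall>z\<in>D. \<exists>W U V p q. openin T W \<and> z \<in> W \<and> W \<subseteq> D \<and> W \<subseteq> U \<times> V \<and>
             openin (zar X) U \<and> openin (zar Y) V \<and>
             p \<in> tensor_funs X Y U V \<and> q \<in> tensor_funs X Y U V \<and>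
             (\<forall>y\<in>W. q y \<noteq> 0 \<and> f y = p y / q y)})\<rparr>)"

definition sheaf_of_functions :: "'p funspace \<Rightarrow> bool" where
  "sheaf_of_functions X \<longleftrightarrow>
     (\<forall>U f g. openin (zar X) U \<longrightarrow> f \<in> regular X U \<longrightarrow> (\<forall>x\<in>U. f x = g x) \<longrightarrow> g \<in> regular X U) \<and>
     (\<forall>U W f. openin (zar X) U \<longrightarrow> openin (zar X) W \<longrightarrow> W \<subseteq> U \<longrightarrow>
        f \<in> regular X U \<longrightarrow> f \<in> regular X W) \<and>
     (\<forall>U f. openin (zar X) U \<longrightarrow>
        (\<forall>x\<in>U. \<exists>W. openin (zar X) W \<and> x \<in> W \<and> W \<subseteq> U \<and> f \<in> regular X W) \<longrightarrow>
        f \<in> regular X U)"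

definition affine_variety :: "'p funspace \<Rightarrow> bool" where
  "affine_variety X \<longleftrightarrow>
     (\<exists>n Z. closedin (zar (affine_space_on (coord_space n) (carrier (coord_space n)))) Z \<and>
        isomorphic_spaces X (affine_space_on (coord_space n) Z))"

text \<open>A variety is separated and of finite type, but not necessarily irreducible.\<close>

definition variety :: "'p funspace \<Rightarrow> bool" where
  "variety X \<longleftrightarrow>
     sheaf_of_functions X \<and>
     (\<exists>\<U>. finite \<U> \<and> \<Union>\<U> = topspace (zar X) \<and>
        (\<forall>U\<in>\<U>. openin (zar X) U \<and> affine_variety (open_subspace X U))) \<and>
     closedin (zar (prod_space X X)) {(x, x) |x. x \<in> topspace (zar X)}"

definition A1 :: "complex funspace" where
  "A1 = affine_space_on complex_line UNIV"

definition Gm :: "complex funspace" where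
  "Gm = open_subspace A1 (UNIV - {0})"


section \<open>Local rings and flatness\<close>

definition germ ::
    "'p funspace \<Rightarrow> 'p \<Rightarrow> 'p set \<Rightarrow> ('p \<Rightarrow> complex) \<Rightarrow> ('p set \<times> ('p \<Rightarrow> complex)) set" where
  "germ X x U f =
     {(V, g). openin (zar X) V \<and> x \<in> V \<and> g \<in> regular X V \<and>
        (\<exists>W. openin (zar X) W \<and> x \<in> W \<and> W \<subseteq> U \<inter> V \<and> (\<forall>y\<in>W. f y = g y))}"

definition stalk :: "'p funspace \<Rightarrow> 'p \<Rightarrow> ('p set \<times> ('p \<Rightarrow> complex)) set ring" where
  "stalk X x =
     \<lparr>carrier = {germ X x U f |U f. openin (zar X) U \<and> x \<in> U \<and> f \<in> regular X U},
      monoid.mult = (\<lambda>a b. \<Union>(U, f)\<in>a. \<Union>(V, g)\<in>b. germ X x (U \<inter> V) (\<lambda>y. f y * g y)),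
      monoid.one = germ X x (topspace (zar X)) (\<lambda>_. 1),
      ring.zero = germ X x (topspace (zar X)) (\<lambda>_. 0),
      ring.add = (\<lambda>a b. \<Union>(U, f)\<in>a. \<Union>(V, g)\<in>b. germ X x (U \<inter> V) (\<lambda>y. f y + g y))\<rparr>"

definition stalk_map ::
    "'p funspace \<Rightarrow> ('p \<Rightarrow> 'q) \<Rightarrow> 'p \<Rightarrow>
     ('q set \<times> ('q \<Rightarrow> complex)) set \<Rightarrow> ('p set \<times> ('p \<Rightarrow> complex)) set" where
  "stalk_map X \<phi> x a = (\<Union>(V, g)\<in>a. germ X x {y \<in> topspace (zar X). \<phi> y \<in> V} (g \<circ> \<phi>))"

text \<open>The local ring of \<open>X\<close> at \<open>x\<close> as a module over the local ring of the target at \<open>\<pi> x\<close>.\<close>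

definition stalk_module ::
    "'p funspace \<Rightarrow> ('p \<Rightarrow> 'q) \<Rightarrow> 'p \<Rightarrow>
     (('q set \<times> ('q \<Rightarrow> complex)) set, ('p set \<times> ('p \<Rightarrow> complex)) set) module" where
  "stalk_module X \<pi> x =
     \<lparr>carrier = carrier (stalk X x), monoid.mult = monoid.mult (stalk X x), monoid.one = monoid.one (stalk X x),
      ring.zero = ring.zero (stalk X x), ring.add = ring.add (stalk X x),
      module.smult = (\<lambda>r a. stalk_map X \<pi> x r \<otimes>\<^bsub>stalk X x\<^esub> a)\<rparr>"

text \<open>
  The tensor product of the \<open>R\<close>-modules \<open>N\<close> and \<open>M\<close> is the free abelian group on
  \<open>carrier N \<times> carrier M\<close> modulo the following subgroup.
\<close>

definition tensor_null ::
    "('r, 'k) ring_scheme \<Rightarrow> ('r, 'n, 'l) module_scheme \<Rightarrow> ('r, 'm, 'j) module_scheme \<Rightarrow>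
     ('n \<times> 'm \<Rightarrow>\<^sub>0 int) set" where
  "tensor_null R N M =
     generate (free_Abelian_group (carrier N \<times> carrier M))
       ({frag_of (a \<oplus>\<^bsub>N\<^esub> b, m) - frag_of (a, m) - frag_of (b, m) |a b m.
           a \<in> carrier N \<and> b \<in> carrier N \<and> m \<in> carrier M} \<union>
        {frag_of (a, m \<oplus>\<^bsub>M\<^esub> n) - frag_of (a, m) - frag_of (a, n) |a m n.
           a \<in> carrier N \<and> m \<in> carrier M \<and> n \<in> carrier M} \<union>
        {frag_of (r \<odot>\<^bsub>N\<^esub> a, m) - frag_of (a, r \<odot>\<^bsub>M\<^esub> m) |r a m.
           r \<in> carrier R \<and> a \<in> carrier N \<and> m \<in> carrier M})"

definition module_inj ::
    "('r, 'k) ring_scheme \<Rightarrow> ('r, 'a, 'l) module_scheme \<Rightarrow> ('r, 'b, 'j) module_scheme \<Rightarrow>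
     ('a \<Rightarrow> 'b) \<Rightarrow> bool" where
  "module_inj R N' N \<phi> \<longleftrightarrow>
     \<phi> \<in> carrier N' \<rightarrow> carrier N \<and> inj_on \<phi> (carrier N') \<and>
     (\<forall>a\<in>carrier N'. \<forall>b\<in>carrier N'. \<phi> (a \<oplus>\<^bsub>N'\<^esub> b) = \<phi> a \<oplus>\<^bsub>N\<^esub> \<phi> b) \<and>
     (\<forall>r\<in>carrier R. \<forall>a\<in>carrier N'. \<phi> (r \<odot>\<^bsub>N'\<^esub> a) = r \<odot>\<^bsub>N\<^esub> \<phi> a)"

text \<open>
  Flatness: tensoring with \<open>M\<close> preserves injectivity.  The test modules range over all
  \<open>R\<close>-modules whose elements are taken from the type \<open>nat \<Rightarrow> 'r\<close>; this includes, up to isomorphism,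
  all finitely generated ones, so nothing is lost.
\<close>

definition flat_module :: "('r, 'k) ring_scheme \<Rightarrow> ('r, 'm, 'j) module_scheme \<Rightarrow> bool" where
  "flat_module R M \<longleftrightarrow>
     Module.module R M \<and>
     (\<forall>(N' :: ('r, nat \<Rightarrow> 'r) module) (N :: ('r, nat \<Rightarrow> 'r) module) \<phi>.
        Module.module R N' \<longrightarrow> Module.module R N \<longrightarrow> module_inj R N' N \<phi> \<longrightarrow>
        (\<forall>\<xi> \<in> carrier (free_Abelian_group (carrier N' \<times> carrier M)).
           frag_extend (\<lambda>(a, m). frag_of (\<phi> a, m)) \<xi> \<in> tensor_null R N M \<longrightarrow>
           \<xi> \<in> tensor_null R N' M))"

definition flat_morphism :: "'p funspace \<Rightarrow> 'q funspace \<Rightarrow> ('p \<Rightarrow> 'q) \<Rightarrow> bool" where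
  "flat_morphism X Y \<pi> \<longleftrightarrow>
     morphism X Y \<pi> \<and>
     (\<forall>x\<in>topspace (zar X). flat_module (stalk Y (\<pi> x)) (stalk_module X \<pi> x))"


section \<open>Flat degenerations\<close>

text \<open>
  \<open>X\<close> is isomorphic to the scheme-theoretic fibre of \<open>\<pi>\<close> over \<open>a\<close>, that is, to the set-theoretic
  fibre with structure sheaf the quotient of the one of \<open>\<X>\<close> by the ideal generated by \<open>\<pi> - a\<close>.
\<close>

definition isomorphic_to_fibre ::
    "'x funspace \<Rightarrow> 'p funspace \<Rightarrow> ('p \<Rightarrow> complex) \<Rightarrow> complex \<Rightarrow> bool" where
  "isomorphic_to_fibre X \<X> \<pi> a \<longleftrightarrow>
     (\<exists>\<phi>. morphism X \<X> \<phi> \<and>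
        homeomorphic_map (zar X) (subtopology (zar \<X>) {y \<in> topspace (zar \<X>). \<pi> y = a}) \<phi> \<and>
        (\<forall>x\<in>topspace (zar X).
           stalk_map X \<phi> x ` carrier (stalk \<X> (\<phi> x)) = carrier (stalk X x) \<and>
           a_kernel (stalk \<X> (\<phi> x)) (stalk X x) (stalk_map X \<phi> x) =
             PIdl\<^bsub>stalk \<X> (\<phi> x)\<^esub> (germ \<X> (\<phi> x) (topspace (zar \<X>)) (\<lambda>y. \<pi> y - a))))"

text \<open>
  The total space of a flat degeneration of a variety into a variety is itself reduced (it is flat
  over \<open>A1\<close> with reduced fibres), so families of varieties suffice.
\<close>

definition flat_degeneration ::
    "'p funspace \<Rightarrow> ('p \<Rightarrow> complex) \<Rightarrow> 'x funspace \<Rightarrow> 'y funspace \<Rightarrow> bool" where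
  "flat_degeneration \<X> \<pi> X X\<^sub>0 \<longleftrightarrow>
     variety \<X> \<and> flat_morphism \<X> A1 \<pi> \<and>
     (\<forall>a. a \<noteq> 0 \<longrightarrow> isomorphic_to_fibre X \<X> \<pi> a) \<and>
     isomorphic_to_fibre X\<^sub>0 \<X> \<pi> 0"

definition equivariant_Gm_action ::
    "'p funspace \<Rightarrow> ('p \<Rightarrow> complex) \<Rightarrow> (complex \<Rightarrow> 'p \<Rightarrow> 'p) \<Rightarrow> bool" where
  "equivariant_Gm_action \<X> \<pi> \<sigma> \<longleftrightarrow>
     morphism (prod_space Gm \<X>) \<X> (\<lambda>(t, x). \<sigma> t x) \<and>
     (\<forall>x\<in>topspace (zar \<X>).
        \<sigma> 1 x = x \<and>
        (\<forall>s t. s \<noteq> 0 \<longrightarrow> t \<noteq> 0 \<longrightarrow> \<sigma> (s * t) x = \<sigma> s (\<sigma> t x)) \<and>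
        (\<forall>t. t \<noteq> 0 \<longrightarrow> \<pi> (\<sigma> t x) = inverse t * \<pi> x))"

text \<open>
  The points of the total space are taken from the type \<open>(nat \<Rightarrow> complex) set\<close>.  Every complex
  variety has at most continuum many points, so this is no restriction.
\<close>

definition degenerates_to :: "'x funspace \<Rightarrow> 'y funspace \<Rightarrow> bool" where
  "degenerates_to X X\<^sub>0 \<longleftrightarrow>
     (\<exists>(\<X> :: (nat \<Rightarrow> complex) set funspace) \<pi> \<sigma>.
        flat_degeneration \<X> \<pi> X X\<^sub>0 \<and> equivariant_Gm_action \<X> \<pi> \<sigma>)"


section \<open>Unipotent groups and their representations\<close>

text \<open>Unipotent algebraic groups are closed subgroups of some \<open>GL\<^sub>n\<close> with unipotent elements.\<close>

definition unipotent_group :: "(complex ^ 'n ^ 'n) set \<Rightarrow> bool" where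
  "unipotent_group G \<longleftrightarrow>
     closedin (zar (affine_space_on mat_space {A. invertible A})) G \<and>
     mat 1 \<in> G \<and> (\<forall>A\<in>G. \<forall>B\<in>G. A ** B \<in> G) \<and> (\<forall>A\<in>G. matrix_inv A \<in> G) \<and>
     (\<forall>A\<in>G. \<exists>k. ((\<lambda>B. B ** (A - mat 1)) ^^ k) (mat 1) = 0)"

definition rational_rep ::
    "(complex ^ 'n ^ 'n) set \<Rightarrow> (complex ^ 'n ^ 'n \<Rightarrow> complex ^ 'm ^ 'm) \<Rightarrow> bool" where
  "rational_rep G \<rho> \<longleftrightarrow>
     \<rho> (mat 1) = mat 1 \<and> (\<forall>A\<in>G. \<forall>B\<in>G. \<rho> (A ** B) = \<rho> A ** \<rho> B) \<and>
     (\<forall>i j. (\<lambda>A. \<rho> A $ i $ j) \<in> regular (affine_space_on mat_space G) G)"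

text \<open>The Lie algebra is the Zariski tangent space of the group at the identity.\<close>

definition lie_algebra :: "(complex ^ 'n ^ 'n) set \<Rightarrow> (complex ^ 'n ^ 'n) set" where
  "lie_algebra G =
     {X. \<forall>p\<in>poly_funs mat_space. (\<forall>A\<in>G. p A = 0) \<longrightarrow>
           deriv (\<lambda>s. p (mat 1 + mat_scale s X)) 0 = 0}"

text \<open>
  The differential at the identity of a regular function \<open>h\<close> on the group, evaluated at a tangent
  vector \<open>X\<close>: the value computed from any local presentation of \<open>h\<close> as a quotient of polynomial
  functions.
\<close>

definition differential ::
    "(complex ^ 'n ^ 'n) set \<Rightarrow> (complex ^ 'n ^ 'n \<Rightarrow> complex) \<Rightarrow> complex ^ 'n ^ 'n \<Rightarrow> complex" where
  "differential G h X =
     (THE d. \<forall>W p q.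
        openin (zar (affine_space_on mat_space G)) W \<longrightarrow> mat 1 \<in> W \<longrightarrow>
        p \<in> poly_funs mat_space \<longrightarrow> q \<in> poly_funs mat_space \<longrightarrow>
        (\<forall>A\<in>W. q A \<noteq> 0 \<and> h A = p A / q A) \<longrightarrow>
        d = deriv (\<lambda>s. p (mat 1 + mat_scale s X) / q (mat 1 + mat_scale s X)) 0)"

definition lie_rep ::
    "(complex ^ 'n ^ 'n) set \<Rightarrow> (complex ^ 'n ^ 'n \<Rightarrow> complex ^ 'm ^ 'm) \<Rightarrow>
     complex ^ 'n ^ 'n \<Rightarrow> complex ^ 'm ^ 'm" where
  "lie_rep G \<rho> X = (\<chi> i j. differential G (\<lambda>A. \<rho> A $ i $ j) X)"

text \<open>
  Below \<open>\<LL>\<close> is the set of operators by which the Lie algebra acts and \<open>F 1, ..., F N\<close> are the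
  operators by which its ordered basis acts.
\<close>

definition PBW_filtration ::
    "(complex ^ 'm ^ 'm) set \<Rightarrow> complex ^ 'm \<Rightarrow> nat \<Rightarrow> (complex ^ 'm) set" where
  "PBW_filtration \<LL> v s = vec.span {foldr (*v) xs v |xs. set xs \<subseteq> \<LL> \<and> length xs \<le> s}"

definition cyclic_vector :: "(complex ^ 'm ^ 'm) set \<Rightarrow> complex ^ 'm \<Rightarrow> bool" where
  "cyclic_vector \<LL> v \<longleftrightarrow> v \<noteq> 0 \<and> vec.span {foldr (*v) xs v |xs. set xs \<subseteq> \<LL>} = UNIV"

text \<open>The tensor power of order \<open>n\<close> of \<open>\<complex>\<^sup>m\<close>: coordinate functions on words of length \<open>n\<close>.\<close>

definition tensor_scale :: "complex \<Rightarrow> ('m list \<Rightarrow> complex) \<Rightarrow> 'm list \<Rightarrow> complex" where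
  "tensor_scale c T = (\<lambda>w. c * T w)"

interpretation tensors: vector_space "tensor_scale :: complex \<Rightarrow> ('m list \<Rightarrow> complex) \<Rightarrow> 'm list \<Rightarrow> complex"
  by unfold_locales (simp_all add: tensor_scale_def fun_eq_iff algebra_simps)

definition tensor_power :: "nat \<Rightarrow> complex ^ 'm \<Rightarrow> 'm list \<Rightarrow> complex" where
  "tensor_power n v = (\<lambda>w. if length w = n then \<Prod>i<n. v $ (w ! i) else 0)"

definition tensor_action ::
    "complex ^ 'm ^ 'm \<Rightarrow> ('m list \<Rightarrow> complex) \<Rightarrow> 'm list \<Rightarrow> complex" where
  "tensor_action A T = (\<lambda>w. \<Sum>i<length w. \<Sum>j\<in>UNIV. A $ (w ! i) $ j * T (w[i := j]))"

text \<open>The submodule \<open>M\<^sup>\<odot>\<^sup>n\<close> of the tensor power generated by \<open>v \<otimes> ... \<otimes> v\<close>.\<close>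

definition cartan_power ::
    "(complex ^ 'm ^ 'm) set \<Rightarrow> complex ^ 'm \<Rightarrow> nat \<Rightarrow> ('m list \<Rightarrow> complex) set" where
  "cartan_power \<LL> v n = tensors.span {foldr tensor_action xs (tensor_power n v) |xs. set xs \<subseteq> \<LL>}"


section \<open>Monomial orders and essential monomials\<close>

text \<open>\<open>\<int>\<^sub>\<ge>\<^sub>0\<^sup>N\<close> and \<open>\<real>\<^sup>N\<close> are realised as functions on \<open>nat\<close> vanishing outside \<open>{1..N}\<close>.\<close>

definition exponents :: "nat \<Rightarrow> (nat \<Rightarrow> nat) set" where
  "exponents N = {p. \<forall>i. i \<notin> {1..N} \<longrightarrow> p i = 0}"

definition unit_exp :: "nat \<Rightarrow> nat \<Rightarrow> nat" where
  "unit_exp i = (\<lambda>j. if j = i then 1 else 0)"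

definition ordered_basis ::
    "(complex ^ 'n ^ 'n) set \<Rightarrow> nat \<Rightarrow> (nat \<Rightarrow> complex ^ 'n ^ 'n) \<Rightarrow> bool" where
  "ordered_basis \<NN> N f \<longleftrightarrow>
     inj_on f {1..N} \<and> mats.independent (f ` {1..N}) \<and> mats.span (f ` {1..N}) = \<NN>"

text \<open>\<open>lt p q\<close> stands for the strict order \<open>p < q\<close>.\<close>

definition homogeneous_monomial_order ::
    "nat \<Rightarrow> ((nat \<Rightarrow> nat) \<Rightarrow> (nat \<Rightarrow> nat) \<Rightarrow> bool) \<Rightarrow> bool" where
  "homogeneous_monomial_order N lt \<longleftrightarrow>
     (\<forall>p\<in>exponents N. \<not> lt p p) \<and>
     (\<forall>p\<in>exponents N. \<forall>q\<in>exponents N. \<forall>r\<in>exponents N. lt p q \<longrightarrow> lt q r \<longrightarrow> lt p r) \<and>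
     (\<forall>p\<in>exponents N. \<forall>q\<in>exponents N. p \<noteq> q \<longrightarrow> lt p q \<or> lt q p) \<and>
     (\<forall>p\<in>exponents N. \<forall>q\<in>exponents N. \<forall>r\<in>exponents N. lt p q \<longrightarrow> lt (p + r) (q + r)) \<and>
     (\<forall>i j. 1 \<le> i \<longrightarrow> i < j \<longrightarrow> j \<le> N \<longrightarrow> lt (unit_exp j) (unit_exp i)) \<and>
     (\<forall>p\<in>exponents N. \<forall>q\<in>exponents N. (\<Sum>i=1..N. p i) < (\<Sum>i=1..N. q i) \<longrightarrow> lt p q)"

definition monomial_vec ::
    "nat \<Rightarrow> (nat \<Rightarrow> complex ^ 'm ^ 'm) \<Rightarrow> complex ^ 'm \<Rightarrow> (nat \<Rightarrow> nat) \<Rightarrow> complex ^ 'm" where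
  "monomial_vec N F v p = foldr (\<lambda>i w. (((*v) (F i)) ^^ p i) w) [1..<Suc N] v"

definition F_less ::
    "nat \<Rightarrow> ((nat \<Rightarrow> nat) \<Rightarrow> (nat \<Rightarrow> nat) \<Rightarrow> bool) \<Rightarrow> (nat \<Rightarrow> complex ^ 'm ^ 'm) \<Rightarrow> complex ^ 'm \<Rightarrow>
     (nat \<Rightarrow> nat) \<Rightarrow> (complex ^ 'm) set" where
  "F_less N lt F v p = vec.span {monomial_vec N F v q |q. q \<in> exponents N \<and> lt q p}"

definition F_le ::
    "nat \<Rightarrow> ((nat \<Rightarrow> nat) \<Rightarrow> (nat \<Rightarrow> nat) \<Rightarrow> bool) \<Rightarrow> (nat \<Rightarrow> complex ^ 'm ^ 'm) \<Rightarrow> complex ^ 'm \<Rightarrow>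
     (nat \<Rightarrow> nat) \<Rightarrow> (complex ^ 'm) set" where
  "F_le N lt F v p = vec.span {monomial_vec N F v q |q. q \<in> exponents N \<and> (lt q p \<or> q = p)}"

definition essential_exps ::
    "nat \<Rightarrow> ((nat \<Rightarrow> nat) \<Rightarrow> (nat \<Rightarrow> nat) \<Rightarrow> bool) \<Rightarrow> (nat \<Rightarrow> complex ^ 'm ^ 'm) \<Rightarrow> complex ^ 'm \<Rightarrow>
     (nat \<Rightarrow> nat) set" where
  "essential_exps N lt F v = {p \<in> exponents N. monomial_vec N F v p \<notin> F_less N lt F v p}"


section \<open>Normal polytopes and favourable modules\<close>

definition lattice_pts :: "(nat \<Rightarrow> real) set \<Rightarrow> (nat \<Rightarrow> real) set" where
  "lattice_pts P = {x \<in> P. \<forall>i. x i \<in> \<int>}"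

definition lattice_polytope :: "nat \<Rightarrow> (nat \<Rightarrow> real) set \<Rightarrow> bool" where
  "lattice_polytope N P \<longleftrightarrow>
     (\<exists>V. finite V \<and> (\<forall>a\<in>V. \<forall>i. a i \<in> \<int> \<and> (i \<notin> {1..N} \<longrightarrow> a i = 0)) \<and>
        P = {(\<lambda>i. \<Sum>a\<in>V. c a * a i) |c. (\<forall>a\<in>V. 0 \<le> c a) \<and> (\<Sum>a\<in>V. c a) = 1})"

definition normal_polytope :: "nat \<Rightarrow> (nat \<Rightarrow> real) set \<Rightarrow> bool" where
  "normal_polytope N P \<longleftrightarrow>
     lattice_polytope N P \<and>
     (\<forall>n\<ge>1. \<forall>x \<in> lattice_pts ((\<lambda>y i. real n * y i) ` P).
        \<exists>s. (\<forall>k<n. s k \<in> lattice_pts P) \<and> x = (\<lambda>i. \<Sum>k<n. s k i))"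

definition minkowski_multiple :: "nat \<Rightarrow> (nat \<Rightarrow> nat) set \<Rightarrow> (nat \<Rightarrow> nat) set" where
  "minkowski_multiple n S = {(\<lambda>i. \<Sum>k<n. s k i) |s. \<forall>k<n. s k \<in> S}"

definition favourable_for ::
    "(complex ^ 'n ^ 'n) set \<Rightarrow> (complex ^ 'n ^ 'n \<Rightarrow> complex ^ 'm ^ 'm) \<Rightarrow> complex ^ 'm \<Rightarrow>
     nat \<Rightarrow> (nat \<Rightarrow> complex ^ 'n ^ 'n) \<Rightarrow> ((nat \<Rightarrow> nat) \<Rightarrow> (nat \<Rightarrow> nat) \<Rightarrow> bool) \<Rightarrow> bool" where
  "favourable_for G \<rho> v N f lt \<longleftrightarrow>
     ordered_basis (lie_algebra G) N f \<and> homogeneous_monomial_order N lt \<and>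
     (let S = essential_exps N lt (lie_rep G \<rho> \<circ> f) v in
        (\<exists>P. normal_polytope N P \<and> lattice_pts P = (\<lambda>p i. real (p i)) ` S) \<and>
        (\<forall>n. tensors.dim (cartan_power (lie_rep G \<rho> ` lie_algebra G) v n) =
               card (minkowski_multiple n S)))"


section \<open>Associated graded modules\<close>

text \<open>
  For families of subspaces \<open>B i \<subseteq> A i\<close>, the direct sum over \<open>i \<in> I\<close> of the quotients \<open>A i / B i\<close>.
  An element assigns to every index a coset, almost all of them trivial.
\<close>

definition graded_space ::
    "'i set \<Rightarrow> ('i \<Rightarrow> (complex ^ 'm) set) \<Rightarrow> ('i \<Rightarrow> (complex ^ 'm) set) \<Rightarrow>
     (complex, 'i \<Rightarrow> (complex ^ 'm) set) module" where
  "graded_space I A B =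
     mk_space
       {x \<in> (\<Pi>\<^sub>E i\<in>I. {(+) a ` B i |a. a \<in> A i}). finite {i \<in> I. x i \<noteq> B i}}
       (\<lambda>i\<in>I. B i)
       (\<lambda>x y. \<lambda>i\<in>I. {a + b |a b. a \<in> x i \<and> b \<in> y i})
       (\<lambda>c x. \<lambda>i\<in>I. {c *s a + b |a b. a \<in> x i \<and> b \<in> B i})"

definition graded_class ::
    "'i set \<Rightarrow> ('i \<Rightarrow> (complex ^ 'm) set) \<Rightarrow> 'i \<Rightarrow> complex ^ 'm \<Rightarrow> 'i \<Rightarrow> (complex ^ 'm) set" where
  "graded_class I B j v = (\<lambda>i\<in>I. if i = j then (+) v ` B i else B i)"

text \<open>
  The map induced by \<open>A\<close> on graded pieces.  The piece of index \<open>k\<close> is sent to the piece of index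
  \<open>i\<close> if \<open>pre i = Some k\<close>; a piece with \<open>pre i = None\<close> receives nothing.
\<close>

definition graded_map ::
    "'i set \<Rightarrow> ('i \<Rightarrow> (complex ^ 'm) set) \<Rightarrow> ('i \<Rightarrow> 'i option) \<Rightarrow> complex ^ 'm ^ 'm \<Rightarrow>
     ('i \<Rightarrow> (complex ^ 'm) set) \<Rightarrow> 'i \<Rightarrow> (complex ^ 'm) set" where
  "graded_map I B pre A x =
     (\<lambda>i\<in>I. case pre i of None \<Rightarrow> B i | Some k \<Rightarrow> {A *v a + b |a b. a \<in> x k \<and> b \<in> B i})"

text \<open>\<open>PBW_lower \<LL> v s\<close> is \<open>M\<^sub>s\<^sub>-\<^sub>1\<close>, with \<open>M\<^sub>-\<^sub>1 = 0\<close>.\<close>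

definition PBW_lower ::
    "(complex ^ 'm ^ 'm) set \<Rightarrow> complex ^ 'm \<Rightarrow> nat \<Rightarrow> (complex ^ 'm) set" where
  "PBW_lower \<LL> v s = (if s = 0 then {0} else PBW_filtration \<LL> v (s - 1))"

definition Ma_space ::
    "(complex ^ 'm ^ 'm) set \<Rightarrow> complex ^ 'm \<Rightarrow> (complex, nat \<Rightarrow> (complex ^ 'm) set) module" where
  "Ma_space \<LL> v = graded_space UNIV (PBW_filtration \<LL> v) (PBW_lower \<LL> v)"

definition Ma_vec ::
    "(complex ^ 'm ^ 'm) set \<Rightarrow> complex ^ 'm \<Rightarrow> nat \<Rightarrow> (complex ^ 'm) set" where
  "Ma_vec \<LL> v = graded_class UNIV (PBW_lower \<LL> v) 0 v"

definition Ma_action ::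
    "(complex ^ 'm ^ 'm) set \<Rightarrow> complex ^ 'm \<Rightarrow> complex ^ 'm ^ 'm \<Rightarrow>
     (nat \<Rightarrow> (complex ^ 'm) set) \<Rightarrow> nat \<Rightarrow> (complex ^ 'm) set" where
  "Ma_action \<LL> v A =
     graded_map UNIV (PBW_lower \<LL> v) (\<lambda>s. if s = 0 then None else Some (s - 1)) A"

definition Mt_space ::
    "nat \<Rightarrow> ((nat \<Rightarrow> nat) \<Rightarrow> (nat \<Rightarrow> nat) \<Rightarrow> bool) \<Rightarrow> (nat \<Rightarrow> complex ^ 'm ^ 'm) \<Rightarrow> complex ^ 'm \<Rightarrow>
     (complex, (nat \<Rightarrow> nat) \<Rightarrow> (complex ^ 'm) set) module" where
  "Mt_space N lt F v = graded_space (exponents N) (F_le N lt F v) (F_less N lt F v)"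

definition Mt_vec ::
    "nat \<Rightarrow> ((nat \<Rightarrow> nat) \<Rightarrow> (nat \<Rightarrow> nat) \<Rightarrow> bool) \<Rightarrow> (nat \<Rightarrow> complex ^ 'm ^ 'm) \<Rightarrow> complex ^ 'm \<Rightarrow>
     (nat \<Rightarrow> nat) \<Rightarrow> (complex ^ 'm) set" where
  "Mt_vec N lt F v = graded_class (exponents N) (F_less N lt F v) (\<lambda>_. 0) v"

definition Mt_action ::
    "nat \<Rightarrow> ((nat \<Rightarrow> nat) \<Rightarrow> (nat \<Rightarrow> nat) \<Rightarrow> bool) \<Rightarrow> (nat \<Rightarrow> complex ^ 'm ^ 'm) \<Rightarrow> complex ^ 'm \<Rightarrow> nat \<Rightarrow>
     ((nat \<Rightarrow> nat) \<Rightarrow> (complex ^ 'm) set) \<Rightarrow> (nat \<Rightarrow> nat) \<Rightarrow> (complex ^ 'm) set" where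
  "Mt_action N lt F v j =
     graded_map (exponents N) (F_less N lt F v)
       (\<lambda>p. if p j = 0 then None else Some (p(j := p j - 1))) (F j)"


section \<open>Degenerate flag varieties\<close>

text \<open>The exponential series of a locally nilpotent operator \<open>X\<close>, applied to \<open>x\<close>.\<close>

definition exp_action :: "(complex, 'v) module \<Rightarrow> ('v \<Rightarrow> 'v) \<Rightarrow> 'v \<Rightarrow> 'v" where
  "exp_action V X x =
     finsum V (\<lambda>k. (1 / fact k) \<odot>\<^bsub>V\<^esub> (X ^^ k) x) {k. (X ^^ k) x \<noteq> \<zero>\<^bsub>V\<^esub>}"

text \<open>
  The orbit of \<open>w\<close> under the abelian group \<open>exp (\<NN>\<^sup>a)\<close>, where the basis vector \<open>f\<^sub>i\<close> acts by \<open>T i\<close>.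
\<close>

definition abelian_orbit ::
    "(complex, 'v) module \<Rightarrow> nat \<Rightarrow> (nat \<Rightarrow> 'v \<Rightarrow> 'v) \<Rightarrow> 'v \<Rightarrow> 'v set" where
  "abelian_orbit V N T w =
     {exp_action V (\<lambda>x. finsum V (\<lambda>i. c i \<odot>\<^bsub>V\<^esub> T i x) {1..N}) w |c. True}"

definition orbit_closure :: "(complex, 'v) module \<Rightarrow> 'v set \<Rightarrow> 'v set set" where
  "orbit_closure V Orb = zar (proj_space_on V (proj_points V)) closure_of (line V ` Orb)"

definition flag_var ::
    "(complex ^ 'n ^ 'n) set \<Rightarrow> (complex ^ 'n ^ 'n \<Rightarrow> complex ^ 'm ^ 'm) \<Rightarrow> complex ^ 'm \<Rightarrow>
     (complex ^ 'm) set set" where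
  "flag_var G \<rho> v = orbit_closure vec_space {\<rho> A *v v |A. A \<in> G}"

definition flag_var_a ::
    "(complex ^ 'm ^ 'm) set \<Rightarrow> nat \<Rightarrow> (nat \<Rightarrow> complex ^ 'm ^ 'm) \<Rightarrow> complex ^ 'm \<Rightarrow>
     (nat \<Rightarrow> (complex ^ 'm) set) set set" where
  "flag_var_a \<LL> N F v =
     orbit_closure (Ma_space \<LL> v)
       (abelian_orbit (Ma_space \<LL> v) N (\<lambda>i. Ma_action \<LL> v (F i)) (Ma_vec \<LL> v))"

definition flag_var_t ::
    "nat \<Rightarrow> ((nat \<Rightarrow> nat) \<Rightarrow> (nat \<Rightarrow> nat) \<Rightarrow> bool) \<Rightarrow> (nat \<Rightarrow> complex ^ 'm ^ 'm) \<Rightarrow> complex ^ 'm \<Rightarrow>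
     ((nat \<Rightarrow> nat) \<Rightarrow> (complex ^ 'm) set) set set" where
  "flag_var_t N lt F v =
     orbit_closure (Mt_space N lt F v)
       (abelian_orbit (Mt_space N lt F v) N (Mt_action N lt F v) (Mt_vec N lt F v))"

definition cone_variety :: "(complex, 'v) module \<Rightarrow> 'v set set \<Rightarrow> 'v funspace" where
  "cone_variety V Z = affine_space_on V (affine_cone V Z)"

end

theory Submission
 imports Defs
  "HOL-Computational_Algebra.Formal_Power_Series"
  "HOL-Computational_Algebra.Fundamental_Theorem_Algebra"
begin

text \<open>
 In exponential coordinates the orbit of \<open>v\<close> is the image of a polynomial map.
 Expanding words in the essential basis \<open>f\<^sup>p v\<close>, \<open>p \<in> es M\<close>, only words of weight at least that of
 \<open>p\<close> contribute to the coordinate \<open>p\<close>, both for the weight given by the degree and, by Gordan's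
 theorem, for a linear weight inducing the monomial order on the finitely many exponents that occur.
 Rescaling by \<open>t\<close> therefore gives polynomial families of orbits with special fibres the orbits in
 \<open>M\<^sup>a\<close> and \<open>M\<^sup>t\<close>.  In degree \<open>n\<close> the homogeneous coordinate rings of all three orbit closures have
 dimension \<open>\<sharp> n S(M)\<close>: for the general fibre this is \<open>dim M\<^sup>\<odot>\<^sup>n\<close>, and for the special ones it follows
 from the lower bound given by the \<open>n\<close>-fold sums of exponents.  Hence no equations are lost in the
 limit, and the closure of the family has the expected fibre over \<open>0\<close>.
\<close>

text \<open>Fibres are meant scheme-theoretically, so matching the orbit closures as sets is not
  enough. The pivot is \<open>extend\<close>: a form vanishing on a single fibre is the restriction
  of a form vanishing on the whole family. It identifies the fibre as a set, and it makes functions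
  vanishing on the fibre over \<open>a\<close> divisible by \<open>t - a\<close> modulo the
  equations of the family. It rests on one set of monomials being a basis in every fibre.
  Independence is an open condition and moves from the special fibre to the general one; spanning
  moves the other way, by clearing powers of \<open>t\<close>. Hence independence is proved directly
  only for \<open>M^t\<close>, where each coordinate of the orbit is a single monomial in the
  parameters, and spanning only for \<open>M\<close>, where forms of degree \<open>n\<close> are
  functionals on the Cartan power. For \<open>M^a\<close> independence comes from its own
  degeneration to \<open>M^t\<close>, and spanning from being a limit of \<open>M\<close>. Flatness,
  stated by tensor products, becomes torsion-freeness over the local rings of the line, because
  divisibility in these is total.\<close>

abbreviation pts :: "'p funspace => 'p set" where "pts X == topspace (zar X)"
abbreviation opn :: "'p funspace => 'p set => bool" where "opn X == openin (zar X)"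
abbreviation nz :: "'p set => ('p => complex) => 'p set" where "nz Z h == {z \<in> Z. h z ~= 0}"
abbreviation mat_polys :: "(complex ^ 'n ^ 'n => complex) set" where "mat_polys == poly_funs mat_space"
abbreviation cspace :: "nat => (nat => complex) set" where "cspace k == carrier (coord_space (Suc k))"
abbreviation cpolys :: "nat => ((nat => complex) => complex) set" where "cpolys k == poly_funs (coord_space (Suc k))"
abbreviation tail :: "(nat => complex) => nat => complex" where "tail x == %i. x (Suc i)"

section \<open>Torsion-free modules over uniserial rings are flat\<close>

context module
begin

definition lincomb :: "'c set => ('c => 'a) => 'c" where
 "lincomb B c = (\<Oplus>\<^bsub>M\<^esub>b\<in>B. c b \<odot>\<^bsub>M\<^esub> b)"

definition lspan :: "'c set => 'c set" where
 "lspan B = lincomb B ` (B \<rightarrow> carrier R)"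

definition free_set :: "'c set => bool" where
 "free_set B \<longleftrightarrow> finite B & B \<subseteq> carrier M & (ALL c:B \<rightarrow> carrier R. lincomb B c = \<zero>\<^bsub>M\<^esub> --> (ALL b:B. c b = \<zero>))"

lemma lincomb_closed: "B \<subseteq> carrier M ==> c \<in> B \<rightarrow> carrier R ==> lincomb B c \<in> carrier M"
 unfolding lincomb_def by (rule M.finsum_closed) auto

lemma lincomb_add:
 assumes B: "B \<subseteq> carrier M" and c: "c \<in> B \<rightarrow> carrier R" and d: "d \<in> B \<rightarrow> carrier R"
 shows "lincomb B (%b. c b \<oplus> d b) = lincomb B c \<oplus>\<^bsub>M\<^esub> lincomb B d"
proof -
 have "lincomb B (%b. c b \<oplus> d b) = (\<Oplus>\<^bsub>M\<^esub>b\<in>B. c b \<odot>\<^bsub>M\<^esub> b \<oplus>\<^bsub>M\<^esub> d b \<odot>\<^bsub>M\<^esub> b)"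
  unfolding lincomb_def by (rule M.finsum_cong') (use B c d in \<open>auto simp: smult_l_distr Pi_iff subset_iff\<close>)
 also have "\<dots> = lincomb B c \<oplus>\<^bsub>M\<^esub> lincomb B d"
  unfolding lincomb_def by (rule M.finsum_addf) (use B c d in \<open>auto simp: Pi_iff subset_iff\<close>)
 finally show ?thesis .
qed

lemma lincomb_smult:
 assumes B: "finite B" "B \<subseteq> carrier M" and c: "c \<in> B \<rightarrow> carrier R" and r: "r \<in> carrier R"
 shows "lincomb B (%b. r \<otimes> c b) = r \<odot>\<^bsub>M\<^esub> lincomb B c"
proof -
 have "lincomb B (%b. r \<otimes> c b) = (\<Oplus>\<^bsub>M\<^esub>b\<in>B. r \<odot>\<^bsub>M\<^esub> (c b \<odot>\<^bsub>M\<^esub> b))"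
  unfolding lincomb_def by (rule M.finsum_cong') (use B c r in \<open>auto simp: smult_assoc1 Pi_iff subset_iff\<close>)
 thus ?thesis unfolding lincomb_def by (subst finsum_smult_ldistr) (use B c r in \<open>auto simp: Pi_iff subset_iff\<close>)
qed

lemma lincomb_unit:
 assumes "finite B" "B \<subseteq> carrier M" "b \<in> B"
 shows "lincomb B (%b'. if b' = b then \<one> else \<zero>) = b"
proof -
 have "lincomb B (%b'. if b' = b then \<one> else \<zero>) = (\<Oplus>\<^bsub>M\<^esub>b'\<in>B. if b = b' then b' else \<zero>\<^bsub>M\<^esub>)"
  unfolding lincomb_def by (rule M.finsum_cong') (use assms in \<open>auto simp: smult_l_null\<close>)
 also have "\<dots> = b" by (rule M.finsum_singleton) (use assms in auto)
 finally show ?thesis .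
qed

lemma uniserial_basis:
 assumes total: "!!a b. a \<in> carrier R ==> b \<in> carrier R ==>
   (EX c:carrier R. a = c \<otimes> b) \<or> (EX c:carrier R. b = c \<otimes> a)"
  and torsion_free: "!!r m. r \<in> carrier R ==> m \<in> carrier M ==> r \<odot>\<^bsub>M\<^esub> m = \<zero>\<^bsub>M\<^esub> ==>
   r = \<zero> \<or> m = \<zero>\<^bsub>M\<^esub>"
  and B0: "finite B0" "B0 \<subseteq> carrier M"
 shows "EX B. free_set B & B0 \<subseteq> lspan B"
proof -
 let ?P = "%B. finite B & B \<subseteq> carrier M & B0 \<subseteq> lspan B"
 have "?P B0"
 proof (intro conjI subsetI B0)
  fix m assume m: "m \<in> B0"
  have "lincomb B0 (%b. if b = m then \<one> else \<zero>) \<in> lspan B0" unfolding lspan_def by (rule imageI) auto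
  thus "m \<in> lspan B0" unfolding lincomb_unit[OF B0 m] .
 qed (use B0 in blast)
 then obtain B where B: "?P B" and min: "!!B'. ?P B' ==> card B \<le> card B'" using ex_has_least_nat[of ?P B0 card] by blast
 hence fB: "finite B" "B \<subseteq> carrier M" "B0 \<subseteq> lspan B" by auto
 have "c b = \<zero>" if c: "c \<in> B \<rightarrow> carrier R" and c0: "lincomb B c = \<zero>\<^bsub>M\<^esub>" and b: "b \<in> B" for c b
 proof (rule ccontr)
  assume nz: "c b ~= \<zero>"
  \<comment> \<open>Divisibility is total, so finitely many coefficients have one that divides all
    of them.\<close>
  have "EX b1:B'. ALL b':B'. EX d:carrier R. c b' = d \<otimes> c b1" if "finite B'" "B' ~= {}" "B' \<subseteq> B" for B' using that
  proof (induction B' rule: finite_ne_induct)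
   case (singleton x)
   thus ?case using c by (auto intro!: bexI[of _ \<one>] simp: Pi_iff)
  next
   case (insert x B')
   then obtain b1 where b1: "b1 \<in> B'" "ALL b':B'. EX d:carrier R. c b' = d \<otimes> c b1" by auto
   have cx: "c x \<in> carrier R" "c b1 \<in> carrier R" using c insert.prems b1 by auto
   from total[OF cx] show ?case
   proof
    assume "EX d:carrier R. c x = d \<otimes> c b1"
    thus ?thesis using b1 by auto
   next
    assume "EX d:carrier R. c b1 = d \<otimes> c x"
    then obtain d where d: "d \<in> carrier R" "c b1 = d \<otimes> c x" by blast
    have "EX e:carrier R. c b' = e \<otimes> c x" if "b' \<in> B'" for b'
    proof -
     obtain e where "e \<in> carrier R" "c b' = e \<otimes> c b1" using b1 \<open>b' \<in> B'\<close> by auto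
     thus ?thesis using d cx by (intro bexI[of _ "e \<otimes> d"]) (auto simp: m_assoc)
    qed
    moreover have "c x = \<one> \<otimes> c x" using cx by auto
    ultimately show ?thesis by auto
   qed
  qed
  from this[of B] fB(1) b obtain b1 where b1: "b1 \<in> B" "ALL b':B. EX d:carrier R. c b' = d \<otimes> c b1" by auto
  then obtain d0 where d0: "!!b'. b' \<in> B ==> d0 b' \<in> carrier R & c b' = d0 b' \<otimes> c b1" by metis
  have cb1: "c b1 \<in> carrier R" using c b1 by auto
  \<comment> \<open>The quotient found at \<open>b1\<close> is only known to fix \<open>c b1\<close>
    under multiplication; it is replaced by one so that \<open>b1\<close> can be eliminated.\<close>
  define d where "d = d0(b1 := \<one>)"
  have d: "d b' \<in> carrier R & c b' = c b1 \<otimes> d b'" if "b' \<in> B" for b'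
   using d0[OF that] cb1 by (cases "b' = b1") (auto simp: d_def m_comm)
  hence dB: "d \<in> B \<rightarrow> carrier R" and d1: "d b1 = \<one>" by (auto simp: d_def)
  have "lincomb B c = lincomb B (%b. c b1 \<otimes> d b)"
   unfolding lincomb_def by (rule M.finsum_cong') (use d fB cb1 in \<open>auto simp: Pi_iff subset_iff\<close>)
  hence "c b1 \<odot>\<^bsub>M\<^esub> lincomb B d = \<zero>\<^bsub>M\<^esub>" using lincomb_smult[OF fB(1,2) dB cb1] c0 by simp
  moreover have "c b1 ~= \<zero>" using nz d[OF b] by auto
  ultimately have s0: "lincomb B d = \<zero>\<^bsub>M\<^esub>" using torsion_free[OF cb1 lincomb_closed[OF fB(2) dB]] by auto
  \<comment> \<open>Subtracting \<open>e b1\<close> times the relation \<open>d\<close> from an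
    expression of \<open>m\<close> removes \<open>b1\<close> without changing the value. This
    contradicts the minimality of \<open>B\<close>.\<close>
  have "m \<in> lspan (B - {b1})" if m: "m \<in> B0" for m
  proof -
   obtain e where e: "e \<in> B \<rightarrow> carrier R" "m = lincomb B e" using m fB(3) by (auto simp: lspan_def)
   have eb: "e b1 \<in> carrier R" using e b1 by auto
   let ?e = "%b. e b \<oplus> (\<ominus> e b1 \<otimes> d b)"
   have eB: "?e \<in> B \<rightarrow> carrier R" using e dB eb by (auto simp: Pi_iff)
   have "lincomb B ?e = lincomb B e \<oplus>\<^bsub>M\<^esub> (\<ominus> e b1 \<odot>\<^bsub>M\<^esub> lincomb B d)"
    using lincomb_add[OF fB(2) e(1), of "%b. \<ominus> e b1 \<otimes> d b"] lincomb_smult[OF fB(1,2) dB] dB eb by (auto simp: Pi_iff)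
   hence "m = lincomb B ?e" using lincomb_closed[OF fB(2) e(1)] e(2) eb by (simp add: s0 smult_r_null)
   moreover have "lincomb (insert b1 (B - {b1})) ?e = ?e b1 \<odot>\<^bsub>M\<^esub> b1 \<oplus>\<^bsub>M\<^esub> lincomb (B - {b1}) ?e"
    unfolding lincomb_def by (rule M.finsum_insert) (use eB fB b1 in \<open>auto simp: Pi_iff subset_iff\<close>)
   moreover have "?e b1 = \<zero>" using eb by (simp add: d1 R.r_neg)
   moreover have "lincomb (B - {b1}) ?e \<in> carrier M" by (rule lincomb_closed) (use eB fB in auto)
   moreover have "insert b1 (B - {b1}) = B" "b1 \<in> carrier M" using b1(1) fB(2) by auto
   ultimately have "m = lincomb (B - {b1}) ?e" by (simp add: smult_l_null)
   thus ?thesis unfolding lspan_def using eB by (intro image_eqI[of _ _ ?e]) auto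
  qed
  hence "?P (B - {b1})" using fB by auto
  from min[OF this] b1(1) fB(1) show False by (metis card_Diff1_less not_le)
 qed
 thus ?thesis using fB by (auto simp: free_set_def)
qed

text \<open>The value zero outside the span makes the function total, as the universal property of
  the free abelian group asks for values on all pairs. Additivity and linearity hold only inside the
  span.\<close>

definition coeff_of :: "'c set => 'c => 'c => 'a" where
 "coeff_of B m b = (if m \<in> lspan B then (SOME c. c \<in> B \<rightarrow> carrier R & lincomb B c = m) b else \<zero>)"

lemma coeff_of:
 assumes "m \<in> lspan B" shows "coeff_of B m \<in> B \<rightarrow> carrier R" "lincomb B (coeff_of B m) = m"
proof -
 have "coeff_of B m = (SOME c. c \<in> B \<rightarrow> carrier R & lincomb B c = m)" using assms by (simp add: coeff_of_def fun_eq_iff)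
 thus "coeff_of B m \<in> B \<rightarrow> carrier R" "lincomb B (coeff_of B m) = m"
  using someI_ex[of "%c. c \<in> B \<rightarrow> carrier R & lincomb B c = m"] assms by (auto simp: lspan_def)
qed

lemma coeff_of_closed: "b \<in> B ==> coeff_of B m b \<in> carrier R" using coeff_of(1)[of m B] by (cases "m \<in> lspan B") (auto simp: coeff_of_def)

lemma coeff_of_lincomb:
 assumes B: "free_set B" and c: "c \<in> B \<rightarrow> carrier R" and b: "b \<in> B"
 shows "coeff_of B (lincomb B c) b = c b"
proof -
 let ?d = "coeff_of B (lincomb B c)" and ?e = "%b. c b \<oplus> (\<ominus> \<one> \<otimes> coeff_of B (lincomb B c) b)"
 have fB: "finite B" "B \<subseteq> carrier M" using B by (auto simp: free_set_def)
 have m: "lincomb B c \<in> lspan B" using c by (auto simp: lspan_def)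
 note d = coeff_of[OF m]
 have cl: "lincomb B c \<in> carrier M" by (rule lincomb_closed[OF fB(2) c])
 have eB: "?e \<in> B \<rightarrow> carrier R" using c d(1) by (auto simp: Pi_iff)
 have "lincomb B ?e = lincomb B c \<oplus>\<^bsub>M\<^esub> (\<ominus> \<one> \<odot>\<^bsub>M\<^esub> lincomb B ?d)"
  using lincomb_add[OF fB(2) c, of "%b. \<ominus> \<one> \<otimes> ?d b"] lincomb_smult[OF fB d(1), of "\<ominus> \<one>"] d(1) by (auto simp: Pi_iff)
 also have "\<dots> = \<zero>\<^bsub>M\<^esub>" unfolding d(2) using cl smult_l_minus[of \<one> "lincomb B c"] by (simp add: M.r_neg)
 finally have "?e b = \<zero>" using B eB b unfolding free_set_def by blast
 moreover have "c b \<in> carrier R" "?d b \<in> carrier R" using c d(1) b by auto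
 ultimately show ?thesis using R.minus_equality[of "c b" "\<ominus> ?d b"] R.minus_minus[of "?d b"] by (simp add: R.l_minus)
qed

lemma coeff_of_add:
 assumes B: "free_set B" and mn: "m \<in> lspan B" "n \<in> lspan B" and b: "b \<in> B"
 shows "coeff_of B (m \<oplus>\<^bsub>M\<^esub> n) b = coeff_of B m b \<oplus> coeff_of B n b"
proof -
 have "m \<oplus>\<^bsub>M\<^esub> n = lincomb B (%b. coeff_of B m b \<oplus> coeff_of B n b)"
  using lincomb_add[of B "coeff_of B m" "coeff_of B n"] coeff_of mn B by (simp add: free_set_def)
 thus ?thesis using coeff_of_lincomb[OF B _ b] coeff_of_closed by auto
qed

lemma coeff_of_smult:
 assumes B: "free_set B" and m: "m \<in> lspan B" and r: "r \<in> carrier R" and b: "b \<in> B"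
 shows "coeff_of B (r \<odot>\<^bsub>M\<^esub> m) b = r \<otimes> coeff_of B m b"
proof -
 have "r \<odot>\<^bsub>M\<^esub> m = lincomb B (%b. r \<otimes> coeff_of B m b)"
  using lincomb_smult[of B "coeff_of B m" r] coeff_of m r B by (simp add: free_set_def)
 thus ?thesis using coeff_of_lincomb[OF B _ b] coeff_of_closed r by auto
qed

end

section \<open>Tensor products: the subgroup of relations and coordinates with respect to a free
  set\<close>

lemma frag_induction [consumes 1, case_names zero one diff]:
 assumes "Poly_Mapping.keys c \<subseteq> S" and "P 0" and "!!x. x \<in> S ==> P (frag_of x)"
  and "!!a b. Poly_Mapping.keys a \<subseteq> S ==> Poly_Mapping.keys b \<subseteq> S ==> P a ==> P b ==> P (a - b)"
 shows "P c" using assms(1) by (rule free_Abelian_group_induct) (use assms(2-4) in blast)+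

locale tensor_pair = module R M + N: module R N
 for R :: "('r, 'k) ring_scheme" (structure) and M :: "('r, 'c, 'l) module_scheme" (structure)
  and N :: "('r, 'n, 'j) module_scheme"
begin

abbreviation Null :: "('n \<times> 'c \<Rightarrow>\<^sub>0 int) set" where "Null == tensor_null R N M"

abbreviation supported :: "('n \<times> 'c \<Rightarrow>\<^sub>0 int) => bool" where
 "supported x == Poly_Mapping.keys x \<subseteq> carrier N \<times> carrier M"

lemma null_relations:
 "a \<in> carrier N ==> a' \<in> carrier N ==> m \<in> carrier M ==> frag_of (a \<oplus>\<^bsub>N\<^esub> a', m) - frag_of (a, m) - frag_of (a', m) \<in> Null"
 "a \<in> carrier N ==> m \<in> carrier M ==> n \<in> carrier M ==> frag_of (a, m \<oplus>\<^bsub>M\<^esub> n) - frag_of (a, m) - frag_of (a, n) \<in> Null"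
 "r \<in> carrier R ==> a \<in> carrier N ==> m \<in> carrier M ==> frag_of (r \<odot>\<^bsub>N\<^esub> a, m) - frag_of (a, r \<odot>\<^bsub>M\<^esub> m) \<in> Null"
 unfolding tensor_null_def by (rule generate.incl, blast)+

lemma supported_frag: "a \<in> carrier N ==> m \<in> carrier M ==> supported (frag_of (a, m))"
 and supported_diff: "supported x ==> supported y ==> supported (x - y)" using keys_diff[of x y] by (auto simp: keys_frag_of)

text \<open>Inverses and products of the generated subgroup are merged into closure under
  differences. The support is carried along because the difference step may use it.\<close>

lemma null_induct [consumes 1, case_names zero add1 add2 smult diff]:
 assumes x: "x \<in> Null" and zero: "P 0"
  and "!!a a' m. a \<in> carrier N ==> a' \<in> carrier N ==> m \<in> carrier M ==> P (frag_of (a \<oplus>\<^bsub>N\<^esub> a', m) - frag_of (a, m) - frag_of (a', m))"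
  and "!!a m n. a \<in> carrier N ==> m \<in> carrier M ==> n \<in> carrier M ==> P (frag_of (a, m \<oplus>\<^bsub>M\<^esub> n) - frag_of (a, m) - frag_of (a, n))"
  and "!!r a m. r \<in> carrier R ==> a \<in> carrier N ==> m \<in> carrier M ==> P (frag_of (r \<odot>\<^bsub>N\<^esub> a, m) - frag_of (a, r \<odot>\<^bsub>M\<^esub> m))"
  and diff: "!!x y. supported x ==> supported y ==> P x ==> P y ==> P (x - y)"
 shows "P x & supported x" using x unfolding tensor_null_def
proof (induction rule: generate.induct)
 case one
 show ?case using zero by simp
next
 case (incl h)
 thus ?case using assms(3-5) by (elim UnE CollectE exE conjE) (simp_all add: supported_diff supported_frag)
next
 case (inv h)
 hence "P h & supported h" using assms(3-5) by (elim UnE CollectE exE conjE) (simp_all add: supported_diff supported_frag)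
 thus ?case using diff[of 0 h] zero by simp
next
 case (eng x y)
 thus ?case using diff[of 0 y] diff[of x "- y"] zero keys_add[of x y] by auto
qed

lemma null_diff: "x \<in> Null ==> y \<in> Null ==> x - y \<in> Null"
proof -
 let ?G = "free_Abelian_group (carrier N \<times> carrier M)"
 have s: "supported x" if "x \<in> Null" for x using null_induct[OF that, of "%_. True"] by simp
 have c: "tensor_null R N M \<subseteq> carrier ?G" using s by auto
 have "subgroup (tensor_null R N M) ?G" unfolding tensor_null_def
  by (rule group.generate_is_subgroup[OF group_free_Abelian_group subset_trans[OF _ c[unfolded tensor_null_def]]])
   (blast intro: generate.incl)
 note g = subgroup.m_inv_closed[OF this] subgroup.m_closed[OF this]
 assume xy: "x \<in> Null" "y \<in> Null"
 have "- y \<in> Null" using g(1)[OF xy(2)] s[OF xy(2)] by simp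
 from g(2)[OF xy(1) this] show "x - y \<in> Null" by simp
qed

lemma null_0: "0 \<in> Null" unfolding tensor_null_def using generate.one[of "free_Abelian_group (carrier N \<times> carrier M)"] by simp

lemma null_add: "x \<in> Null ==> y \<in> Null ==> x + y \<in> Null" using null_diff[of x "0 - y"] null_diff[OF null_0, of y] by simp

lemma null_sum: "(!!i. i \<in> I ==> g i \<in> Null) ==> sum g I \<in> Null"
 by (induction I rule: infinite_finite_induct) (auto intro: null_0 null_add)

lemma null_zero_left: "m \<in> carrier M ==> frag_of (\<zero>\<^bsub>N\<^esub>, m) \<in> Null"
 and null_zero_right: "a \<in> carrier N ==> frag_of (a, \<zero>\<^bsub>M\<^esub>) \<in> Null"
 using null_diff[OF null_0 null_relations(1)[of "\<zero>\<^bsub>N\<^esub>" "\<zero>\<^bsub>N\<^esub>" m]]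
  null_diff[OF null_0 null_relations(2)[of a "\<zero>\<^bsub>M\<^esub>" "\<zero>\<^bsub>M\<^esub>"]] by simp_all

text \<open>The functions \<open>h\<close> with the following property compute coordinates in \<open>N \<otimes> M\<close>.\<close>

definition coordinate :: "'c set => 'c => (('n \<times> 'c \<Rightarrow>\<^sub>0 int) => 'n) => bool" where
 "coordinate B b h \<longleftrightarrow> h \<in> hom (free_Abelian_group (carrier N \<times> carrier M)) (add_monoid N) &
  (ALL a:carrier N. ALL m:carrier M. h (frag_of (a, m)) = coeff_of B m b \<odot>\<^bsub>N\<^esub> a)"

lemma coordinate_ex:
 assumes "b \<in> B" shows "EX h. coordinate B b h"
proof -
 have "(%(a, m). coeff_of B m b \<odot>\<^bsub>N\<^esub> a) ` (carrier N \<times> carrier M) \<subseteq> carrier (add_monoid N)"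
  using coeff_of_closed[OF assms] by auto
 then obtain h where "h \<in> hom (free_Abelian_group (carrier N \<times> carrier M)) (add_monoid N)"
  "!!x. x \<in> carrier N \<times> carrier M ==> h (frag_of x) = (%(a, m). coeff_of B m b \<odot>\<^bsub>N\<^esub> a) x"
  using comm_group.free_Abelian_group_universal[OF N.M.a_comm_group] by blast
 thus ?thesis unfolding coordinate_def by (intro exI[of _ h]) auto
qed

lemma coordinate_diff:
 assumes "coordinate B b h" "supported x" "supported y"
 shows "h (x - y) = h x \<ominus>\<^bsub>N\<^esub> h y" "h x \<in> carrier N" "h 0 = \<zero>\<^bsub>N\<^esub>"
proof -
 interpret h: group_hom "free_Abelian_group (carrier N \<times> carrier M)" "add_monoid N" h
  using assms(1) N.M.a_group by (simp add: coordinate_def group_hom_def group_hom_axioms_def)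
 show "h (x - y) = h x \<ominus>\<^bsub>N\<^esub> h y" "h x \<in> carrier N" "h 0 = \<zero>\<^bsub>N\<^esub>"
  using h.hom_mult[of x "- y"] h.hom_inv[of y] h.hom_closed[of x] h.hom_one assms(2,3) by (simp_all add: a_minus_def a_inv_def)
qed

lemma coordinate_frag: "coordinate B b h ==> a \<in> carrier N ==> m \<in> carrier M ==> h (frag_of (a, m)) = coeff_of B m b \<odot>\<^bsub>N\<^esub> a"
 by (simp add: coordinate_def)

text \<open>\<open>M\<close> itself may have no basis, only its finitely generated parts do. A null
  element comes from finitely many relations, which involve finitely many elements of
  \<open>M\<close>; collecting these in \<open>B0\<close> makes every coordinate function respect
  the relations as soon as the span of \<open>B\<close> contains \<open>B0\<close>.\<close>

lemma null_coordinates: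
 assumes "x \<in> Null"
 shows "EX B0. finite B0 & B0 \<subseteq> carrier M &
  (ALL B b h. free_set B --> B0 \<subseteq> lspan B --> b \<in> B --> coordinate B b h --> h x = \<zero>\<^bsub>N\<^esub>)" (is "EX B0. ?P B0 x")
proof -
 have c3: "h (frag_of u - frag_of v - frag_of w) = h (frag_of u) \<ominus>\<^bsub>N\<^esub> h (frag_of v) \<ominus>\<^bsub>N\<^esub> h (frag_of w)"
  if "coordinate B b h" "u \<in> carrier N \<times> carrier M" "v \<in> carrier N \<times> carrier M" "w \<in> carrier N \<times> carrier M" for B b h u v w
  using that by (simp add: coordinate_diff[OF that(1)] supported_diff keys_frag_of)
 have z: "p \<oplus>\<^bsub>N\<^esub> q \<ominus>\<^bsub>N\<^esub> p \<ominus>\<^bsub>N\<^esub> q = \<zero>\<^bsub>N\<^esub>" if "p \<in> carrier N" "q \<in> carrier N" for p q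
  using that by (simp add: N.M.a_comm[of p q] N.M.a_assoc N.M.r_neg a_minus_def)
 have "(EX B0. ?P B0 x) & supported x" using assms
 proof (induction rule: null_induct)
  case zero
  show ?case using coordinate_diff(3)[where x = 0 and y = 0] by (intro exI[of _ "{}"]) auto
 next
  case (add1 a a' m)
  thus ?case using coeff_of_closed by (intro exI[of _ "{m}"]) (auto simp: c3 coordinate_frag N.smult_r_distr z)
 next
  case (add2 a m n)
  thus ?case using coeff_of_closed by (intro exI[of _ "{m, n}"]) (auto simp: c3 coordinate_frag coeff_of_add N.smult_l_distr z)
 next
  case (smult r a m)
  have "h (frag_of (r \<odot>\<^bsub>N\<^esub> a, m) - frag_of (a, r \<odot>\<^bsub>M\<^esub> m)) = \<zero>\<^bsub>N\<^esub>"
   if h: "coordinate B b h" and B: "free_set B" "m \<in> lspan B" "b \<in> B" for B b h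
  proof -
   have c: "coeff_of B m b \<in> carrier R" using coeff_of_closed B by simp
   have "h (frag_of (r \<odot>\<^bsub>N\<^esub> a, m) - frag_of (a, r \<odot>\<^bsub>M\<^esub> m)) = coeff_of B m b \<odot>\<^bsub>N\<^esub> (r \<odot>\<^bsub>N\<^esub> a) \<ominus>\<^bsub>N\<^esub> (r \<otimes> coeff_of B m b) \<odot>\<^bsub>N\<^esub> a"
    using smult B by (simp add: coordinate_diff[OF h] supported_frag coordinate_frag[OF h] coeff_of_smult)
   thus ?thesis using smult c by (simp add: N.smult_assoc1[symmetric] m_comm a_minus_def N.M.r_neg)
  qed
  thus ?case using smult by (intro exI[of _ "{m}"]) auto
 next
  case (diff x y)
  then obtain B1 B2 where "?P B1 x" "?P B2 y" by (elim exE)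
  moreover have "h (x - y) = \<zero>\<^bsub>N\<^esub>" if "coordinate B b h" "h x = \<zero>\<^bsub>N\<^esub>" "h y = \<zero>\<^bsub>N\<^esub>" for B b h
   using that coordinate_diff(1)[OF that(1) diff(1,2)] by (simp add: a_minus_def)
  ultimately show ?case by (intro exI[of _ "B1 \<union> B2"]) auto
 qed
 thus ?thesis by blast
qed

lemma expand:
 assumes a: "a \<in> carrier N" and D: "finite D" "D \<subseteq> carrier M" "c \<in> D \<rightarrow> carrier R"
 shows "frag_of (a, lincomb D c) - (\<Sum>b\<in>D. frag_of (c b \<odot>\<^bsub>N\<^esub> a, b)) \<in> Null" using D
proof (induction D)
 case empty
 thus ?case using null_zero_right[OF a] by (simp add: lincomb_def)
next
 case (insert x D)
 have x: "x \<in> carrier M" "c x \<in> carrier R" and D: "D \<subseteq> carrier M" "c \<in> D \<rightarrow> carrier R" using insert.prems by auto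
 have e: "lincomb (insert x D) c = c x \<odot>\<^bsub>M\<^esub> x \<oplus>\<^bsub>M\<^esub> lincomb D c"
  unfolding lincomb_def by (rule M.finsum_insert) (use insert.hyps D x in \<open>auto simp: Pi_iff subset_iff\<close>)
 let ?S = "lincomb D c"
 have "(frag_of (a, c x \<odot>\<^bsub>M\<^esub> x \<oplus>\<^bsub>M\<^esub> ?S) - frag_of (a, c x \<odot>\<^bsub>M\<^esub> x) - frag_of (a, ?S))
  + (frag_of (a, ?S) - (\<Sum>b\<in>D. frag_of (c b \<odot>\<^bsub>N\<^esub> a, b)))
  - (frag_of (c x \<odot>\<^bsub>N\<^esub> a, x) - frag_of (a, c x \<odot>\<^bsub>M\<^esub> x)) \<in> Null"
  by (intro null_add null_diff null_relations insert.IH a x D smult_closed lincomb_closed)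
 thus ?case using insert.hyps unfolding e by (simp add: algebra_simps)
qed

text \<open>The normal form of a tensor over a free set: all of its information lies in the
  coordinates \<open>h b x\<close>, so a tensor with zero coordinates is null.\<close>

lemma reduce:
 assumes B: "free_set B" and h: "!!b. b \<in> B ==> coordinate B b (h b)"
  and x: "Poly_Mapping.keys x \<subseteq> carrier N \<times> (lspan B \<inter> carrier M)"
 shows "x - (\<Sum>b\<in>B. frag_of (h b x, b)) \<in> Null" using x
proof (induction x rule: frag_induction)
 case zero
 have "(\<Sum>b\<in>B. frag_of (h b 0, b)) \<in> Null"
  by (rule null_sum) (use B coordinate_diff(3)[OF h, of _ 0 0] null_zero_left in \<open>auto simp: free_set_def\<close>)
 from null_diff[OF null_0 this] show ?case by simp
next
 case (diff x y)
 have s: "supported x" "supported y" using diff by auto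
 have "(\<Sum>b\<in>B. frag_of (h b x, b) - frag_of (h b (x - y), b) - frag_of (h b y, b)) \<in> Null"
 proof (rule null_sum)
  fix b assume b: "b \<in> B"
  note f = coordinate_diff[OF h[OF b] s] coordinate_diff(2)[OF h[OF b] s(2,1)]
  have "(h b x \<ominus>\<^bsub>N\<^esub> h b y) \<oplus>\<^bsub>N\<^esub> h b y = h b x" using f by (simp add: a_minus_def N.M.a_assoc N.M.l_neg)
  thus "frag_of (h b x, b) - frag_of (h b (x - y), b) - frag_of (h b y, b) \<in> Null"
   using null_relations(1)[of "h b x \<ominus>\<^bsub>N\<^esub> h b y" "h b y" b] f b B by (auto simp: free_set_def)
 qed
 from null_add[OF null_diff[OF diff(3,4)] this] show ?case by (simp add: sum_subtractf sum.distrib algebra_simps)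
next
 case (one z)
 then obtain a m where z: "z = (a, m)" "a \<in> carrier N" "m \<in> lspan B" "m \<in> carrier M" by auto
 have "frag_of (a, lincomb B (coeff_of B m)) - (\<Sum>b\<in>B. frag_of (coeff_of B m b \<odot>\<^bsub>N\<^esub> a, b)) \<in> Null"
  by (rule expand) (use z B coeff_of in \<open>auto simp: free_set_def\<close>)
 moreover have "(\<Sum>b\<in>B. frag_of (coeff_of B m b \<odot>\<^bsub>N\<^esub> a, b)) = (\<Sum>b\<in>B. frag_of (h b (frag_of z), b))"
  by (rule sum.cong) (use z coordinate_frag[OF h] in auto)
 ultimately show ?case using z coeff_of(2) by simp
qed

end

text \<open>A tensor killed by \<open>ph\<close> is killed by finitely many relations. Over a free
  set whose span contains all elements of \<open>M\<close> involved, its coordinates in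
  \<open>N\<close> vanish. They are the images under \<open>ph\<close> of the coordinates in
  \<open>N'\<close>, which vanish by injectivity, and \<open>reduce\<close> then shows that the
  tensor was null from the start.\<close>

theorem (in module) uniserial_torsion_free_flat:
 assumes total: "!!a b. a \<in> carrier R ==> b \<in> carrier R ==>
   (EX c:carrier R. a = c \<otimes> b) \<or> (EX c:carrier R. b = c \<otimes> a)"
  and torsion_free: "!!r m. r \<in> carrier R ==> m \<in> carrier M ==> r \<odot>\<^bsub>M\<^esub> m = \<zero>\<^bsub>M\<^esub> ==>
   r = \<zero> \<or> m = \<zero>\<^bsub>M\<^esub>"
 shows "flat_module R M" unfolding flat_module_def
proof (intro conjI allI impI ballI)
 show "module R M" by (rule module_axioms)
 fix N' N :: "('a, nat => 'a) module" and ph xi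
 assume N': "module R N'" and N: "module R N" and inj: "module_inj R N' N ph"
  and xi: "xi \<in> carrier (free_Abelian_group (carrier N' \<times> carrier M))"
  and null: "frag_extend (%(a, m). frag_of (ph a, m)) xi \<in> tensor_null R N M"
 interpret N: tensor_pair R M N by (intro tensor_pair.intro module_axioms N)
 interpret N': tensor_pair R M N' by (intro tensor_pair.intro module_axioms N')
 let ?F = "frag_extend (%(a, m). frag_of (ph a, m))"
 obtain B0 where B0: "finite B0" "B0 \<subseteq> carrier M"
  and kill: "!!B b h. free_set B ==> B0 \<subseteq> lspan B ==> b \<in> B ==> N.coordinate B b h ==> h (?F xi) = \<zero>\<^bsub>N\<^esub>"
 proof -
  from N.null_coordinates[OF null] obtain B0 where B0: "finite B0 & B0 \<subseteq> carrier M & (ALL B b h. free_set B -->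
   B0 \<subseteq> lspan B --> b \<in> B --> N.coordinate B b h --> h (?F xi) = \<zero>\<^bsub>N\<^esub>)" by (elim exE)
  show thesis by (rule that[of B0]) (use B0 in simp_all)
 qed
 let ?B1 = "B0 \<union> snd ` Poly_Mapping.keys xi"
 have "EX B. free_set B & ?B1 \<subseteq> lspan B" by (rule uniserial_basis[OF total torsion_free]) (use B0 xi in auto)
 then obtain B where B: "free_set B" "?B1 \<subseteq> lspan B" by blast
 have "EX h. ALL b:B. N.coordinate B b (h b)" by (intro bchoice ballI N.coordinate_ex)
 then obtain h where "ALL b:B. N.coordinate B b (h b)" by (elim exE)
 note h = bspec[OF this]
 have "EX h. ALL b:B. N'.coordinate B b (h b)" by (intro bchoice ballI N'.coordinate_ex)
 then obtain h' where "ALL b:B. N'.coordinate B b (h' b)" by (elim exE)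
 note h' = bspec[OF this]
 have ph: "a \<in> carrier N' ==> ph a \<in> carrier N"
  "a \<in> carrier N' ==> b \<in> carrier N' ==> ph (a \<oplus>\<^bsub>N'\<^esub> b) = ph a \<oplus>\<^bsub>N\<^esub> ph b"
  "r \<in> carrier R ==> a \<in> carrier N' ==> ph (r \<odot>\<^bsub>N'\<^esub> a) = r \<odot>\<^bsub>N\<^esub> ph a" for a b r
  using inj by (auto simp: module_inj_def)
 have ph_zero: "ph \<zero>\<^bsub>N'\<^esub> = \<zero>\<^bsub>N\<^esub>"
  using ph(1)[of "\<zero>\<^bsub>N'\<^esub>"] ph(3)[of \<zero> "\<zero>\<^bsub>N'\<^esub>"] by (simp add: N'.N.smult_l_null N.N.smult_l_null)
 have ph_minus: "ph (a \<ominus>\<^bsub>N'\<^esub> b) = ph a \<ominus>\<^bsub>N\<^esub> ph b" if ab: "a \<in> carrier N'" "b \<in> carrier N'" for a b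
 proof -
  have "ph (\<ominus>\<^bsub>N'\<^esub> b) \<oplus>\<^bsub>N\<^esub> ph b = \<zero>\<^bsub>N\<^esub>"
   using ph(2)[of "\<ominus>\<^bsub>N'\<^esub> b" b] ab ph_zero by (simp add: N'.N.M.l_neg)
  hence "ph (\<ominus>\<^bsub>N'\<^esub> b) = \<ominus>\<^bsub>N\<^esub> ph b" using ph(1) ab N.N.M.minus_equality by simp
  thus ?thesis using ph(2)[of a "\<ominus>\<^bsub>N'\<^esub> b"] ab by (simp add: a_minus_def)
 qed
 have F_keys: "N.supported (?F x)" if "N'.supported x" for x
  by (rule order_trans[OF keys_frag_extend]) (use that ph in \<open>auto simp: keys_frag_of\<close>)
 have natural: "h b (?F x) = ph (h' b x)" if "N'.supported x" and b: "b \<in> B" for x b using that(1)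
 proof (induction x rule: frag_induction)
  case zero
  show ?case using N.coordinate_diff(3)[OF h[OF b], of 0 0] N'.coordinate_diff(3)[OF h'[OF b], of 0 0] ph_zero by simp
 next
  case (diff x y)
  thus ?case using N.coordinate_diff(1)[OF h[OF b] F_keys[OF diff(1)] F_keys[OF diff(2)]] N'.coordinate_diff(1,2)[OF h'[OF b] diff(1,2)]
    N'.coordinate_diff(2)[OF h'[OF b] diff(2,1)] by (simp add: frag_extend_diff ph_minus)
 next
  case (one x)
  thus ?case using N.coordinate_frag[OF h[OF b]] N'.coordinate_frag[OF h'[OF b]] ph coeff_of_closed[OF b] by auto
 qed
 have s: "N'.supported xi" using xi by simp
 have "h' b xi = \<zero>\<^bsub>N'\<^esub>" if b: "b \<in> B" for b
 proof -
  have "ph (h' b xi) = ph \<zero>\<^bsub>N'\<^esub>" using natural[OF s b] kill[OF B(1) _ b h[OF b]] B(2) ph_zero by simp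
  thus ?thesis using inj N'.coordinate_diff(2)[OF h'[OF b] s s] by (auto simp: module_inj_def inj_on_def)
 qed
 hence "(\<Sum>b\<in>B. frag_of (h' b xi, b)) \<in> tensor_null R N' M" using B(1) N'.null_zero_left by (intro N'.null_sum) (auto simp: free_set_def)
 moreover have "Poly_Mapping.keys xi \<subseteq> carrier N' \<times> (lspan B \<inter> carrier M)" using s B(2) by fastforce
 ultimately have "(xi - (\<Sum>b\<in>B. frag_of (h' b xi, b))) + (\<Sum>b\<in>B. frag_of (h' b xi, b)) \<in> tensor_null R N' M"
  by (intro N'.null_add[OF N'.reduce[OF B(1) h']])
 thus "xi \<in> tensor_null R N' M" by simp
qed

section \<open>Spaces defined by graded systems of functions\<close>

text \<open>Regularity is always defined as being locally of a certain shape \<open>Q\<close>. Such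
  a condition is a sheaf as soon as \<open>Q\<close> passes to smaller open sets and only depends on
  the values on the set.\<close>

lemma sheaf_of_functionsI:
 assumes reg: "!!U. regular X U = {f. ALL z:U. EX W. opn X W & z \<in> W & W \<subseteq> U & Q W f}"
  and anti: "!!W W' f. opn X W ==> opn X W' ==> W' \<subseteq> W ==> Q W f ==> Q W' f"
  and cong: "!!W f g. Q W f ==> (!!x. x \<in> W ==> f x = g x) ==> Q W g"
 shows "sheaf_of_functions X" unfolding sheaf_of_functions_def
proof (intro conjI allI impI)
 fix U f g assume "f \<in> regular X U" and eq: "ALL x:U. f x = g x"
 show "g \<in> regular X U" unfolding reg
 proof (intro CollectI ballI)
  fix z assume "z \<in> U"
  then obtain W where "opn X W" "z \<in> W" "W \<subseteq> U" "Q W f" using \<open>f \<in> regular X U\<close> unfolding reg by blast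
  thus "EX W. opn X W & z \<in> W & W \<subseteq> U & Q W g" using cong[of W f g] eq by blast
 qed
next
 fix U V f assume V: "opn X V" "V \<subseteq> U" and f: "f \<in> regular X U"
 show "f \<in> regular X V" unfolding reg
 proof (intro CollectI ballI)
  fix z assume z: "z \<in> V"
  then obtain W where W: "opn X W" "z \<in> W" "W \<subseteq> U" "Q W f" using f V unfolding reg by blast
  thus "EX W. opn X W & z \<in> W & W \<subseteq> V & Q W f"
   using anti[of W "W \<inter> V" f] V z openin_Int[of "zar X" W V] by (intro exI[of _ "W \<inter> V"]) auto
 qed
next
 fix U f assume *: "ALL x:U. EX W. opn X W & x \<in> W & W \<subseteq> U & f \<in> regular X W"
 show "f \<in> regular X U" unfolding reg
 proof (intro CollectI ballI)
  fix z assume "z \<in> U"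
  with * obtain W where W: "z \<in> W" "W \<subseteq> U" "f \<in> regular X W" by blast
  then obtain W' where "opn X W'" "z \<in> W'" "W' \<subseteq> W" "Q W' f" unfolding reg by blast
  with W show "EX W. opn X W & z \<in> W & W \<subseteq> U & Q W f" by blast
 qed
qed

lemma sheaf_cong:
 assumes "sheaf_of_functions X" "opn X U" "f \<in> regular X U" "!!x. x \<in> U ==> f x = g x"
 shows "g \<in> regular X U" using assms(1)[unfolded sheaf_of_functions_def, THEN conjunct1, rule_format, of U f g] assms(2-4) by simp

lemma sheaf_restrict:
 "sheaf_of_functions X ==> opn X U ==> opn X W ==> W \<subseteq> U ==> f \<in> regular X U ==>
  f \<in> regular X W" unfolding sheaf_of_functions_def by blast

lemma sheaf_glue:
 assumes "sheaf_of_functions X" "opn X U"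
  and "!!x. x \<in> U ==> EX W. opn X W & x \<in> W & W \<subseteq> U & f \<in> regular X W"
 shows "f \<in> regular X U" using assms(1)[unfolded sheaf_of_functions_def, THEN conjunct2, THEN conjunct2, rule_format, of U f] assms(2,3) by simp

definition gtop :: "(nat => ('p => complex) set) => 'p set => 'p topology" where
 "gtop H Z = topology_generated_by {(nz Z h) |h d. h \<in> H d}"

text \<open>
 An abstraction of \<open>affine_space_on\<close>, where every \<open>H d\<close> consists of all polynomial functions, and
 of \<open>proj_space_on\<close>, where \<open>H d\<close> consists of the forms of degree \<open>d\<close>, evaluated at chosen
 representatives of the points.
\<close>

definition gspace :: "(nat => ('p => complex) set) => 'p set => 'p funspace" where
 "gspace H Z = \<lparr>zar = gtop H Z,
  regular = (%U. {f. ALL z:U. EX W p q d. openin (gtop H Z) W & z \<in> W & W \<subseteq> U &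
    p \<in> H d & q \<in> H d & (ALL y:W. q y ~= 0 & f y = p y / q y)})\<rparr>"

lemma zar_gspace [simp]: "zar (gspace H Z) = gtop H Z" by (simp add: gspace_def)

lemma sheaf_gspace: "sheaf_of_functions (gspace H Z)"
 by (rule sheaf_of_functionsI[where Q = "%W f. EX p q d. p \<in> H d & q \<in> H d & (ALL y:W. q y ~= 0 & f y = p y / q y)"])
  ((simp add: gspace_def; fail) | (meson subsetD; fail) | metis)+

lemma sheaf_prod_space: "sheaf_of_functions (prod_space X Y)" by (rule sheaf_of_functionsI[where Q = "%W f. EX U V p q. W \<subseteq> U \<times> V &
      opn X U & opn Y V &
      p \<in> tensor_funs X Y U V & q \<in> tensor_funs X Y U V &
      (ALL y:W. q y ~= 0 & f y = p y / q y)"])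
  ((simp add: prod_space_def Let_def; fail) | (meson subsetD subset_trans; fail) | metis)+

text \<open>One condition on quotients of equal degree serves twice: with \<open>p = q\<close> its
  domain of definition gives continuity, and with general \<open>p\<close> it gives the pullback of
  regular functions. The constant in degree 0 ensures that the basic open sets cover
  \<open>Z\<close>.\<close>

lemma morphism_gspaceI:
 assumes X: "sheaf_of_functions X"
  and into: "!!x. x \<in> pts X ==> th x \<in> Z"
  and quot: "!!d p q x. p \<in> H d ==> q \<in> H d ==> x \<in> pts X ==> q (th x) ~= 0 ==>
   EX U. opn X U & x \<in> U & (%z. p (th z) / q (th z)) \<in> regular X U & (ALL z:U. q (th z) ~= 0)"
  and one: "(%_. 1) \<in> H 0"
 shows "morphism X (gspace H Z) th" unfolding morphism_def
proof (intro conjI allI impI)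
 show cont: "continuous_map (zar X) (zar (gspace H Z)) th" unfolding zar_gspace gtop_def
 proof (rule continuous_on_generated_topo)
  fix U assume "U \<in> {(nz Z h) |h d. h \<in> H d}"
  then obtain h d where U: "U = (nz Z h)" "h \<in> H d" by blast
  have "EX T. opn X T & x \<in> T & T \<subseteq> th -` U \<inter> pts X" if "x \<in> th -` U \<inter> pts X" for x
  proof -
   from that U have "x \<in> pts X" "h (th x) ~= 0" by auto
   from quot[OF U(2) U(2) this] obtain T where "opn X T" "x \<in> T" "ALL z:T. h (th z) ~= 0" by blast
   thus ?thesis using U into openin_subset[of "zar X" T] by (intro exI[of _ T]) auto
  qed
  thus "opn X (th -` U \<inter> pts X)" by (subst openin_subopen) blast
 next
  show "th ` pts X \<subseteq> \<Union>{(nz Z h) |h d. h \<in> H d}"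
  proof
   fix y assume "y \<in> th ` pts X"
   hence "y \<in> {z \<in> Z. (%_. 1 :: complex) z ~= 0}" using into by auto
   thus "y \<in> \<Union>{(nz Z h) |h d. h \<in> H d}" using one by blast
  qed
 qed
 fix W g assume W: "opn (gspace H Z) W" and g: "g \<in> regular (gspace H Z) W"
 have op: "opn X {x \<in> pts X. th x \<in> W'}" if "openin (gtop H Z) W'" for W'
  using cont that unfolding zar_gspace by (rule openin_continuous_map_preimage)
 show "g \<circ> th \<in> regular X {x \<in> pts X. th x \<in> W}"
 proof (rule sheaf_glue[OF X op])
  show "openin (gtop H Z) W" using W by simp
  fix x assume "x \<in> {x \<in> pts X. th x \<in> W}"
  hence x: "x \<in> pts X" "th x \<in> W" by auto
  with g obtain W' p q d where W': "openin (gtop H Z) W'" "th x \<in> W'" "W' \<subseteq> W"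
   and pq: "p \<in> H d" "q \<in> H d" "!!y. y \<in> W' ==> q y ~= 0 & g y = p y / q y" unfolding gspace_def by auto
  obtain U where U: "opn X U" "x \<in> U" "(%z. p (th z) / q (th z)) \<in> regular X U" using quot[OF pq(1,2) x(1)] pq(3) W' by blast
  let ?U = "U \<inter> {x \<in> pts X. th x \<in> W'}"
  have o: "opn X ?U" using U op[OF W'(1)] by auto
  have "(%z. p (th z) / q (th z)) \<in> regular X ?U" by (rule sheaf_restrict[OF X U(1) o _ U(3)]) auto
  hence "g \<circ> th \<in> regular X ?U" by (rule sheaf_cong[OF X o]) (use pq(3) in auto)
  thus "EX U'. opn X U' & x \<in> U' & U' \<subseteq> {x \<in> pts X. th x \<in> W} & g \<circ> th \<in> regular X U'"
  proof (intro exI conjI)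
   show "?U \<subseteq> {x \<in> pts X. th x \<in> W}" using W' by auto
  qed (use o x U W' in auto)
 qed
qed

lemma morphism_open_subspace:
 assumes "morphism X Y th" and "opn Y U" and "!!x. x \<in> pts X ==> th x \<in> U"
 shows "morphism X (open_subspace Y U) th" using assms unfolding morphism_def open_subspace_def
 by (auto simp: continuous_map_in_subtopology openin_open_subtopology)

lemma sheaf_open_subspace:
 assumes "sheaf_of_functions X" "opn X U"
 shows "sheaf_of_functions (open_subspace X U)"
proof -
 have op: "opn (open_subspace X U) W \<longleftrightarrow> opn X W & W \<subseteq> U" for W
  using assms(2) by (simp add: open_subspace_def openin_open_subtopology)
 have reg: "regular (open_subspace X U) = regular X" by (simp add: open_subspace_def)
 show ?thesis unfolding sheaf_of_functions_def op reg
 proof (intro conjI allI impI)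
  fix V f g assume "opn X V & V \<subseteq> U" "f \<in> regular X V" "ALL x:V. f x = g x"
  thus "g \<in> regular X V" using sheaf_cong[OF assms(1), of V f g] by auto
 next
  fix V W f assume "opn X V & V \<subseteq> U" "opn X W & W \<subseteq> U" "W \<subseteq> V" "f \<in> regular X V"
  thus "f \<in> regular X W" using sheaf_restrict[OF assms(1), of V W f] by auto
 next
  fix V f assume V: "opn X V & V \<subseteq> U"
   and *: "ALL x:V. EX W. (opn X W & W \<subseteq> U) & x \<in> W & W \<subseteq> V & f \<in> regular X W"
  show "f \<in> regular X V"
  proof (rule sheaf_glue[OF assms(1)])
   fix x assume "x \<in> V"
   from bspec[OF * this] show "EX W. opn X W & x \<in> W & W \<subseteq> V & f \<in> regular X W" by blast
  qed (use V in blast)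
 qed
qed

locale gfun =
 fixes H :: "nat => ('p => complex) set" and Z :: "'p set"
 assumes one: "(%_. 1) \<in> H 0"
  and add: "p \<in> H d ==> q \<in> H d ==> (%z. p z + q z) \<in> H d"
  and scale: "p \<in> H d ==> (%z. c * p z) \<in> H d"
  and mult: "p \<in> H d ==> q \<in> H e ==> (%z. p z * q z) \<in> H (d + e)"
begin

lemma const: "(%_. c) \<in> H 0" using scale[OF one, of c] by simp

lemma topspace_gtop [simp]: "topspace (gtop H Z) = Z"
proof
 show "Z \<subseteq> topspace (gtop H Z)"
 proof
  fix z assume "z \<in> Z"
  hence "z \<in> {z \<in> Z. (%_. 1 :: complex) z ~= 0}" by auto
  thus "z \<in> topspace (gtop H Z)" unfolding gtop_def topology_generated_by_topspace using one by blast
 qed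
qed (auto simp: gtop_def topology_generated_by_topspace)

lemma open_basic: "h \<in> H d ==> openin (gtop H Z) (nz Z h)" unfolding gtop_def by (rule topology_generated_by_Basis) blast

text \<open>The generating sets already form a basis: functions multiply, so the intersection of two
  nonvanishing sets is again one.\<close>

lemma openin_gtop_iff:
 "openin (gtop H Z) U \<longleftrightarrow>
  U \<subseteq> Z & (ALL z:U. EX d. EX h:H d. h z ~= 0 & (ALL y:Z. h y ~= 0 --> y \<in> U))" (is "_ \<longleftrightarrow> ?R U")
proof
 assume "openin (gtop H Z) U"
 hence "generate_topology_on {(nz Z h) |h d. h \<in> H d} U" unfolding gtop_def openin_topology_generated_by_iff .
 thus "?R U"
 proof (induction rule: generate_topology_on.induct)
  case (Int a b)
  show ?case
  proof (intro conjI ballI)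
   fix z assume "z \<in> a \<inter> b"
   with Int.IH obtain d e h k where "h \<in> H d" "h z ~= 0" "ALL y:Z. h y ~= 0 --> y \<in> a"
    "k \<in> H e" "k z ~= 0" "ALL y:Z. k y ~= 0 --> y \<in> b" by blast
   thus "EX d. EX h:H d. h z ~= 0 & (ALL y:Z. h y ~= 0 --> y \<in> a \<inter> b)" by (intro exI[of _ "d + e"] bexI[of _ "%z. h z * k z"] mult) auto
  qed (use Int.IH in auto)
 next
  case (UN K)
  show ?case
  proof (intro conjI ballI)
   fix z assume "z \<in> \<Union>K"
   then obtain k where "k \<in> K" "z \<in> k" by blast
   with UN.IH[OF this(1)] show "EX d. EX h:H d. h z ~= 0 & (ALL y:Z. h y ~= 0 --> y \<in> \<Union>K)" by blast
  qed (use UN.IH in auto)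
 qed auto
next
 assume U: "?R U"
 show "openin (gtop H Z) U"
 proof (subst openin_subopen, intro ballI)
  fix z assume "z \<in> U"
  with U obtain d h where h: "h \<in> H d" "h z ~= 0" "ALL y:Z. h y ~= 0 --> y \<in> U" by blast
  thus "EX T. openin (gtop H Z) T & z \<in> T & T \<subseteq> U"
   using open_basic[OF h(1)] U \<open>z \<in> U\<close> by (intro exI[of _ "(nz Z h)"]) auto
 qed
qed

text \<open>The neighbourhood is absorbed into the denominator: multiplying \<open>p\<close> and
  \<open>q\<close> by a function whose nonvanishing set lies inside it lets the set where
  \<open>q\<close> is nonzero play its role.\<close>

lemma regular_iff:
 assumes U: "openin (gtop H Z) U"
 shows "f \<in> regular (gspace H Z) U \<longleftrightarrow>
  (ALL z:U. EX d. EX p:H d. EX q:H d. q z ~= 0 & (ALL y:Z. q y ~= 0 --> y \<in> U & f y = p y / q y))"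
proof
 assume f: "f \<in> regular (gspace H Z) U"
 show "ALL z:U. EX d. EX p:H d. EX q:H d. q z ~= 0 & (ALL y:Z. q y ~= 0 --> y \<in> U & f y = p y / q y)"
 proof
  fix z assume "z \<in> U"
  with f obtain W p q d where W: "openin (gtop H Z) W" "z \<in> W" "W \<subseteq> U"
   and pq: "p \<in> H d" "q \<in> H d" "ALL y:W. q y ~= 0 & f y = p y / q y" unfolding gspace_def by auto
  from W obtain e h where h: "h \<in> H e" "h z ~= 0" "ALL y:Z. h y ~= 0 --> y \<in> W" unfolding openin_gtop_iff by blast
  show "EX d. EX p:H d. EX q:H d. q z ~= 0 & (ALL y:Z. q y ~= 0 --> y \<in> U & f y = p y / q y)"
   by (rule exI[of _ "d + e"], rule bexI[OF _ mult[OF pq(1) h(1)]], rule bexI[OF _ mult[OF pq(2) h(1)]]) (use pq h W in auto)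
 qed
next
 assume *: "ALL z:U. EX d. EX p:H d. EX q:H d. q z ~= 0 & (ALL y:Z. q y ~= 0 --> y \<in> U & f y = p y / q y)"
 have "EX W p q d. openin (gtop H Z) W & z \<in> W & W \<subseteq> U & p \<in> H d & q \<in> H d &
    (ALL y:W. q y ~= 0 & f y = p y / q y)" if z: "z \<in> U" for z
 proof -
  from * z obtain d p q where pq: "p \<in> H d" "q \<in> H d" "q z ~= 0"
   "ALL y:Z. q y ~= 0 --> y \<in> U & f y = p y / q y" by blast
  thus ?thesis using open_basic[OF pq(2)] openin_subset[OF U] z by (intro exI[of _ "(nz Z q)"] exI[of _ p] exI[of _ q] exI[of _ d]) auto
 qed
 thus "f \<in> regular (gspace H Z) U" unfolding gspace_def by simp
qed

lemma regular_quotient: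
 assumes "p \<in> H d" "q \<in> H d" "openin (gtop H Z) U" "!!z. z \<in> U ==> q z ~= 0"
 shows "(%z. p z / q z) \<in> regular (gspace H Z) U"
proof -
 have "EX W p' q' d. openin (gtop H Z) W & z \<in> W & W \<subseteq> U & p' \<in> H d & q' \<in> H d &
   (ALL y:W. q' y ~= 0 & p y / q y = p' y / q' y)" if "z \<in> U" for z
  by (rule exI[of _ U], rule exI[of _ p], rule exI[of _ q], rule exI[of _ d]) (use assms that in simp)
 thus ?thesis unfolding gspace_def by simp
qed

lemma regularE:
 assumes "openin (gtop H Z) U" "f \<in> regular (gspace H Z) U" "z \<in> U"
 obtains d p q where "p \<in> H d" "q \<in> H d" "q z ~= 0"
  "!!y. y \<in> Z ==> q y ~= 0 ==> y \<in> U" "!!y. y \<in> Z ==> q y ~= 0 ==> f y = p y / q y"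
proof -
 have "EX d. EX p:H d. EX q:H d. q z ~= 0 & (ALL y:Z. q y ~= 0 --> y \<in> U & f y = p y / q y)"
  using assms(2,3) unfolding regular_iff[OF assms(1)] by (rule bspec)
 thus ?thesis by (elim exE bexE conjE) (rule that, assumption+, simp_all)
qed

end

locale ringed =
 fixes X :: "'p funspace"
 assumes sheaf: "sheaf_of_functions X"
  and reg_const: "opn X U ==> (%_. c) \<in> regular X U"
  and reg_add: "opn X U ==> f \<in> regular X U ==> g \<in> regular X U ==> (%x. f x + g x) \<in> regular X U"
  and reg_mult: "opn X U ==> f \<in> regular X U ==> g \<in> regular X U ==> (%x. f x * g x) \<in> regular X U"

sublocale gfun \<subseteq> ringed "gspace H Z"
proof
 show "sheaf_of_functions (gspace H Z)" by (rule sheaf_gspace)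
 fix U assume "opn (gspace H Z) U"
 hence U: "openin (gtop H Z) U" by simp
 hence UZ: "U \<subseteq> Z" using openin_subset by fastforce
 show "(%_. c) \<in> regular (gspace H Z) U" for c using regular_quotient[OF const[of c] one U] by simp
 fix f g assume "f \<in> regular (gspace H Z) U" "g \<in> regular (gspace H Z) U"
 note f = this(1) and g = this(2)
 show "(%x. f x + g x) \<in> regular (gspace H Z) U" unfolding regular_iff[OF U]
 proof
  fix z assume z: "z \<in> U"
  obtain d p q where 1: "p \<in> H d" "q \<in> H d" "q z ~= 0" "!!y. y \<in> Z ==> q y ~= 0 ==> y \<in> U"
   "!!y. y \<in> Z ==> q y ~= 0 ==> f y = p y / q y" using regularE[OF U f z] by metis
  obtain e r s where 2: "r \<in> H e" "s \<in> H e" "s z ~= 0" "!!y. y \<in> Z ==> s y ~= 0 ==> y \<in> U"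
   "!!y. y \<in> Z ==> s y ~= 0 ==> g y = r y / s y" using regularE[OF U g z] by metis
  have 3: "(%y. p y * s y + q y * r y) \<in> H (d + e)" "(%y. q y * s y) \<in> H (d + e)" using 1 2 by (auto intro!: add mult)
  show "EX d. EX p:H d. EX q:H d. q z ~= 0 & (ALL y:Z. q y ~= 0 --> y \<in> U & f y + g y = p y / q y)"
  proof (rule exI[of _ "d + e"], rule bexI[OF _ 3(1)], rule bexI[OF _ 3(2)], intro conjI ballI impI)
   fix y assume "y \<in> Z" "q y * s y ~= 0"
   hence "q y ~= 0" "s y ~= 0" "y \<in> U" "f y = p y / q y" "g y = r y / s y" using 1(4,5)[of y] 2(5)[of y] by auto
   thus "y \<in> U" "f y + g y = (p y * s y + q y * r y) / (q y * s y)" by (auto simp: field_simps)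
  qed (use 1 2 in auto)
 qed
 show "(%x. f x * g x) \<in> regular (gspace H Z) U" unfolding regular_iff[OF U]
 proof
  fix z assume z: "z \<in> U"
  obtain d p q where 1: "p \<in> H d" "q \<in> H d" "q z ~= 0" "!!y. y \<in> Z ==> q y ~= 0 ==> y \<in> U"
   "!!y. y \<in> Z ==> q y ~= 0 ==> f y = p y / q y" using regularE[OF U f z] by metis
  obtain e r s where 2: "r \<in> H e" "s \<in> H e" "s z ~= 0" "!!y. y \<in> Z ==> s y ~= 0 ==> y \<in> U"
   "!!y. y \<in> Z ==> s y ~= 0 ==> g y = r y / s y" using regularE[OF U g z] by metis
  have 3: "(%y. p y * r y) \<in> H (d + e)" "(%y. q y * s y) \<in> H (d + e)" using 1 2 by (auto intro!: mult)
  show "EX d. EX p:H d. EX q:H d. q z ~= 0 & (ALL y:Z. q y ~= 0 --> y \<in> U & f y * g y = p y / q y)"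
  proof (rule exI[of _ "d + e"], rule bexI[OF _ 3(1)], rule bexI[OF _ 3(2)], intro conjI ballI impI)
   fix y assume "y \<in> Z" "q y * s y ~= 0"
   hence "q y ~= 0" "s y ~= 0" "y \<in> U" "f y = p y / q y" "g y = r y / s y" using 1(4,5)[of y] 2(5)[of y] by auto
   thus "y \<in> U" "f y * g y = (p y * r y) / (q y * s y)" by auto
  qed (use 1 2 in auto)
 qed
qed

section \<open>Stalks\<close>

context ringed
begin

lemma reg_Int:
 assumes "opn X U" "opn X V"
 shows "f \<in> regular X U ==> f \<in> regular X (U \<inter> V)" "f \<in> regular X V ==> f \<in> regular X (U \<inter> V)"
 using assms sheaf_restrict[OF sheaf, of U "U \<inter> V" f] sheaf_restrict[OF sheaf, of V "U \<inter> V" f] by auto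

lemma germ_eq_iff:
 assumes "opn X U" "x \<in> U" "f \<in> regular X U" "opn X V" "x \<in> V" "g \<in> regular X V"
 shows "germ X x U f = germ X x V g \<longleftrightarrow>
  (EX W. opn X W & x \<in> W & W \<subseteq> U \<inter> V & (ALL y:W. f y = g y))"
proof
 assume "germ X x U f = germ X x V g"
 moreover have "(V, g) \<in> germ X x V g" using assms unfolding germ_def by auto
 ultimately have "(V, g) \<in> germ X x U f" by simp
 thus "EX W. opn X W & x \<in> W & W \<subseteq> U \<inter> V & (ALL y:W. f y = g y)" unfolding germ_def by blast
next
 have sub: "germ X x U f \<subseteq> germ X x V g"
  if "opn X W" "x \<in> W" "W \<subseteq> U \<inter> V" "ALL y:W. f y = g y" for W U V f g
 proof
  fix a assume "a \<in> germ X x U f"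
  then obtain V' g' W' where a: "a = (V', g')" "opn X V'" "x \<in> V'" "g' \<in> regular X V'"
   "opn X W'" "x \<in> W'" "W' \<subseteq> U \<inter> V'" "ALL y:W'. f y = g' y" unfolding germ_def by blast
  thus "a \<in> germ X x V g" using that openin_Int[of "zar X" W W'] unfolding germ_def by (auto intro!: exI[of _ "W \<inter> W'"])
 qed
 assume "EX W. opn X W & x \<in> W & W \<subseteq> U \<inter> V & (ALL y:W. f y = g y)"
 thus "germ X x U f = germ X x V g" using sub[of _ U V f g] sub[of _ V U g f] by (metis Int_commute subset_antisym)
qed

lemma germ_restrict:
 assumes "opn X U" "f \<in> regular X U" "opn X W" "x \<in> W" "W \<subseteq> U"
 shows "germ X x U f = germ X x W f" by (subst germ_eq_iff) (use assms sheaf_restrict[OF sheaf] in auto)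

lemma germ_cong:
 assumes "opn X U" "f \<in> regular X U" "x \<in> U" "!!y. y \<in> U ==> f y = g y"
 shows "germ X x U f = germ X x U g" by (subst germ_eq_iff) (use assms sheaf_cong[OF sheaf] in auto)

lemma germ_in_stalk:
 "opn X U ==> x \<in> U ==> f \<in> regular X U ==> germ X x U f \<in> carrier (stalk X x)" unfolding stalk_def by auto

lemma stalkE:
 assumes "a \<in> carrier (stalk X x)"
 obtains U f where "opn X U" "x \<in> U" "f \<in> regular X U" "a = germ X x U f" using assms unfolding stalk_def by auto

text \<open>The operations of \<open>stalk\<close> are unions over all representatives of a germ.
  Such a union collapses to its value at one representative once all representatives give the same
  value.\<close>

lemma germ_UN:
 assumes U: "opn X U" "x \<in> U" "f \<in> regular X U"
  and eq: "!!U' f'. opn X U' ==> x \<in> U' ==> f' \<in> regular X U' ==> germ X x U' f' = germ X x U f ==> G U' f' = G U f"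
 shows "(\<Union>(U', f')\<in>germ X x U f. G U' f') = G U f"
proof -
 have "(U, f) \<in> germ X x U f" using U unfolding germ_def by auto
 moreover have "G U' f' = G U f" if "(U', f') \<in> germ X x U f" for U' f'
 proof (rule eq)
  from that show *: "opn X U'" "x \<in> U'" "f' \<in> regular X U'" unfolding germ_def by auto
  show "germ X x U' f' = germ X x U f"
  proof -
   from that obtain W where "opn X W" "x \<in> W" "W \<subseteq> U \<inter> U'" "ALL y:W. f y = f' y" unfolding germ_def by auto
   thus ?thesis by (subst germ_eq_iff[OF * U]) (intro exI[of _ W], auto)
  qed
 qed
 hence "(\<Union>(U', f')\<in>germ X x U f. G U' f') = (\<Union>a\<in>germ X x U f. G U f)"
  by (intro SUP_cong refl) (auto simp only: split: prod.split)
 ultimately show ?thesis by blast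
qed

text \<open>A single argument for sum and product in the stalk; all that matters is that
  \<open>op\<close> preserves regularity pointwise.\<close>

lemma germ_op:
 assumes U: "opn X U" "x \<in> U" "f \<in> regular X U" and V: "opn X V" "x \<in> V" "g \<in> regular X V"
  and op: "!!U f g. opn X U ==> f \<in> regular X U ==> g \<in> regular X U ==> (%x. op (f x) (g x)) \<in> regular X U"
 shows "(\<Union>(U', f')\<in>germ X x U f. \<Union>(V', g')\<in>germ X x V g. germ X x (U' \<inter> V') (%y. op (f' y) (g' y)))
  = germ X x (U \<inter> V) (%y. op (f y) (g y))"
proof -
 have reg: "(%y. op (f y) (g y)) \<in> regular X (U \<inter> V)" if "opn X U" "f \<in> regular X U"
  "opn X V" "g \<in> regular X V" for U V f g by (rule op) (use that reg_Int in auto)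
 have eq: "germ X x (U' \<inter> V') (%y. op (f' y) (g' y)) = germ X x (U \<inter> V) (%y. op (f y) (g y))"
  if U: "opn X U" "x \<in> U" "f \<in> regular X U" "opn X U'" "x \<in> U'" "f' \<in> regular X U'"
   and V: "opn X V" "x \<in> V" "g \<in> regular X V" "opn X V'" "x \<in> V'" "g' \<in> regular X V'"
   and e: "germ X x U' f' = germ X x U f" "germ X x V' g' = germ X x V g" for U V U' V' f f' g g'
 proof -
  obtain W where W: "opn X W" "x \<in> W" "W \<subseteq> U' \<inter> U" "ALL y:W. f' y = f y" using e(1) germ_eq_iff[OF U(4-6) U(1-3)] by auto
  obtain W' where W': "opn X W'" "x \<in> W'" "W' \<subseteq> V' \<inter> V" "ALL y:W'. g' y = g y" using e(2) germ_eq_iff[OF V(4-6) V(1-3)] by auto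
  show ?thesis by (subst germ_eq_iff) (use U V W W' reg in \<open>auto intro!: exI[of _ "W \<inter> W'"]\<close>)
 qed
 have inner: "(\<Union>(V', g')\<in>germ X x V g. germ X x (U' \<inter> V') (%y. op (f' y) (g' y))) = germ X x (U' \<inter> V) (%y. op (f' y) (g y))"
  if "opn X U'" "x \<in> U'" "f' \<in> regular X U'" for U' f' by (rule germ_UN[OF V]) (rule eq[OF that that V(1-3) _ _ _ refl], assumption+)
 hence "(\<Union>(U', f')\<in>germ X x U f. \<Union>(V', g')\<in>germ X x V g. germ X x (U' \<inter> V') (%y. op (f' y) (g' y)))
  = (\<Union>(U', f')\<in>germ X x U f. germ X x (U' \<inter> V) (%y. op (f' y) (g y)))"
 proof (intro SUP_cong refl)
  fix a assume a: "a \<in> germ X x U f"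
  obtain U' f' where "a = (U', f')" by (cases a)
  moreover from this a have "opn X U'" "x \<in> U'" "f' \<in> regular X U'" unfolding germ_def by auto
  moreover note inner
  ultimately show "(case a of (U', f') => \<Union>(V', g')\<in>germ X x V g. germ X x (U' \<inter> V') (%y. op (f' y) (g' y))) =
    (case a of (U', f') => germ X x (U' \<inter> V) (%y. op (f' y) (g y)))" by simp
 qed
 also have "\<dots> = germ X x (U \<inter> V) (%y. op (f y) (g y))" by (rule germ_UN[OF U]) (rule eq[OF U _ _ _ V V _ refl], assumption+)
 finally show ?thesis .
qed

lemma stalk_mult:
 assumes "opn X U" "x \<in> U" "f \<in> regular X U" "opn X V" "x \<in> V" "g \<in> regular X V"
 shows "germ X x U f \<otimes>\<^bsub>stalk X x\<^esub> germ X x V g = germ X x (U \<inter> V) (%y. f y * g y)"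
 using germ_op[OF assms, of "(*)"] reg_mult by (simp add: stalk_def)

lemma stalk_add:
 assumes "opn X U" "x \<in> U" "f \<in> regular X U" "opn X V" "x \<in> V" "g \<in> regular X V"
 shows "germ X x U f \<oplus>\<^bsub>stalk X x\<^esub> germ X x V g = germ X x (U \<inter> V) (%y. f y + g y)"
 using germ_op[OF assms, of "(+)"] reg_add by (simp add: stalk_def)

lemma stalkE2:
 assumes "a \<in> carrier (stalk X x)" "b \<in> carrier (stalk X x)"
 obtains U f g where "opn X U" "x \<in> U" "f \<in> regular X U" "g \<in> regular X U"
  "a = germ X x U f" "b = germ X x U g"
proof -
 obtain U f where U: "opn X U" "x \<in> U" "f \<in> regular X U" "a = germ X x U f" using assms(1) by (rule stalkE)
 obtain V g where V: "opn X V" "x \<in> V" "g \<in> regular X V" "b = germ X x V g" using assms(2) by (rule stalkE)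
 have o: "opn X (U \<inter> V)" using U V by auto
 show ?thesis by (rule that[OF o, of f g]) (use U V o germ_restrict[OF U(1,3) o] germ_restrict[OF V(1,3) o] reg_Int in auto)
qed

lemma stalkE3:
 assumes "a \<in> carrier (stalk X x)" "b \<in> carrier (stalk X x)" "c \<in> carrier (stalk X x)"
 obtains U f g h where "opn X U" "x \<in> U" "f \<in> regular X U" "g \<in> regular X U" "h \<in> regular X U"
  "a = germ X x U f" "b = germ X x U g" "c = germ X x U h"
proof -
 obtain U f g where U: "opn X U" "x \<in> U" "f \<in> regular X U" "g \<in> regular X U"
  "a = germ X x U f" "b = germ X x U g" using assms(1,2) by (rule stalkE2)
 obtain V h where V: "opn X V" "x \<in> V" "h \<in> regular X V" "c = germ X x V h" using assms(3) by (rule stalkE)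
 have o: "opn X (U \<inter> V)" using U V by auto
 show ?thesis by (rule that[OF o, of f g h]) (use U V o germ_restrict[OF U(1,3) o] germ_restrict[OF U(1,4) o] germ_restrict[OF V(1,3) o]
    reg_Int in auto)
qed

lemma stalk_one: "\<one>\<^bsub>stalk X x\<^esub> = germ X x (pts X) (%_. 1)"
 and stalk_zero: "\<zero>\<^bsub>stalk X x\<^esub> = germ X x (pts X) (%_. 0)" by (simp_all add: stalk_def)

lemma germ_const:
 assumes "opn X U" "x \<in> U"
 shows "germ X x (pts X) (%_. c) = germ X x U (%_. c)" by (rule germ_restrict) (use assms reg_const openin_subset[OF assms(1)] in auto)

lemma stalk_cring:
 assumes x: "x \<in> pts X"
 shows "cring (stalk X x)"
proof (rule cringI)
 let ?R = "stalk X x"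
 have one: "\<one>\<^bsub>?R\<^esub> \<in> carrier ?R" and zero: "\<zero>\<^bsub>?R\<^esub> \<in> carrier ?R"
  unfolding stalk_one stalk_zero by (rule germ_in_stalk; use x reg_const in simp)+
 show "abelian_group ?R"
 proof (rule abelian_groupI)
  fix a b c assume "a \<in> carrier ?R" "b \<in> carrier ?R" "c \<in> carrier ?R"
  thus "a \<oplus>\<^bsub>?R\<^esub> b \<oplus>\<^bsub>?R\<^esub> c = a \<oplus>\<^bsub>?R\<^esub> (b \<oplus>\<^bsub>?R\<^esub> c)"
   by (rule stalkE3) (simp add: stalk_add reg_add add.assoc)
 next
  fix a b assume "a \<in> carrier ?R" "b \<in> carrier ?R"
  thus "a \<oplus>\<^bsub>?R\<^esub> b \<in> carrier ?R" "a \<oplus>\<^bsub>?R\<^esub> b = b \<oplus>\<^bsub>?R\<^esub> a"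
   by (rule stalkE2, simp add: stalk_add reg_add germ_in_stalk add.commute)+
 next
  fix a assume "a \<in> carrier ?R"
  then obtain U f where U: "opn X U" "x \<in> U" "f \<in> regular X U" "a = germ X x U f" by (rule stalkE)
  thus "\<zero>\<^bsub>?R\<^esub> \<oplus>\<^bsub>?R\<^esub> a = a" by (simp add: stalk_zero germ_const stalk_add reg_const)
  have m: "(%y. (-1) * f y) \<in> regular X U" by (rule reg_mult) (use U reg_const in auto)
  have "germ X x U (%y. (-1) * f y) \<oplus>\<^bsub>?R\<^esub> a = \<zero>\<^bsub>?R\<^esub>"
   using U m by (simp add: stalk_zero germ_const stalk_add)
  thus "EX y:carrier ?R. y \<oplus>\<^bsub>?R\<^esub> a = \<zero>\<^bsub>?R\<^esub>" using U m germ_in_stalk by blast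
 qed (rule zero)
 show "comm_monoid ?R"
 proof (rule comm_monoidI)
  fix a b c assume "a \<in> carrier ?R" "b \<in> carrier ?R" "c \<in> carrier ?R"
  thus "a \<otimes>\<^bsub>?R\<^esub> b \<otimes>\<^bsub>?R\<^esub> c = a \<otimes>\<^bsub>?R\<^esub> (b \<otimes>\<^bsub>?R\<^esub> c)"
   by (rule stalkE3) (simp add: stalk_mult reg_mult mult.assoc)
 next
  fix a b assume "a \<in> carrier ?R" "b \<in> carrier ?R"
  thus "a \<otimes>\<^bsub>?R\<^esub> b \<in> carrier ?R" "a \<otimes>\<^bsub>?R\<^esub> b = b \<otimes>\<^bsub>?R\<^esub> a"
   by (rule stalkE2, simp add: stalk_mult reg_mult germ_in_stalk mult.commute)+
 next
  fix a assume "a \<in> carrier ?R"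
  thus "\<one>\<^bsub>?R\<^esub> \<otimes>\<^bsub>?R\<^esub> a = a" by (rule stalkE) (simp add: stalk_one germ_const stalk_mult reg_const)
 qed (rule one)
 fix a b c assume "a \<in> carrier ?R" "b \<in> carrier ?R" "c \<in> carrier ?R"
 thus "(a \<oplus>\<^bsub>?R\<^esub> b) \<otimes>\<^bsub>?R\<^esub> c = a \<otimes>\<^bsub>?R\<^esub> c \<oplus>\<^bsub>?R\<^esub> b \<otimes>\<^bsub>?R\<^esub> c"
  by (rule stalkE3) (simp add: stalk_mult stalk_add reg_add reg_mult distrib_right)
qed

end

lemma stalk_map_germ:
 assumes X: "ringed X" and Y: "ringed Y" and ph: "morphism X Y ph" and x: "x \<in> pts X"
  and V: "opn Y V" "ph x \<in> V" "g \<in> regular Y V"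
 shows "stalk_map X ph x (germ Y (ph x) V g) = germ X x {y \<in> pts X. ph y \<in> V} (g \<circ> ph)"
  and "opn X {y \<in> pts X. ph y \<in> V}"
  and "g \<circ> ph \<in> regular X {y \<in> pts X. ph y \<in> V}"
proof -
 interpret X: ringed X by (rule X)
 interpret Y: ringed Y by (rule Y)
 have op: "opn X {y \<in> pts X. ph y \<in> V}" if "opn Y V" for V
  using ph that unfolding morphism_def by (blast intro: openin_continuous_map_preimage)
 have reg: "g \<circ> ph \<in> regular X {y \<in> pts X. ph y \<in> V}"
  if "opn Y V" "g \<in> regular Y V" for V g using ph that unfolding morphism_def by blast
 show "opn X {y \<in> pts X. ph y \<in> V}" "g \<circ> ph \<in> regular X {y \<in> pts X. ph y \<in> V}" using op reg V by auto
 show "stalk_map X ph x (germ Y (ph x) V g) = germ X x {y \<in> pts X. ph y \<in> V} (g \<circ> ph)" unfolding stalk_map_def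
 proof (rule Y.germ_UN[OF V])
  fix U' f' assume U': "opn Y U'" "ph x \<in> U'" "f' \<in> regular Y U'" "germ Y (ph x) U' f' = germ Y (ph x) V g"
  then obtain W where W: "opn Y W" "ph x \<in> W" "W \<subseteq> U' \<inter> V" "ALL y:W. f' y = g y" using Y.germ_eq_iff[OF U'(1-3) V] by auto
  show "germ X x {y \<in> pts X. ph y \<in> U'} (f' \<circ> ph) = germ X x {y \<in> pts X. ph y \<in> V} (g \<circ> ph)"
  proof (subst X.germ_eq_iff)
   show "EX W. opn X W & x \<in> W &
    W \<subseteq> {y \<in> pts X. ph y \<in> U'} \<inter> {y \<in> pts X. ph y \<in> V} &
    (ALL y:W. (f' \<circ> ph) y = (g \<circ> ph) y)" by (rule exI[of _ "{y \<in> pts X. ph y \<in> W}"]) (use W op[of W] x in auto)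
  qed (use op reg U' V x in auto)
 qed
qed

lemma stalk_module:
 assumes X: "ringed X" and Y: "ringed Y" and ph: "morphism X Y ph" and x: "x \<in> pts X"
 shows "module (stalk Y (ph x)) (stalk_module X ph x)"
proof -
 interpret X: ringed X by (rule X)
 interpret Y: ringed Y by (rule Y)
 let ?R = "stalk Y (ph x)" and ?S = "stalk X x" and ?m = "stalk_map X ph x"
 have phx: "ph x \<in> pts Y" using ph x unfolding morphism_def continuous_map_def by auto
 interpret R: cring ?R by (rule Y.stalk_cring[OF phx])
 interpret S: cring ?S by (rule X.stalk_cring[OF x])
 note sm = stalk_map_germ[OF X Y ph x]
 have closed: "?m a \<in> carrier ?S" if "a \<in> carrier ?R" for a
  using that by (rule Y.stalkE) (use sm x in \<open>auto intro!: X.germ_in_stalk\<close>)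
 have Int: "{y \<in> pts X. ph y \<in> V} \<inter> {y \<in> pts X. ph y \<in> V} = {y \<in> pts X. ph y \<in> V}" for V by auto
 have add: "?m (a \<oplus>\<^bsub>?R\<^esub> b) = ?m a \<oplus>\<^bsub>?S\<^esub> ?m b" if "a \<in> carrier ?R" "b \<in> carrier ?R" for a b
  using that
 proof (rule Y.stalkE2)
  fix V f g assume V: "opn Y V" "ph x \<in> V" "f \<in> regular Y V" "g \<in> regular Y V"
   and "a = germ Y (ph x) V f" "b = germ Y (ph x) V g"
  thus ?thesis using sm[OF V(1,2,3)] sm[OF V(1,2,4)] sm(1)[OF V(1,2) Y.reg_add[OF V(1,3,4)]] x by (simp add: Y.stalk_add X.stalk_add comp_def)
 qed
 have mult: "?m (a \<otimes>\<^bsub>?R\<^esub> b) = ?m a \<otimes>\<^bsub>?S\<^esub> ?m b" if "a \<in> carrier ?R" "b \<in> carrier ?R" for a b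
  using that
 proof (rule Y.stalkE2)
  fix V f g assume V: "opn Y V" "ph x \<in> V" "f \<in> regular Y V" "g \<in> regular Y V"
   and "a = germ Y (ph x) V f" "b = germ Y (ph x) V g"
  thus ?thesis using sm[OF V(1,2,3)] sm[OF V(1,2,4)] sm(1)[OF V(1,2) Y.reg_mult[OF V(1,3,4)]] x by (simp add: Y.stalk_mult X.stalk_mult comp_def)
 qed
 have one: "?m \<one>\<^bsub>?R\<^esub> = \<one>\<^bsub>?S\<^esub>"
 proof -
  have "{y \<in> pts X. ph y \<in> pts Y} = pts X" using ph unfolding morphism_def continuous_map_def by auto
  thus ?thesis using sm(1)[OF openin_topspace phx Y.reg_const[OF openin_topspace], of 1] by (simp add: Y.stalk_one X.stalk_one comp_def)
 qed
 have "abelian_group (stalk_module X ph x)"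
 proof (rule abelian_groupI)
  fix a assume "a \<in> carrier (stalk_module X ph x)"
  thus "EX y:carrier (stalk_module X ph x). y \<oplus>\<^bsub>stalk_module X ph x\<^esub> a = \<zero>\<^bsub>stalk_module X ph x\<^esub>"
   by (intro bexI[of _ "\<ominus>\<^bsub>?S\<^esub> a"]) (simp_all add: stalk_module_def S.l_neg)
 qed (simp_all add: stalk_module_def S.a_ac)
 thus ?thesis
 proof (intro module.intro module_axioms.intro R.is_cring)
 qed (simp_all add: stalk_module_def closed add mult one S.l_distr S.r_distr S.m_assoc)
qed

section \<open>The affine line and its local rings\<close>

lemma affine_space_on_eq: "affine_space_on V Z = gspace (%_. poly_funs V) Z" by (simp add: affine_space_on_def gspace_def gtop_def Let_def)

lemma gfun_poly_funs: "gfun (%_. poly_funs V)" by unfold_locales (auto intro: poly_funs.intros poly_funs.mult[OF poly_funs.const])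

lemma A1_eq: "A1 = gspace (%_. poly_funs complex_line) UNIV" by (simp add: A1_def affine_space_on_eq)

interpretation A1g: gfun "%_. poly_funs complex_line" UNIV by (rule gfun_poly_funs)

interpretation A1: ringed A1 unfolding A1_eq by (rule A1g.ringed_axioms)

lemma mk_space_simps [simp]:
 "carrier (mk_space C z a s) = C" "\<zero>\<^bsub>mk_space C z a s\<^esub> = z"
 "add (mk_space C z a s) = a" "module.smult (mk_space C z a s) = s" by (simp_all add: mk_space_def)

lemma linear_form_complex_line: "linear_form complex_line l \<longleftrightarrow> (ALL x. l x = x * l 1)"
proof
 assume "linear_form complex_line l"
 hence "l (c * x) = c * l x" for c x by (auto simp: linear_form_def complex_line_def)
 from this[of _ 1] show "ALL x. l x = x * l 1" by (metis mult.right_neutral)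
next
 assume "ALL x. l x = x * l 1"
 then obtain c where "l = (%x. x * c)" by blast
 thus "linear_form complex_line l" by (simp add: linear_form_def complex_line_def distrib_right)
qed

lemma poly_funs_complex_line: "p \<in> poly_funs complex_line \<longleftrightarrow> (EX P. p = poly P)"
proof
 assume "p \<in> poly_funs complex_line"
 thus "EX P. p = poly P"
 proof induction
  case (const c)
  show ?case by (rule exI[of _ "[:c:]"]) auto
 next
  case (linear l)
  then obtain c where "l = (%x. x * c)" unfolding linear_form_complex_line by blast
  thus ?case by (intro exI[of _ "[:0, c:]"]) auto
 next
  case (add p q)
  then obtain P Q where "p = poly P" "q = poly Q" by blast
  thus ?case by (intro exI[of _ "P + Q"]) auto
 next
  case (mult p q)
  then obtain P Q where "p = poly P" "q = poly Q" by blast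
  thus ?case by (intro exI[of _ "P * Q"]) auto
 qed
next
 assume "EX P. p = poly P"
 then obtain P where P: "p = poly P" by blast
 have "poly P \<in> poly_funs complex_line"
 proof (induction P)
  case 0
  show ?case using poly_funs.const[of 0 complex_line] by (simp add: fun_eq_iff[symmetric] poly_0[abs_def])
 next
  case (pCons a P)
  have "(%x. x) \<in> poly_funs complex_line" by (rule poly_funs.linear) (simp add: linear_form_complex_line)
  hence "(%x. a + x * poly P x) \<in> poly_funs complex_line" using pCons by (intro poly_funs.add poly_funs.mult poly_funs.const)
  moreover have "poly (pCons a P) = (%x. a + x * poly P x)" by auto
  ultimately show ?case by simp
 qed
 thus "p \<in> poly_funs complex_line" using P by simp
qed

definition frac_germ :: "complex => complex poly => complex poly => (complex set \<times> (complex => complex)) set" where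
 "frac_germ s P Q = germ A1 s {x. poly Q x ~= 0} (%x. poly P x / poly Q x)"

lemma frac_regular:
 "openin (zar A1) {x. poly Q x ~= 0}"
 "(%x. poly P x / poly Q x) \<in> regular A1 {x. poly Q x ~= 0}"
proof -
 have PQ: "poly P \<in> poly_funs complex_line" "poly Q \<in> poly_funs complex_line" by (auto simp: poly_funs_complex_line)
 show o: "openin (zar A1) {x. poly Q x ~= 0}" using A1g.open_basic[OF PQ(2)] by (simp add: A1_eq)
 show "(%x. poly P x / poly Q x) \<in> regular A1 {x. poly Q x ~= 0}" unfolding A1_eq
  by (rule A1g.regular_quotient[OF PQ]) (use o in \<open>simp_all only: A1_eq zar_gspace mem_Collect_eq not_False_eq_True\<close>)
qed

lemma frac_germ_cong:
 assumes "poly Q s ~= 0" "poly Q' s ~= 0" "P * Q' = P' * Q"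
 shows "frac_germ s P Q = frac_germ s P' Q'" unfolding frac_germ_def
proof (subst A1.germ_eq_iff)
 show "EX W. openin (zar A1) W & s \<in> W & W \<subseteq> {x. poly Q x ~= 0} \<inter> {x. poly Q' x ~= 0} &
  (ALL y:W. poly P y / poly Q y = poly P' y / poly Q' y)"
 proof (intro exI conjI ballI)
  show "openin (zar A1) {x. poly (Q * Q') x ~= 0}" by (rule frac_regular)
  fix y assume "y \<in> {x. poly (Q * Q') x ~= 0}"
  moreover have "poly P y * poly Q' y = poly P' y * poly Q y" using assms(3) by (metis poly_mult)
  ultimately show "poly P y / poly Q y = poly P' y / poly Q' y" by (simp add: frac_eq_eq)
 qed (use assms in auto)
qed (use assms frac_regular in auto)

lemma frac_germ_mult:
 assumes "poly Q s ~= 0" "poly Q' s ~= 0"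
 shows "frac_germ s P Q \<otimes>\<^bsub>stalk A1 s\<^esub> frac_germ s P' Q' = frac_germ s (P * P') (Q * Q')"
proof -
 have "{x. poly Q x ~= 0} \<inter> {x. poly Q' x ~= 0} = {x. poly (Q * Q') x ~= 0}" by auto
 thus ?thesis unfolding frac_germ_def by (subst A1.stalk_mult) (use assms frac_regular in auto)
qed

lemma frac_germ_in_stalk: "poly Q s ~= 0 ==> frac_germ s P Q \<in> carrier (stalk A1 s)"
 unfolding frac_germ_def by (rule A1.germ_in_stalk) (use frac_regular in auto)

lemma A1_stalkE:
 assumes "a \<in> carrier (stalk A1 s)"
 obtains P Q where "poly Q s ~= 0" "a = frac_germ s P Q"
proof -
 obtain U f where U: "openin (zar A1) U" "s \<in> U" "f \<in> regular A1 U" "a = germ A1 s U f" using assms by (rule A1.stalkE)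
 obtain p q where pq: "p \<in> poly_funs complex_line" "q \<in> poly_funs complex_line" "q s ~= 0"
  "!!y. q y ~= 0 ==> y \<in> U" "!!y. q y ~= 0 ==> f y = p y / q y" using A1g.regularE[of U f s] U by (metis A1_eq UNIV_I zar_gspace)
 obtain P Q where PQ: "p = poly P" "q = poly Q" using pq poly_funs_complex_line by auto
 have "a = frac_germ s P Q" unfolding U(4) frac_germ_def
  by (subst A1.germ_eq_iff) (use U frac_regular pq PQ in \<open>auto intro!: exI[of _ "{x. poly Q x ~= 0}"]\<close>)
 thus ?thesis using that pq PQ by auto
qed

lemma frac_germ_zero: "poly Q s ~= 0 ==> frac_germ s 0 Q = \<zero>\<^bsub>stalk A1 s\<^esub>"
 unfolding A1.stalk_zero using A1.germ_const[of "{x. poly Q x ~= 0}" s 0] frac_regular(1) by (simp add: frac_germ_def)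

text \<open>The local ring at \<open>s\<close> is a discrete valuation ring. Nonzero numerators are
  compared by their order of vanishing at \<open>s\<close>; after the common power of the
  uniformizer is split off, the cofactor of the divisor does not vanish at \<open>s\<close> and may
  enter the denominator.\<close>

lemma A1_stalk_uniserial:
 assumes "a \<in> carrier (stalk A1 s)" "b \<in> carrier (stalk A1 s)"
 shows "(EX c:carrier (stalk A1 s). a = c \<otimes>\<^bsub>stalk A1 s\<^esub> b) \<or> (EX c:carrier (stalk A1 s). b = c \<otimes>\<^bsub>stalk A1 s\<^esub> a)"
proof -
 obtain P1 Q1 where 1: "poly Q1 s ~= 0" "a = frac_germ s P1 Q1" using assms(1) by (rule A1_stalkE)
 obtain P2 Q2 where 2: "poly Q2 s ~= 0" "b = frac_germ s P2 Q2" using assms(2) by (rule A1_stalkE)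
 have zero: "EX c:carrier (stalk A1 s). frac_germ s 0 Q = c \<otimes>\<^bsub>stalk A1 s\<^esub> frac_germ s P' Q'"
  if "poly Q s ~= 0" "poly Q' s ~= 0" for Q P' Q' by (rule bexI[of _ "frac_germ s 0 1"])
   (use that frac_germ_cong[of Q s Q' 0 0] in \<open>auto simp: frac_germ_mult frac_germ_in_stalk\<close>)
 have div: "EX c:carrier (stalk A1 s). frac_germ s P' Q' = c \<otimes>\<^bsub>stalk A1 s\<^esub> frac_germ s P Q"
  if PQ: "poly Q s ~= 0" "poly Q' s ~= 0" "P ~= 0" "P' ~= 0" "Polynomial.order s P \<le> Polynomial.order s P'" for P Q P' Q'
 proof -
  obtain R where R: "P = [:- s, 1:] ^ Polynomial.order s P * R" "\<not> [:- s, 1:] dvd R" using order_decomp[OF PQ(3)] by blast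
  obtain R' where R': "P' = [:- s, 1:] ^ Polynomial.order s P' * R'" using order_decomp[OF PQ(4)] by blast
  have Rs: "poly R s ~= 0" using R(2) poly_eq_0_iff_dvd by blast
  let ?c = "[:- s, 1:] ^ (Polynomial.order s P' - Polynomial.order s P) * R' * Q"
  have e: "[:- s, 1:] ^ Polynomial.order s P' = [:- s, 1:] ^ (Polynomial.order s P' - Polynomial.order s P) * [:- s, 1:] ^ Polynomial.order s P"
   using PQ(5) by (simp flip: power_add)
  have "P' * (Q' * R * Q) = ([:- s, 1:] ^ (Polynomial.order s P' - Polynomial.order s P) * [:- s, 1:] ^ Polynomial.order s P * R') * (Q' * R * Q)"
   using R' e by simp
  also have "\<dots> = ?c * ([:- s, 1:] ^ Polynomial.order s P * R) * Q'" by (simp only: ac_simps)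
  also have "\<dots> = ?c * P * Q'" using R(1) by simp
  finally have "frac_germ s P' Q' = frac_germ s (?c * P) (Q' * R * Q)" using PQ Rs by (intro frac_germ_cong) simp_all
  also have "\<dots> = frac_germ s ?c (Q' * R) \<otimes>\<^bsub>stalk A1 s\<^esub> frac_germ s P Q"
   by (rule frac_germ_mult[symmetric]) (use PQ Rs in simp_all)
  finally have "frac_germ s P' Q' = frac_germ s ?c (Q' * R) \<otimes>\<^bsub>stalk A1 s\<^esub> frac_germ s P Q" .
  moreover have "frac_germ s ?c (Q' * R) \<in> carrier (stalk A1 s)" by (rule frac_germ_in_stalk) (use PQ Rs in simp)
  ultimately show ?thesis by (rule bexI)
 qed
 show ?thesis
 proof (cases "P1 = 0 \<or> P2 = 0")
  case True
  thus ?thesis using zero[OF 1(1) 2(1), of P2] zero[OF 2(1) 1(1), of P1] 1 2 by auto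
 next
  case False
  thus ?thesis using div[OF 1(1) 2(1), of P1 P2] div[OF 2(1) 1(1), of P2 P1] 1 2 nat_le_linear by blast
 qed
qed

lemma (in ringed) reg_poly:
 assumes "opn X U" "f \<in> regular X U"
 shows "(%x. poly P (f x)) \<in> regular X U" by (induction P) (use assms in \<open>auto intro!: reg_add reg_mult reg_const\<close>)

text \<open>
 A space dominating the line by all its open subsets is flat over it, since its local rings are
 torsion free over the discrete valuation rings of the line.
\<close>

lemma (in gfun) flat_over_A1:
 assumes pr: "morphism (gspace H Z) A1 pr"
  and dense: "!!h d A z. h \<in> H d ==> finite A ==> (!!z. z \<in> Z ==> pr z \<notin> A ==> h z = 0) ==> z \<in> Z ==> h z = 0"
 shows "flat_morphism (gspace H Z) A1 pr" unfolding flat_morphism_def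
proof (intro conjI ballI pr)
 let ?X = "gspace H Z"
 fix x assume "x \<in> pts ?X"
 hence x: "x \<in> Z" by simp
 interpret M: module "stalk A1 (pr x)" "stalk_module ?X pr x" by (rule stalk_module[OF ringed_axioms A1.ringed_axioms pr]) (simp add: x)
 show "flat_module (stalk A1 (pr x)) (stalk_module ?X pr x)"
 proof (rule M.uniserial_torsion_free_flat[OF A1_stalk_uniserial])
  fix r m assume r: "r \<in> carrier (stalk A1 (pr x))" and "m \<in> carrier (stalk_module ?X pr x)"
   and "r \<odot>\<^bsub>stalk_module ?X pr x\<^esub> m = \<zero>\<^bsub>stalk_module ?X pr x\<^esub>"
  hence m: "m \<in> carrier (stalk ?X x)" and rm: "stalk_map ?X pr x r \<otimes>\<^bsub>stalk ?X x\<^esub> m = \<zero>\<^bsub>stalk ?X x\<^esub>"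
   by (auto simp: stalk_module_def)
  obtain P Q where PQ: "poly Q (pr x) ~= 0" "r = frac_germ (pr x) P Q" using r by (rule A1_stalkE)
  obtain U f where U: "openin (gtop H Z) U" "x \<in> U" "f \<in> regular ?X U" "m = germ ?X x U f" using m by (rule stalkE) auto
  show "r = \<zero>\<^bsub>stalk A1 (pr x)\<^esub> \<or> m = \<zero>\<^bsub>stalk_module ?X pr x\<^esub>"
  proof (cases "P = 0")
   case True
   thus ?thesis using frac_germ_zero PQ by auto
  next
   case False
   define V where "V = {y \<in> pts ?X. pr y \<in> {x. poly Q x ~= 0}}"
   define g where "g = (%x. poly P x / poly Q x) \<circ> pr"
   have sm: "stalk_map ?X pr x r = germ ?X x V g" "opn ?X V" "g \<in> regular ?X V" unfolding V_def g_def PQ(2) frac_germ_def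
    using stalk_map_germ[OF ringed_axioms A1.ringed_axioms pr, of x "{x. poly Q x ~= 0}" "%x. poly P x / poly Q x"]
     frac_regular x PQ(1) by simp_all
   hence V: "stalk_map ?X pr x r = germ ?X x V g" "openin (gtop H Z) V" "g \<in> regular ?X V" by simp_all
   have xV: "x \<in> V" using x PQ by (simp add: V_def)
   have Zo: "openin (gtop H Z) Z" using openin_topspace[of "gtop H Z"] by simp
   have "germ ?X x (V \<inter> U) (%y. g y * f y) = germ ?X x Z (%_. 0)" using rm V U xV by (simp add: stalk_mult stalk_zero)
   moreover have "(%y. g y * f y) \<in> regular ?X (V \<inter> U)" by (rule reg_mult) (use V U reg_Int[of V U] in auto)
   moreover have VU: "openin (gtop H Z) (V \<inter> U)" using V U by auto
   ultimately obtain W where W: "openin (gtop H Z) W" "x \<in> W" "W \<subseteq> V \<inter> U" "!!y. y \<in> W ==> g y * f y = 0"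
    using germ_eq_iff[of "V \<inter> U" x "%y. g y * f y" Z "%_. 0"] U xV x Zo reg_const[of Z 0] by auto
   have fW: "f \<in> regular ?X W" by (rule sheaf_restrict[OF sheaf _ _ _ U(3)]) (use U W in auto)
   obtain p d q where pq: "p \<in> H d" "q \<in> H d" "q x ~= 0" "!!y. y \<in> Z ==> q y ~= 0 ==> y \<in> W"
    "!!y. y \<in> Z ==> q y ~= 0 ==> f y = p y / q y" by (rule regularE[OF W(1) fW W(2)], rule that; assumption)
   \<comment> \<open>The quotient describes \<open>f\<close> only where \<open>q\<close> is nonzero,
     hence the product \<open>p q\<close>. It vanishes over all points of the line that are not
     among the finitely many roots of \<open>P\<close>, so everywhere by density.\<close>
   have pq0: "p z * q z = 0" if "z \<in> Z" for z
   proof (rule dense[OF mult[OF pq(1,2)] poly_roots_finite[OF False] _ that])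
    fix z assume z: "z \<in> Z" "pr z \<notin> {x. poly P x = 0}"
    show "p z * q z = 0"
    proof (cases "q z = 0")
     case False
     have "z \<in> W" by (rule pq(4)[OF z(1) False])
     hence "g z * f z = 0" "poly Q (pr z) ~= 0" using W(3,4) by (auto simp: V_def)
     hence "f z = 0" using z(2) by (simp add: g_def)
     thus ?thesis using pq(5)[OF z(1) False] False by simp
    qed simp
   qed
   have "germ ?X x U f = germ ?X x Z (%_. 0)"
   proof (subst germ_eq_iff)
    show "EX W. opn ?X W & x \<in> W & W \<subseteq> U \<inter> Z & (ALL y:W. f y = 0)"
     proof (intro exI conjI ballI)
     show "opn ?X (nz Z q)" using open_basic[OF pq(2)] by simp
     show "(nz Z q) \<subseteq> U \<inter> Z" using pq(4) W(3) by blast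
     fix y assume y: "y \<in> (nz Z q)"
     hence "f y = p y / q y" by (intro pq(5)) auto
     thus "f y = 0" using pq0[of y] y by auto
    qed (use x pq(3) in simp)
   qed (use U x reg_const[of Z 0] Zo in auto)
   thus ?thesis using U stalk_zero[of x] by (simp add: stalk_module_def)
  qed
 qed
qed


section \<open>Fibres, charts and actions\<close>

lemma (in ringed) morphism_A1I:
 assumes pr: "pr \<in> regular X (pts X)"
  and inverse: "!!f. f \<in> regular X (pts X) ==> opn X {x \<in> pts X. f x ~= 0} &
   (%x. 1 / f x) \<in> regular X {x \<in> pts X. f x ~= 0}"
 shows "morphism X A1 pr" unfolding A1_eq
proof (rule morphism_gspaceI[OF sheaf])
 fix d :: nat and p q x
 assume "p \<in> poly_funs complex_line" "q \<in> poly_funs complex_line"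
  and x: "x \<in> pts X" "q (pr x) ~= 0"
 then obtain P Q where PQ: "p = poly P" "q = poly Q" by (auto simp: poly_funs_complex_line)
 let ?U = "{x \<in> pts X. q (pr x) ~= 0}"
 have Q: "opn X ?U" "(%x. 1 / q (pr x)) \<in> regular X ?U" using inverse[OF reg_poly[OF openin_topspace pr, of Q]] PQ by auto
 have "(%x. p (pr x)) \<in> regular X ?U" unfolding PQ(1) by (rule reg_poly[OF Q(1)], rule sheaf_restrict[OF sheaf openin_topspace Q(1) _ pr]) auto
 from reg_mult[OF Q(1) this Q(2)] have "(%x. p (pr x) / q (pr x)) \<in> regular X ?U" by simp
 thus "EX U. opn X U & x \<in> U & (%z. p (pr z) / q (pr z)) \<in> regular X U & (ALL z:U. q (pr z) ~= 0)" using Q x by (intro exI[of _ ?U]) auto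
qed (auto intro: poly_funs.const)

text \<open>Where \<open>f\<close> is \<open>p / q\<close>, its inverse is written as
  \<open>q q / (p q)\<close>: with the extra factor \<open>q\<close>, nonvanishing of the
  denominator also ensures that the presentation of \<open>f\<close> is valid there.\<close>

lemma (in gfun) regular_inverse:
 assumes "openin (gtop H Z) U" "f \<in> regular (gspace H Z) U"
 shows "openin (gtop H Z) (nz U f)" "(%x. 1 / f x) \<in> regular (gspace H Z) (nz U f)"
proof -
 have *: "EX d. EX p:H d. EX q:H d. q z ~= 0 & (ALL y:Z. q y ~= 0 --> y \<in> (nz U f) & 1 / f y = p y / q y)"
  if z: "z \<in> (nz U f)" for z
 proof -
  have zU: "z \<in> U" "z \<in> Z" using z openin_subset[OF assms(1)] by auto
  obtain p d q where pq: "p \<in> H d" "q \<in> H d" "q z ~= 0" "!!y. y \<in> Z ==> q y ~= 0 ==> y \<in> U"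
   "!!y. y \<in> Z ==> q y ~= 0 ==> f y = p y / q y" by (rule regularE[OF assms zU(1)], rule that; assumption)
  have "p z ~= 0" using pq(3) pq(5)[OF zU(2) pq(3)] z by auto
  moreover have "y \<in> (nz U f) & 1 / f y = (q y * q y) / (p y * q y)" if "y \<in> Z" "p y * q y ~= 0" for y using pq(4,5)[of y] that by auto
  ultimately show ?thesis
   using pq(3) mult[OF pq(1,2)] mult[OF pq(2,2)] by (intro exI[of _ "d + d"] bexI[of _ "%y. q y * q y"] bexI[of _ "%y. p y * q y"]) auto
 qed
 show o: "openin (gtop H Z) (nz U f)" unfolding openin_gtop_iff
 proof (intro conjI ballI)
  fix z assume "z \<in> (nz U f)"
  from *[OF this] show "EX d. EX h:H d. h z ~= 0 & (ALL y:Z. h y ~= 0 --> y \<in> (nz U f))"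
  proof (elim exE bexE)
   fix d p q assume "q \<in> H d" "q z ~= 0 & (ALL y:Z. q y ~= 0 --> y \<in> (nz U f) & 1 / f y = p y / q y)"
   thus ?thesis by (intro exI[of _ d] bexI[of _ q]) simp_all
  qed
 qed (use openin_subset[OF assms(1)] in auto)
 show "(%x. 1 / f x) \<in> regular (gspace H Z) (nz U f)" unfolding regular_iff[OF o] using * by blast
qed

lemma (in gfun) morphism_A1:
 assumes "pr \<in> regular (gspace H Z) Z"
 shows "morphism (gspace H Z) A1 pr"
proof (rule morphism_A1I)
 have o: "openin (gtop H Z) Z" using openin_topspace[of "gtop H Z"] by simp
 show "opn (gspace H Z) {x \<in> pts (gspace H Z). f x ~= 0} &
   (%x. 1 / f x) \<in> regular (gspace H Z) {x \<in> pts (gspace H Z). f x ~= 0}"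
  if "f \<in> regular (gspace H Z) (pts (gspace H Z))" for f using regular_inverse[OF o, of f] that by simp
qed (use assms in simp)

text \<open>The unit \<open>u\<close> measures the change of representative between a point of the
  fibre and its image in the total space. A function of degree \<open>d\<close> picks up
  \<open>u z ^ d\<close>, which cancels in quotients. The assumption \<open>divide\<close> is the
  algebraic core: functions vanishing on the image are multiples of \<open>pr - a\<close>.\<close>

locale gfun_fibre = H: gfun H Z + H': gfun H' Z'
 for H :: "nat => ('p => complex) set" and Z and H' :: "nat => ('q => complex) set" and Z' +
 fixes th :: "'p => 'q" and u :: "'p => complex" and pr :: "'q => complex" and a :: complex
 assumes pr_reg: "pr \<in> regular (gspace H' Z') Z'"
  and image: "th ` Z = {y \<in> Z'. pr y = a}"
  and inj: "inj_on th Z"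
  and unit: "z \<in> Z ==> u z ~= 0"
  and pull: "h' \<in> H' d ==> EX h:H d. ALL z:Z. h' (th z) = u z ^ d * h z"
  and lift: "h \<in> H d ==> EX h':H' d. ALL z:Z. h' (th z) = u z ^ d * h z"
  and divide: "h' \<in> H' d ==> (!!z. z \<in> Z ==> h' (th z) = 0) ==>
   EX h'':H' d. ALL y:Z'. h' y = (pr y - a) * h'' y"
begin

lemma into: "z \<in> Z ==> th z \<in> Z'" and over: "z \<in> Z ==> pr (th z) = a" using image by auto

lemma morphism: "morphism (gspace H Z) (gspace H' Z') th"
proof (rule morphism_gspaceI[OF H.sheaf])
 fix d p' q' x assume p': "p' \<in> H' d" and q': "q' \<in> H' d" and "x \<in> pts (gspace H Z)" "q' (th x) ~= 0"
 hence x: "x \<in> Z" "q' (th x) ~= 0" by auto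
 obtain p where p: "p \<in> H d" "!!z. z \<in> Z ==> p' (th z) = u z ^ d * p z" using pull[OF p'] by blast
 obtain q where q: "q \<in> H d" "!!z. z \<in> Z ==> q' (th z) = u z ^ d * q z" using pull[OF q'] by blast
 let ?U = "(nz Z q)"
 have o: "openin (gtop H Z) ?U" by (rule H.open_basic[OF q(1)])
 have "(%z. p z / q z) \<in> regular (gspace H Z) ?U" by (rule H.regular_quotient[OF p(1) q(1) o]) auto
 hence "(%z. p' (th z) / q' (th z)) \<in> regular (gspace H Z) ?U" by (rule sheaf_cong[OF H.sheaf, rotated]) (use o p q unit in auto)
 thus "EX U. opn (gspace H Z) U & x \<in> U & (%z. p' (th z) / q' (th z)) \<in> regular (gspace H Z) U &
   (ALL z:U. q' (th z) ~= 0)" using o x q unit by (intro exI[of _ ?U]) auto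
qed (use into H'.one in auto)

lemma homeomorphic:
 "homeomorphic_map (zar (gspace H Z)) (subtopology (zar (gspace H' Z')) {y \<in> pts (gspace H' Z'). pr y = a}) th"
proof (rule bijective_open_imp_homeomorphic_map)
 let ?F = "{y \<in> pts (gspace H' Z'). pr y = a}"
 show "continuous_map (zar (gspace H Z)) (subtopology (zar (gspace H' Z')) ?F) th"
  using morphism into over unfolding morphism_def by (auto simp: continuous_map_in_subtopology)
 show "th ` pts (gspace H Z) = topspace (subtopology (zar (gspace H' Z')) ?F)" using image by (auto simp: topspace_subtopology)
 show "inj_on th (pts (gspace H Z))" using inj by simp
 show "open_map (zar (gspace H Z)) (subtopology (zar (gspace H' Z')) ?F) th" unfolding open_map_def
 proof (intro allI impI)
  fix U assume "opn (gspace H Z) U"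
  hence U: "openin (gtop H Z) U" by simp
  hence UZ: "U \<subseteq> Z" using openin_subset by fastforce
  show "openin (subtopology (zar (gspace H' Z')) ?F) (th ` U)"
  proof (subst openin_subopen, intro ballI)
   fix y assume "y \<in> th ` U"
   then obtain z where z: "z \<in> U" "y = th z" by blast
   obtain d h where h: "h \<in> H d" "h z ~= 0" "!!y. y \<in> Z ==> h y ~= 0 ==> y \<in> U" using U z(1) unfolding H.openin_gtop_iff by blast
   obtain h' where h': "h' \<in> H' d" "!!z. z \<in> Z ==> h' (th z) = u z ^ d * h z" using lift[OF h(1)] by blast
   let ?T = "(nz Z' h') \<inter> ?F"
   have "openin (subtopology (zar (gspace H' Z')) ?F) ?T" unfolding openin_subtopology using H'.open_basic[OF h'(1)] by auto
   moreover have "y \<in> ?T" using z UZ into over h h' unit by auto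
   moreover have "?T \<subseteq> th ` U"
   proof
    fix w assume w: "w \<in> ?T"
    hence "w \<in> th ` Z" unfolding image by auto
    then obtain z' where "z' \<in> Z" "w = th z'" by blast
    with w h h' show "w \<in> th ` U" by auto
   qed
   ultimately show "EX T. openin (subtopology (zar (gspace H' Z')) ?F) T & y \<in> T & T \<subseteq> th ` U" by blast
  qed
 qed
qed

lemma germ_lift:
 assumes x: "x \<in> Z" and b: "b \<in> carrier (stalk (gspace H' Z') (th x))"
 obtains d p q where "p \<in> H' d" "q \<in> H' d" "q (th x) ~= 0"
  "b = germ (gspace H' Z') (th x) (nz Z' q) (%y. p y / q y)"
proof -
 obtain U f where U: "openin (gtop H' Z') U" "th x \<in> U" "f \<in> regular (gspace H' Z') U" "b = germ (gspace H' Z') (th x) U f"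
  using b by (rule H'.stalkE) auto
 obtain p d q where pq: "p \<in> H' d" "q \<in> H' d" "q (th x) ~= 0" "!!y. y \<in> Z' ==> q y ~= 0 ==> y \<in> U"
  "!!y. y \<in> Z' ==> q y ~= 0 ==> f y = p y / q y" by (rule H'.regularE[OF U(1,3,2)], rule that; assumption)
 have o: "openin (gtop H' Z') (nz Z' q)" by (rule H'.open_basic[OF pq(2)])
 have r: "(%y. p y / q y) \<in> regular (gspace H' Z') (nz Z' q)" by (rule H'.regular_quotient[OF pq(1,2) o]) auto
 have "b = germ (gspace H' Z') (th x) (nz Z' q) (%y. p y / q y)" unfolding U(4)
 proof (subst H'.germ_eq_iff)
  show "EX W. opn (gspace H' Z') W & th x \<in> W & W \<subseteq> U \<inter> (nz Z' q) & (ALL y:W. f y = p y / q y)"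
   by (rule exI[of _ "(nz Z' q)"]) (use o pq(3-5) into[OF x] in auto)
 qed (use U o r into[OF x] pq in auto)
 thus ?thesis using that pq by blast
qed

lemma stalk_map_quotient:
 assumes x: "x \<in> Z" and pq: "p \<in> H' d" "q \<in> H' d" "q (th x) ~= 0"
 shows "stalk_map (gspace H Z) th x (germ (gspace H' Z') (th x) (nz Z' q) (%y. p y / q y)) =
  germ (gspace H Z) x {z \<in> Z. q (th z) ~= 0} (%z. p (th z) / q (th z))"
  and "openin (gtop H Z) {z \<in> Z. q (th z) ~= 0}"
  and "(%z. p (th z) / q (th z)) \<in> regular (gspace H Z) {z \<in> Z. q (th z) ~= 0}"
proof -
 have o: "openin (gtop H' Z') (nz Z' q)" by (rule H'.open_basic[OF pq(2)])
 have r: "(%y. p y / q y) \<in> regular (gspace H' Z') (nz Z' q)" by (rule H'.regular_quotient[OF pq(1,2) o]) auto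
 have e: "{y \<in> pts (gspace H Z). th y \<in> (nz Z' q)} = {z \<in> Z. q (th z) ~= 0}" using into by auto
 note * = stalk_map_germ[OF H.ringed_axioms H'.ringed_axioms morphism, of x "(nz Z' q)" "%y. p y / q y",
  unfolded e comp_def]
 show "stalk_map (gspace H Z) th x (germ (gspace H' Z') (th x) (nz Z' q) (%y. p y / q y)) =
  germ (gspace H Z) x {z \<in> Z. q (th z) ~= 0} (%z. p (th z) / q (th z))" by (rule *(1)) (use o r x into pq in auto)
 show "openin (gtop H Z) {z \<in> Z. q (th z) ~= 0}" using *(2) o r x into pq by auto
 show "(%z. p (th z) / q (th z)) \<in> regular (gspace H Z) {z \<in> Z. q (th z) ~= 0}" by (rule *(3)) (use o r x into pq in auto)
qed

lemma stalk_map_surj: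
 assumes x: "x \<in> Z"
 shows "stalk_map (gspace H Z) th x ` carrier (stalk (gspace H' Z') (th x)) = carrier (stalk (gspace H Z) x)"
proof (intro equalityI subsetI)
 fix b assume "b \<in> stalk_map (gspace H Z) th x ` carrier (stalk (gspace H' Z') (th x))"
 then obtain c where c: "c \<in> carrier (stalk (gspace H' Z') (th x))" "b = stalk_map (gspace H Z) th x c" by blast
 obtain d p q where pq: "p \<in> H' d" "q \<in> H' d" "q (th x) ~= 0"
  "c = germ (gspace H' Z') (th x) (nz Z' q) (%y. p y / q y)" by (rule germ_lift[OF x c(1)], rule that; assumption)
 show "b \<in> carrier (stalk (gspace H Z) x)" unfolding c(2) pq(4) stalk_map_quotient(1)[OF x pq(1-3)]
  by (rule H.germ_in_stalk) (use stalk_map_quotient(2,3)[OF x pq(1-3)] x pq in auto)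
next
 fix b assume "b \<in> carrier (stalk (gspace H Z) x)"
 then obtain U f where U: "openin (gtop H Z) U" "x \<in> U" "f \<in> regular (gspace H Z) U" "b = germ (gspace H Z) x U f" by (rule H.stalkE) auto
 obtain p d q where pq: "p \<in> H d" "q \<in> H d" "q x ~= 0" "!!y. y \<in> Z ==> q y ~= 0 ==> y \<in> U"
  "!!y. y \<in> Z ==> q y ~= 0 ==> f y = p y / q y" by (rule H.regularE[OF U(1,3,2)], rule that; assumption)
 obtain p' where p': "p' \<in> H' d" "!!z. z \<in> Z ==> p' (th z) = u z ^ d * p z" using lift[OF pq(1)] by blast
 obtain q' where q': "q' \<in> H' d" "!!z. z \<in> Z ==> q' (th z) = u z ^ d * q z" using lift[OF pq(2)] by blast
 have q'x: "q' (th x) ~= 0" using q' x unit pq by auto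
 note sq = stalk_map_quotient[OF x p'(1) q'(1) q'x]
 let ?c = "germ (gspace H' Z') (th x) (nz Z' q') (%y. p' y / q' y)"
 have "b = germ (gspace H Z) x {z \<in> Z. q' (th z) ~= 0} (%z. p' (th z) / q' (th z))" unfolding U(4)
 proof (subst H.germ_eq_iff)
  show "EX W. opn (gspace H Z) W & x \<in> W & W \<subseteq> U \<inter> {z \<in> Z. q' (th z) ~= 0} & (ALL y:W. f y = p' (th y) / q' (th y))"
  proof (intro exI conjI ballI)
   fix y assume "y \<in> {z \<in> Z. q' (th z) ~= 0}"
   thus "f y = p' (th y) / q' (th y)" using p' q' pq(5)[of y] unit[of y] by auto
  qed (use sq(2) x q'x q' pq(4) in auto)
 qed (use U sq x q'x in auto)
 hence "b = stalk_map (gspace H Z) th x ?c" using sq(1) by simp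
 moreover have "?c \<in> carrier (stalk (gspace H' Z') (th x))" by (rule H'.germ_in_stalk)
   (use H'.open_basic[OF q'(1)] H'.regular_quotient[OF p'(1) q'(1)] into[OF x] q'x in auto)
 ultimately show "b \<in> stalk_map (gspace H Z) th x ` carrier (stalk (gspace H' Z') (th x))" by blast
qed

text \<open>If \<open>p / q\<close> pulls back to zero near \<open>x\<close>, multiplication by a
  suitable \<open>k'\<close> that is nonzero at the image of \<open>x\<close> makes the numerator
  vanish on the whole fibre, where \<open>divide\<close> applies. The factor \<open>k'\<close> is a
  unit in the stalk. Conversely \<open>pr - a\<close> pulls back to zero.\<close>

lemma stalk_map_kernel:
 assumes x: "x \<in> Z"
 shows "a_kernel (stalk (gspace H' Z') (th x)) (stalk (gspace H Z) x) (stalk_map (gspace H Z) th x) =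
  PIdl\<^bsub>stalk (gspace H' Z') (th x)\<^esub> (germ (gspace H' Z') (th x) (pts (gspace H' Z')) (%y. pr y - a))"
  (is "_ = PIdl\<^bsub>?R\<^esub> ?g")
proof -
 let ?X = "gspace H' Z'" and ?m = "stalk_map (gspace H Z) th x"
 have Zo: "openin (gtop H' Z') Z'" using openin_topspace[of "gtop H' Z'"] by simp
 have reg: "(%y. pr y - a) \<in> regular ?X Z'" using H'.reg_add[of Z' pr "%_. - a"] pr_reg H'.reg_const[of Z' "- a"] Zo by simp
 have g: "?g = germ ?X (th x) Z' (%y. pr y - a)" by simp
 show ?thesis
 proof (intro equalityI subsetI)
  fix b assume "b \<in> a_kernel ?R (stalk (gspace H Z) x) ?m"
  hence b: "b \<in> carrier ?R" "?m b = \<zero>\<^bsub>stalk (gspace H Z) x\<^esub>" by (auto simp: a_kernel_def')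
  obtain d p q where pq: "p \<in> H' d" "q \<in> H' d" "q (th x) ~= 0"
   "b = germ ?X (th x) (nz Z' q) (%y. p y / q y)" by (rule germ_lift[OF x b(1)], rule that; assumption)
  note sq = stalk_map_quotient[OF x pq(1-3)]
  have ZoH: "openin (gtop H Z) Z" using openin_topspace[of "gtop H Z"] by simp
  have "germ (gspace H Z) x {z \<in> Z. q (th z) ~= 0} (%z. p (th z) / q (th z)) = germ (gspace H Z) x Z (%_. 0)"
   using b(2) sq(1) pq(4) by (simp add: H.stalk_zero)
  then obtain W where W: "openin (gtop H Z) W" "x \<in> W" "W \<subseteq> {z \<in> Z. q (th z) ~= 0}"
   "!!z. z \<in> W ==> p (th z) / q (th z) = 0"
   using H.germ_eq_iff[of "{z \<in> Z. q (th z) ~= 0}" x "%z. p (th z) / q (th z)" Z "%_. 0"] sq ZoH x pq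
    H.reg_const[of Z 0] by auto
  obtain e k where k: "k \<in> H e" "k x ~= 0" "!!y. y \<in> Z ==> k y ~= 0 ==> y \<in> W" using W unfolding H.openin_gtop_iff by blast
  obtain k' where k': "k' \<in> H' e" "!!z. z \<in> Z ==> k' (th z) = u z ^ e * k z" using lift[OF k(1)] by blast
  have pk: "(%y. p y * k' y) \<in> H' (d + e)" by (rule H'.mult[OF pq(1) k'(1)])
  have qk: "(%y. q y * k' y) \<in> H' (d + e)" by (rule H'.mult[OF pq(2) k'(1)])
  have "p (th z) * k' (th z) = 0" if z: "z \<in> Z" for z
  proof (cases "k z = 0")
   case False
   hence "z \<in> W" by (rule k(3)[OF z])
   hence "q (th z) ~= 0" "p (th z) / q (th z) = 0" using W(3,4) by blast+
   thus ?thesis by simp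
  qed (use k'(2)[OF z] in simp)
  from divide[OF pk this] obtain h where h: "h \<in> H' (d + e)" "!!y. y \<in> Z' ==> p y * k' y = (pr y - a) * h y" by blast
  let ?D = "{y \<in> Z'. q y * k' y ~= 0}"
  have o: "openin (gtop H' Z') ?D" by (rule H'.open_basic[OF qk])
  have xD: "th x \<in> ?D" using into[OF x] pq(3) k k'(2)[OF x] unit[OF x] by auto
  have r: "(%y. h y / (q y * k' y)) \<in> regular ?X ?D" by (rule H'.regular_quotient[OF h(1) qk o]) auto
  let ?c = "germ ?X (th x) ?D (%y. h y / (q y * k' y))"
  have c: "?c \<in> carrier ?R" by (rule H'.germ_in_stalk) (use o xD r in auto)
  have "?c \<otimes>\<^bsub>?R\<^esub> ?g = germ ?X (th x) (?D \<inter> Z') (%y. h y / (q y * k' y) * (pr y - a))"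
   unfolding g by (rule H'.stalk_mult) (use o xD r Zo reg into[OF x] in auto)
  also have "\<dots> = germ ?X (th x) (nz Z' q) (%y. p y / q y)"
  proof (subst H'.germ_eq_iff)
   have DZ: "?D \<inter> Z' = ?D" by auto
   show "(%y. h y / (q y * k' y) * (pr y - a)) \<in> regular ?X (?D \<inter> Z')"
    unfolding DZ by (rule H'.reg_mult) (use o r Zo reg sheaf_restrict[OF H'.sheaf, of Z' ?D] in auto)
   show "EX W. opn ?X W & th x \<in> W & W \<subseteq> ?D \<inter> Z' \<inter> (nz Z' q) &
    (ALL y:W. h y / (q y * k' y) * (pr y - a) = p y / q y)"
   proof (intro exI conjI ballI)
    fix y assume y: "y \<in> ?D"
    hence "h y / (q y * k' y) * (pr y - a) = (p y * k' y) / (q y * k' y)" using h(2) by auto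
    thus "h y / (q y * k' y) * (pr y - a) = p y / q y" using y by simp
   qed (use o xD in auto)
   show "opn ?X (?D \<inter> Z')" unfolding DZ using o by simp
  qed (use o xD into[OF x] pq H'.open_basic[OF pq(2)] H'.regular_quotient[OF pq(1,2)] in auto)
  finally show "b \<in> PIdl\<^bsub>?R\<^esub> ?g" using c pq(4) unfolding cgenideal_def by auto
 next
  fix b assume "b \<in> PIdl\<^bsub>?R\<^esub> ?g"
  then obtain c where c: "c \<in> carrier ?R" "b = c \<otimes>\<^bsub>?R\<^esub> ?g" unfolding cgenideal_def by auto
  obtain U f where U: "openin (gtop H' Z') U" "th x \<in> U" "f \<in> regular ?X U" "c = germ ?X (th x) U f" using c(1) by (rule H'.stalkE) auto
  have UZ: "U \<inter> Z' = U" using openin_subset[OF U(1)] by auto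
  have b: "b = germ ?X (th x) U (%y. f y * (pr y - a))" unfolding c(2) U(4) g by (subst H'.stalk_mult) (use U Zo reg into[OF x] UZ in auto)
  have r: "(%y. f y * (pr y - a)) \<in> regular ?X U" by (rule H'.reg_mult) (use U Zo reg sheaf_restrict[OF H'.sheaf, of Z' U] UZ in auto)
  note sm = stalk_map_germ[OF H.ringed_axioms H'.ringed_axioms morphism, of x U "%y. f y * (pr y - a)"]
  have "?m b = germ (gspace H Z) x {y \<in> pts (gspace H Z). th y \<in> U} ((%y. f y * (pr y - a)) \<circ> th)"
   unfolding b by (rule sm(1)) (use x U r in auto)
  also have "\<dots> = germ (gspace H Z) x {y \<in> pts (gspace H Z). th y \<in> U} (%_. 0)" by (rule H.germ_cong) (use sm(2,3) x U r over in auto)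
  also have "\<dots> = \<zero>\<^bsub>stalk (gspace H Z) x\<^esub>"
   unfolding H.stalk_zero by (rule H.germ_const[symmetric]) (use sm(2) x U r in auto)
  finally have "?m b = \<zero>\<^bsub>stalk (gspace H Z) x\<^esub>" .
  moreover have "b \<in> carrier ?R" unfolding b by (rule H'.germ_in_stalk) (use U r in auto)
  ultimately show "b \<in> a_kernel ?R (stalk (gspace H Z) x) ?m" by (simp add: a_kernel_def')
 qed
qed

theorem isomorphic_to_fibre: "isomorphic_to_fibre (gspace H Z) (gspace H' Z') pr a" unfolding isomorphic_to_fibre_def
 by (intro exI[of _ th] conjI ballI morphism homeomorphic) (use stalk_map_surj stalk_map_kernel in auto)

end


section \<open>Separatedness, affine charts and torus actions\<close>

lemma prod_space_basis:
 assumes "opn X U" "opn Y V" "h \<in> tensor_funs X Y U V"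
 shows "opn (prod_space X Y) {z \<in> U \<times> V. h z ~= 0}" unfolding prod_space_def Let_def funspace.select_convs
 by (rule topology_generated_by_Basis) (use assms in blast)

lemma tensor_funsI:
 fixes k :: nat
 assumes "!!i. i < k ==> f i \<in> regular X U" "!!i. i < k ==> g i \<in> regular Y V"
 shows "(%z. \<Sum>i<k. f i (fst z) * g i (snd z)) \<in> tensor_funs X Y U V" unfolding tensor_funs_def
 by (rule CollectI, rule exI[of _ k], rule exI[of _ f], rule exI[of _ g]) (use assms in simp)

text \<open>The expression \<open>p x * q y - q x * p y\<close> vanishes on the diagonal. Dividing
  it by \<open>h x * g y\<close>, with \<open>h\<close> and \<open>g\<close> of the same degree and
  nonzero at the two points, turns it into a sum of two products of regular functions.\<close>

lemma (in gfun) closed_diagonal: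
 assumes sep: "!!x y. x \<in> Z ==> y \<in> Z ==> x ~= y ==> EX d. EX p:H d. EX q:H d. p x * q y ~= q x * p y"
 shows "closedin (zar (prod_space (gspace H Z) (gspace H Z))) {(x, x) |x. x \<in> pts (gspace H Z)}"
proof -
 let ?X = "gspace H Z" and ?P = "prod_space (gspace H Z) (gspace H Z)"
 have basis: "opn ?P {z \<in> U \<times> V. h z ~= 0}"
  if "openin (gtop H Z) U" "openin (gtop H Z) V" "h \<in> tensor_funs ?X ?X U V" for U V h by (rule prod_space_basis) (use that in simp_all)
 have Zo: "openin (gtop H Z) Z" using openin_topspace[of "gtop H Z"] by simp
 have tens: "(%z. \<Sum>i<k. f i (fst z) * g i (snd z)) \<in> tensor_funs ?X ?X U V"
  if "!!i. i < k ==> f i \<in> regular ?X U" "!!i. i < k ==> g i \<in> regular ?X V" for k :: nat and f g U V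
  by (rule tensor_funsI) (use that in simp_all)
 have top: "pts ?P = Z \<times> Z"
 proof
  show "pts ?P \<subseteq> Z \<times> Z" unfolding prod_space_def Let_def using openin_subset[of "gtop H Z"]
   by (fastforce simp: topology_generated_by_topspace)
  have "opn ?P {z \<in> Z \<times> Z. (\<Sum>i<1::nat. 1 * (1::complex)) ~= 0}"
   using basis[OF Zo Zo tens[of 1 "%_ _. 1" _ "%_ _. 1"]] reg_const[of Z 1] Zo by simp
  thus "Z \<times> Z \<subseteq> pts ?P" using openin_subset by fastforce
 qed
 have "opn ?P (Z \<times> Z - {(x, x) |x. x \<in> Z})"
 proof (subst openin_subopen, intro ballI)
  fix w assume "w \<in> Z \<times> Z - {(x, x) |x. x \<in> Z}"
  then obtain x y where w: "w = (x, y)" "x \<in> Z" "y \<in> Z" "x ~= y" by auto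
  then obtain d p q where pq: "p \<in> H d" "q \<in> H d" "p x * q y ~= q x * p y" using sep by blast
  have "p x ~= 0 \<or> q x ~= 0" "p y ~= 0 \<or> q y ~= 0" using pq(3) by auto
  then obtain h g where h: "h \<in> H d" "h x ~= 0" and g: "g \<in> H d" "g y ~= 0" using pq(1,2) by metis
  let ?U = "(nz Z h)" and ?V = "(nz Z g)"
  have o: "openin (gtop H Z) ?U" "openin (gtop H Z) ?V" using open_basic h g by auto
  have r: "(%z. k z / h z) \<in> regular ?X ?U" "(%z. k z / g z) \<in> regular ?X ?V" if "k \<in> H d" for k
   using regular_quotient[OF that h(1) o(1)] regular_quotient[OF that g(1) o(2)] by auto
  let ?f1 = "%i::nat. if i = 0 then (%z. p z / h z) else (%z. - 1 * (q z / h z))"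
  let ?f2 = "%i::nat. if i = 0 then (%z. q z / g z) else (%z. p z / g z)"
  let ?t = "%z. \<Sum>i<2::nat. ?f1 i (fst z) * ?f2 i (snd z)"
  have "?t \<in> tensor_funs ?X ?X ?U ?V" by (rule tens) (use r pq reg_mult[OF _ reg_const r(1)[OF pq(2)], of "-1"] o in auto)
  hence "opn ?P {z \<in> ?U \<times> ?V. ?t z ~= 0}" by (rule basis[OF o])
  moreover have t: "?t (a, b) = (p a * q b - q a * p b) / (h a * g b)" if "h a ~= 0" "g b ~= 0" for a b
   using that by (simp add: lessThan_nat_numeral lessThan_Suc field_simps)
  have "w \<in> {z \<in> ?U \<times> ?V. ?t z ~= 0}" using w h g pq t[of x y] by auto
  moreover have "{z \<in> ?U \<times> ?V. ?t z ~= 0} \<subseteq> Z \<times> Z - {(x, x) |x. x \<in> Z}" using t by (auto simp del: sum.lessThan_Suc)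
  ultimately show "EX T. opn ?P T & w \<in> T & T \<subseteq> Z \<times> Z - {(x, x) |x. x \<in> Z}" by blast
 qed
 thus ?thesis using top by (auto simp: closedin_def)
qed

lemma (in gfun) varietyI:
 assumes sep: "!!x y. x \<in> Z ==> y \<in> Z ==> x ~= y ==> EX d. EX p:H d. EX q:H d. p x * q y ~= q x * p y"
  and "finite I" "Z \<subseteq> (\<Union>i\<in>I. U i)"
  and "!!i. i \<in> I ==> openin (gtop H Z) (U i)"
  and "!!i. i \<in> I ==> affine_variety (open_subspace (gspace H Z) (U i))"
 shows "variety (gspace H Z)" unfolding variety_def
proof (intro conjI)
 show "EX \<U>. finite \<U> & \<Union>\<U> = pts (gspace H Z) &
    (ALL V:\<U>. opn (gspace H Z) V & affine_variety (open_subspace (gspace H Z) V))"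
 proof (intro exI[of _ "U ` I"] conjI)
  show "\<Union>(U ` I) = pts (gspace H Z)" using assms openin_subset by fastforce
 qed (use assms in auto)
qed (use sheaf closed_diagonal[OF sep] in auto)

lemma carrier_coord_space: "carrier (coord_space n) = {x. \<forall>i\<ge>n. x i = 0}" by (simp add: coord_space_def)

lemma linear_form_coord: "linear_form (coord_space n) (%x. x i)" by (simp add: linear_form_def coord_space_def)

lemma linear_form_coord_space:
 assumes l: "linear_form (coord_space n) l" and x: "x \<in> carrier (coord_space n)"
 shows "l x = (\<Sum>i<n. x i * l (%j. if j = i then 1 else 0))"
proof -
 let ?e = "%i j. if j = i then 1 else 0 :: complex"
 have add: "l (%i. x i + y i) = l x + l y" if "!!i. i \<ge> n ==> x i = 0" "!!i. i \<ge> n ==> y i = 0" for x y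
  using l that by (auto simp: linear_form_def coord_space_def)
 have smult: "l (%i. c * x i) = c * l x" if "!!i. i \<ge> n ==> x i = 0" for c x using l that by (auto simp: linear_form_def coord_space_def)
 have "l (%i. if i < m then x i else 0) = (\<Sum>i<m. x i * l (?e i))" if "m \<le> n" for m using that
 proof (induction m)
  case 0
  show ?case using smult[of "%_. 0" 0] by simp
 next
  case (Suc m)
  have "(%i. if i < Suc m then x i else 0) = (%i. (if i < m then x i else 0) + x m * ?e m i)" by (auto simp: fun_eq_iff less_Suc_eq)
  moreover have "l (%i. (if i < m then x i else 0) + x m * ?e m i) = l (%i. if i < m then x i else 0) + x m * l (?e m)"
  proof (subst add)
   show "l (%i. if i < m then x i else 0) + l (%i. x m * ?e m i) = l (%i. if i < m then x i else 0) + x m * l (?e m)"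
    by (subst smult) (use Suc.prems in auto)
  qed (use Suc.prems in auto)
  ultimately show ?case using Suc by simp
 qed
 from this[OF order_refl] have "l (%i. if i < n then x i else 0) = (\<Sum>i<n. x i * l (?e i))" .
 moreover have "(%i. if i < n then x i else 0) = x" using x by (auto simp: coord_space_def)
 ultimately show ?thesis by simp
qed

lemma (in ringed) reg_sum:
 assumes "opn X U" "!!i. i \<in> I ==> f i \<in> regular X U"
 shows "(%x. \<Sum>i\<in>I. f i x) \<in> regular X U"
 using assms(2) by (induction I rule: infinite_finite_induct) (use assms(1) in \<open>auto intro!: reg_add reg_const\<close>)

lemma (in ringed) reg_poly_funs:
 assumes U: "opn X U" and th: "!!x. x \<in> U ==> th x \<in> carrier (coord_space n)"
  and coord: "!!i. i < n ==> (%x. th x i) \<in> regular X U"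
  and P: "P \<in> poly_funs (coord_space n)"
 shows "(%x. P (th x)) \<in> regular X U" using P
proof induction
 case (linear l)
 have "(%x. \<Sum>i<n. th x i * l (%j. if j = i then 1 else 0)) \<in> regular X U"
  using coord by (intro reg_sum[OF U] reg_mult[OF U] reg_const[OF U]) auto
 thus ?case by (rule sheaf_cong[OF sheaf U]) (use linear_form_coord_space[OF linear th] in auto)
qed (auto intro: reg_const[OF U] reg_add[OF U] reg_mult[OF U])

lemma closedin_affine_zeros:
 assumes "S \<subseteq> poly_funs V"
 shows "closedin (zar (affine_space_on V (carrier V))) {x \<in> carrier V. ALL p:S. p x = 0}"
proof -
 interpret gfun "%_. poly_funs V" "carrier V" by (rule gfun_poly_funs)
 have "openin (gtop (%_. poly_funs V) (carrier V)) (carrier V - {x \<in> carrier V. ALL p:S. p x = 0})"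
  unfolding openin_gtop_iff using assms by blast
 thus ?thesis by (auto simp: closedin_def affine_space_on_eq)
qed

text \<open>The map \<open>ps\<close> may land on a normalised representative of the point with
  coordinates \<open>x\<close>. The factor \<open>u x ^ d\<close> accounts for that and cancels in
  quotients of equal degree, so polynomials remain.\<close>

lemma (in gfun) affine_chartI:
 assumes U: "openin (gtop H Z) U"
  and closed: "closedin (zar (affine_space_on (coord_space n) (carrier (coord_space n)))) C"
  and th: "!!z. z \<in> U ==> th z \<in> C" "!!z. z \<in> U ==> ps (th z) = z"
  and ps: "!!x. x \<in> C ==> ps x \<in> U" "!!x. x \<in> C ==> th (ps x) = x"
  and coord: "!!i. i < n ==> (%z. th z i) \<in> regular (gspace H Z) U"
  and pull: "!!d h. h \<in> H d ==> EX P:poly_funs (coord_space n). ALL x:C. h (ps x) = u x ^ d * P x"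
  and unit: "!!x. x \<in> C ==> u x ~= 0"
 shows "affine_variety (open_subspace (gspace H Z) U)"
proof -
 let ?X = "open_subspace (gspace H Z) U"
 let ?A = "gspace (%_. poly_funs (coord_space n)) C"
 interpret A: gfun "%_. poly_funs (coord_space n)" C by (rule gfun_poly_funs)
 have CC: "C \<subseteq> carrier (coord_space n)"
 proof -
  interpret B: gfun "%_. poly_funs (coord_space n)" "carrier (coord_space n)" by (rule gfun_poly_funs)
  show ?thesis using closedin_subset[OF closed] by (simp add: affine_space_on_eq)
 qed
 have UZ: "U \<subseteq> Z" using openin_subset[OF U] by simp
 have top: "pts ?X = U" using UZ by (auto simp: open_subspace_def)
 have op: "opn ?X W \<longleftrightarrow> openin (gtop H Z) W & W \<subseteq> U" for W
  using U by (simp add: open_subspace_def openin_open_subtopology)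
 have reg: "regular ?X = regular (gspace H Z)" by (simp add: open_subspace_def)
 have sheafX: "sheaf_of_functions ?X" by (rule sheaf_open_subspace[OF sheaf]) (use U in simp)
 have polyreg: "(%z. P (th z)) \<in> regular (gspace H Z) U" if "P \<in> poly_funs (coord_space n)" for P
  by (rule reg_poly_funs[where n = n]) (use U th CC coord that in auto)
 have "morphism ?X ?A th"
 proof (rule morphism_gspaceI[OF sheafX])
  fix d :: nat and p q x
  assume p: "p \<in> poly_funs (coord_space n)" and q: "q \<in> poly_funs (coord_space n)"
   and "x \<in> pts ?X" "q (th x) ~= 0"
  hence x: "x \<in> U" "q (th x) ~= 0" using top by auto
  let ?W = "{z \<in> U. q (th z) ~= 0}"
  note inv = regular_inverse[OF U polyreg[OF q]]
  have "(%z. p (th z)) \<in> regular (gspace H Z) ?W" by (rule sheaf_restrict[OF sheaf _ _ _ polyreg[OF p]]) (use U inv in auto)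
  from reg_mult[OF _ this inv(2)] inv(1) have "(%z. p (th z) / q (th z)) \<in> regular (gspace H Z) ?W" by simp
  thus "EX W. opn ?X W & x \<in> W & (%z. p (th z) / q (th z)) \<in> regular ?X W & (ALL z:W. q (th z) ~= 0)"
   using x inv(1) unfolding reg op by (intro exI[of _ ?W]) auto
 qed (use th top poly_funs.const in auto)
 moreover have "morphism ?A ?X ps"
 proof (rule morphism_open_subspace[OF morphism_gspaceI[OF A.sheaf]])
  fix d p q x assume p: "p \<in> H d" and q: "q \<in> H d" and "x \<in> pts ?A" "q (ps x) ~= 0"
  hence x: "x \<in> C" "q (ps x) ~= 0" by auto
  obtain P where P: "P \<in> poly_funs (coord_space n)" "!!x. x \<in> C ==> p (ps x) = u x ^ d * P x" using pull[OF p] by blast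
  obtain Q where Q: "Q \<in> poly_funs (coord_space n)" "!!x. x \<in> C ==> q (ps x) = u x ^ d * Q x" using pull[OF q] by blast
  let ?W = "(nz C Q)"
  have o: "opn ?A ?W" using A.open_basic[OF Q(1)] by simp
  have "(%x. P x / Q x) \<in> regular ?A ?W" by (rule A.regular_quotient[OF P(1) Q(1)]) (use o in auto)
  hence "(%x. p (ps x) / q (ps x)) \<in> regular ?A ?W" by (rule sheaf_cong[OF A.sheaf o]) (use P Q unit in auto)
  thus "EX W. opn ?A W & x \<in> W & (%x. p (ps x) / q (ps x)) \<in> regular ?A W & (ALL z:W. q (ps z) ~= 0)"
   using o x Q unit by (intro exI[of _ ?W]) auto
 qed (use ps UZ U one in auto)
 ultimately have "isomorphic_spaces ?X ?A" unfolding isomorphic_spaces_def using th ps top by (intro exI[of _ th] exI[of _ ps]) auto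
 thus ?thesis unfolding affine_variety_def using closed by (auto simp: affine_space_on_eq)
qed

lemma topspace_A1: "topspace (zar A1) = UNIV" by (simp add: A1_eq)

lemma open_punctured: "openin (zar A1) (UNIV - {0})"
proof -
 have "{x. poly [:0, 1:] x ~= (0::complex)} = UNIV - {0}" by auto
 thus ?thesis using frac_regular(1)[of "[:0, 1:]"] by simp
qed

lemma topspace_Gm: "pts Gm = UNIV - {0}" by (simp add: Gm_def open_subspace_def topspace_A1)

lemma openin_Gm: "opn Gm (UNIV - {0})" using openin_topspace[of "zar Gm"] by (simp add: topspace_Gm)

lemma regular_Gm: "regular Gm = regular A1" by (simp add: Gm_def open_subspace_def)

lemma Gm_monomial: "(%t. t ^ m * inverse t ^ k) \<in> regular Gm (UNIV - {0})"
proof -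
 have "{x. poly ([:0, 1:] ^ k) x ~= (0::complex)} \<supseteq> UNIV - {0}" by (auto simp: poly_power)
 hence "(%x. poly ([:0, 1:] ^ m) x / poly ([:0, 1:] ^ k) x) \<in> regular A1 (UNIV - {0})"
  by (rule sheaf_restrict[OF A1.sheaf frac_regular(1) open_punctured _ frac_regular(2)])
 thus ?thesis by (simp add: regular_Gm poly_power divide_inverse power_inverse)
qed

text \<open>Regularity on a product requires finite sums of functions of \<open>t\<close> times
  functions of \<open>x\<close>, and \<open>act\<close> supplies them in each degree. Dividing by a
  function \<open>e\<close> of the same degree makes the second factors regular functions.\<close>

lemma (in gfun) equivariant_Gm_actionI:
 assumes into: "!!t x. t ~= 0 ==> x \<in> Z ==> sg t x \<in> Z"
  and one': "!!x. x \<in> Z ==> sg 1 x = x"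
  and comp: "!!s t x. s ~= 0 ==> t ~= 0 ==> x \<in> Z ==> sg (s * t) x = sg s (sg t x)"
  and equi: "!!t x. t ~= 0 ==> x \<in> Z ==> pr (sg t x) = inverse t * pr x"
  and unit: "!!t x. t ~= 0 ==> x \<in> Z ==> u t x ~= 0"
  and act: "!!d h. h \<in> H d ==> \<exists>(k::nat) a g. (ALL i<k. a i \<in> regular Gm (UNIV - {0}) & g i \<in> H d) &
   (ALL t x. t ~= 0 --> x \<in> Z --> h (sg t x) = u t x ^ d * (\<Sum>i<k. a i t * g i x))"
 shows "equivariant_Gm_action (gspace H Z) pr sg"
proof -
 let ?X = "gspace H Z" and ?P = "prod_space Gm (gspace H Z)"
 let ?G = "UNIV - {0 :: complex}"
 have basis: "opn ?P {z \<in> U \<times> V. h z ~= 0}"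
  if "opn Gm U" "openin (gtop H Z) V" "h \<in> tensor_funs Gm ?X U V" for U V h by (rule prod_space_basis) (use that in simp_all)
 have top: "pts ?P \<subseteq> ?G \<times> Z" unfolding prod_space_def Let_def using openin_subset[of "gtop H Z"] openin_subset[of "zar Gm"]
  by (fastforce simp: topology_generated_by_topspace topspace_Gm)
 have "morphism ?P ?X (%(t, x). sg t x)"
 proof (rule morphism_gspaceI[OF sheaf_prod_space])
  fix d p q z assume p: "p \<in> H d" and q: "q \<in> H d" and z: "z \<in> pts ?P"
   and nz: "q ((%(t, x). sg t x) z) ~= 0"
  obtain t0 x0 where z0: "z = (t0, x0)" "t0 ~= 0" "x0 \<in> Z" using z top by (cases z) auto
  obtain k :: nat and a g where A: "!!i. i < k ==> a i \<in> regular Gm ?G" "!!i. i < k ==> g i \<in> H d"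
   "!!t x. t ~= 0 ==> x \<in> Z ==> p (sg t x) = u t x ^ d * (\<Sum>i<k. a i t * g i x)" using act[OF p] by blast
  obtain l :: nat and b h where B: "!!i. i < l ==> b i \<in> regular Gm ?G" "!!i. i < l ==> h i \<in> H d"
   "!!t x. t ~= 0 ==> x \<in> Z ==> q (sg t x) = u t x ^ d * (\<Sum>i<l. b i t * h i x)" using act[OF q] by blast
  have "(\<Sum>i<l. b i t0 * h i x0) ~= 0" using nz z0 B(3) by auto
  \<comment> \<open>The denominator is nonzero at the base point, so one of the functions
    \<open>h i\<close> is nonzero at \<open>x0\<close>. It has the right degree to serve as
    \<open>e\<close>.\<close>
  then obtain i where "i < l" "h i x0 ~= 0" by (metis (no_types, lifting) lessThan_iff mult_zero_right sum.neutral)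
  then obtain e where e: "e \<in> H d" "e x0 ~= 0" using B(2) by blast
  let ?V = "(nz Z e)"
  have o: "openin (gtop H Z) ?V" by (rule open_basic[OF e(1)])
  have r: "(%x. k x / e x) \<in> regular ?X ?V" if "k \<in> H d" for k by (rule regular_quotient[OF that e(1) o]) auto
  let ?p = "%z. \<Sum>i<k. a i (fst z) * (g i (snd z) / e (snd z))"
  let ?q = "%z. \<Sum>i<l. b i (fst z) * (h i (snd z) / e (snd z))"
  have P: "?p \<in> tensor_funs Gm ?X ?G ?V" by (rule tensor_funsI) (use A(1) r[OF A(2)] in simp_all)
  have Q: "?q \<in> tensor_funs Gm ?X ?G ?V" by (rule tensor_funsI) (use B(1) r[OF B(2)] in simp_all)
  let ?W = "{z \<in> ?G \<times> ?V. ?q z ~= 0}"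
  have oW: "opn ?P ?W" by (rule basis[OF openin_Gm o Q])
  have qs: "q (sg t x) = u t x ^ d * (e x * ?q (t, x))" if "t ~= 0" "x \<in> ?V" for t x
  proof -
   have "e x * ?q (t, x) = (\<Sum>i<l. b i t * h i x)" using that by (simp add: sum_distrib_left)
   thus ?thesis using B(3)[of t x] that by simp
  qed
  have pqs: "p (sg t x) = u t x ^ d * (e x * ?p (t, x))" if "t ~= 0" "x \<in> ?V" for t x
  proof -
   have "e x * ?p (t, x) = (\<Sum>i<k. a i t * g i x)" using that by (simp add: sum_distrib_left)
   thus ?thesis using A(3)[of t x] that by simp
  qed
  have zW: "z \<in> ?W" using nz z0 e qs[of t0 x0] by auto
  have nzW: "q ((%(t, x). sg t x) w) ~= 0" and eqW: "p ((%(t, x). sg t x) w) / q ((%(t, x). sg t x) w) = ?p w / ?q w"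
   if w: "w \<in> ?W" for w
  proof -
   obtain t x where tx: "w = (t, x)" "t ~= 0" "x \<in> ?V" "?q (t, x) ~= 0" using w by (cases w) auto
   have uu: "u t x ~= 0" "e x ~= 0" using unit tx by auto
   show "q ((%(t, x). sg t x) w) ~= 0" using qs[OF tx(2,3)] uu tx by (simp del: sum_eq_0_iff)
   show "p ((%(t, x). sg t x) w) / q ((%(t, x). sg t x) w) = ?p w / ?q w" unfolding tx(1) prod.case qs[OF tx(2,3)] pqs[OF tx(2,3)] using uu by simp
  qed
  have "(%z. p ((%(t, x). sg t x) z) / q ((%(t, x). sg t x) z)) \<in> regular ?P ?W"
  proof -
   have "EX W' U V p' q'. opn ?P W' & w \<in> W' & W' \<subseteq> ?W & W' \<subseteq> U \<times> V &
      opn Gm U & opn ?X V & p' \<in> tensor_funs Gm ?X U V & q' \<in> tensor_funs Gm ?X U V &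
      (ALL y:W'. q' y ~= 0 & p ((%(t, x). sg t x) y) / q ((%(t, x). sg t x) y) = p' y / q' y)"
    if "w \<in> ?W" for w by (rule exI[of _ ?W], rule exI[of _ ?G], rule exI[of _ ?V], rule exI[of _ ?p], rule exI[of _ ?q])
     (intro conjI ballI, use oW that openin_Gm o P Q eqW in auto)
   thus ?thesis unfolding prod_space_def Let_def by simp
  qed
  thus "EX U. opn ?P U & z \<in> U & (%z. p ((%(t, x). sg t x) z) / q ((%(t, x). sg t x) z)) \<in> regular ?P U &
    (ALL z:U. q ((%(t, x). sg t x) z) ~= 0)" using oW zW nzW by blast
 qed (use top into one in auto)
 thus ?thesis unfolding equivariant_Gm_action_def using one' comp equi by auto
qed

section \<open>Families of parametrised cones\<close>

text \<open>Monomials are indexed by words rather than by exponents. The repetitions do no harm,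
  since spans and relations are what matters, and a product of monomials is concatenation.\<close>

definition words :: "nat => nat => nat list set" where
 "words k d = {js. length js = d & set js \<subseteq> {..<k}}"

definition wmon :: "nat list => (nat => complex) => complex" where
 "wmon js y = prod_list (map y js)"

text \<open>A point of the line times an affine space of dimension \<open>k\<close>: the parameter
  sits in coordinate 0, and values of \<open>y\<close> beyond \<open>k\<close> are cut off so that
  the point lies in \<open>cspace k\<close>.\<close>

definition pt :: "nat => complex => (nat => complex) => nat => complex" where
 "pt k t y = (%i. case i of 0 => t | Suc j => if j < k then y j else 0)"

lemma finite_words [simp]: "finite (words k d)" unfolding words_def using finite_lists_length_eq[of "{..<k}" d] by (simp add: conj_commute)

lemma wmon_append: "wmon (is @ js) y = wmon is y * wmon js y" by (simp add: wmon_def)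

lemma wmon_cong: "js \<in> words k d ==> (!!i. i < k ==> y i = z i) ==> wmon js y = wmon js z"
 unfolding wmon_def words_def by (rule arg_cong[of _ _ prod_list]) (auto simp: subset_iff)

lemma wmon_mult: "wmon js (%i. a i * y i) = wmon js a * wmon js y" by (induction js) (auto simp: wmon_def)

lemma wmon_power: "wmon js (%i. t ^ w i) = t ^ sum_list (map w js)" by (induction js) (auto simp: wmon_def power_add)

lemma wmon_const: "wmon js (%_. c) = c ^ length js" by (induction js) (auto simp: wmon_def)

lemma wmon_scale: "js \<in> words k d ==> wmon js (%i. c * y i) = c ^ d * wmon js y" by (simp add: wmon_mult wmon_const words_def)

lemma pt_simps [simp]: "pt k t y 0 = t" "i < k ==> pt k t y (Suc i) = y i" by (simp_all add: pt_def)

lemma pt_carrier [simp]: "pt k t y \<in> cspace k" by (auto simp: carrier_coord_space pt_def split: nat.split)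

lemma pt_eqI: "x \<in> cspace k ==> pt k (x 0) (tail x) = x" by (auto simp: carrier_coord_space pt_def fun_eq_iff split: nat.split)

lemma pt_cong: "(!!i. i < k ==> y i = z i) ==> pt k t y = pt k t z" by (auto simp: pt_def fun_eq_iff split: nat.split)

text \<open>The part of degree \<open>d\<close> of the polynomial ring in \<open>k\<close> variables
  over the ring of polynomials in the parameter \<open>x 0\<close>; the parameter has degree
  0.\<close>

definition forms :: "nat => nat => ((nat => complex) => complex) set" where
 "forms k d = {(%x. \<Sum>js\<in>words k d. poly (c js) (x 0) * wmon js (tail x)) |c. True}"

lemma formsI: "(%x. \<Sum>js\<in>words k d. poly (c js) (x 0) * wmon js (tail x)) \<in> forms k d" unfolding forms_def by blast

lemma forms_add: "p \<in> forms k d ==> q \<in> forms k d ==> (%x. p x + q x) \<in> forms k d"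
proof -
 assume "p \<in> forms k d" "q \<in> forms k d"
 then obtain a b where "p = (%x. \<Sum>js\<in>words k d. poly (a js) (x 0) * wmon js (tail x))"
  "q = (%x. \<Sum>js\<in>words k d. poly (b js) (x 0) * wmon js (tail x))" unfolding forms_def by blast
 thus ?thesis using formsI[where c = "%js. a js + b js"] by (simp add: distrib_right sum.distrib)
qed

lemma forms_scale_poly: "p \<in> forms k d ==> (%x. poly c (x 0) * p x) \<in> forms k d"
proof -
 assume "p \<in> forms k d"
 then obtain a where "p = (%x. \<Sum>js\<in>words k d. poly (a js) (x 0) * wmon js (tail x))" unfolding forms_def by blast
 thus ?thesis using formsI[where c = "%js. c * a js"] by (simp add: sum_distrib_left mult.assoc)
qed

lemma forms_scale: "p \<in> forms k d ==> (%x. c * p x) \<in> forms k d" using forms_scale_poly[of p k d "[:c:]"] by simp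

lemma forms_sum: "finite I ==> (!!i. i \<in> I ==> p i \<in> forms k d) ==> (%x. \<Sum>i\<in>I. p i x) \<in> forms k d"
proof (induction I rule: finite_induct)
 case empty
 show ?case using formsI[where c = "%_. 0"] by simp
qed (auto intro: forms_add)

lemma forms_mon: "js \<in> words k d ==> (%x. wmon js (tail x)) \<in> forms k d"
proof -
 assume js: "js \<in> words k d"
 have "(%x. \<Sum>is\<in>words k d. poly (if is = js then 1 else 0) (x 0) * wmon is (tail x)) =
   (%x. \<Sum>is\<in>words k d. if js = is then wmon is (tail x) else 0)" by (intro ext sum.cong) auto
 also have "\<dots> = (%x. wmon js (tail x))" using js by simp
 finally show ?thesis using formsI[where k = k and d = d and c = "%is. if is = js then 1 else 0"] by simp
qed

lemma words_append: "is \<in> words k d ==> js \<in> words k e ==> is @ js \<in> words k (d + e)" by (auto simp: words_def)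

lemma forms_mult:
 assumes "p \<in> forms k d" "q \<in> forms k e"
 shows "(%x. p x * q x) \<in> forms k (d + e)"
proof -
 obtain a b where "p = (%x. \<Sum>js\<in>words k d. poly (a js) (x 0) * wmon js (tail x))"
  "q = (%x. \<Sum>js\<in>words k e. poly (b js) (x 0) * wmon js (tail x))" using assms unfolding forms_def by blast
 hence eq: "(%x. p x * q x) = (%x. \<Sum>is\<in>words k d. \<Sum>js\<in>words k e.
   poly (a is * b js) (x 0) * wmon (is @ js) (tail x))" by (simp add: sum_product wmon_append mult.assoc mult.left_commute)
 show ?thesis unfolding eq by (intro forms_sum forms_scale_poly forms_mon words_append finite_words)
qed

lemma forms_const: "(%x. c) \<in> forms k 0" using forms_scale[OF forms_mon[of "[]" k 0], of c] by (simp add: words_def wmon_def)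

lemma forms_param: "(%x. poly c (x 0)) \<in> forms k 0" using forms_scale_poly[OF forms_const[of 1]] by simp

lemma forms_coord: "i < k ==> (%x. x (Suc i)) \<in> forms k 1" using forms_mon[of "[i]" k 1] by (simp add: words_def wmon_def)

lemma forms_homogeneous:
 assumes "p \<in> forms k d"
 shows "p (pt k t (%i. c * y i)) = c ^ d * p (pt k t y)"
proof -
 obtain a where "p = (%x. \<Sum>js\<in>words k d. poly (a js) (x 0) * wmon js (tail x))" using assms unfolding forms_def by blast
 moreover have "wmon js (%i. pt k t (%i. c * y i) (Suc i)) = c ^ d * wmon js (%i. pt k t y (Suc i))"
  if "js \<in> words k d" for js
  using wmon_cong[OF that, of "%i. pt k t (%i. c * y i) (Suc i)" "%i. c * pt k t y (Suc i)"] wmon_scale[OF that] by simp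
 ultimately show ?thesis by (simp add: sum_distrib_left mult.assoc mult.left_commute)
qed

lemma poly_funs_sum: "finite I ==> (!!i. i \<in> I ==> p i \<in> poly_funs V) ==> (%x. \<Sum>i\<in>I. p i x) \<in> poly_funs V"
 by (induction I rule: finite_induct) (auto intro: poly_funs.intros)

lemma forms_poly_funs: "p \<in> forms k d ==> p \<in> poly_funs (coord_space n)"
proof -
 assume "p \<in> forms k d"
 then obtain a where p: "p = (%x. \<Sum>js\<in>words k d. poly (a js) (x 0) * wmon js (tail x))" unfolding forms_def by blast
 have "(%x. poly c (x 0)) \<in> poly_funs (coord_space n)" for c
 proof (induction c)
  case (pCons a c)
  hence "(%x. a + x 0 * poly c (x 0)) \<in> poly_funs (coord_space n)"
   by (intro poly_funs.add[OF poly_funs.const] poly_funs.mult[OF poly_funs.linear[OF linear_form_coord]])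
  thus ?case by simp
 qed (simp add: poly_funs.const)
 moreover have "(%x. wmon js (tail x)) \<in> poly_funs (coord_space n)" for js by (induction js)
   (auto simp: wmon_def poly_funs.const intro!: poly_funs.mult[OF poly_funs.linear[OF linear_form_coord]])
 ultimately show ?thesis unfolding p by (auto intro!: poly_funs_sum poly_funs.mult)
qed

text \<open>Decomposition into forms that are homogeneous in the fibre coordinates. It is an
  identity on \<open>cspace k\<close> only, because a linear form is constrained only on the
  carrier.\<close>

lemma poly_funs_decompose:
 assumes "P \<in> cpolys k"
 shows "EX D F. (ALL d. F d \<in> forms k d) & (ALL x:cspace k. P x = (\<Sum>d<D. F d x))" using assms
proof induction
 case (const c)
 \<comment> \<open>The empty sum is the zero form in the shape in which \<open>forms_sum\<close>
   provides it.\<close>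
 have "ALL d. (if d = 0 then (%_. c) else (%x. \<Sum>i\<in>({}::nat set). 0)) \<in> forms k d"
  using forms_const[of c k] forms_sum[of "{}::nat set" "%_ _. 0" k] by auto
 thus ?case by (intro exI[of _ 1] exI[of _ "%d. if d = 0 then (%_. c) else (%x. \<Sum>i\<in>({}::nat set). 0)"]) auto
next
 case (linear l)
 let ?e = "%i. l (%j. if j = i then 1 else 0)"
 let ?F = "%(d::nat) x. if d = 0 then poly [:0, ?e 0:] (x 0) else if d = 1 then (\<Sum>i<k. ?e (Suc i) * x (Suc i)) else (\<Sum>i\<in>({}::nat set). 0)"
 have "?F d \<in> forms k d" for d
 proof -
  have "(%x. \<Sum>i<k. ?e (Suc i) * x (Suc i)) \<in> forms k 1" by (rule forms_sum) (auto intro!: forms_scale forms_coord[simplified])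
  moreover have "(%x. poly [:0, ?e 0:] (x 0)) \<in> forms k 0" by (rule forms_param)
  moreover have "(%x. \<Sum>i\<in>({}::nat set). 0) \<in> forms k d" by (rule forms_sum) auto
  ultimately show ?thesis
  proof -
   assume *: "(%x. \<Sum>i<k. ?e (Suc i) * x (Suc i)) \<in> forms k 1" "(%x. poly [:0, ?e 0:] (x 0)) \<in> forms k 0"
    "(%x. \<Sum>i\<in>({}::nat set). 0) \<in> forms k d"
   consider "d = 0" | "d = 1" | "d ~= 0" "d ~= 1" by blast
   thus ?thesis using * by cases (simp_all only: if_True if_False refl zero_neq_one one_neq_zero)
  qed
 qed
 moreover have "l x = (\<Sum>d<2. ?F d x)" if "x \<in> cspace k" for x using linear_form_coord_space[OF linear that]
  by (simp add: sum.lessThan_Suc_shift lessThan_nat_numeral mult.commute numeral_2_eq_2 del: sum.lessThan_Suc)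
 ultimately show ?case by (intro exI[of _ 2] exI[of _ ?F]) blast
next
 case (add p q)
 then obtain D F E G where F: "!!d. F d \<in> forms k d" "!!x. x \<in> cspace k ==> p x = (\<Sum>d<D. F d x)"
  and G: "!!d. G d \<in> forms k d" "!!x. x \<in> cspace k ==> q x = (\<Sum>d<E. G d x)" by blast
 let ?F = "%d x. (if d < D then 1 else 0) * F d x + (if d < E then 1 else 0) * G d x"
 have "?F d \<in> forms k d" for d using F G by (intro forms_add forms_scale)
 moreover have "p x + q x = (\<Sum>d<D + E. ?F d x)" if "x \<in> cspace k" for x
 proof -
  have "(\<Sum>d<D + E. (if d < D then 1 else 0) * F d x) = (\<Sum>d<D. F d x)" by (rule sum.mono_neutral_cong_right) auto
  moreover have "(\<Sum>d<D + E. (if d < E then 1 else 0) * G d x) = (\<Sum>d<E. G d x)" by (rule sum.mono_neutral_cong_right) auto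
  ultimately show ?thesis using F G that by (simp add: sum.distrib)
 qed
 ultimately show ?case by (intro exI[of _ "D + E"] exI[of _ ?F]) blast
next
 case (mult p q)
 then obtain D F E G where F: "!!d. F d \<in> forms k d" "!!x. x \<in> cspace k ==> p x = (\<Sum>d<D. F d x)"
  and G: "!!d. G d \<in> forms k d" "!!x. x \<in> cspace k ==> q x = (\<Sum>d<E. G d x)" by blast
 let ?S = "{..<D} \<times> {..<E}"
 let ?F = "%m x. \<Sum>(d, e)\<in>{z \<in> ?S. fst z + snd z = m}. F d x * G e x"
 have "?F m \<in> forms k m" for m
 proof -
  have "(%x. \<Sum>z\<in>{z \<in> ?S. fst z + snd z = m}. F (fst z) x * G (snd z) x) \<in> forms k m"
   by (rule forms_sum) (use forms_mult[OF F(1) G(1)] in auto)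
  thus ?thesis by (simp add: case_prod_beta)
 qed
 moreover have "p x * q x = (\<Sum>m<D + E. ?F m x)" if "x \<in> cspace k" for x
 proof -
  have "p x * q x = (\<Sum>(d, e)\<in>?S. F d x * G e x)" using F G that by (simp add: sum_product sum.cartesian_product)
  also have "\<dots> = (\<Sum>m<D + E. ?F m x)" by (rule sum.group[symmetric]) auto
  finally show ?thesis .
 qed
 ultimately show ?case by (intro exI[of _ "D + E"] exI[of _ ?F]) blast
qed

section \<open>Polynomial functions of one parameter\<close>

definition polyfun :: "(complex => complex) => bool" where
 "polyfun f \<longleftrightarrow> f \<in> range poly"

lemma polyfun_poly [simp]: "polyfun (poly p)" "polyfun (%t. poly p t)" by (auto simp: polyfun_def)

lemma polyfun_const [simp]: "polyfun (%_. c)" unfolding polyfun_def by (rule range_eqI[of _ _ "[:c:]"]) auto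

lemma polyfun_id [simp]: "polyfun (%t. t)" unfolding polyfun_def by (rule range_eqI[of _ _ "[:0, 1:]"]) auto

lemma polyfun_add: "polyfun f ==> polyfun g ==> polyfun (%t. f t + g t)"
proof -
 assume "polyfun f" "polyfun g"
 then obtain p q where "f = poly p" "g = poly q" by (auto simp: polyfun_def)
 hence "(%t. f t + g t) = poly (p + q)" by auto
 thus ?thesis by simp
qed

lemma polyfun_mult: "polyfun f ==> polyfun g ==> polyfun (%t. f t * g t)"
proof -
 assume "polyfun f" "polyfun g"
 then obtain p q where "f = poly p" "g = poly q" by (auto simp: polyfun_def)
 hence "(%t. f t * g t) = poly (p * q)" by auto
 thus ?thesis by simp
qed

lemma polyfun_power: "polyfun f ==> polyfun (%t. f t ^ n)" by (induction n) (auto intro: polyfun_mult)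

lemma polyfun_compose: "polyfun f ==> polyfun (%t. poly p (f t))" by (induction p) (auto intro: polyfun_add polyfun_mult)

lemma polyfun_sum: "(!!i. i \<in> I ==> polyfun (f i)) ==> polyfun (%t. \<Sum>i\<in>I. f i t)"
 by (induction I rule: infinite_finite_induct) (auto intro: polyfun_add)

lemma polyfun_diff: "polyfun f ==> polyfun g ==> polyfun (%t. f t - g t)" using polyfun_add[of f "%t. (-1) * g t"] polyfun_mult[of "%_. -1" g] by simp

lemma polyfun_mon: "(!!i. i \<in> set js ==> polyfun (%t. y t i)) ==> polyfun (%t. wmon js (y t))"
 by (induction js) (auto simp: wmon_def intro: polyfun_mult)

lemma polyfun_eq_0:
 assumes "polyfun f" "finite A" "!!t. t \<notin> A ==> f t = 0"
 shows "f t = 0"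
proof -
 obtain p where p: "f = poly p" using assms(1) by (auto simp: polyfun_def)
 have "p = 0"
 proof (rule ccontr)
  assume "p ~= 0"
  hence "finite {t. poly p t = 0}" by (rule poly_roots_finite)
  moreover have "- A \<subseteq> {t. poly p t = 0}" using assms(3) p by auto
  ultimately have "finite (- A)" using finite_subset by blast
  hence "finite (UNIV :: complex set)" using assms(2) finite_Un[of A "- A"] by (simp add: Compl_partition)
  thus False using infinite_UNIV_char_0 by blast
 qed
 thus ?thesis using p by simp
qed

lemma polyfun_eq:
 assumes "polyfun f" "polyfun g" "finite A" "!!t. t \<notin> A ==> f t = g t"
 shows "f t = g t" using polyfun_eq_0[OF polyfun_diff[OF assms(1,2)] assms(3), of t] assms(4) by simp

lemma poly_funs_polyfun:
 assumes "P \<in> poly_funs (coord_space n)" "!!t. y t \<in> carrier (coord_space n)" "!!i. i < n ==> polyfun (%t. y t i)"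
 shows "polyfun (%t. P (y t))" using assms(1)
proof induction
 case (linear l)
 have "polyfun (%t. \<Sum>i<n. y t i * l (%j. if j = i then 1 else 0))" by (rule polyfun_sum) (auto intro!: polyfun_mult assms(3))
 thus ?case using linear_form_coord_space[OF linear assms(2)] by simp
qed (auto intro: polyfun_add polyfun_mult)

section \<open>Flat limits of parametrised cones\<close>

text \<open>
 The weights \<open>w\<close> make all members \<open>ph t\<close> with \<open>t \<noteq> 0\<close> equivalent to \<open>ph 1\<close>.  In every degree the
 monomials indexed by \<open>B d\<close> are a basis of the span of all monomials of that degree in the
 coordinates of \<open>ph 1\<close> as well as of \<open>ph 0\<close>; this expresses that the Hilbert functions agree.
\<close>

locale degeneration_data =
 fixes k :: nat and ph :: "complex => 'x => nat => complex" and w :: "nat => nat" and B :: "nat => nat list set"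
 assumes poly_t: "i < k ==> polyfun (%t. ph t xi i)"
  and equi: "t ~= 0 ==> EX xi'. ALL i<k. ph 1 xi' i = t ^ w i * ph t xi i"
  and equi': "t ~= 0 ==> EX xi'. ALL i<k. t ^ w i * ph t xi' i = ph 1 xi i"
  and B_words: "B d \<subseteq> words k d"
  and indep0: "(!!xi. (\<Sum>js\<in>B d. c js * wmon js (ph 0 xi)) = 0) ==> js \<in> B d ==> c js = 0"
begin

abbreviation wt :: "nat list => nat" where "wt js == sum_list (map w js)"

lemma finite_B [simp]: "finite (B d)" using finite_subset[OF B_words] by simp

lemma B_wordsD: "js \<in> B d ==> js \<in> words k d" using B_words by auto

lemma polyfun_mon_ph: "js \<in> words k d ==> polyfun (%t. wmon js (ph t xi))" by (rule polyfun_mon) (auto simp: words_def intro!: poly_t)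

lemma wmon_wt: "wmon js (%i. t ^ w i * y i) = t ^ wt js * wmon js y" by (simp add: wmon_mult wmon_power)

text \<open>Induction on the weight of \<open>js\<close>. Once all coefficients of smaller weight
  vanish, the identity can be divided by \<open>t\<close> to that weight. At \<open>t = 0\<close>
  only words of exactly this weight survive on the right, while the left side keeps a positive power
  of \<open>t\<close>; independence in the special fibre kills the coefficient.\<close>

lemma limit:
 assumes R: "!!xi. polyfun (%t. R t xi)"
  and eq: "!!t xi. t ~= 0 ==> t ^ m * R t xi = (\<Sum>js\<in>B d. c js * t ^ wt js * wmon js (ph t xi))"
  and js: "js \<in> B d" "wt js < m"
 shows "c js = 0" using js
proof (induction "wt js" arbitrary: js rule: less_induct)
 case less
 let ?e = "wt js"
 have IH: "c is = 0" if "is \<in> B d" "wt is < ?e" for "is" using less.hyps[of "is"] that less.prems by auto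
 let ?f = "%xi t. t ^ (m - ?e) * R t xi"
 let ?g = "%xi t. \<Sum>is\<in>B d. (if wt is < ?e then 0 else c is * t ^ (wt is - ?e) * wmon is (ph t xi))"
 have "?f xi 0 = ?g xi 0" for xi
 proof (rule polyfun_eq[where A = "{0}" and f = "?f xi" and g = "?g xi"])
  show "polyfun (?f xi)" by (intro polyfun_mult polyfun_power R) auto
  show "polyfun (?g xi)"
  proof (rule polyfun_sum)
   fix "is" assume "is \<in> B d"
   hence "is \<in> words k d" using B_words by auto
   thus "polyfun (%t. if wt is < ?e then 0 else c is * t ^ (wt is - ?e) * wmon is (ph t xi))"
    by (cases "wt is < ?e") (auto intro!: polyfun_mult polyfun_power polyfun_mon_ph)
  qed
  fix t :: complex assume "t \<notin> {0}"
  hence t: "t ~= 0" by simp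
  have "t ^ ?e * ?f xi t = t ^ m * R t xi" using less.prems by (simp add: mult.assoc[symmetric] power_add[symmetric])
  also have "\<dots> = (\<Sum>is\<in>B d. c is * t ^ wt is * wmon is (ph t xi))" by (rule eq[OF t])
  also have "\<dots> = t ^ ?e * ?g xi t" unfolding sum_distrib_left
  proof (rule sum.cong[OF refl])
   fix "is" assume "is \<in> B d"
   thus "c is * t ^ wt is * wmon is (ph t xi) =
     t ^ ?e * (if wt is < ?e then 0 else c is * t ^ (wt is - ?e) * wmon is (ph t xi))" using IH[of "is"] power_add[of t ?e "wt is - ?e"] by auto
  qed
  finally show "?f xi t = ?g xi t" using t by simp
 qed simp
 moreover have "?f xi 0 = 0" for xi using less.prems by simp
 moreover have "?g xi 0 = (\<Sum>is\<in>B d. (if wt is = ?e then c is else 0) * wmon is (ph 0 xi))" for xi by (rule sum.cong[OF refl]) auto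
 ultimately have "(if wt js = ?e then c js else 0) = 0"
  by (intro indep0[where d = d and c = "%is. if wt is = ?e then c is else 0"]) (use less.prems in auto)
 thus ?case by simp
qed

text \<open>Independence spreads from the fibre over 0 to every fibre. Every member over
  \<open>t\<close> is carried to one over \<open>a\<close> by passing through the fibre over 1, so a
  relation over \<open>a\<close> becomes a rescaled relation over all \<open>t\<close> different
  from 0, and \<open>limit\<close> applies.\<close>

lemma indep:
 assumes c: "!!xi. (\<Sum>js\<in>B d. c js * wmon js (ph a xi)) = 0" and js: "js \<in> B d"
 shows "c js = 0"
proof (cases "a = 0")
 case True
 thus ?thesis using indep0[where d = d and c = c] c js by simp
next
 case False
 have "inverse a ^ wt js * c js = 0"
 \<comment> \<open>The remainder is zero, so any \<open>m\<close> above the weight of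
   \<open>js\<close> will do. The powers of \<open>inverse a\<close> compensate for the passage from
   the fibre over \<open>a\<close> to the fibre over 1.\<close>
 proof (rule limit[where R = "%_ _. 0" and m = "Suc (wt js)" and d = d and c = "%js. inverse a ^ wt js * c js"])
  fix t :: complex and xi assume t: "t ~= 0"
  obtain xi1 where 1: "!!i. i < k ==> ph 1 xi1 i = t ^ w i * ph t xi i" using equi[OF t] by blast
  obtain xi2 where 2: "!!i. i < k ==> a ^ w i * ph a xi2 i = ph 1 xi1 i" using equi'[OF False] by blast
  have "t ^ wt is * wmon is (ph t xi) = a ^ wt is * wmon is (ph a xi2)" if "is \<in> B d" for "is"
  proof -
   have "is \<in> words k d" using that B_words by auto
   thus ?thesis using wmon_cong[of "is" k d "%i. t ^ w i * ph t xi i" "%i. a ^ w i * ph a xi2 i"] 1 2 by (simp add: wmon_wt)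
  qed
  hence "(\<Sum>is\<in>B d. inverse a ^ wt is * c is * t ^ wt is * wmon is (ph t xi)) =
    (\<Sum>is\<in>B d. c is * wmon is (ph a xi2))" using False by (intro sum.cong refl) (simp add: mult.assoc field_simps power_inverse)
  thus "t ^ Suc (wt js) * 0 = (\<Sum>is\<in>B d. inverse a ^ wt is * c is * t ^ wt is * wmon is (ph t xi))" using c by simp
 qed (use js in auto)
 thus ?thesis using False by simp
qed

end

text \<open>Spanning is asked over 1 and independence over 0; together they force the monomials of
  \<open>B d\<close> to be a basis in every fibre. The assumption \<open>nonzero\<close> keeps every
  fibre nonempty after projectivisation.\<close>

locale family = degeneration_data +
 assumes span1: "is \<in> words k d ==> EX ga. ALL xi. wmon is (ph 1 xi) = (\<Sum>js\<in>B d. ga js * wmon js (ph 1 xi))"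
  and nonzero: "EX xi. EX i<k. ph a xi i ~= 0"
begin

text \<open>The relation over 1 is rescaled to all \<open>t\<close> different from 0. By
  \<open>limit\<close> no word of weight below that of the given word occurs in it, so the common
  power of \<open>t\<close> can be divided out and the relation continues polynomially to
  \<open>t = 0\<close>. Truncated subtraction in the exponent is harmless, as the coefficient is
  zero there.\<close>

lemma relations:
 assumes "is": "is \<in> words k d"
 obtains ga where "!!t xi. wmon is (ph t xi) = (\<Sum>js\<in>B d. ga js * t ^ (wt js - wt is) * wmon js (ph t xi))"
proof -
 obtain ga where ga: "!!xi. wmon is (ph 1 xi) = (\<Sum>js\<in>B d. ga js * wmon js (ph 1 xi))" using span1[OF "is"] by blast
 have eq: "t ^ wt is * wmon is (ph t xi) = (\<Sum>js\<in>B d. ga js * t ^ wt js * wmon js (ph t xi))" if t: "t ~= 0" for t xi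
 proof -
  obtain xi1 where 1: "!!i. i < k ==> ph 1 xi1 i = t ^ w i * ph t xi i" using equi[OF t] by blast
  have *: "wmon js (ph 1 xi1) = t ^ wt js * wmon js (ph t xi)" if "js \<in> words k d" for js
   using wmon_cong[OF that, of "ph 1 xi1" "%i. t ^ w i * ph t xi i"] 1 by (simp add: wmon_wt)
  show ?thesis using ga[of xi1] *[OF "is"] * B_words[of d] by (simp add: mult.assoc subset_iff)
 qed
 have zero: "ga js = 0" if "js \<in> B d" "wt js < wt is" for js by (rule limit[OF polyfun_mon_ph[OF "is"] eq that])
 have "wmon is (ph t xi) = (\<Sum>js\<in>B d. ga js * t ^ (wt js - wt is) * wmon js (ph t xi))" for t xi
 proof (rule polyfun_eq[where A = "{0}" and f = "%t. wmon is (ph t xi)"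
   and g = "%t. \<Sum>js\<in>B d. ga js * t ^ (wt js - wt is) * wmon js (ph t xi)"])
  show "polyfun (%t. wmon is (ph t xi))" by (rule polyfun_mon_ph[OF "is"])
  show "polyfun (%t. \<Sum>js\<in>B d. ga js * t ^ (wt js - wt is) * wmon js (ph t xi))"
   by (intro polyfun_sum polyfun_mult polyfun_power polyfun_const polyfun_id polyfun_mon_ph[of _ d]) (use B_words in auto)
  fix t :: complex assume "t \<notin> {0}"
  hence t: "t ~= 0" by simp
  have "t ^ wt is * wmon is (ph t xi) = (\<Sum>js\<in>B d. ga js * t ^ wt js * wmon js (ph t xi))" by (rule eq[OF t])
  also have "\<dots> = t ^ wt is * (\<Sum>js\<in>B d. ga js * t ^ (wt js - wt is) * wmon js (ph t xi))" unfolding sum_distrib_left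
  proof (rule sum.cong[OF refl])
   fix js assume "js \<in> B d"
   thus "ga js * t ^ wt js * wmon js (ph t xi) = t ^ wt is * (ga js * t ^ (wt js - wt is) * wmon js (ph t xi))"
    using zero[of js] power_add[of t "wt is" "wt js - wt is"] by (cases "wt js < wt is") auto
  qed
  finally show "wmon is (ph t xi) = (\<Sum>js\<in>B d. ga js * t ^ (wt js - wt is) * wmon js (ph t xi))" using t by simp
 qed simp
 thus ?thesis by (rule that)
qed

text \<open>The factor \<open>l\<close> takes the cone over each member of the family, so that these
  are equations for cones, fibre by fibre.\<close>

definition vanishing :: "((nat => complex) => complex) => bool" where
 "vanishing P \<longleftrightarrow> (ALL t l xi. P (pt k t (%i. l * ph t xi i)) = 0)"

definition cone :: "(nat => complex) set" where
 "cone = {x \<in> cspace k. ALL P:{P. vanishing P & (EX d. P \<in> forms k d)}. P x = 0}"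

lemma forms_vanishing:
 "P \<in> forms k d ==> (!!t xi. P (pt k t (ph t xi)) = 0) ==> vanishing P" unfolding vanishing_def by (simp add: forms_homogeneous)

text \<open>Each monomial of \<open>P\<close> is replaced by its defect from the relation in terms
  of \<open>B d\<close>, which vanishes on the whole family. Over \<open>a\<close> the result
  differs from \<open>P\<close> by a combination of basis monomials. That combination vanishes on
  the fibre over \<open>a\<close>, and independence there makes it zero.\<close>

lemma extend:
 assumes P: "P \<in> forms k d" and v: "!!xi. P (pt k a (ph a xi)) = 0"
 obtains P' where "P' \<in> forms k d" "vanishing P'" "!!y. P' (pt k a y) = P (pt k a y)"
proof -
 obtain c where c: "P = (%x. \<Sum>is\<in>words k d. poly (c is) (x 0) * wmon is (tail x))" using P unfolding forms_def by blast
 have "EX ga. ALL t xi. wmon is (ph t xi) = (\<Sum>js\<in>B d. ga js * t ^ (wt js - wt is) * wmon js (ph t xi))"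
  if w: "is \<in> words k d" for "is"
 proof (rule relations[OF w])
  fix ga assume *: "!!t xi. wmon is (ph t xi) = (\<Sum>js\<in>B d. ga js * t ^ (wt js - wt is) * wmon js (ph t xi))"
  show ?thesis by (intro exI[of _ ga] allI *)
 qed
 hence "ALL is. EX ga. is \<in> words k d -->
   (ALL t xi. wmon is (ph t xi) = (\<Sum>js\<in>B d. ga js * t ^ (wt js - wt is) * wmon js (ph t xi)))" by blast
 from choice[OF this] obtain ga where "ALL is. is \<in> words k d -->
   (ALL t xi. wmon is (ph t xi) = (\<Sum>js\<in>B d. ga is js * t ^ (wt js - wt is) * wmon js (ph t xi)))" ..
 note ga = this[rule_format]
 define G where "G is x = wmon is (tail x) +
  (\<Sum>js\<in>B d. poly (monom (- ga is js) (wt js - wt is)) (x 0) * wmon js (tail x))" for "is" and x :: "nat => complex"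
 \<comment> \<open>The coefficients of \<open>P\<close> are frozen at \<open>a\<close>, since
   agreement is wanted only over \<open>a\<close>; the dependence on the parameter sits in the
   relations.\<close>
 define P' where "P' x = (\<Sum>is\<in>words k d. poly (c is) a * G is x)" for x
 have G: "G is \<in> forms k d" if "is \<in> words k d" for "is"
  unfolding G_def[abs_def] by (intro forms_add forms_mon that forms_sum forms_scale_poly) (use B_words in auto)
 have pm: "wmon js (%i. pt k t y (Suc i)) = wmon js y" if "js \<in> words k d" for js t y by (rule wmon_cong[OF that]) simp
 have Gv: "G is (pt k t (ph t xi)) = 0" if "is \<in> words k d" for "is" t xi
 proof -
  have "(\<Sum>js\<in>B d. poly (monom (- ga is js) (wt js - wt is)) t * wmon js (%i. pt k t (ph t xi) (Suc i))) =
   - (\<Sum>js\<in>B d. ga is js * t ^ (wt js - wt is) * wmon js (ph t xi))"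
   unfolding sum_negf[symmetric] by (rule sum.cong[OF refl]) (use pm[OF B_wordsD] in \<open>auto simp: poly_monom\<close>)
  thus ?thesis using ga[OF that, of t xi] pm[OF that] by (simp add: G_def)
 qed
 have P': "P' \<in> forms k d" unfolding P'_def[abs_def] by (intro forms_sum forms_scale G) auto
 have P'v: "vanishing P'" by (rule forms_vanishing[OF P']) (simp add: P'_def Gv)
 define dl where "dl js = (\<Sum>is\<in>words k d. poly (c is) a * (- ga is js * a ^ (wt js - wt is)))" for js
 have eq: "P' (pt k a y) = P (pt k a y) + (\<Sum>js\<in>B d. dl js * wmon js y)" for y
 proof -
  have "P' (pt k a y) = (\<Sum>is\<in>words k d. poly (c is) a * wmon is y +
    (\<Sum>js\<in>B d. poly (c is) a * (- ga is js * a ^ (wt js - wt is)) * wmon js y))" unfolding P'_def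
  proof (rule sum.cong[OF refl])
   fix "is" assume i: "is \<in> words k d"
   have "(\<Sum>js\<in>B d. poly (monom (- ga is js) (wt js - wt is)) a * wmon js (%i. pt k a y (Suc i))) =
    (\<Sum>js\<in>B d. - ga is js * a ^ (wt js - wt is) * wmon js y)"
    by (rule sum.cong[OF refl]) (use pm[OF B_wordsD] in \<open>auto simp: poly_monom\<close>)
   thus "poly (c is) a * G is (pt k a y) = poly (c is) a * wmon is y +
    (\<Sum>js\<in>B d. poly (c is) a * (- ga is js * a ^ (wt js - wt is)) * wmon js y)"
    using pm[OF i] by (simp add: G_def distrib_left sum_distrib_left mult.assoc)
  qed
  also have "\<dots> = (\<Sum>is\<in>words k d. poly (c is) a * wmon is y) +
    (\<Sum>is\<in>words k d. \<Sum>js\<in>B d. poly (c is) a * (- ga is js * a ^ (wt js - wt is)) * wmon js y)" by (simp add: sum.distrib)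
  also have "(\<Sum>is\<in>words k d. poly (c is) a * wmon is y) = P (pt k a y)" unfolding c using pm by simp
  also have "(\<Sum>is\<in>words k d. \<Sum>js\<in>B d. poly (c is) a * (- ga is js * a ^ (wt js - wt is)) * wmon js y) =
   (\<Sum>js\<in>B d. dl js * wmon js y)" unfolding dl_def sum_distrib_right by (rule sum.swap)
  finally show ?thesis .
 qed
 have "dl js = 0" if "js \<in> B d" for js
 proof (rule indep[where d = d and c = dl and a = a, OF _ that])
  fix xi
  have "P' (pt k a (ph a xi)) = 0" by (simp add: P'_def Gv)
  thus "(\<Sum>js\<in>B d. dl js * wmon js (ph a xi)) = 0" using eq[of "ph a xi"] v[of xi] by simp
 qed
 hence "P' (pt k a y) = P (pt k a y)" for y using eq[of y] by simp
 thus ?thesis using that P' P'v by blast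
qed

end

lemma power_sum_eq_0:
 fixes c :: "nat => complex"
 assumes "!!l. (\<Sum>d<D. l ^ d * c d) = 0" "d < D"
 shows "c d = 0"
proof -
 let ?p = "\<Sum>d<D. monom (c d) d"
 have "poly ?p l = 0" for l using assms(1)[of l] by (simp add: poly_sum poly_monom mult.commute)
 hence "?p = 0" using poly_all_0_iff_0 by blast
 hence "coeff ?p d = 0" by simp
 moreover have "coeff ?p d = (\<Sum>e<D. if e = d then c e else 0)" by (simp add: coeff_sum)
 ultimately show ?thesis using assms(2) by simp
qed

lemma forms_act: "p \<in> forms k d ==> (%x. p (pt k (a * x 0) (%i. b i * x (Suc i)))) \<in> forms k d"
proof -
 assume "p \<in> forms k d"
 then obtain c where c: "p = (%x. \<Sum>js\<in>words k d. poly (c js) (x 0) * wmon js (tail x))" unfolding forms_def by blast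
 have "(%x. p (pt k (a * x 0) (%i. b i * x (Suc i)))) =
   (%x. \<Sum>js\<in>words k d. poly ([:wmon js b:] * (c js \<circ>\<^sub>p [:0, a:])) (x 0) * wmon js (tail x))" unfolding c
 proof (intro ext sum.cong refl)
  fix x js assume js: "js \<in> words k d"
  have "wmon js (%i. pt k (a * x 0) (%i. b i * x (Suc i)) (Suc i)) = wmon js (%i. b i * x (Suc i))" by (rule wmon_cong[OF js]) simp
  thus "poly (c js) (pt k (a * x 0) (%i. b i * x (Suc i)) 0) * wmon js (%i. pt k (a * x 0) (%i. b i * x (Suc i)) (Suc i)) =
   poly ([:wmon js b:] * (c js \<circ>\<^sub>p [:0, a:])) (x 0) * wmon js (tail x)" by (simp add: wmon_mult poly_pcompose mult.commute)
 qed
 thus ?thesis using formsI[where c = "%js. [:wmon js b:] * (c js \<circ>\<^sub>p [:0, a:])"] by simp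
qed

context family
begin

lemma closedin_cone: "closedin (zar (affine_space_on (coord_space (Suc k)) (cspace k))) cone"
 unfolding cone_def by (rule closedin_affine_zeros) (auto intro: forms_poly_funs)

lemma cone_carrier: "x \<in> cone ==> x \<in> cspace k" by (simp add: cone_def)

lemma coneI: "x \<in> cspace k ==> (!!d P. P \<in> forms k d ==> vanishing P ==> P x = 0) ==> x \<in> cone" by (auto simp: cone_def)

lemma coneD: "x \<in> cone ==> P \<in> forms k d ==> vanishing P ==> P x = 0" by (auto simp: cone_def)

lemma family_in_cone: "pt k t (%i. l * ph t xi i) \<in> cone" by (rule coneI) (auto simp: vanishing_def)

lemma homogeneous_components_vanish:
 assumes F: "!!d. F d \<in> forms k d" and "!!l. (\<Sum>d<D. F d (pt k t (%i. l * y i))) = 0" and "d < D"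
 shows "F d (pt k t y) = 0" by (rule power_sum_eq_0[where c = "%d. F d (pt k t y)" and D = D])
  (use assms in \<open>simp_all add: forms_homogeneous[OF F]\<close>)

text \<open>The cone is cut out by homogeneous equations, but loses nothing: the family is stable
  under scaling, so the homogeneous components of an equation vanish on it separately.\<close>

lemma poly_vanish_cone:
 assumes P: "P \<in> cpolys k" and v: "vanishing P" and x: "x \<in> cone"
 shows "P x = 0"
proof -
 obtain D F where F: "!!d. F d \<in> forms k d" "!!x. x \<in> cspace k ==> P x = (\<Sum>d<D. F d x)" using poly_funs_decompose[OF P] by blast
 have "vanishing (F d)" if "d < D" for d
 proof (rule forms_vanishing[OF F(1)], rule homogeneous_components_vanish[OF F(1) _ that])
  fix t xi l
  show "(\<Sum>d<D. F d (pt k t (%i. l * ph t xi i))) = 0" using v F(2)[of "pt k t (%i. l * ph t xi i)"] by (simp add: vanishing_def)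
 qed
 thus ?thesis using F(2)[OF cone_carrier[OF x]] coneD[OF x F(1)] by simp
qed

lemma polyfun_family:
 "P \<in> cpolys k ==> polyfun (%t. P (pt k (b * t) (%i. c i * ph t xi i)))"
proof (rule poly_funs_polyfun[where y = "%t. pt k (b * t) (%i. c i * ph t xi i)" and n = "Suc k"])
 fix i assume "i < Suc k"
 thus "polyfun (%t. pt k (b * t) (%i. c i * ph t xi i) i)" by (cases i) (auto intro!: polyfun_mult poly_t)
qed auto

text \<open>Along a fixed parameter \<open>xi\<close> and scalar \<open>l\<close> a polynomial
  restricts to a polynomial in \<open>t\<close>, so finitely many exceptional values of
  \<open>t\<close> do not matter. This is the density needed for flatness.\<close>

lemma dense_cone:
 assumes h: "h \<in> cpolys k" and A: "finite A"
  and z: "!!t l xi. t \<notin> A ==> h (pt k t (%i. l * ph t xi i)) = 0" and x: "x \<in> cone"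
 shows "h x = 0"
proof (rule poly_vanish_cone[OF h _ x])
 show "vanishing h" unfolding vanishing_def
 proof (intro allI)
  fix t l xi
  show "h (pt k t (%i. l * ph t xi i)) = 0" by (rule polyfun_eq_0[where f = "%t. h (pt k t (%i. l * ph t xi i))" and A = A])
    (use polyfun_family[OF h, of 1 "%_. l"] A z in auto)
 qed
qed

lemma cone_scale:
 assumes x: "x \<in> cone"
 shows "pt k (x 0) (%i. c * x (Suc i)) \<in> cone"
proof (rule coneI)
 fix d P assume P: "P \<in> forms k d" "vanishing P"
 show "P (pt k (x 0) (%i. c * x (Suc i))) = 0" using coneD[OF x P] by (simp add: forms_homogeneous[OF P(1)] pt_eqI[OF cone_carrier[OF x]])
qed simp

text \<open>The base coordinate is divided by \<open>t\<close> because
  \<open>t ^ w i * ph s xi i\<close> belongs to the fibre over \<open>s / t\<close>: the rescalings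
  of the fibres over \<open>s\<close> and \<open>s / t\<close> by their own weights meet in the
  fibre over 1.\<close>

definition act :: "complex => (nat => complex) => nat => complex" where
 "act t x = pt k (inverse t * x 0) (%i. t ^ w i * x (Suc i))"

lemma cone_act:
 assumes t: "t ~= 0" and x: "x \<in> cone"
 shows "act t x \<in> cone"
proof (rule coneI)
 fix d P assume P: "P \<in> forms k d" "vanishing P"
 let ?Q = "%x. P (pt k (inverse t * x 0) (%i. t ^ w i * x (Suc i)))"
 have Q: "?Q \<in> forms k d" by (rule forms_act[OF P(1)])
 have q: "?Q (pt k s (ph s xi)) = P (pt k (inverse t * s) (%i. t ^ w i * ph s xi i))" for s xi
 proof -
  have "pt k (inverse t * s) (%i. t ^ w i * pt k s (ph s xi) (Suc i)) = pt k (inverse t * s) (%i. t ^ w i * ph s xi i)" by (rule pt_cong) simp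
  thus ?thesis by simp
 qed
 have "vanishing ?Q"
 proof (rule forms_vanishing[OF Q])
  fix s xi
  have "P (pt k (inverse t * s) (%i. t ^ w i * ph s xi i)) = 0"
  \<comment> \<open>Over \<open>s = 0\<close> no comparison with the fibre over 1 is available; the
    value there follows by polynomial continuation in \<open>s\<close>.\<close>
  proof (rule polyfun_eq_0[where f = "%s. P (pt k (inverse t * s) (%i. t ^ w i * ph s xi i))" and A = "{0}"])
   show "polyfun (%s. P (pt k (inverse t * s) (%i. t ^ w i * ph s xi i)))" by (rule polyfun_family[OF forms_poly_funs[OF P(1)]])
   fix s :: complex assume "s \<notin> {0}"
   hence s: "s ~= 0" by simp
   obtain xi1 where 1: "!!i. i < k ==> ph 1 xi1 i = s ^ w i * ph s xi i" using equi[OF s] by blast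
   have st: "inverse t * s ~= 0" using s t by simp
   obtain xi2 where 2: "!!i. i < k ==> (inverse t * s) ^ w i * ph (inverse t * s) xi2 i = ph 1 xi1 i" using equi'[OF st] by blast
   have "t ^ w i * ph s xi i = ph (inverse t * s) xi2 i" if "i < k" for i
    using 1[OF that] 2[OF that] s t by (simp add: power_mult_distrib power_inverse field_simps)
   hence "pt k (inverse t * s) (%i. t ^ w i * ph s xi i) = pt k (inverse t * s) (%i. 1 * ph (inverse t * s) xi2 i)" by (intro pt_cong) simp
   thus "P (pt k (inverse t * s) (%i. t ^ w i * ph s xi i)) = 0" using P(2) unfolding vanishing_def by metis
  qed auto
  thus "?Q (pt k s (ph s xi)) = 0" using q by simp
 qed
 thus "P (act t x) = 0" using coneD[OF x Q] by (simp add: act_def)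
qed (simp add: act_def)

text \<open>Subtracting the form supplied by \<open>extend\<close> does not change \<open>P\<close>
  on the cone, and afterwards \<open>P\<close> vanishes on the whole slice over \<open>a\<close>,
  not only on the fibre. Division of the coefficients by \<open>t - a\<close> then leaves no
  remainder.\<close>

lemma divide_forms:
 assumes P: "P \<in> forms k d" and v: "!!xi. P (pt k a (ph a xi)) = 0"
 shows "EX Q:forms k d. ALL x:cone. P x = (x 0 - a) * Q x"
proof -
 obtain P' where P': "P' \<in> forms k d" "vanishing P'" "!!y. P' (pt k a y) = P (pt k a y)" using extend[OF P v] by metis
 have "(%x. P x + (-1) * P' x) \<in> forms k d" by (intro forms_add forms_scale P P')
 then obtain c where c: "(%x. P x + (-1) * P' x) = (%x. \<Sum>js\<in>words k d. poly (c js) (x 0) * wmon js (tail x))" unfolding forms_def by blast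
 let ?q = "%js. (c js - [:poly (c js) a:]) div [:- a, 1:]"
 have q: "c js = [:poly (c js) a:] + [:- a, 1:] * ?q js" for js
 proof -
  have "poly (c js - [:poly (c js) a:]) a = 0" by simp
  hence "[:- a, 1:] dvd c js - [:poly (c js) a:]" using poly_eq_0_iff_dvd by blast
  hence "[:- a, 1:] * ?q js = c js - [:poly (c js) a:]" by (rule dvd_mult_div_cancel)
  thus ?thesis by simp
 qed
 have pc: "poly (c js) s = poly (c js) a + (s - a) * poly (?q js) s" for js s
 proof -
  have "poly (c js) s = poly ([:poly (c js) a:] + [:- a, 1:] * ?q js) s" by (rule arg_cong[OF q])
  thus ?thesis by (simp add: algebra_simps)
 qed
 let ?Q = "%x. \<Sum>js\<in>words k d. poly (?q js) (x 0) * wmon js (tail x)"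
 have "P x = (x 0 - a) * ?Q x" if x: "x \<in> cone" for x
 proof -
  \<comment> \<open>Different words may give the same monomial, so the remainders
    \<open>poly (c js) a\<close> need not vanish one by one; only their total contribution
    does.\<close>
  have z: "(\<Sum>js\<in>words k d. poly (c js) a * wmon js (tail x)) = 0"
  proof -
   have "(\<Sum>js\<in>words k d. poly (c js) a * wmon js (tail x)) =
    (\<Sum>js\<in>words k d. poly (c js) (pt k a (tail x) 0) * wmon js (%i. pt k a (tail x) (Suc i)))"
   proof (rule sum.cong[OF refl])
    fix js assume "js \<in> words k d"
    hence "wmon js (%i. pt k a (tail x) (Suc i)) = wmon js (tail x)" by (rule wmon_cong) simp
    thus "poly (c js) a * wmon js (tail x) =
     poly (c js) (pt k a (tail x) 0) * wmon js (%i. pt k a (tail x) (Suc i))" by simp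
   qed
   also have "\<dots> = 0" using fun_cong[OF c, of "pt k a (tail x)"] P'(3) by simp
   finally show ?thesis .
  qed
  have "P x = (\<Sum>js\<in>words k d. poly (c js) (x 0) * wmon js (tail x))" using fun_cong[OF c, of x] coneD[OF x P'(1,2)] by simp
  also have "\<dots> = (\<Sum>js\<in>words k d. poly (c js) a * wmon js (tail x) +
    (x 0 - a) * (poly (?q js) (x 0) * wmon js (tail x)))" by (rule sum.cong[OF refl]) (subst pc, simp add: distrib_right mult.assoc)
  also have "\<dots> = (x 0 - a) * ?Q x" by (simp only: sum.distrib z sum_distrib_left add_0_left)
  finally show ?thesis .
 qed
 thus ?thesis by (intro bexI[OF _ formsI[where c = ?q and k = k and d = d]] ballI)
qed

lemma divide_poly:
 assumes P: "P \<in> cpolys k" and v: "!!l xi. P (pt k a (%i. l * ph a xi i)) = 0"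
 shows "EX Q:cpolys k. ALL x:cone. P x = (x 0 - a) * Q x"
proof -
 obtain D F where F: "!!d. F d \<in> forms k d" "!!x. x \<in> cspace k ==> P x = (\<Sum>d<D. F d x)" using poly_funs_decompose[OF P] by blast
 have "EX Q:forms k d. ALL x:cone. F d x = (x 0 - a) * Q x" if "d < D" for d
 proof (rule divide_forms[OF F(1)], rule homogeneous_components_vanish[OF F(1) _ that])
  fix xi l
  show "(\<Sum>d<D. F d (pt k a (%i. l * ph a xi i))) = 0" using v F(2)[of "pt k a (%i. l * ph a xi i)"] by simp
 qed
 then obtain Q where Q: "!!d. d < D ==> Q d \<in> forms k d" "!!d x. d < D ==> x \<in> cone ==> F d x = (x 0 - a) * Q d x" by metis
 have "P x = (x 0 - a) * (\<Sum>d<D. Q d x)" if "x \<in> cone" for x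
  using F(2)[OF cone_carrier[OF that]] Q(2)[OF _ that] by (simp add: sum_distrib_left)
 moreover have "(%x. \<Sum>d<D. Q d x) \<in> cpolys k" by (rule poly_funs_sum) (auto intro: forms_poly_funs Q)
 ultimately show ?thesis by (intro bexI[of _ "%x. \<Sum>d<D. Q d x"] ballI)
qed

text \<open>The separation of variables that regularity of the action on the product demands:
  Laurent monomials in \<open>t\<close> times functions on the cone.\<close>

definition act_expandable :: "((nat => complex) => complex) set => ((nat => complex) => complex) => bool" where
 "act_expandable \<H> P \<longleftrightarrow> (\<exists>(n::nat) e e' g. (ALL i<n. g i \<in> \<H>) &
  (ALL t x. t ~= 0 --> x \<in> cone --> P (act t x) = (\<Sum>i<n. (t ^ e i * inverse t ^ e' i) * g i x)))"

lemma act_expandable_add: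
 assumes "act_expandable \<H> P" "act_expandable \<H> Q"
 shows "act_expandable \<H> (%x. P x + Q x)"
proof -
 obtain n :: nat and e e' g where P: "!!i. i < n ==> g i \<in> \<H>"
  "!!t x. t ~= 0 ==> x \<in> cone ==> P (act t x) = (\<Sum>i<n. (t ^ e i * inverse t ^ e' i) * g i x)"
  using assms(1) unfolding act_expandable_def by blast
 obtain m :: nat and r r' h where Q: "!!i. i < m ==> h i \<in> \<H>"
  "!!t x. t ~= 0 ==> x \<in> cone ==> Q (act t x) = (\<Sum>i<m. (t ^ r i * inverse t ^ r' i) * h i x)"
  using assms(2) unfolding act_expandable_def by blast
 let ?e = "%i. if i < n then e i else r (i - n)" and ?e' = "%i. if i < n then e' i else r' (i - n)"
  and ?g = "%i. if i < n then g i else h (i - n)"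
 have split: "(\<Sum>i<n + m. f i) = (\<Sum>i<n. f i) + (\<Sum>i<m. f (n + i))" for f :: "nat => complex" by (induction m) (auto simp: add.assoc)
 show ?thesis unfolding act_expandable_def
 proof (rule exI[of _ "n + m"], rule exI[of _ ?e], rule exI[of _ ?e'], rule exI[of _ ?g], intro conjI allI impI)
  fix t :: complex and x assume t: "t ~= 0" and x: "x \<in> cone"
  show "P (act t x) + Q (act t x) = (\<Sum>i<n + m. (t ^ ?e i * inverse t ^ ?e' i) * ?g i x)"
   using P(2)[OF t x] Q(2)[OF t x] unfolding split by simp
 qed (use P(1) Q(1) in auto)
qed

lemma act_expandable_sum:
 assumes "finite I" "!!i. i \<in> I ==> act_expandable \<H> (P i)"
 shows "act_expandable \<H> (%x. \<Sum>i\<in>I. P i x)" using assms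
proof (induction I rule: finite_induct)
 case empty
 show ?case unfolding act_expandable_def by (rule exI[of _ 0]) auto
qed (auto intro: act_expandable_add)

lemma act_expandable_mono: "act_expandable \<H> P ==> \<H> \<subseteq> \<H>' ==> act_expandable \<H>' P" unfolding act_expandable_def by blast

lemma act_expandable_forms:
 assumes "P \<in> forms k d"
 shows "act_expandable (forms k d) P"
proof -
 obtain c where c: "P = (%x. \<Sum>js\<in>words k d. poly (c js) (x 0) * wmon js (tail x))" using assms unfolding forms_def by blast
 have "act_expandable (forms k d) (%x. poly (c js) (x 0) * wmon js (tail x))" if js: "js \<in> words k d" for js
 proof -
  have step: "poly (c js) (act t x 0) * wmon js (%i. act t x (Suc i)) = (\<Sum>i<Suc (degree (c js)). (t ^ wt js * inverse t ^ i) * (poly (monom (coeff (c js) i) i) (x 0) * wmon js (tail x)))" for t x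
  proof -
   have "wmon js (%i. act t x (Suc i)) = wmon js (%i. t ^ w i * x (Suc i))" by (rule wmon_cong[OF js]) (simp add: act_def)
   hence "poly (c js) (act t x 0) * wmon js (%i. act t x (Suc i)) = poly (c js) (inverse t * x 0) * (t ^ wt js * wmon js (tail x))"
    by (simp add: wmon_wt act_def)
   also have "\<dots> = (\<Sum>i\<le>degree (c js). coeff (c js) i * (inverse t * x 0) ^ i) * (t ^ wt js * wmon js (tail x))"
    by (simp only: poly_altdef)
   also have "\<dots> = (\<Sum>i<Suc (degree (c js)). (t ^ wt js * inverse t ^ i) * (poly (monom (coeff (c js) i) i) (x 0) * wmon js (tail x)))"
    unfolding sum_distrib_right lessThan_Suc_atMost by (rule sum.cong[OF refl]) (simp only: poly_monom power_mult_distrib ac_simps)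
   finally show ?thesis .
  qed
  show ?thesis unfolding act_expandable_def by (rule exI[of _ "Suc (degree (c js))"], rule exI[of _ "%_. wt js"], rule exI[of _ "%i. i"],
    rule exI[of _ "%i x. poly (monom (coeff (c js) i) i) (x 0) * wmon js (tail x)"],
    intro conjI allI impI step forms_scale_poly forms_mon js)
 qed
 thus ?thesis unfolding c by (intro act_expandable_sum) auto
qed

lemma act_expandable_poly:
 assumes "P \<in> cpolys k"
 shows "act_expandable (cpolys k) P"
proof -
 obtain D F where F: "!!d. F d \<in> forms k d" "!!x. x \<in> cspace k ==> P x = (\<Sum>d<D. F d x)" using poly_funs_decompose[OF assms] by blast
 have "act_expandable (cpolys k) (F d)" for d by (rule act_expandable_mono[OF act_expandable_forms[OF F(1)]]) (auto intro: forms_poly_funs)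
 hence "act_expandable (cpolys k) (%x. \<Sum>d<D. F d x)" by (intro act_expandable_sum) auto
 moreover have "P (act t x) = (\<Sum>d<D. F d (act t x))" for t x by (rule F(2)) (simp add: act_def)
 ultimately show ?thesis unfolding act_expandable_def by simp
qed

end

section \<open>Total spaces\<close>

text \<open>
 The total space consists of the singletons of the normal forms \<open>nu x\<close> of the points \<open>x \<in> D\<close>, where
 \<open>nu\<close> is the identity in the affine case and scales to one the first nonzero coordinate in the
 projective case.
\<close>

locale total = family k ph w B
 for k :: nat and ph :: "complex => 'x => nat => complex" and w B +
 fixes HH :: "nat => ((nat => complex) => complex) set" and D :: "(nat => complex) set"
  and nu :: "(nat => complex) => nat => complex" and uu :: "(nat => complex) => complex"
 assumes HH: "gfun HH" and param: "(%x. x 0) \<in> HH 0"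
  and D_cone: "D \<subseteq> cone"
  and D_act: "t ~= 0 ==> x \<in> D ==> act t x \<in> D"
  and nu_D: "x \<in> D ==> nu x \<in> D" and nu_nu: "x \<in> D ==> nu (nu x) = nu x"
  and nu_0: "nu x 0 = x 0"
  and uu: "x \<in> D ==> uu x ~= 0"
  and HH_nu: "F \<in> HH d ==> x \<in> D ==> F (nu x) = uu x ^ d * F x"
  and nu_act: "t ~= 0 ==> x \<in> D ==> nu (act t (nu x)) = nu (act t x)"
  and dense: "F \<in> HH d ==> finite A ==> (!!x. x \<in> D ==> x 0 \<notin> A ==> F x = 0) ==> x \<in> D ==> F x = 0"
  and expand: "F \<in> HH d ==> act_expandable (HH d) F"
begin

definition \<H> :: "nat => ((nat => complex) set => complex) set" where
 "\<H> d = (%F z. F (the_elem z)) ` HH d"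

definition \<Z> :: "(nat => complex) set set" where
 "\<Z> = (%x. {nu x}) ` D"

definition pr :: "(nat => complex) set => complex" where
 "pr z = the_elem z 0"

definition sg :: "complex => (nat => complex) set => (nat => complex) set" where
 "sg t z = {nu (act t (the_elem z))}"

sublocale HH: gfun HH UNIV by (rule HH)

sublocale T: gfun \<H> \<Z>
proof
 show "(%_. 1) \<in> \<H> 0" unfolding \<H>_def using HH.one by (auto intro!: image_eqI[of _ _ "%_. 1"])
 fix d e p q c assume p: "p \<in> \<H> d"
 then obtain P where P: "P \<in> HH d" "p = (%z. P (the_elem z))" by (auto simp: \<H>_def)
 show "(%z. c * p z) \<in> \<H> d" unfolding \<H>_def P(2) by (rule image_eqI[OF _ HH.scale[OF P(1)]]) auto
 show "(%z. p z + q z) \<in> \<H> d" if "q \<in> \<H> d"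
 proof -
  from that obtain Q where Q: "Q \<in> HH d" "q = (%z. Q (the_elem z))" by (auto simp: \<H>_def)
  show ?thesis unfolding \<H>_def P(2) Q(2) by (rule image_eqI[OF _ HH.add[OF P(1) Q(1)]]) auto
 qed
 show "(%z. p z * q z) \<in> \<H> (d + e)" if "q \<in> \<H> e"
 proof -
  from that obtain Q where Q: "Q \<in> HH e" "q = (%z. Q (the_elem z))" by (auto simp: \<H>_def)
  show ?thesis unfolding \<H>_def P(2) Q(2) by (rule image_eqI[OF _ HH.mult[OF P(1) Q(1)]]) auto
 qed
qed

lemma \<Z>E:
 assumes "z \<in> \<Z>" obtains x where "x \<in> D" "z = {x}" "nu x = x" "the_elem z = x" using assms nu_D nu_nu by (auto simp: \<Z>_def)

lemma \<Z>I: "x \<in> D ==> {nu x} \<in> \<Z>" by (auto simp: \<Z>_def)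

lemma pr_regular: "pr \<in> regular (gspace \<H> \<Z>) \<Z>"
proof -
 have "pr \<in> \<H> 0" unfolding \<H>_def pr_def[abs_def] by (rule image_eqI[OF _ param]) auto
 hence "(%z. pr z / 1) \<in> regular (gspace \<H> \<Z>) \<Z>"
  by (rule T.regular_quotient[OF _ T.one]) (use openin_topspace[of "gtop \<H> \<Z>"] in auto)
 thus ?thesis by simp
qed

lemma flat: "flat_morphism (gspace \<H> \<Z>) A1 pr"
proof (rule T.flat_over_A1[OF T.morphism_A1[OF pr_regular]])
 fix h d A z assume h: "h \<in> \<H> d" and A: "finite A" and *: "!!z. z \<in> \<Z> ==> pr z \<notin> A ==> h z = 0" and z: "z \<in> \<Z>"
 obtain F where F: "F \<in> HH d" "h = (%z. F (the_elem z))" using h by (auto simp: \<H>_def)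
 have "F x = 0" if "x \<in> D" for x
 proof (rule dense[OF F(1) A _ that])
  fix x assume x: "x \<in> D" "x 0 \<notin> A"
  have "F (nu x) = 0" using *[OF \<Z>I[OF x(1)]] x F by (simp add: pr_def nu_0)
  thus "F x = 0" using HH_nu[OF F(1) x(1)] uu[OF x(1)] by simp
 qed
 thus "h z = 0" using z F by (auto elim!: \<Z>E)
qed

lemma equivariant: "equivariant_Gm_action (gspace \<H> \<Z>) pr sg"
proof (rule T.equivariant_Gm_actionI[where u = "%t z. uu (act t (the_elem z))"])
 fix t z assume t: "(t::complex) ~= 0" and z: "z \<in> \<Z>"
 then obtain x where x: "x \<in> D" "z = {x}" "nu x = x" by (auto elim: \<Z>E)
 show "sg t z \<in> \<Z>" using D_act[OF t x(1)] x(2) by (simp add: sg_def \<Z>I)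
 show "pr (sg t z) = inverse t * pr z" using x(2) by (simp add: pr_def sg_def nu_0 act_def)
 show "uu (act t (the_elem z)) ~= 0" using D_act[OF t x(1)] x(2) uu by simp
next
 fix z assume "z \<in> \<Z>"
 then obtain x where x: "x \<in> D" "z = {x}" "nu x = x" by (auto elim: \<Z>E)
 have "act 1 x = x" using pt_eqI[of x k] cone_carrier D_cone x(1) by (auto simp: act_def)
 thus "sg 1 z = z" using x by (simp add: sg_def)
next
 fix s t z assume s: "(s::complex) ~= 0" and t: "(t::complex) ~= 0" and "z \<in> \<Z>"
 then obtain x where x: "x \<in> D" "z = {x}" by (auto elim: \<Z>E)
 have "act (s * t) x = act s (act t x)"
 proof -
  have "inverse (s * t) * x 0 = inverse s * (inverse t * x 0)" by simp
  thus ?thesis unfolding act_def pt_simps(1) by (simp only:) (rule pt_cong, simp add: power_mult_distrib)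
 qed
 thus "sg (s * t) z = sg s (sg t z)" using nu_act[OF s D_act[OF t x(1)]] x by (simp add: sg_def)
next
 fix d h assume "h \<in> \<H> d"
 then obtain F where F: "F \<in> HH d" "h = (%z. F (the_elem z))" by (auto simp: \<H>_def)
 obtain n :: nat and e e' g where E: "!!i. i < n ==> g i \<in> HH d"
  "!!t x. t ~= 0 ==> x \<in> cone ==> F (act t x) = (\<Sum>i<n. (t ^ e i * inverse t ^ e' i) * g i x)"
  using expand[OF F(1)] unfolding act_expandable_def by blast
 show "\<exists>(n::nat) a g. (ALL i<n. a i \<in> regular Gm (UNIV - {0}) & g i \<in> \<H> d) &
   (ALL t z. t ~= 0 --> z \<in> \<Z> --> h (sg t z) = uu (act t (the_elem z)) ^ d * (\<Sum>i<n. a i t * g i z))"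
 proof (rule exI[of _ n], rule exI[of _ "%i t. t ^ e i * inverse t ^ e' i"], rule exI[of _ "%i z. g i (the_elem z)"],
   intro conjI allI impI)
  fix i assume "i < n"
  thus "(%z. g i (the_elem z)) \<in> \<H> d" unfolding \<H>_def by (intro image_eqI[OF _ E(1)]) auto
  show "(%t. t ^ e i * inverse t ^ e' i) \<in> regular Gm (UNIV - {0})" by (rule Gm_monomial)
 next
  fix t z assume t: "(t::complex) ~= 0" and "z \<in> \<Z>"
  then obtain x where x: "x \<in> D" "z = {x}" by (auto elim: \<Z>E)
  show "h (sg t z) = uu (act t (the_elem z)) ^ d * (\<Sum>i<n. (t ^ e i * inverse t ^ e' i) * g i (the_elem z))"
   using HH_nu[OF F(1) D_act[OF t x(1)]] E(2)[OF t, of x] x D_cone F(2) by (auto simp: sg_def)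
 qed
qed

text \<open>The map \<open>\<rho>\<close> selects a vector over each point of the candidate fibre;
  points are compared after passing to normal forms. What remains to be checked concerns only
  functions on \<open>D\<close>, with \<open>divide\<close> coming from the division by
  \<open>x 0 - a\<close> on the cone.\<close>

lemma fibre:
 assumes H: "gfun H"
  and \<rho>_D: "!!z. z \<in> Z ==> \<rho> z \<in> D" "!!z. z \<in> Z ==> \<rho> z 0 = a"
  and surj: "!!x. x \<in> D ==> x 0 = a ==> EX z:Z. nu (\<rho> z) = nu x"
  and inj: "!!z z'. z \<in> Z ==> z' \<in> Z ==> nu (\<rho> z) = nu (\<rho> z') ==> z = z'"
  and pull: "!!d F. F \<in> HH d ==> EX h:H d. ALL z:Z. h z = F (\<rho> z)"
  and lift: "!!d h. h \<in> H d ==> EX F:HH d. ALL z:Z. h z = F (\<rho> z)"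
  and divide: "!!d F. F \<in> HH d ==> (!!z. z \<in> Z ==> F (\<rho> z) = 0) ==> EX G:HH d. ALL x:D. F x = (x 0 - a) * G x"
 shows "isomorphic_to_fibre (gspace H Z) (gspace \<H> \<Z>) pr a"
proof -
 interpret H: gfun H Z by (rule H)
 interpret gfun_fibre H Z \<H> \<Z> "%z. {nu (\<rho> z)}" "%z. uu (\<rho> z)" pr a
 proof
  show "pr \<in> regular (gspace \<H> \<Z>) \<Z>" by (rule pr_regular)
  show "(%z. {nu (\<rho> z)}) ` Z = {y \<in> \<Z>. pr y = a}"
  proof (intro equalityI subsetI)
   fix y assume "y \<in> (%z. {nu (\<rho> z)}) ` Z"
   thus "y \<in> {y \<in> \<Z>. pr y = a}" using \<rho>_D by (auto simp: pr_def nu_0 intro: \<Z>I)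
  next
   fix y assume "y \<in> {y \<in> \<Z>. pr y = a}"
   then obtain x where x: "x \<in> D" "y = {x}" "nu x = x" "x 0 = a" by (auto simp: pr_def elim: \<Z>E)
   thus "y \<in> (%z. {nu (\<rho> z)}) ` Z" using surj[OF x(1,4)] by auto
  qed
  show "inj_on (%z. {nu (\<rho> z)}) Z" using inj by (auto simp: inj_on_def)
  show "uu (\<rho> z) ~= 0" if "z \<in> Z" for z using uu \<rho>_D that by auto
 next
  fix h' d assume "h' \<in> \<H> d"
  then obtain F where F: "F \<in> HH d" "h' = (%z. F (the_elem z))" by (auto simp: \<H>_def)
  from pull[OF F(1)] obtain h where h: "h \<in> H d" "!!z. z \<in> Z ==> h z = F (\<rho> z)" by blast
  thus "EX h:H d. ALL z:Z. h' {nu (\<rho> z)} = uu (\<rho> z) ^ d * h z" using HH_nu[OF F(1) \<rho>_D(1)] F(2) by (intro bexI[OF _ h(1)]) auto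
  show "EX h'':\<H> d. ALL y:\<Z>. h' y = (pr y - a) * h'' y" if z: "!!z. z \<in> Z ==> h' {nu (\<rho> z)} = 0"
  proof -
   have "F (\<rho> z) = 0" if "z \<in> Z" for z using z[OF that] HH_nu[OF F(1) \<rho>_D(1)[OF that]] uu[OF \<rho>_D(1)[OF that]] F(2) by auto
   from divide[OF F(1) this] obtain G where "G \<in> HH d" "!!x. x \<in> D ==> F x = (x 0 - a) * G x" by blast
   thus ?thesis unfolding \<H>_def F(2) by (intro bexI[OF _ imageI[of G]]) (auto simp: pr_def elim!: \<Z>E)
  qed
 next
  fix h d assume "h \<in> H d"
  then obtain F where F: "F \<in> HH d" "!!z. z \<in> Z ==> h z = F (\<rho> z)" using lift by blast
  thus "EX h':\<H> d. ALL z:Z. h' {nu (\<rho> z)} = uu (\<rho> z) ^ d * h z"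
   unfolding \<H>_def using HH_nu[OF F(1) \<rho>_D(1)] by (intro bexI[OF _ imageI[OF F(1)]]) auto
 qed
 show ?thesis by (rule isomorphic_to_fibre)
qed

end

section \<open>Linear coordinates\<close>

text \<open>A vector space given as a record together with a linear coordinate system. The module
  and both of its graded versions are treated uniformly through it.\<close>

locale lin_coords =
 fixes V :: "(complex, 'v) module" and k :: nat and ka :: "'v => nat => complex"
 assumes bij: "bij_betw ka (carrier V) (carrier (coord_space k))"
  and zero_closed: "\<zero>\<^bsub>V\<^esub> \<in> carrier V" and ka_zero: "ka \<zero>\<^bsub>V\<^esub> = (%_. 0)"
  and add_closed: "x \<in> carrier V ==> y \<in> carrier V ==> x \<oplus>\<^bsub>V\<^esub> y \<in> carrier V"
  and ka_add: "x \<in> carrier V ==> y \<in> carrier V ==> ka (x \<oplus>\<^bsub>V\<^esub> y) = (%i. ka x i + ka y i)"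
  and smult_closed: "x \<in> carrier V ==> c \<odot>\<^bsub>V\<^esub> x \<in> carrier V"
  and ka_smult: "x \<in> carrier V ==> ka (c \<odot>\<^bsub>V\<^esub> x) = (%i. c * ka x i)"
begin

lemma ka_carrier: "x \<in> carrier V ==> ka x \<in> carrier (coord_space k)" using bij by (auto simp: bij_betw_def)

lemma ka_out: "x \<in> carrier V ==> k \<le> i ==> ka x i = 0" using ka_carrier[of x] by (auto simp: carrier_coord_space)

lemma ka_inj: "x \<in> carrier V ==> y \<in> carrier V ==> ka x = ka y ==> x = y" using bij by (auto simp: bij_betw_def inj_on_def)

lemma eqI: "x \<in> carrier V ==> y \<in> carrier V ==> (!!i. i < k ==> ka x i = ka y i) ==> x = y"
 by (rule ka_inj, assumption, assumption, rule ext) (metis ka_out not_le)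

lemma obtain_vector:
 assumes "y \<in> carrier (coord_space k)" obtains x where "x \<in> carrier V" "ka x = y" using bij assms unfolding bij_betw_def by (metis imageE)

lemma nonzero_coord: "x \<in> carrier V ==> x ~= \<zero>\<^bsub>V\<^esub> ==> EX i<k. ka x i ~= 0"
 using eqI[of x "\<zero>\<^bsub>V\<^esub>"] zero_closed ka_zero by auto

lemma smult_assoc: "x \<in> carrier V ==> c \<odot>\<^bsub>V\<^esub> (d \<odot>\<^bsub>V\<^esub> x) = (c * d) \<odot>\<^bsub>V\<^esub> x"
 by (rule eqI) (simp_all add: smult_closed ka_smult)

lemma smult_one: "x \<in> carrier V ==> 1 \<odot>\<^bsub>V\<^esub> x = x" by (rule eqI) (simp_all add: smult_closed ka_smult)

lemma smult_0: "x \<in> carrier V ==> 0 \<odot>\<^bsub>V\<^esub> x = \<zero>\<^bsub>V\<^esub>"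
 by (rule eqI) (simp_all add: smult_closed ka_smult zero_closed ka_zero)

lemma linear_form_ka: "linear_form V (%x. ka x i)" by (simp add: linear_form_def ka_add ka_smult)

lemma linear_form_expand:
 assumes l: "linear_form V l"
 shows "EX b. ALL x:carrier V. l x = (\<Sum>i<k. ka x i * b i)"
proof -
 let ?g = "inv_into (carrier V) ka"
 have g: "?g y \<in> carrier V" "ka (?g y) = y" if "y \<in> carrier (coord_space k)" for y
  using that bij unfolding bij_betw_def by (auto simp: inv_into_into f_inv_into_f)
 have "linear_form (coord_space k) (%y. l (?g y))" unfolding linear_form_def
 proof (intro conjI ballI allI)
  fix x y assume xy: "x \<in> carrier (coord_space k)" "y \<in> carrier (coord_space k)"
  hence s: "x \<oplus>\<^bsub>coord_space k\<^esub> y \<in> carrier (coord_space k)" by (auto simp: coord_space_def)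
  have "?g (x \<oplus>\<^bsub>coord_space k\<^esub> y) = ?g x \<oplus>\<^bsub>V\<^esub> ?g y"
   by (rule ka_inj) (use g[OF xy(1)] g[OF xy(2)] g[OF s] in \<open>simp_all add: add_closed ka_add\<close>, simp add: coord_space_def)
  thus "l (?g (x \<oplus>\<^bsub>coord_space k\<^esub> y)) = l (?g x) + l (?g y)" using l g[OF xy(1)] g[OF xy(2)] by (simp add: linear_form_def)
 next
  fix c x assume x: "x \<in> carrier (coord_space k)"
  hence s: "c \<odot>\<^bsub>coord_space k\<^esub> x \<in> carrier (coord_space k)" by (auto simp: coord_space_def)
  have "?g (c \<odot>\<^bsub>coord_space k\<^esub> x) = c \<odot>\<^bsub>V\<^esub> ?g x"
   by (rule ka_inj) (use g[OF x] g[OF s] in \<open>simp_all add: smult_closed ka_smult\<close>, simp add: coord_space_def)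
  thus "l (?g (c \<odot>\<^bsub>coord_space k\<^esub> x)) = c * l (?g x)" using l g[OF x] by (simp add: linear_form_def)
 qed
 from linear_form_coord_space[OF this]
 have "l (?g (ka x)) = (\<Sum>i<k. ka x i * l (?g (%j. if j = i then 1 else 0)))" if "x \<in> carrier V" for x using ka_carrier[OF that] by blast
 moreover have "?g (ka x) = x" if "x \<in> carrier V" for x using that bij unfolding bij_betw_def by (auto simp: inv_into_f_f)
 ultimately show ?thesis by (intro exI[of _ "%i. l (?g (%j. if j = i then 1 else 0))"]) auto
qed

lemma poly_funs_lift:
 assumes "p \<in> poly_funs V"
 shows "EX P:cpolys k. ALL x:carrier V. p x = P (pt k a (ka x))" using assms
proof induction
 case (const c)
 show ?case by (rule bexI[of _ "%_. c"]) (auto intro: poly_funs.const)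
next
 case (linear l)
 then obtain b where b: "!!x. x \<in> carrier V ==> l x = (\<Sum>i<k. ka x i * b i)" using linear_form_expand by blast
 let ?P = "%x. \<Sum>i<k. x (Suc i) * b i"
 have "?P \<in> cpolys k" by (rule poly_funs_sum) (auto intro!: poly_funs.mult poly_funs.const poly_funs.linear[OF linear_form_coord])
 thus ?case by (rule bexI[rotated]) (simp add: b)
next
 case (add p q)
 then obtain P Q where "P \<in> cpolys k" "ALL x:carrier V. p x = P (pt k a (ka x))"
  "Q \<in> cpolys k" "ALL x:carrier V. q x = Q (pt k a (ka x))" by blast
 thus ?case by (intro bexI[of _ "%x. P x + Q x"]) (auto intro: poly_funs.add)
next
 case (mult p q)
 then obtain P Q where "P \<in> cpolys k" "ALL x:carrier V. p x = P (pt k a (ka x))"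
  "Q \<in> cpolys k" "ALL x:carrier V. q x = Q (pt k a (ka x))" by blast
 thus ?case by (intro bexI[of _ "%x. P x * Q x"]) (auto intro: poly_funs.mult)
qed

lemma poly_funs_pull:
 assumes "P \<in> cpolys k"
 shows "(%x. P (pt k a (ka x))) \<in> poly_funs V" using assms
proof induction
 case (linear l)
 have "(%x. l (pt k a (ka x))) = (%x. a * l (%j. if j = 0 then 1 else 0) + (\<Sum>i<k. ka x i * l (%j. if j = Suc i then 1 else 0)))"
  using linear_form_coord_space[OF linear pt_carrier] by (simp add: sum.lessThan_Suc_shift del: sum.lessThan_Suc)
 also have "\<dots> \<in> poly_funs V" by (intro poly_funs.add[OF poly_funs.const] poly_funs_sum)
   (auto intro!: poly_funs.mult[OF poly_funs.linear[OF linear_form_ka] poly_funs.const])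
 finally show ?case .
qed (auto intro: poly_funs.intros)

lemma forms_pull:
 assumes "P \<in> forms k d"
 shows "(%x. P (pt k a (ka x))) \<in> hom_polys V d" unfolding hom_polys_def
 using poly_funs_pull[OF forms_poly_funs[OF assms]] forms_homogeneous[OF assms] by (auto simp: ka_smult)

text \<open>Any polynomial lift of \<open>p\<close> is split into forms, and the powers of
  \<open>l\<close> in the value at \<open>l\<close> times \<open>x\<close> are compared: only the
  component of degree \<open>d\<close> can contribute.\<close>

lemma forms_lift:
 assumes p: "p \<in> hom_polys V d"
 shows "EX P:forms k d. ALL x:carrier V. p x = P (pt k a (ka x))"
proof -
 obtain P where P: "P \<in> cpolys k" "!!x. x \<in> carrier V ==> p x = P (pt k a (ka x))"
  using poly_funs_lift[of p a] p by (auto simp: hom_polys_def)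
 obtain D F where F: "!!d. F d \<in> forms k d" "!!x. x \<in> cspace k ==> P x = (\<Sum>d<D. F d x)" using poly_funs_decompose[OF P(1)] by blast
 let ?P = "%y. (if d < D then 1 else 0) * F d y"
 have "p x = ?P (pt k a (ka x))" if x: "x \<in> carrier V" for x
 proof -
  \<comment> \<open>Coefficients of a polynomial identity in \<open>l\<close>. The range is extended
    to \<open>D + Suc d\<close> so that degree \<open>d\<close> is covered even if the decomposition
    stops earlier.\<close>
  let ?c = "%e. (if e < D then F e (pt k a (ka x)) else 0) - (if e = d then p x else 0)"
  have "(\<Sum>e<D + Suc d. l ^ e * ?c e) = 0" for l
  proof -
   have 1: "(\<Sum>e<D + Suc d. l ^ e * (if e < D then F e (pt k a (ka x)) else 0)) = (\<Sum>e<D. l ^ e * F e (pt k a (ka x)))"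
    by (rule sum.mono_neutral_cong_right) auto
   have 2: "(\<Sum>e<D + Suc d. l ^ e * (if e = d then p x else 0)) = (\<Sum>e<D + Suc d. if e = d then l ^ d * p x else 0)"
    by (rule sum.cong) auto
   have "(\<Sum>e<D. l ^ e * F e (pt k a (ka x))) = P (pt k a (%i. l * ka x i))"
    using F(2)[of "pt k a (%i. l * ka x i)"] by (simp add: forms_homogeneous[OF F(1)])
   also have "\<dots> = p (l \<odot>\<^bsub>V\<^esub> x)" using P(2)[OF smult_closed[OF x]] by (simp add: ka_smult[OF x])
   also have "\<dots> = l ^ d * p x" using p x by (auto simp: hom_polys_def)
   finally show ?thesis using 1 2 by (simp add: right_diff_distrib sum_subtractf del: sum.lessThan_Suc add_Suc_right)
  qed
  from power_sum_eq_0[where D = "D + Suc d" and c = ?c and d = d, OF this] have c: "?c d = 0" by simp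
  thus ?thesis by (cases "d < D") auto
 qed
 moreover have "?P \<in> forms k d" by (rule forms_scale[OF F(1)])
 ultimately show ?thesis by (intro bexI[of _ ?P] ballI)
qed


section \<open>Lines, representatives and projective space\<close>

lemma lineI: "c \<odot>\<^bsub>V\<^esub> x \<in> line V x" unfolding line_def by blast

lemma line_smult:
 assumes x: "x \<in> carrier V" and c: "c ~= 0"
 shows "line V (c \<odot>\<^bsub>V\<^esub> x) = line V x"
proof (intro equalityI subsetI)
 fix y assume "y \<in> line V (c \<odot>\<^bsub>V\<^esub> x)"
 then obtain e where "y = e \<odot>\<^bsub>V\<^esub> (c \<odot>\<^bsub>V\<^esub> x)" by (auto simp: line_def)
 thus "y \<in> line V x" using x by (simp add: smult_assoc lineI)
next
 fix y assume "y \<in> line V x"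
 then obtain e where e: "y = e \<odot>\<^bsub>V\<^esub> x" by (auto simp: line_def)
 have "y = (e / c) \<odot>\<^bsub>V\<^esub> (c \<odot>\<^bsub>V\<^esub> x)" using x c e by (simp add: smult_assoc)
 thus "y \<in> line V (c \<odot>\<^bsub>V\<^esub> x)" by (simp add: lineI)
qed

definition rep :: "'v set => 'v" where
 "rep L = (SOME x. x \<in> carrier V & x ~= \<zero>\<^bsub>V\<^esub> & line V x = L)"

lemma rep:
 assumes "L \<in> proj_points V"
 shows "rep L \<in> carrier V" "rep L ~= \<zero>\<^bsub>V\<^esub>" "line V (rep L) = L"
proof -
 have "EX x. x \<in> carrier V & x ~= \<zero>\<^bsub>V\<^esub> & line V x = L" using assms by (auto simp: proj_points_def)
 from someI_ex[OF this] show "rep L \<in> carrier V" "rep L ~= \<zero>\<^bsub>V\<^esub>" "line V (rep L) = L" unfolding rep_def by auto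
qed

lemma line_proj_points: "x \<in> carrier V ==> x ~= \<zero>\<^bsub>V\<^esub> ==> line V x \<in> proj_points V" by (auto simp: proj_points_def)

lemma in_line_rep:
 assumes "L \<in> proj_points V" "x \<in> L" "x ~= \<zero>\<^bsub>V\<^esub>"
 obtains c where "c ~= 0" "x = c \<odot>\<^bsub>V\<^esub> rep L"
proof -
 from assms(2) have "x \<in> line V (rep L)" using rep(3)[OF assms(1)] by simp
 then obtain c where "x = c \<odot>\<^bsub>V\<^esub> rep L" by (auto simp: line_def)
 moreover from this have "c ~= 0" using assms(3) smult_0[OF rep(1)[OF assms(1)]] by auto
 ultimately show ?thesis by (rule that[rotated])
qed

lemma rep_line:
 assumes "x \<in> carrier V" "x ~= \<zero>\<^bsub>V\<^esub>"
 obtains c where "c ~= 0" "x = c \<odot>\<^bsub>V\<^esub> rep (line V x)"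
proof (rule in_line_rep[OF line_proj_points[OF assms] _ assms(2)])
 show "x \<in> line V x" using lineI[of 1 x] smult_one[OF assms(1)] by simp
qed

lemma hom_polys_smult: "p \<in> hom_polys V d ==> x \<in> carrier V ==> p (c \<odot>\<^bsub>V\<^esub> x) = c ^ d * p x" by (auto simp: hom_polys_def)

lemma nonvanishing_on_line:
 assumes "L \<in> proj_points V" "p \<in> hom_polys V d"
 shows "(ALL x:L - {\<zero>\<^bsub>V\<^esub>}. p x ~= 0) \<longleftrightarrow> p (rep L) ~= 0"
proof
 assume *: "ALL x:L - {\<zero>\<^bsub>V\<^esub>}. p x ~= 0"
 have "rep L \<in> line V (rep L)" using lineI[of 1 "rep L"] smult_one[OF rep(1)[OF assms(1)]] by simp
 thus "p (rep L) ~= 0" using * rep[OF assms(1)] by auto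
next
 assume nz: "p (rep L) ~= 0"
 show "ALL x:L - {\<zero>\<^bsub>V\<^esub>}. p x ~= 0"
 proof
  fix x assume "x \<in> L - {\<zero>\<^bsub>V\<^esub>}"
  then obtain c where "c ~= 0" "x = c \<odot>\<^bsub>V\<^esub> rep L" using in_line_rep[OF assms(1), of x] by blast
  thus "p x ~= 0" using nz hom_polys_smult[OF assms(2) rep(1)[OF assms(1)]] by simp
 qed
qed

lemma quotient_on_line:
 assumes L: "L \<in> proj_points V" and p: "p \<in> hom_polys V d" and q: "q \<in> hom_polys V d"
 shows "(ALL x:L - {\<zero>\<^bsub>V\<^esub>}. q x ~= 0 & c = p x / q x) \<longleftrightarrow> q (rep L) ~= 0 & c = p (rep L) / q (rep L)"
proof
 assume *: "ALL x:L - {\<zero>\<^bsub>V\<^esub>}. q x ~= 0 & c = p x / q x"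
 have "rep L \<in> line V (rep L)" using lineI[of 1 "rep L"] smult_one[OF rep(1)[OF L]] by simp
 thus "q (rep L) ~= 0 & c = p (rep L) / q (rep L)" using * rep[OF L] by auto
next
 assume nz: "q (rep L) ~= 0 & c = p (rep L) / q (rep L)"
 show "ALL x:L - {\<zero>\<^bsub>V\<^esub>}. q x ~= 0 & c = p x / q x"
 proof
  fix x assume "x \<in> L - {\<zero>\<^bsub>V\<^esub>}"
  then obtain e where "e ~= 0" "x = e \<odot>\<^bsub>V\<^esub> rep L" using in_line_rep[OF L, of x] by blast
  thus "q x ~= 0 & c = p x / q x" using nz hom_polys_smult[OF p rep(1)[OF L]] hom_polys_smult[OF q rep(1)[OF L]] by simp
 qed
qed

definition PH :: "nat => ('v set => complex) set" where
 "PH d = (%p L. p (rep L)) ` hom_polys V d"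

lemma hom_polys_mult: "p \<in> hom_polys V d ==> q \<in> hom_polys V e ==> (%x. p x * q x) \<in> hom_polys V (d + e)"
 unfolding hom_polys_def by (auto simp: power_add intro: poly_funs.mult)

lemma gfun_PH: "gfun PH"
proof
 have "(%_. 1) \<in> hom_polys V 0" by (auto simp: hom_polys_def intro: poly_funs.const)
 thus "(%_. 1) \<in> PH 0" unfolding PH_def by (auto intro!: image_eqI[of _ _ "%_. 1"])
 fix d e p q c assume "p \<in> PH d"
 then obtain P where P: "P \<in> hom_polys V d" "p = (%L. P (rep L))" by (auto simp: PH_def)
 have "(%x. c * P x) \<in> hom_polys V d" using P(1) by (auto simp: hom_polys_def intro: poly_funs.mult poly_funs.const)
 thus "(%z. c * p z) \<in> PH d" unfolding PH_def P(2) by (rule image_eqI[rotated]) auto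
 show "(%z. p z + q z) \<in> PH d" if "q \<in> PH d"
 proof -
  from that obtain Q where Q: "Q \<in> hom_polys V d" "q = (%L. Q (rep L))" by (auto simp: PH_def)
  have "(%x. P x + Q x) \<in> hom_polys V d" using P(1) Q(1) by (auto simp: hom_polys_def distrib_left intro: poly_funs.add)
  thus ?thesis unfolding PH_def P(2) Q(2) by (rule image_eqI[rotated]) auto
 qed
 show "(%z. p z * q z) \<in> PH (d + e)" if "q \<in> PH e"
 proof -
  from that obtain Q where Q: "Q \<in> hom_polys V e" "q = (%L. Q (rep L))" by (auto simp: PH_def)
  show ?thesis unfolding PH_def P(2) Q(2) by (rule image_eqI[OF _ hom_polys_mult[OF P(1) Q(1)]]) auto
 qed
qed

text \<open>Conditions quantified over all nonzero vectors of a line hold as soon as they hold for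
  one representative, because numerator and denominator have the same degree.\<close>

lemma proj_space_on_eq:
 assumes Z: "Z \<subseteq> proj_points V"
 shows "proj_space_on V Z = gspace PH Z"
proof -
 interpret P: gfun PH Z by (rule gfun_PH)
 have "{L \<in> Z. ALL x:L - {\<zero>\<^bsub>V\<^esub>}. p x ~= 0} = {L \<in> Z. p (rep L) ~= 0}" if "p \<in> hom_polys V d" for p d
 proof (rule Collect_cong, rule conj_cong[OF refl])
  fix L assume "L \<in> Z"
  hence "L \<in> proj_points V" using Z by auto
  thus "(ALL x:L - {\<zero>\<^bsub>V\<^esub>}. p x ~= 0) \<longleftrightarrow> p (rep L) ~= 0" by (rule nonvanishing_on_line[OF _ that])
 qed
 hence "{{L \<in> Z. ALL x:L - {\<zero>\<^bsub>V\<^esub>}. p x ~= 0} |p d. p \<in> hom_polys V d} = {(nz Z h) |h d. h \<in> PH d}"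
 proof -
  assume eq: "!!p d. p \<in> hom_polys V d ==> {L \<in> Z. ALL x:L - {\<zero>\<^bsub>V\<^esub>}. p x ~= 0} = {L \<in> Z. p (rep L) ~= 0}"
  show ?thesis
  proof (intro equalityI subsetI)
   fix S assume "S \<in> {{L \<in> Z. ALL x:L - {\<zero>\<^bsub>V\<^esub>}. p x ~= 0} |p d. p \<in> hom_polys V d}"
   then obtain p d where p: "p \<in> hom_polys V d" "S = {L \<in> Z. ALL x:L - {\<zero>\<^bsub>V\<^esub>}. p x ~= 0}" by blast
   hence "(%L. p (rep L)) \<in> PH d" "S = {L \<in> Z. (%L. p (rep L)) L ~= 0}" using eq[OF p(1)] by (auto simp: PH_def)
   thus "S \<in> {(nz Z h) |h d. h \<in> PH d}" by (intro CollectI exI conjI)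
  next
   fix S assume "S \<in> {(nz Z h) |h d. h \<in> PH d}"
   then obtain p d where p: "p \<in> hom_polys V d" "S = {L \<in> Z. p (rep L) ~= 0}" by (auto simp: PH_def)
   thus "S \<in> {{L \<in> Z. ALL x:L - {\<zero>\<^bsub>V\<^esub>}. p x ~= 0} |p d. p \<in> hom_polys V d}"
    using eq[OF p(1)] by (intro CollectI exI[of _ p] exI[of _ d]) simp
  qed
 qed
 hence T: "topology_generated_by {{L \<in> Z. ALL x:L - {\<zero>\<^bsub>V\<^esub>}. p x ~= 0} |p d. p \<in> hom_polys V d} = gtop PH Z"
  by (simp add: gtop_def)
 have "(EX W p q d. openin (gtop PH Z) W & K \<in> W & W \<subseteq> U & p \<in> hom_polys V d & q \<in> hom_polys V d &
   (ALL L:W. ALL x:L - {\<zero>\<^bsub>V\<^esub>}. q x ~= 0 & f L = p x / q x)) \<longleftrightarrow>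
  (EX W p q d. openin (gtop PH Z) W & K \<in> W & W \<subseteq> U & p \<in> PH d & q \<in> PH d &
   (ALL L:W. q L ~= 0 & f L = p L / q L))" (is "?L \<longleftrightarrow> ?R") for K U f
 proof
  assume ?L
  then obtain W p q d where *: "openin (gtop PH Z) W" "K \<in> W" "W \<subseteq> U" "p \<in> hom_polys V d" "q \<in> hom_polys V d"
   "ALL L:W. ALL x:L - {\<zero>\<^bsub>V\<^esub>}. q x ~= 0 & f L = p x / q x" by blast
  have quot: "ALL L:W. q (rep L) ~= 0 & f L = p (rep L) / q (rep L)"
  proof
   fix L assume L: "L \<in> W"
   hence "L \<in> proj_points V" using openin_subset[OF *(1)] Z by auto
   from quotient_on_line[OF this *(4,5)] bspec[OF *(6) L] show "q (rep L) ~= 0 & f L = p (rep L) / q (rep L)" by blast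
  qed
  show ?R by (rule exI[of _ W], rule exI[of _ "%L. p (rep L)"], rule exI[of _ "%L. q (rep L)"], rule exI[of _ d])
    (use *(1-5) quot in \<open>auto simp: PH_def\<close>)
 next
  assume ?R
  then obtain W p q d where *: "openin (gtop PH Z) W" "K \<in> W" "W \<subseteq> U" "p \<in> hom_polys V d" "q \<in> hom_polys V d"
   "ALL L:W. q (rep L) ~= 0 & f L = p (rep L) / q (rep L)" unfolding PH_def by blast
  have "ALL L:W. ALL x:L - {\<zero>\<^bsub>V\<^esub>}. q x ~= 0 & f L = p x / q x"
  proof
   fix L assume L: "L \<in> W"
   hence "L \<in> proj_points V" using openin_subset[OF *(1)] Z by auto
   from quotient_on_line[OF this *(4,5)] bspec[OF *(6) L] show "ALL x:L - {\<zero>\<^bsub>V\<^esub>}. q x ~= 0 & f L = p x / q x" by blast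
  qed
  thus ?L using *(1-5) by blast
 qed
 thus ?thesis unfolding proj_space_on_def gspace_def Let_def T by (simp only:)
qed

text \<open>To be used with \<open>c i = a ^ w i\<close>. An orbit that is the member over 1 in the
  old coordinates is the member over \<open>a\<close> in the new ones, so all fibres over nonzero
  \<open>a\<close> are the same variety in different coordinates.\<close>

lemma lin_coords_rescale:
 assumes c: "!!i. c i ~= 0"
 shows "lin_coords V k (%x i. ka x i / c i)"
proof
 show "bij_betw (%x i. ka x i / c i) (carrier V) (carrier (coord_space k))" unfolding bij_betw_def
 proof (intro conjI equalityI subsetI)
  show "inj_on (%x i. ka x i / c i) (carrier V)" by (rule inj_onI, rule eqI) (use c in \<open>auto simp: fun_eq_iff\<close>)
  fix y
  show "y \<in> carrier (coord_space k)" if "y \<in> (%x i. ka x i / c i) ` carrier V" using that ka_out by (auto simp: carrier_coord_space)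
  assume y: "y \<in> carrier (coord_space k)"
  hence "(%i. c i * y i) \<in> carrier (coord_space k)" by (auto simp: carrier_coord_space)
  then obtain x where "x \<in> carrier V" "ka x = (%i. c i * y i)" by (rule obtain_vector)
  thus "y \<in> (%x i. ka x i / c i) ` carrier V" using c by (intro image_eqI[of _ _ x]) auto
 qed
qed (auto simp: zero_closed ka_zero add_closed ka_add smult_closed ka_smult add_divide_distrib)

end

locale orbit_member = family k ph w B + lin_coords V k ka
 for k :: nat and ph :: "complex => 'x => nat => complex" and w B and V :: "(complex, 'v) module" and ka +
 fixes Orb :: "'v set" and a :: complex
 assumes orbit: "x \<in> Orb ==> x \<in> carrier V" "x \<in> Orb ==> EX xi. ALL i<k. ka x i = ph a xi i"
  and orbit': "EX x:Orb. ALL i<k. ka x i = ph a xi i"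
begin

lemma orbit_pt: "x \<in> Orb ==> EX xi. pt k a (ka x) = pt k a (ph a xi)" using orbit(2) pt_cong by metis

lemma orbit_pt': "EX x:Orb. pt k a (ka x) = pt k a (ph a xi)" using orbit' pt_cong by metis

text \<open>The fibre of the closure of the family is not larger than the cone over the orbit
  closure: by \<open>extend\<close> every form vanishing on the orbit comes from an equation of the
  family. The other inclusion is restriction of equations.\<close>

lemma pt_cone_iff:
 assumes x: "x \<in> carrier V"
 shows "pt k a (ka x) \<in> cone \<longleftrightarrow> (ALL d. ALL p:hom_polys V d. (ALL y:Orb. p y = 0) --> p x = 0)"
proof
 assume c: "pt k a (ka x) \<in> cone"
 show "ALL d. ALL p:hom_polys V d. (ALL y:Orb. p y = 0) --> p x = 0"
 proof (intro allI ballI impI)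
  fix d p assume p: "p \<in> hom_polys V d" and v: "ALL y:Orb. p y = 0"
  obtain P where P: "P \<in> forms k d" "!!x. x \<in> carrier V ==> p x = P (pt k a (ka x))" using forms_lift[OF p] by blast
  have "P (pt k a (ph a xi)) = 0" for xi
  proof -
   obtain y where "y \<in> Orb" "pt k a (ka y) = pt k a (ph a xi)" using orbit_pt' by blast
   thus ?thesis using v P(2) orbit(1) by metis
  qed
  then obtain P' where "P' \<in> forms k d" "vanishing P'" "!!y. P' (pt k a y) = P (pt k a y)" using extend[OF P(1)] by metis
  thus "p x = 0" using coneD[OF c] P(2)[OF x] by metis
 qed
next
 assume *: "ALL d. ALL p:hom_polys V d. (ALL y:Orb. p y = 0) --> p x = 0"
 show "pt k a (ka x) \<in> cone"
 proof (rule coneI)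
  fix d P assume P: "P \<in> forms k d" "vanishing P"
  have "P (pt k a (ka y)) = 0" if y: "y \<in> Orb" for y
  proof -
   obtain xi where "pt k a (ka y) = pt k a (%i. 1 * ph a xi i)" using orbit_pt[OF y] by auto
   thus ?thesis using P(2) unfolding vanishing_def by metis
  qed
  thus "P (pt k a (ka x)) = 0" using *[rule_format, OF forms_pull[OF P(1)]] by simp
 qed simp
qed

lemma orbit_closure_subset: "orbit_closure V Orb \<subseteq> proj_points V"
proof -
 interpret P: gfun PH "proj_points V" by (rule gfun_PH)
 show ?thesis unfolding orbit_closure_def using closure_of_subset_topspace[of "gtop PH (proj_points V)"] by (simp add: proj_space_on_eq)
qed

lemma line_in_orbit_closure_iff:
 assumes x: "x \<in> carrier V" "x ~= \<zero>\<^bsub>V\<^esub>"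
 shows "line V x \<in> orbit_closure V Orb \<longleftrightarrow> pt k a (ka x) \<in> cone"
proof -
 interpret P: gfun PH "proj_points V" by (rule gfun_PH)
 have cl: "line V x \<in> orbit_closure V Orb \<longleftrightarrow>
  (ALL T. line V x \<in> T & openin (gtop PH (proj_points V)) T --> (EX y. y \<in> line V ` Orb & y \<in> T))"
  unfolding orbit_closure_def by (simp add: proj_space_on_eq in_closure_of line_proj_points[OF x])
 have nz: "p (rep (line V y)) ~= 0 \<longleftrightarrow> p y ~= 0" if p: "p \<in> hom_polys V d" and y: "y \<in> carrier V" "y ~= \<zero>\<^bsub>V\<^esub>" for p d y
 proof -
  obtain c where c: "c ~= 0" "y = c \<odot>\<^bsub>V\<^esub> rep (line V y)" by (rule rep_line[OF y])
  have "p y = p (c \<odot>\<^bsub>V\<^esub> rep (line V y))" using c(2) by simp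
  also have "\<dots> = c ^ d * p (rep (line V y))" by (rule hom_polys_smult[OF p rep(1)[OF line_proj_points[OF y]]])
  finally show ?thesis using c(1) by simp
 qed
 show ?thesis unfolding cl pt_cone_iff[OF x(1)]
 proof (intro iffI allI ballI impI)
  fix d p assume T: "ALL T. line V x \<in> T & openin (gtop PH (proj_points V)) T --> (EX y. y \<in> line V ` Orb & y \<in> T)"
   and p: "p \<in> hom_polys V d" and v: "ALL y:Orb. p y = 0"
  show "p x = 0"
  proof (rule ccontr)
   assume "p x ~= 0"
   let ?T = "{L \<in> proj_points V. p (rep L) ~= 0}"
   have "openin (gtop PH (proj_points V)) ?T" by (rule P.open_basic) (use p in \<open>auto simp: PH_def\<close>)
   moreover have "line V x \<in> ?T" using nz[OF p x] \<open>p x \<noteq> 0\<close> line_proj_points[OF x] by simp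
   ultimately have "EX y. y \<in> line V ` Orb & y \<in> ?T" using T[rule_format, of ?T] by simp
   then obtain y where y: "y \<in> Orb" "line V y \<in> ?T" by auto
   have L: "line V y \<in> proj_points V" using y by simp
   have "rep (line V y) \<in> line V y" using lineI[of 1 "rep (line V y)"] smult_one[OF rep(1)[OF L]] rep(3)[OF L] by simp
   then obtain c where "rep (line V y) = c \<odot>\<^bsub>V\<^esub> y" by (auto simp: line_def)
   hence "p (rep (line V y)) = 0" using hom_polys_smult[OF p orbit(1)[OF y(1)], of c] v y by simp
   thus False using y by simp
  qed
 next
  fix T assume *: "ALL d. ALL p:hom_polys V d. (ALL y:Orb. p y = 0) --> p x = 0"
   and T: "line V x \<in> T & openin (gtop PH (proj_points V)) T"
  then obtain d h where h: "h \<in> PH d" "h (line V x) ~= 0" "!!y. y \<in> proj_points V ==> h y ~= 0 ==> y \<in> T"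
   unfolding P.openin_gtop_iff by blast
  then obtain p where p: "p \<in> hom_polys V d" "h = (%L. p (rep L))" by (auto simp: PH_def)
  obtain i where i: "i < k" "ka x i ~= 0" using nonzero_coord[OF x] by blast
  \<comment> \<open>The extra factor \<open>ka x i\<close> forces the orbit point found below to be
    nonzero, so that it spans a point of projective space.\<close>
  have "(%x. ka x i) \<in> hom_polys V 1" unfolding hom_polys_def by (auto simp: ka_smult intro: poly_funs.linear linear_form_ka)
  from hom_polys_mult[OF p(1) this] have q: "(%x. p x * ka x i) \<in> hom_polys V (d + 1)" .
  have "p x * ka x i ~= 0" using h p(2) nz[OF p(1) x] i by simp
  then obtain y where y: "y \<in> Orb" "p y * ka y i ~= 0" using *[rule_format, OF q] by metis
  hence y0: "y ~= \<zero>\<^bsub>V\<^esub>" using ka_zero by auto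
  have "line V y \<in> T" using h(3)[OF line_proj_points[OF orbit(1)[OF y(1)] y0]] nz[OF p(1) orbit(1)[OF y(1)] y0] y p(2) by auto
  thus "EX y. y \<in> line V ` Orb & y \<in> T" using y by blast
 qed
qed

lemma affine_cone_iff: "x \<in> affine_cone V (orbit_closure V Orb) \<longleftrightarrow> x \<in> carrier V & pt k a (ka x) \<in> cone"
proof (cases "x = \<zero>\<^bsub>V\<^esub>")
 case True
 have "pt k a (%_. 0) \<in> cone" using family_in_cone[of a 0] by simp
 thus ?thesis using True zero_closed by (simp add: affine_cone_def ka_zero)
next
 case False
 thus ?thesis using line_in_orbit_closure_iff[of x] by (auto simp: affine_cone_def)
qed

end

section \<open>Degenerations of cones and of projective varieties\<close>

context family
begin

definition lead :: "(nat => complex) => complex" where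
 "lead x = x (Suc (LEAST i. i < k & x (Suc i) ~= 0))"

definition nrm :: "(nat => complex) => nat => complex" where
 "nrm x = pt k (x 0) (%i. 1 / lead x * x (Suc i))"

definition pcone :: "(nat => complex) set" where
 "pcone = {x \<in> cone. EX i<k. x (Suc i) ~= 0}"

lemma lead_nonzero: "x \<in> pcone ==> lead x ~= 0" unfolding pcone_def lead_def using LeastI_ex[of "%i. i < k & x (Suc i) ~= 0"] by auto

lemma pcone_cone: "x \<in> pcone ==> x \<in> cone" by (simp add: pcone_def)

lemma nrm_scale:
 assumes c: "c ~= 0" and x: "EX i<k. x (Suc i) ~= 0" and y: "y 0 = x 0" "!!i. i < k ==> y (Suc i) = c * x (Suc i)"
 shows "nrm y = nrm x"
proof -
 have L: "(LEAST i. i < k & y (Suc i) ~= 0) = (LEAST i. i < k & x (Suc i) ~= 0)" by (rule arg_cong[of _ _ Least]) (use y c in auto)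
 have "(LEAST i. i < k & x (Suc i) ~= 0) < k" using LeastI_ex[of "%i. i < k & x (Suc i) ~= 0"] x by auto
 hence "lead y = c * lead x" unfolding lead_def L using y by simp
 thus ?thesis unfolding nrm_def y(1) using y(2) c by (intro pt_cong) simp
qed

lemma nrm_eqD:
 assumes x: "x \<in> pcone" and y: "y \<in> pcone" and "nrm x = nrm y" and i: "i < k"
 shows "y (Suc i) = lead y / lead x * x (Suc i)"
proof -
 have "nrm x (Suc i) = nrm y (Suc i)" using assms by simp
 thus ?thesis using i lead_nonzero[OF x] lead_nonzero[OF y] by (simp add: nrm_def field_simps)
qed

lemma pcone_scale: "x \<in> pcone ==> c ~= 0 ==> pt k (x 0) (%i. c * x (Suc i)) \<in> pcone" unfolding pcone_def using cone_scale[of x c] by auto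

lemma nrm_pcone: "x \<in> pcone ==> nrm x \<in> pcone" unfolding nrm_def by (rule pcone_scale) (use lead_nonzero in auto)

lemma nrm_nrm: "x \<in> pcone ==> nrm (nrm x) = nrm x"
 by (rule nrm_scale[of "1 / lead x"]) (use lead_nonzero in \<open>auto simp: pcone_def nrm_def\<close>)

lemma act_pcone: "t ~= 0 ==> x \<in> pcone ==> act t x \<in> pcone" unfolding pcone_def using cone_act[of t x] by (auto simp: act_def)

lemma nrm_act: "t ~= 0 ==> x \<in> pcone ==> nrm (act t (nrm x)) = nrm (act t x)"
 by (rule nrm_scale[of "1 / lead x"]) (use lead_nonzero act_pcone[of t x] in \<open>auto simp: pcone_def nrm_def act_def\<close>)

lemma family_pcone: "EX xi. pt k t (ph t xi) \<in> pcone"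
proof -
 obtain xi i where "i < k" "ph t xi i ~= 0" using nonzero[of t] by blast
 thus ?thesis unfolding pcone_def using family_in_cone[of t 1 xi] by (auto intro!: exI[of _ xi])
qed

text \<open>At a member with all coordinates zero the form equals \<open>0 ^ d\<close> times its
  value at another, nonzero member. This detour covers degree 0, where vanishing at the origin is
  not automatic.\<close>

lemma forms_zero_off_pcone:
 assumes F: "F \<in> forms k d" and v: "!!xi. pt k t (ph t xi) \<in> pcone ==> F (pt k t (ph t xi)) = 0"
 shows "F (pt k t (ph t xi)) = 0"
proof (cases "pt k t (ph t xi) \<in> pcone")
 case False
 hence z: "ph t xi i = 0" if "i < k" for i using family_in_cone[of t 1 xi] that by (auto simp: pcone_def)
 obtain xi' where xi': "pt k t (ph t xi') \<in> pcone" using family_pcone by blast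
 have "pt k t (ph t xi) = pt k t (%i. 0 * ph t xi' i)" by (rule pt_cong) (simp add: z)
 hence "F (pt k t (ph t xi)) = 0 ^ d * F (pt k t (ph t xi'))" by (simp only: forms_homogeneous[OF F])
 thus ?thesis using v[OF xi'] by simp
qed (rule v)

lemma gfun_forms: "gfun (forms k)" by unfold_locales (auto intro: forms_const forms_add forms_scale forms_mult)

lemma forms_nrm:
 assumes "F \<in> forms k d" "x \<in> pcone"
 shows "F (nrm x) = (1 / lead x) ^ d * F x" unfolding nrm_def forms_homogeneous[OF assms(1)] pt_eqI[OF cone_carrier[OF pcone_cone[OF assms(2)]]] ..

lemma param_poly: "(%x. x 0) \<in> cpolys k" by (rule poly_funs.linear[OF linear_form_coord])

lemma total_affine: "total k ph w B (%_. cpolys k) cone (%x. x) (%_. 1)"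
proof
 fix F d A x assume F: "F \<in> cpolys k" and A: "finite A"
  and v: "!!x. x \<in> cone ==> x 0 \<notin> A ==> F x = 0" and x: "x \<in> cone"
 show "F x = 0" by (rule dense_cone[OF F A _ x]) (use v family_in_cone in auto)
qed (use cone_act param_poly act_expandable_poly in \<open>auto intro: poly_funs.intros poly_funs.mult[OF poly_funs.const]\<close>)

lemma total_proj: "total k ph w B (forms k) pcone nrm (%x. 1 / lead x)"
proof
 show "(%x. x 0) \<in> forms k 0" using forms_param[of "[:0, 1:]" k] by simp
 show "nrm x 0 = x 0" for x by (simp add: nrm_def)
 fix F d A x assume F: "F \<in> forms k d" and A: "finite A"
  and v: "!!x. x \<in> pcone ==> x 0 \<notin> A ==> F x = 0" and x: "x \<in> pcone"
 show "F x = 0"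
 proof (rule dense_cone[OF forms_poly_funs[OF F] A _ pcone_cone[OF x]])
  fix t l xi assume t: "t \<notin> A"
  have "F (pt k t (ph t xi)) = 0" by (rule forms_zero_off_pcone[OF F v]) (use t in auto)
  thus "F (pt k t (%i. l * ph t xi i)) = 0" by (simp add: forms_homogeneous[OF F])
 qed
qed (use pcone_cone act_pcone nrm_pcone nrm_nrm lead_nonzero forms_nrm nrm_act act_expandable_forms
   gfun.one[OF gfun_forms] gfun.mult[OF gfun_forms] in \<open>auto intro: forms_add forms_scale\<close>)

sublocale aff: total k ph w B "%_. cpolys k" cone "%x. x" "%_. 1" by (rule total_affine)

sublocale proj: total k ph w B "forms k" pcone nrm "%x. 1 / lead x" by (rule total_proj)

lemma variety_affine: "variety (gspace aff.\<H> aff.\<Z>)"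
proof (rule aff.T.varietyI[where I = "{()}" and U = "%_. aff.\<Z>"])
 fix x y assume "x \<in> aff.\<Z>" "y \<in> aff.\<Z>" "x ~= y"
 hence "the_elem x ~= the_elem y" by (auto simp: aff.\<Z>_def)
 then obtain i where i: "the_elem x i ~= the_elem y i" by blast
 have "(%z. the_elem z i) \<in> aff.\<H> 0"
  unfolding aff.\<H>_def by (auto intro!: image_eqI[of _ _ "%x. x i"] poly_funs.linear[OF linear_form_coord])
 thus "EX d. EX p:aff.\<H> d. EX q:aff.\<H> d. p x * q y ~= q x * p y"
  using i by (intro exI[of _ 0] bexI[of _ "%z. the_elem z i"] bexI[OF _ aff.T.one]) auto
next
 have o: "openin (gtop aff.\<H> aff.\<Z>) aff.\<Z>" using openin_topspace[of "gtop aff.\<H> aff.\<Z>"] by simp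
 thus "openin (gtop aff.\<H> aff.\<Z>) aff.\<Z>" .
 show "affine_variety (open_subspace (gspace aff.\<H> aff.\<Z>) aff.\<Z>)"
 proof (rule aff.T.affine_chartI[OF o closedin_cone, where th = the_elem and ps = "%x. {x}" and u = "%_. 1"])
  fix i
  have c: "(%z. the_elem z i) \<in> aff.\<H> 0"
   unfolding aff.\<H>_def by (auto intro!: image_eqI[of _ _ "%x. x i"] poly_funs.linear[OF linear_form_coord])
  have "(%z. the_elem z i / 1) \<in> regular (gspace aff.\<H> aff.\<Z>) aff.\<Z>" by (rule aff.T.regular_quotient[OF c aff.T.one o]) simp
  thus "(%z. the_elem z i) \<in> regular (gspace aff.\<H> aff.\<Z>) aff.\<Z>" by simp
 next
  fix d h assume "h \<in> aff.\<H> d"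
  then obtain P where "P \<in> cpolys k" "h = (%z. P (the_elem z))" by (auto simp: aff.\<H>_def)
  thus "EX P:cpolys k. ALL x:cone. h {x} = 1 ^ d * P x" by auto
 qed (auto simp: aff.\<Z>_def)
qed auto

lemma chart_regular:
 assumes i: "i < k" and U: "U = {z \<in> proj.\<Z>. the_elem z (Suc i) ~= 0}"
 shows "openin (gtop proj.\<H> proj.\<Z>) U"
  and "j < Suc k ==> (%z. pt k (the_elem z 0) (%j. 1 / the_elem z (Suc i) * the_elem z (Suc j)) j)
   \<in> regular (gspace proj.\<H> proj.\<Z>) U"
proof -
 have c: "(%z. the_elem z (Suc j)) \<in> proj.\<H> 1" if "j < k" for j unfolding proj.\<H>_def by (rule image_eqI[OF _ forms_coord[OF that]]) auto
 have p: "(%z. the_elem z 0) \<in> proj.\<H> 0" unfolding proj.\<H>_def by (rule image_eqI[OF _ proj.param]) auto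
 show o: "openin (gtop proj.\<H> proj.\<Z>) U" unfolding U by (rule proj.T.open_basic[OF c[OF i]])
 show "(%z. pt k (the_elem z 0) (%j. 1 / the_elem z (Suc i) * the_elem z (Suc j)) j) \<in> regular (gspace proj.\<H> proj.\<Z>) U"
  if "j < Suc k"
 proof (cases j)
  case 0
  have "(%z. the_elem z 0 / 1) \<in> regular (gspace proj.\<H> proj.\<Z>) U" by (rule proj.T.regular_quotient[OF p proj.T.one o]) simp
  thus ?thesis using 0 by simp
 next
  case (Suc j')
  have "(%z. the_elem z (Suc j') / the_elem z (Suc i)) \<in> regular (gspace proj.\<H> proj.\<Z>) U"
   by (rule proj.T.regular_quotient[OF c c[OF i] o]) (use Suc that U in auto)
  thus ?thesis using Suc that by simp
 qed
qed

text \<open>The chart where fibre coordinate \<open>i\<close> is nonzero is identified with the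
  closed slice of the cone on which that coordinate is one; each line over a parameter value meets
  this slice at most once.\<close>

lemma variety_proj: "variety (gspace proj.\<H> proj.\<Z>)"
proof (rule proj.T.varietyI[where I = "{..<k}" and U = "%i. {z \<in> proj.\<Z>. the_elem z (Suc i) ~= 0}"])
 have c: "(%z. the_elem z (Suc j)) \<in> proj.\<H> 1" if "j < k" for j unfolding proj.\<H>_def by (rule image_eqI[OF _ forms_coord[OF that]]) auto
 have p: "(%z. the_elem z 0) \<in> proj.\<H> 0" unfolding proj.\<H>_def by (rule image_eqI[OF _ proj.param]) auto
 fix z z' assume z: "z \<in> proj.\<Z>" and z': "z' \<in> proj.\<Z>" and "z ~= z'"
 obtain x where x: "x \<in> pcone" "z = {x}" "nrm x = x" using z by (auto elim: proj.\<Z>E)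
 obtain y where y: "y \<in> pcone" "z' = {y}" "nrm y = y" using z' by (auto elim: proj.\<Z>E)
 have xy: "x ~= y" using x y \<open>z \<noteq> z'\<close> by auto
 obtain i where i: "i < k" "x (Suc i) ~= 0" using x(1) by (auto simp: pcone_def)
 show "EX d. EX p:proj.\<H> d. EX q:proj.\<H> d. p z * q z' ~= q z * p z'"
 proof (cases "ALL j<k. x (Suc i) * y (Suc j) = x (Suc j) * y (Suc i)")
  case False
  then obtain j where "j < k" "x (Suc i) * y (Suc j) ~= x (Suc j) * y (Suc i)" by blast
  thus ?thesis using x(2) y(2) c[OF i(1)] c[of j]
   by (intro exI[of _ 1] bexI[of _ "%z. the_elem z (Suc i)"] bexI[of _ "%z. the_elem z (Suc j)"]) auto
 next
  case True
  hence e: "y (Suc j) = (y (Suc i) / x (Suc i)) * x (Suc j)" if "j < k" for j using i that by (simp add: field_simps)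
  have yi: "y (Suc i) ~= 0" using y(1) e by (auto simp: pcone_def)
  have "x 0 ~= y 0"
  proof
   assume "x 0 = y 0"
   have "nrm y = nrm x"
   proof (rule nrm_scale)
    show "y (Suc i) / x (Suc i) ~= 0" using i yi by simp
    show "EX i<k. x (Suc i) ~= 0" using i by blast
    show "y 0 = x 0" using \<open>x 0 = y 0\<close> by simp
   qed (rule e)
   thus False using x y xy by simp
  qed
  \<comment> \<open>The same line over two different parameter values: \<open>t\<close> times
    coordinate \<open>i\<close>, and coordinate \<open>i\<close> itself, are forms of equal degree
    that tell the points apart.\<close>
  hence ne: "(x 0 * x (Suc i)) * y (Suc i) ~= x (Suc i) * (y 0 * y (Suc i))" using i yi by simp
  have m: "(%z. the_elem z 0 * the_elem z (Suc i)) \<in> proj.\<H> 1" using proj.T.mult[OF p c[OF i(1)]] by simp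
  show ?thesis by (rule exI[of _ 1], rule bexI[OF _ m], rule bexI[OF _ c[OF i(1)]]) (use x(2) y(2) ne in simp)
 qed
next
 show "proj.\<Z> \<subseteq> (\<Union>i\<in>{..<k}. {z \<in> proj.\<Z>. the_elem z (Suc i) ~= 0})"
 proof
  fix z assume z: "z \<in> proj.\<Z>"
  then obtain x where "x \<in> pcone" "z = {x}" by (auto elim: proj.\<Z>E)
  thus "z \<in> (\<Union>i\<in>{..<k}. {z \<in> proj.\<Z>. the_elem z (Suc i) ~= 0})" using z by (auto simp: pcone_def)
 qed
 fix i assume "i \<in> {..<k}"
 hence i: "i < k" by simp
 let ?U = "{z \<in> proj.\<Z>. the_elem z (Suc i) ~= 0}"
 let ?C = "{x \<in> cspace k. ALL P:insert (%x. x (Suc i) + - 1) {P. vanishing P & (EX d. P \<in> forms k d)}. P x = 0}"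
 have C: "x \<in> ?C \<longleftrightarrow> x \<in> cone & x (Suc i) = 1" for x by (auto simp: cone_def)
 have Cp: "x \<in> pcone" if "x \<in> ?C" for x using that i unfolding C pcone_def by (auto intro!: exI[of _ i])
 show "openin (gtop proj.\<H> proj.\<Z>) ?U" by (rule chart_regular(1)[OF i refl])
 have closed: "closedin (zar (affine_space_on (coord_space (Suc k)) (cspace k))) ?C"
 proof (rule closedin_affine_zeros)
  have "(%x. x (Suc i) + - 1) \<in> cpolys k" by (rule poly_funs.add[OF poly_funs.linear[OF linear_form_coord] poly_funs.const])
  thus "insert (%x. x (Suc i) + - 1) {P. vanishing P & (EX d. P \<in> forms k d)} \<subseteq> cpolys k" using forms_poly_funs by blast
 qed
 let ?th = "%z. pt k (the_elem z 0) (%j. 1 / the_elem z (Suc i) * the_elem z (Suc j))"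
 show "affine_variety (open_subspace (gspace proj.\<H> proj.\<Z>) ?U)"
 proof (rule proj.T.affine_chartI[OF chart_regular(1)[OF i refl] closed, where th = ?th and ps = "%x. {nrm x}" and u = "%x. 1 / lead x"])
  fix z assume "z \<in> ?U"
  then obtain x where x: "x \<in> pcone" "z = {x}" "nrm x = x" "x (Suc i) ~= 0" by (auto elim: proj.\<Z>E)
  show "?th z \<in> ?C" unfolding C using cone_scale[OF pcone_cone[OF x(1)], of "1 / x (Suc i)"] x i by simp
  have "nrm (?th z) = nrm x" by (rule nrm_scale[of "1 / x (Suc i)"]) (use x i in auto)
  thus "{nrm (?th z)} = z" using x by simp
 next
  fix x assume x: "x \<in> ?C"
  note xp = Cp[OF x]
  have ixi: "x (Suc i) = 1" using x C by blast
  have ni: "nrm x (Suc i) = 1 / lead x" using i ixi by (simp add: nrm_def)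
  show "{nrm x} \<in> ?U" using proj.\<Z>I[OF xp] ni lead_nonzero[OF xp] by simp
  have "?th {nrm x} = pt k (x 0) (%j. x (Suc j))" unfolding the_elem_eq proj.nu_0
  proof (rule pt_cong)
   fix j assume j: "j < k"
   show "1 / nrm x (Suc i) * nrm x (Suc j) = x (Suc j)" unfolding ni using j lead_nonzero[OF xp] by (simp add: nrm_def)
  qed
  thus "?th {nrm x} = x" using pt_eqI[OF cone_carrier[OF pcone_cone[OF xp]]] by simp
  show "1 / lead x ~= 0" using lead_nonzero[OF xp] by simp
 next
  fix j assume "j < Suc k"
  thus "(%z. ?th z j) \<in> regular (gspace proj.\<H> proj.\<Z>) ?U" by (rule chart_regular(2)[OF i refl])
 next
  fix d h assume "h \<in> proj.\<H> d"
  then obtain P where P: "P \<in> forms k d" "h = (%z. P (the_elem z))" by (auto simp: proj.\<H>_def)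
  thus "EX P:cpolys k. ALL x:?C. h {nrm x} = (1 / lead x) ^ d * P x" by (intro bexI[of _ P] ballI) (simp_all add: forms_nrm Cp forms_poly_funs)
 qed
qed auto

end

context orbit_member
begin

lemma affine_fibre: "isomorphic_to_fibre (cone_variety V (orbit_closure V Orb)) (gspace aff.\<H> aff.\<Z>) aff.pr a"
 unfolding cone_variety_def affine_space_on_eq
proof (rule aff.fibre[where \<rho> = "%x. pt k a (ka x)"])
 let ?Z = "affine_cone V (orbit_closure V Orb)"
 show "gfun (%_. poly_funs V)" by (rule gfun_poly_funs)
 show "pt k a (ka z) \<in> cone" if "z \<in> ?Z" for z using that affine_cone_iff by blast
 show "pt k a (ka z) 0 = a" for z by simp
 show "EX z:?Z. pt k a (ka z) = x" if x: "x \<in> cone" "x 0 = a" for x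
 proof -
  have "(tail x) \<in> carrier (coord_space k)" using cone_carrier[OF x(1)] by (auto simp: carrier_coord_space)
  then obtain z where z: "z \<in> carrier V" "ka z = (tail x)" by (rule obtain_vector)
  hence "pt k a (ka z) = x" using pt_eqI[OF cone_carrier[OF x(1)]] x(2) by simp
  moreover from this have "z \<in> ?Z" using affine_cone_iff[of z] z x by simp
  ultimately show ?thesis by blast
 qed
 show "z = z'" if z: "z \<in> ?Z" "z' \<in> ?Z" and e: "pt k a (ka z) = pt k a (ka z')" for z z'
 proof (rule eqI)
  show "z \<in> carrier V" "z' \<in> carrier V" using z affine_cone_iff by auto
  fix i assume "i < k"
  thus "ka z i = ka z' i" using fun_cong[OF e, of "Suc i"] by simp
 qed
 show "EX h:poly_funs V. ALL z:?Z. h z = F (pt k a (ka z))" if "F \<in> cpolys k" for F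
  using poly_funs_pull[OF that] by (intro bexI[of _ "%x. F (pt k a (ka x))"]) auto
 show "EX F:cpolys k. ALL z:?Z. h z = F (pt k a (ka z))" if "h \<in> poly_funs V" for h using poly_funs_lift[OF that, of a] affine_cone_iff by blast
 show "EX G:cpolys k. ALL x:cone. F x = (x 0 - a) * G x"
  if F: "F \<in> cpolys k" and v: "!!z. z \<in> ?Z ==> F (pt k a (ka z)) = 0" for F
 proof (rule divide_poly[OF F])
  fix l xi
  have "(%i. if i < k then l * ph a xi i else 0) \<in> carrier (coord_space k)" by (auto simp: carrier_coord_space)
  then obtain z where z: "z \<in> carrier V" "ka z = (%i. if i < k then l * ph a xi i else 0)" by (rule obtain_vector)
  have e: "pt k a (ka z) = pt k a (%i. l * ph a xi i)" by (rule pt_cong) (simp add: z)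
  hence "z \<in> ?Z" using affine_cone_iff z family_in_cone[of a l xi] by simp
  thus "F (pt k a (%i. l * ph a xi i)) = 0" using v e by metis
 qed
qed

lemma proj_fibre: "isomorphic_to_fibre (proj_space_on V (orbit_closure V Orb)) (gspace proj.\<H> proj.\<Z>) proj.pr a"
 unfolding proj_space_on_eq[OF orbit_closure_subset]
proof (rule proj.fibre[where \<rho> = "%L. pt k a (ka (rep L))"])
 let ?Z = "orbit_closure V Orb"
 have Z: "rep L \<in> carrier V" "rep L ~= \<zero>\<^bsub>V\<^esub>" "line V (rep L) = L" "pt k a (ka (rep L)) \<in> cone" if "L \<in> ?Z" for L
 proof -
  have L: "L \<in> proj_points V" using that orbit_closure_subset by auto
  show "rep L \<in> carrier V" "rep L ~= \<zero>\<^bsub>V\<^esub>" "line V (rep L) = L" by (rule rep[OF L])+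
  thus "pt k a (ka (rep L)) \<in> cone" using line_in_orbit_closure_iff that by metis
 qed
 show "gfun PH" by (rule gfun_PH)
 show D: "pt k a (ka (rep L)) \<in> pcone" if "L \<in> ?Z" for L unfolding pcone_def using Z[OF that] nonzero_coord[OF Z(1,2)[OF that]] by auto
 show "pt k a (ka (rep L)) 0 = a" for L by simp
 have line: "EX L:?Z. EX c. c ~= 0 & x = pt k a (%i. c * ka (rep L) i)" if x: "x \<in> pcone" "x 0 = a" for x
 proof -
  note xc = cone_carrier[OF pcone_cone[OF x(1)]]
  have "(tail x) \<in> carrier (coord_space k)" using xc by (auto simp: carrier_coord_space)
  then obtain z where z: "z \<in> carrier V" "ka z = (tail x)" by (rule obtain_vector)
  have e: "pt k a (ka z) = x" using pt_eqI[OF xc] x(2) z by simp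
  have z0: "z ~= \<zero>\<^bsub>V\<^esub>" using x(1) z ka_zero by (auto simp: pcone_def fun_eq_iff)
  have L: "line V z \<in> ?Z" using line_in_orbit_closure_iff[OF z(1) z0] e pcone_cone[OF x(1)] by simp
  obtain c where c: "c ~= 0" "z = c \<odot>\<^bsub>V\<^esub> rep (line V z)" by (rule rep_line[OF z(1) z0])
  have "ka z = (%i. c * ka (rep (line V z)) i)" using ka_smult[OF Z(1)[OF L], of c] c(2) by simp
  thus ?thesis using L c(1) e by metis
 qed
 show "EX L:?Z. nrm (pt k a (ka (rep L))) = nrm x" if x: "x \<in> pcone" "x 0 = a" for x
 proof -
  obtain L c where L: "L \<in> ?Z" "c ~= 0" "x = pt k a (%i. c * ka (rep L) i)" using line[OF x] by blast
  have "nrm x = nrm (pt k a (ka (rep L)))" by (rule nrm_scale[OF L(2)]) (use L D[OF L(1)] in \<open>auto simp: pcone_def\<close>)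
  thus ?thesis using L(1) by metis
 qed
 show "L = L'" if L: "L \<in> ?Z" "L' \<in> ?Z" and e: "nrm (pt k a (ka (rep L))) = nrm (pt k a (ka (rep L')))" for L L'
 proof -
  let ?c = "lead (pt k a (ka (rep L'))) / lead (pt k a (ka (rep L)))"
  have c: "?c ~= 0" using lead_nonzero[OF D[OF L(1)]] lead_nonzero[OF D[OF L(2)]] by simp
  have "rep L' = ?c \<odot>\<^bsub>V\<^esub> rep L"
  proof (rule eqI)
   fix i assume "i < k"
   thus "ka (rep L') i = ka (?c \<odot>\<^bsub>V\<^esub> rep L) i"
    using nrm_eqD[OF D[OF L(1)] D[OF L(2)] e, of i] by (simp add: ka_smult[OF Z(1)[OF L(1)]])
  qed (use Z(1) L smult_closed in auto)
  thus ?thesis using Z(3)[OF L(1)] Z(3)[OF L(2)] line_smult[OF Z(1)[OF L(1)] c] by simp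
 qed
 show "EX h:PH d. ALL L:?Z. h L = F (pt k a (ka (rep L)))" if "F \<in> forms k d" for F d
  unfolding PH_def by (rule bexI[OF _ imageI[OF forms_pull[OF that, of a]]]) simp
 show "EX F:forms k d. ALL L:?Z. h L = F (pt k a (ka (rep L)))" if "h \<in> PH d" for h d
 proof -
  from that obtain p where p: "p \<in> hom_polys V d" "h = (%L. p (rep L))" by (auto simp: PH_def)
  obtain F where F: "F \<in> forms k d" "!!x. x \<in> carrier V ==> p x = F (pt k a (ka x))" using forms_lift[OF p(1)] by blast
  show ?thesis by (rule bexI[OF _ F(1)]) (use F(2) Z(1) p(2) in auto)
 qed
 show "EX G:forms k d. ALL x:pcone. F x = (x 0 - a) * G x"
  if F: "F \<in> forms k d" and v: "!!L. L \<in> ?Z ==> F (pt k a (ka (rep L))) = 0" for F d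
 proof -
  have "F (pt k a (ph a xi)) = 0" for xi
  proof (rule forms_zero_off_pcone[OF F])
   fix xi assume "pt k a (ph a xi) \<in> pcone"
   from line[OF this] obtain L c where L: "L \<in> ?Z" "pt k a (ph a xi) = pt k a (%i. c * ka (rep L) i)" by auto
   thus "F (pt k a (ph a xi)) = 0" using v[OF L(1)] by (simp add: forms_homogeneous[OF F])
  qed
  from divide_forms[OF F this] show ?thesis using pcone_cone by blast
 qed
qed

end

text \<open>One total space serves all fibres: the orbit in \<open>V\<close> is placed over each
  nonzero \<open>a\<close> by rescaling its coordinates, and the orbit in \<open>V0\<close> is
  placed over 0.\<close>

theorem (in family) degenerations:
 assumes V: "lin_coords V k ka" and V0: "lin_coords V0 k ka0"
  and Orb: "!!x. x \<in> Orb ==> x \<in> carrier V" "!!x. x \<in> Orb ==> EX xi. ALL i<k. ka x i = ph 1 xi i"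
   "!!xi. EX x:Orb. ALL i<k. ka x i = ph 1 xi i"
  and Orb0: "!!x. x \<in> Orb0 ==> x \<in> carrier V0" "!!x. x \<in> Orb0 ==> EX xi. ALL i<k. ka0 x i = ph 0 xi i"
   "!!xi. EX x:Orb0. ALL i<k. ka0 x i = ph 0 xi i"
 shows "degenerates_to (cone_variety V (orbit_closure V Orb)) (cone_variety V0 (orbit_closure V0 Orb0))"
  and "degenerates_to (proj_space_on V (orbit_closure V Orb)) (proj_space_on V0 (orbit_closure V0 Orb0))"
proof -
 interpret V: lin_coords V k ka by (rule V)
 interpret V0: lin_coords V0 k ka0 by (rule V0)
 have M0: "orbit_member k ph w B V0 ka0 Orb0 0" by unfold_locales (use Orb0 in auto)
 have M: "orbit_member k ph w B V (%x i. ka x i / a ^ w i) Orb a" if a: "a ~= 0" for a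
 proof -
  interpret W: lin_coords V k "%x i. ka x i / a ^ w i" by (rule V.lin_coords_rescale) (use a in simp)
  show ?thesis
  proof unfold_locales
   fix x assume x: "x \<in> Orb"
   show "x \<in> carrier V" by (rule Orb(1)[OF x])
   obtain xi where xi: "!!i. i < k ==> ka x i = ph 1 xi i" using Orb(2)[OF x] by blast
   obtain xi' where xi': "!!i. i < k ==> a ^ w i * ph a xi' i = ph 1 xi i" using equi'[OF a] by blast
   have "ka x i / a ^ w i = ph a xi' i" if "i < k" for i using xi[OF that] xi'[OF that] a by (simp add: field_simps)
   thus "EX xi. ALL i<k. ka x i / a ^ w i = ph a xi i" by blast
  next
   fix xi
   obtain xi1 where xi1: "!!i. i < k ==> ph 1 xi1 i = a ^ w i * ph a xi i" using equi[OF a] by blast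
   obtain x where x: "x \<in> Orb" "!!i. i < k ==> ka x i = ph 1 xi1 i" using Orb(3) by blast
   show "EX x:Orb. ALL i<k. ka x i / a ^ w i = ph a xi i" using x xi1 a by (intro bexI[OF _ x(1)]) auto
  qed
 qed
 show "degenerates_to (cone_variety V (orbit_closure V Orb)) (cone_variety V0 (orbit_closure V0 Orb0))"
  unfolding degenerates_to_def flat_degeneration_def by (rule exI[of _ "gspace aff.\<H> aff.\<Z>"], rule exI[of _ aff.pr], rule exI[of _ aff.sg])
   (intro conjI allI impI variety_affine aff.flat aff.equivariant orbit_member.affine_fibre[OF M] orbit_member.affine_fibre[OF M0])
 show "degenerates_to (proj_space_on V (orbit_closure V Orb)) (proj_space_on V0 (orbit_closure V0 Orb0))"
  unfolding degenerates_to_def flat_degeneration_def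
  by (rule exI[of _ "gspace proj.\<H> proj.\<Z>"], rule exI[of _ proj.pr], rule exI[of _ proj.sg])
   (intro conjI allI impI variety_proj proj.flat proj.equivariant orbit_member.proj_fibre[OF M] orbit_member.proj_fibre[OF M0])
qed

section \<open>Powers and exponentials of nilpotent matrices\<close>

definition mpow :: "complex ^ 'n ^ 'n => nat => complex ^ 'n ^ 'n" where
 "mpow A n = ((%B. B ** A) ^^ n) (mat 1)"

lemma mpow_0 [simp]: "mpow A 0 = mat 1" and mpow_Suc: "mpow A (Suc n) = mpow A n ** A" by (simp_all add: mpow_def)

lemma mpow_1 [simp]: "mpow A (Suc 0) = A" by (simp add: mpow_Suc)

lemma mpow_add: "mpow A (m + n) = mpow A m ** mpow A n" by (induction n) (simp_all add: mpow_Suc matrix_mul_assoc)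

lemma mpow_Suc2: "mpow A (Suc n) = A ** mpow A n" using mpow_add[of A 1 n] by simp

lemma matrix_mul_zero_left [simp]: "(0 :: complex ^ 'n ^ 'n) ** A = 0" by (simp add: matrix_matrix_mult_def vec_eq_iff)

lemma matrix_mul_zero_right [simp]: "(A :: complex ^ 'n ^ 'n) ** 0 = 0" by (simp add: matrix_matrix_mult_def vec_eq_iff)

lemma mpow_zero_mono: "mpow A m = 0 ==> m \<le> n ==> mpow A n = 0" using mpow_add[of A m "n - m"] by simp

lemma mat_scale_nth [simp]: "mat_scale c A $ i $ j = c * A $ i $ j" by (simp add: mat_scale_def)

lemma mat_scale_mult_left: "mat_scale c A ** B = mat_scale c (A ** B)"
 and mat_scale_mult_right: "A ** mat_scale c B = mat_scale c (A ** B)"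
 by (simp_all add: vec_eq_iff matrix_matrix_mult_def sum_distrib_left mult.assoc mult.left_commute)

lemma mpow_scale: "mpow (mat_scale c A) n = mat_scale (c ^ n) (mpow A n)"
 by (induction n) (simp_all add: mpow_Suc mat_scale_mult_left mat_scale_mult_right mult.commute)

lemma matrix_add_rdistrib: "((A :: complex ^ 'n ^ 'm) + B) ** C = A ** C + B ** C"
 by (simp add: matrix_matrix_mult_def vec_eq_iff distrib_right sum.distrib)

lemma matrix_sum_left: "(\<Sum>i\<in>I. f i) ** (B :: complex ^ 'n ^ 'n) = (\<Sum>i\<in>I. f i ** B)"
 by (induction I rule: infinite_finite_induct) (auto simp: matrix_add_rdistrib)

lemma matrix_sum_right: "(B :: complex ^ 'n ^ 'n) ** (\<Sum>i\<in>I. f i) = (\<Sum>i\<in>I. B ** f i)"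
 by (induction I rule: infinite_finite_induct) (auto simp: matrix_add_ldistrib)

text \<open>If \<open>l\<close> is the exact nilpotency index, some vector \<open>x\<close> survives
  \<open>l - 1\<close> applications of \<open>A\<close>, and its iterates are independent; so
  \<open>l\<close> is at most the dimension.\<close>

lemma nilpotent_index:
 fixes A :: "complex ^ 'n ^ 'n"
 assumes "mpow A m = 0"
 shows "mpow A CARD('n) = 0"
proof (rule ccontr)
 assume nz: "mpow A CARD('n) ~= 0"
 define l where "l = (LEAST m. mpow A m = 0)"
 have l: "mpow A l = 0" unfolding l_def using assms by (rule LeastI)
 have l': "mpow A i ~= 0" if "i < l" for i using that not_less_Least unfolding l_def by blast
 have "CARD('n) < l" using nz mpow_zero_mono[OF l, of "CARD('n)"] by (metis not_le)
 hence "l - 1 < l" by simp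
 from l'[OF this] have "mpow A (l - 1) ~= 0" .
 then obtain x where x: "mpow A (l - 1) *v x ~= 0" by (metis matrix_eq matrix_vector_mult_0)
 let ?v = "%i. mpow A i *v x"
 \<comment> \<open>Applying the power \<open>l - 1 - i\<close> annihilates the terms after
   \<open>i\<close>, while the coefficients before \<open>i\<close> vanish by induction. Only the
   term of index \<open>i\<close> is left, in the surviving top power.\<close>
 have dep: "c i = 0" if s: "(\<Sum>j<l. c j *s ?v j) = 0" and i: "i < l" for c i using i
 proof (induction i rule: less_induct)
  case (less i)
  have "mpow A (l - 1 - i) *v (\<Sum>j<l. c j *s ?v j) = (\<Sum>j<l. c j *s (mpow A (l - 1 - i) *v ?v j))"
   by (simp add: linear_sum[OF matrix_vector_mul_linear] vec.linear_sum matrix_vector_mult_scaleR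
     vec.scale linear_cmul vector_scalar_commute matrix_vector_right_distrib)
  also have "\<dots> = (\<Sum>j<l. if j = i then c i *s ?v (l - 1) else 0)"
  proof (rule sum.cong[OF refl])
   fix j assume "j \<in> {..<l}"
   hence j: "j < l" by simp
   have "mpow A (l - 1 - i) *v ?v j = ?v (l - 1 - i + j)" by (simp add: matrix_vector_mul_assoc mpow_add)
   moreover have "?v (l - 1 - i + j) = 0" if "i < j" using mpow_zero_mono[OF l, of "l - 1 - i + j"] that less.prems by simp
   moreover have "c j = 0" if "j < i" using less.IH[OF that] that less.prems by simp
   ultimately show "c j *s (mpow A (l - 1 - i) *v ?v j) = (if j = i then c i *s ?v (l - 1) else 0)"
    using less.prems by (cases i j rule: linorder_cases) auto
  qed
  also have "\<dots> = c i *s ?v (l - 1)" using less.prems by simp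
  finally have "c i *s ?v (l - 1) = 0" using s by simp
  thus ?case using x by simp
 qed
 have inj: "inj_on ?v {..<l}"
 proof (rule inj_onI)
  fix i j assume ij: "i \<in> {..<l}" "j \<in> {..<l}" "?v i = ?v j"
  show "i = j"
  proof (rule ccontr)
   assume ne: "i ~= j"
   let ?c = "%m. (if m = i then 1 else 0) - (if m = j then 1 else 0) :: complex"
   have "(\<Sum>m<l. ?c m *s ?v m) = (\<Sum>m<l. (if m = i then ?v m else 0)) - (\<Sum>m<l. (if m = j then ?v m else 0))"
    unfolding sum_subtractf[symmetric] by (rule sum.cong) (auto simp: vec.scale_left_diff_distrib)
   also have "\<dots> = 0" using ij by simp
   finally show False using dep[of ?c i] ij ne by simp
  qed
 qed
 have "vec.independent (?v ` {..<l})"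
 proof -
  have "\<not> vec.dependent (?v ` {..<l})"
  proof
   assume "vec.dependent (?v ` {..<l})"
   then obtain u where u: "EX v:?v ` {..<l}. u v ~= 0" "(\<Sum>v\<in>?v ` {..<l}. u v *s v) = 0" by (auto simp: vec.dependent_finite)
   have "(\<Sum>j<l. u (?v j) *s ?v j) = 0" using u(2) by (simp add: sum.reindex[OF inj])
   thus False using dep[of "%j. u (?v j)"] u(1) by auto
  qed
  thus ?thesis by simp
 qed
 hence "card (?v ` {..<l}) \<le> vec.dim (UNIV :: (complex ^ 'n) set)" by (intro vec.independent_card_le_dim) auto
 thus False using \<open>CARD('n) < l\<close> inj by (simp add: card_image card_cart_basis)
qed

text \<open>The exponential series of a nilpotent matrix. For other matrices infinitely many powers
  are nonzero and the sum takes the value zero.\<close>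

definition mexp :: "complex ^ 'n ^ 'n => complex ^ 'n ^ 'n" where
 "mexp A = (\<Sum>k | mpow A k ~= 0. mat_scale (1 / fact k) (mpow A k))"

lemma mexp_eq:
 assumes "mpow A K = 0"
 shows "mexp A = (\<Sum>k<K. mat_scale (1 / fact k) (mpow A k))" unfolding mexp_def
proof (rule sum.mono_neutral_left)
 show "{k. mpow A k ~= 0} \<subseteq> {..<K}" using mpow_zero_mono[OF assms] by (auto simp: not_le[symmetric])
qed (auto simp: vec_eq_iff)

lemma mexp_scale_eq:
 assumes "mpow A K = 0"
 shows "mexp (mat_scale s A) = (\<Sum>k<K. mat_scale (s ^ k / fact k) (mpow A k))"
proof -
 have "mpow (mat_scale s A) K = 0" using assms by (simp add: mpow_scale vec_eq_iff)
 from mexp_eq[OF this] show ?thesis by (simp add: mpow_scale vec_eq_iff)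
qed

section \<open>Polynomial curves of matrices\<close>

definition polycurve :: "(complex => complex ^ 'n ^ 'n) => bool" where
 "polycurve ga \<longleftrightarrow> (ALL i j. polyfun (%s. ga s $ i $ j))"

definition cderiv :: "(complex => complex ^ 'n ^ 'n) => complex => complex ^ 'n ^ 'n" where
 "cderiv ga s = (\<chi> i j. deriv (%s. ga s $ i $ j) s)"

lemma polyfun_has_derivative:
 assumes "polyfun f" shows "(f has_field_derivative deriv f s) (at s)"
proof -
 obtain p where "f = poly p" using assms by (auto simp: polyfun_def)
 thus ?thesis using poly_DERIV[of p s] DERIV_imp_deriv by metis
qed

text \<open>All derivatives at 0 vanish, hence the polynomial does. This is the algebraic substitute
  for uniqueness of solutions of differential equations; membership in \<open>F\<close> is what
  propagates.\<close>

lemma polyfun_zero_by_derivatives: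
 assumes F: "!!f. f \<in> F ==> polyfun f & f 0 = 0 & deriv f \<in> F" and f: "f \<in> F"
 shows "f s = 0"
proof -
 have "ALL p. poly p \<in> F --> degree p \<le> n --> p = 0" for n
 proof (induction n)
  case 0
  show ?case
  proof (intro allI impI)
   fix p assume p: "poly p \<in> F" "degree p \<le> 0"
   then obtain c where "p = [:c:]" by (metis degree_eq_zeroE le_zero_eq)
   thus "p = 0" using F[OF p(1)] by simp
  qed
 next
  case (Suc n)
  show ?case
  proof (intro allI impI)
   fix p assume p: "poly p \<in> F" "degree p \<le> Suc n"
   have "deriv (poly p) = poly (pderiv p)" using poly_DERIV[of p] DERIV_imp_deriv by blast
   hence "poly (pderiv p) \<in> F" using F[OF p(1)] by simp
   moreover have "degree (pderiv p) \<le> n" using p(2) by (simp add: degree_pderiv)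
   ultimately have "pderiv p = 0" using Suc by blast
   then obtain c where "p = [:c:]" by (metis pderiv_iszero)
   thus "p = 0" using F[OF p(1)] by simp
  qed
 qed
 moreover obtain p where "f = poly p" using F[OF f] by (auto simp: polyfun_def)
 ultimately show ?thesis using f by fastforce
qed

lemma polyfun_eq_nat:
 assumes "polyfun f" "polyfun g" "!!n. f (of_nat n) = g (of_nat n)"
 shows "f s = g s"
proof -
 obtain p where p: "(%s. f s - g s) = poly p" using polyfun_diff[OF assms(1,2)] by (auto simp: polyfun_def)
 have "range of_nat \<subseteq> {s. poly p s = 0}" using assms(3) p[symmetric] by (auto simp: fun_eq_iff)
 moreover have "infinite (range (of_nat :: nat => complex))" by (simp add: range_inj_infinite inj_on_def)
 ultimately have "p = 0" using poly_roots_finite finite_subset by blast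
 thus ?thesis using fun_cong[OF p, of s] by simp
qed

lemma mat_space_simps [simp]:
 "carrier mat_space = UNIV" "x \<oplus>\<^bsub>mat_space\<^esub> y = x + y" "c \<odot>\<^bsub>mat_space\<^esub> x = mat_scale c x"
 by (simp_all add: mat_space_def)

lemma linear_form_mat_space:
 "linear_form mat_space l \<longleftrightarrow> (ALL A B. l (A + B) = l A + l B) & (ALL c A. l (mat_scale c A) = c * l A)"
 by (simp add: linear_form_def)

definition eunit :: "'n => 'n => complex ^ 'n ^ 'n" where
 "eunit i j = (\<chi> a b. if a = i & b = j then 1 else 0)"

lemma matrix_units: "A = (\<Sum>i\<in>UNIV. \<Sum>j\<in>UNIV. mat_scale (A $ i $ j) (eunit i j))"
proof -
 have "(\<Sum>i\<in>UNIV. \<Sum>j\<in>UNIV. A $ i $ j * (if a = i & b = j then 1 else 0)) = A $ a $ b" for a b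
 proof -
  have "(\<Sum>i\<in>UNIV. \<Sum>j\<in>UNIV. A $ i $ j * (if a = i & b = j then 1 else 0)) =
   (\<Sum>i\<in>UNIV. \<Sum>j\<in>UNIV. if b = j then (if a = i then A $ i $ j else 0) else 0)" by (intro sum.cong refl) auto
  also have "\<dots> = (\<Sum>i\<in>UNIV. if a = i then A $ i $ b else 0)" by (intro sum.cong refl) simp
  finally show ?thesis by simp
 qed
 thus ?thesis by (simp add: vec_eq_iff eunit_def)
qed

lemma linear_form_expand_mat:
 assumes l: "linear_form mat_space l"
 shows "l A = (\<Sum>i\<in>UNIV. \<Sum>j\<in>UNIV. A $ i $ j * l (eunit i j))"
proof -
 have z: "l 0 = 0" using l[unfolded linear_form_mat_space, THEN conjunct2, rule_format, of 0 0] by (simp add: vec_eq_iff[symmetric])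
 have s: "l (\<Sum>i\<in>I. f i) = (\<Sum>i\<in>I. l (f i))" for I :: "'a set" and f :: "'a => complex ^ 'a ^ 'a"
  by (induction I rule: infinite_finite_induct) (use l z in \<open>auto simp: linear_form_mat_space\<close>)
 have "l A = l (\<Sum>i\<in>UNIV. \<Sum>j\<in>UNIV. mat_scale (A $ i $ j) (eunit i j))" using matrix_units[of A] by simp
 thus ?thesis using l by (simp add: s linear_form_mat_space)
qed

lemma linear_form_entry: "linear_form mat_space (%A. A $ i $ j)" by (simp add: linear_form_mat_space)

lemma polyfun_polycurve:
 assumes "p \<in> mat_polys" "polycurve ga"
 shows "polyfun (%s. p (ga s))" using assms(1)
proof induction
 case (linear l)
 have "polyfun (%s. \<Sum>i\<in>UNIV. \<Sum>j\<in>UNIV. ga s $ i $ j * l (eunit i j))"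
  using assms(2) by (intro polyfun_sum polyfun_mult) (auto simp: polycurve_def)
 moreover have "(%s. l (ga s)) = (%s. \<Sum>i\<in>UNIV. \<Sum>j\<in>UNIV. ga s $ i $ j * l (eunit i j))"
  by (rule ext) (rule linear_form_expand_mat[OF linear])
 ultimately show ?case by simp
qed (auto intro: polyfun_add polyfun_mult)

section \<open>Directional derivatives, invariant vector fields and formal jets\<close>

definition der :: "(complex ^ 'n ^ 'n => complex) => complex ^ 'n ^ 'n => complex ^ 'n ^ 'n => complex" where
 "der p A X = deriv (%s. p (A + mat_scale s X)) 0"

lemma polycurve_line: "polycurve (%s. A + mat_scale s X)" by (auto simp: polycurve_def intro!: polyfun_add polyfun_mult)

lemma der_const [simp]: "der (%_. c) A X = 0" by (simp add: der_def)

lemma der_linear: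
 assumes "linear_form mat_space l" shows "der l A X = l X"
proof -
 have "(%s. l (A + mat_scale s X)) = (%s. l A + s * l X)" using assms by (simp add: linear_form_mat_space)
 thus ?thesis unfolding der_def by (auto intro!: DERIV_imp_deriv derivative_eq_intros)
qed

lemma chain_add:
 assumes "polyfun f" "polyfun g" shows "deriv (%s. f s + g s) s = deriv f s + deriv g s"
 by (rule DERIV_imp_deriv, rule DERIV_add) (use assms polyfun_has_derivative in auto)

lemma chain_mult:
 assumes "polyfun f" "polyfun g" shows "deriv (%s. f s * g s) s = deriv f s * g s + f s * deriv g s"
proof (rule DERIV_imp_deriv)
 have "((%s. f s * g s) has_field_derivative (deriv f s * g s + deriv g s * f s)) (at s)"
  by (rule DERIV_mult) (use assms polyfun_has_derivative in auto)
 thus "((%s. f s * g s) has_field_derivative (deriv f s * g s + f s * deriv g s)) (at s)" by (simp add: mult.commute)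
qed

lemma chain_sum:
 assumes "!!i. i \<in> I ==> polyfun (f i)" shows "deriv (%s. \<Sum>i\<in>I. f i s) s = (\<Sum>i\<in>I. deriv (f i) s)"
 by (rule DERIV_imp_deriv, rule DERIV_sum) (use assms polyfun_has_derivative in auto)

lemma der_add: "p \<in> mat_polys ==> q \<in> mat_polys ==> der (%A. p A + q A) A X = der p A X + der q A X"
 unfolding der_def by (rule chain_add) (auto intro: polyfun_polycurve polycurve_line)

lemma der_mult: "p \<in> mat_polys ==> q \<in> mat_polys ==>
  der (%A. p A * q A) A X = der p A X * q A + p A * der q A X"
proof -
 assume pq: "p \<in> mat_polys" "q \<in> mat_polys"
 have z: "A + mat_scale 0 X = A" by (simp add: vec_eq_iff)
 show ?thesis unfolding der_def
  using chain_mult[OF polyfun_polycurve[OF pq(1) polycurve_line[of A X]] polyfun_polycurve[OF pq(2) polycurve_line[of A X]], of 0] by (simp add: z)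
qed

lemma der_chain:
 assumes "p \<in> mat_polys" and ga: "polycurve ga"
 shows "deriv (%s. p (ga s)) s = der p (ga s) (cderiv ga s)" using assms(1)
proof induction
 case (linear l)
 have pe: "polyfun (%s. ga s $ i $ j)" for i j using ga by (simp add: polycurve_def)
 have "deriv (%s. \<Sum>i\<in>UNIV. \<Sum>j\<in>UNIV. ga s $ i $ j * l (eunit i j)) s =
   (\<Sum>i\<in>UNIV. \<Sum>j\<in>UNIV. deriv (%s. ga s $ i $ j * l (eunit i j)) s)"
  by (subst chain_sum, intro polyfun_sum polyfun_mult pe polyfun_const, intro sum.cong refl chain_sum polyfun_mult pe polyfun_const)
 also have "\<dots> = (\<Sum>i\<in>UNIV. \<Sum>j\<in>UNIV. cderiv ga s $ i $ j * l (eunit i j))"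
  by (intro sum.cong refl) (simp add: chain_mult[OF pe polyfun_const] cderiv_def)
 also have "\<dots> = l (cderiv ga s)" by (rule linear_form_expand_mat[OF linear, symmetric])
 also have "(%s. \<Sum>i\<in>UNIV. \<Sum>j\<in>UNIV. ga s $ i $ j * l (eunit i j)) = (%s. l (ga s))"
  by (rule ext) (rule linear_form_expand_mat[OF linear, symmetric])
 finally show ?case by (simp add: der_linear[OF linear])
next
 case (add p q)
 thus ?case using chain_add[OF polyfun_polycurve[OF add.hyps(1) ga] polyfun_polycurve[OF add.hyps(2) ga]] by (simp add: der_add)
next
 case (mult p q)
 thus ?case using chain_mult[OF polyfun_polycurve[OF mult.hyps(1) ga] polyfun_polycurve[OF mult.hyps(2) ga]] by (simp add: der_mult)
qed simp

lemma der_linear_arg: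
 assumes "p \<in> mat_polys"
 shows "der p A (X + Y) = der p A X + der p A Y" "der p A (mat_scale c X) = c * der p A X"
proof -
 have "der p A (X + Y) = der p A X + der p A Y & der p A (mat_scale c X) = c * der p A X" using assms
 proof induction
  case (linear l)
  thus ?case by (simp add: der_linear) (simp add: linear_form_mat_space)
 qed (simp_all add: der_add der_mult algebra_simps)
 thus "der p A (X + Y) = der p A X + der p A Y" "der p A (mat_scale c X) = c * der p A X" by auto
qed

lemma poly_funs_linear_map:
 assumes "p \<in> mat_polys" and L: "!!A B. L (A + B) = L A + L B" "!!c A. L (mat_scale c A) = mat_scale c (L A)"
 shows "(%A. p (L A)) \<in> mat_polys" and "der (%A. p (L A)) A X = der p (L A) (L X)"
proof -
 show "(%A. p (L A)) \<in> mat_polys" using assms(1)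
 proof induction
  case (linear l)
  hence "linear_form mat_space (%A. l (L A))" using L by (simp add: linear_form_mat_space)
  thus ?case by (rule poly_funs.linear)
 qed (auto intro: poly_funs.intros)
 show "der (%A. p (L A)) A X = der p (L A) (L X)" unfolding der_def by (simp add: L)
qed

text \<open>The left-invariant vector field belonging to \<open>X\<close>, acting on polynomial
  functions of matrices.\<close>

definition Dx :: "complex ^ 'n ^ 'n => (complex ^ 'n ^ 'n => complex) => complex ^ 'n ^ 'n => complex" where
 "Dx X p A = der p A (A ** X)"

lemma Dx_poly: "p \<in> mat_polys ==> Dx X p \<in> mat_polys"
proof (induction rule: poly_funs.induct)
 case (const c)
 have "Dx X (%_. c) = (%_. 0)" by (simp add: Dx_def fun_eq_iff)
 thus ?case by (simp add: poly_funs.const)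
next
 case (linear l)
 have "Dx X l = (%A. l (A ** X))" by (simp add: Dx_def der_linear[OF linear] fun_eq_iff)
 thus ?case using poly_funs_linear_map(1)[OF poly_funs.linear[OF linear], of "%A. A ** X"] by (simp add: matrix_add_rdistrib mat_scale_mult_left)
next
 case (add p q)
 have "Dx X (%A. p A + q A) = (%A. Dx X p A + Dx X q A)" using add by (simp add: Dx_def der_add fun_eq_iff)
 thus ?case using add by (simp add: poly_funs.add)
next
 case (mult p q)
 have "Dx X (%A. p A * q A) = (%A. Dx X p A * q A + p A * Dx X q A)" using mult by (simp add: Dx_def der_mult fun_eq_iff)
 thus ?case using mult by (simp add: poly_funs.add poly_funs.mult)
qed

lemma Dx_const: "Dx X (%_. c) = (%_. 0)" by (simp add: Dx_def fun_eq_iff)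

lemma Dx_add: "p \<in> mat_polys ==> q \<in> mat_polys ==>
  Dx X (%A. p A + q A) = (%A. Dx X p A + Dx X q A)" by (simp add: Dx_def der_add fun_eq_iff)

text \<open>The formal Taylor series of \<open>p\<close> along \<open>exp (s X)\<close> at
  \<open>s = 0\<close>. It makes sense before \<open>X\<close> is known to be nilpotent, which is
  exactly when it is needed.\<close>

definition jet :: "complex ^ 'n ^ 'n => (complex ^ 'n ^ 'n => complex) => complex fps" where
 "jet X p = Abs_fps (%k. (Dx X ^^ k) p (mat 1) / fact k)"

lemma jet_Suc: "of_nat (Suc k) * fps_nth (jet X p) (Suc k) = fps_nth (jet X (Dx X p)) k"
 by (simp add: jet_def funpow_Suc_right field_simps del: funpow.simps of_nat_Suc fact_Suc) (simp add: fact_Suc)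

lemma Dx_poly_iter: "p \<in> mat_polys ==> (Dx X ^^ k) p \<in> mat_polys" by (induction k) (auto intro: Dx_poly)

lemma jet_add:
 assumes "p \<in> mat_polys" "q \<in> mat_polys"
 shows "jet X (%A. p A + q A) = jet X p + jet X q"
proof -
 have "(Dx X ^^ k) (%A. p A + q A) = (%A. (Dx X ^^ k) p A + (Dx X ^^ k) q A)" for k
 proof (induction k)
  case (Suc k)
  thus ?case using Dx_add[OF Dx_poly_iter[OF assms(1), where X = X and k = k] Dx_poly_iter[OF assms(2), where X = X and k = k], of X] by simp
 qed simp
 thus ?thesis by (simp add: jet_def fps_eq_iff add_divide_distrib)
qed

text \<open>Formal differentiation of a jet corresponds to applying \<open>Dx X\<close>, and both
  satisfy the product rule. So the coefficient of order \<open>k + 1\<close> follows from the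
  coefficients of order \<open>k\<close> of the derivatives.\<close>

lemma jet_mult_nth:
 assumes "p \<in> mat_polys" "q \<in> mat_polys"
 shows "fps_nth (jet X (%A. p A * q A)) k = fps_nth (jet X p * jet X q) k" using assms
proof (induction k arbitrary: p q)
 case 0
 thus ?case by (simp add: jet_def)
next
 case (Suc k)
 have D: "Dx X p \<in> mat_polys" "Dx X q \<in> mat_polys" using Suc.prems Dx_poly by auto
 have dj: "fps_deriv (jet X r) = jet X (Dx X r)" for r using jet_Suc[of _ X r] by (simp add: fps_eq_iff)
 have "of_nat (Suc k) * fps_nth (jet X (%A. p A * q A)) (Suc k) = fps_nth (jet X (Dx X (%A. p A * q A))) k" by (rule jet_Suc)
 also have "Dx X (%A. p A * q A) = (%A. Dx X p A * q A + p A * Dx X q A)" using Suc.prems by (simp add: Dx_def der_mult fun_eq_iff)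
 also have "fps_nth (jet X (%A. Dx X p A * q A + p A * Dx X q A)) k =
   fps_nth (jet X (%A. Dx X p A * q A) + jet X (%A. p A * Dx X q A)) k" using Suc.prems D by (subst jet_add) (auto intro: poly_funs.mult)
 also have "\<dots> = fps_nth (jet X (Dx X p) * jet X q + jet X p * jet X (Dx X q)) k" using Suc D by simp
 also have "jet X (Dx X p) * jet X q + jet X p * jet X (Dx X q) = fps_deriv (jet X p * jet X q)" by (simp add: dj add.commute)
 also have "fps_nth (fps_deriv (jet X p * jet X q)) k = of_nat (Suc k) * fps_nth (jet X p * jet X q) (Suc k)"
  by (simp only: fps_deriv_nth Suc_eq_plus1)
 finally show ?case by (simp del: of_nat_Suc)
qed

lemma jet_mult:
 "p \<in> mat_polys ==> q \<in> mat_polys ==> jet X (%A. p A * q A) = jet X p * jet X q" by (rule fps_ext) (rule jet_mult_nth)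

lemma jet_sum:
 assumes "finite I" "!!i. i \<in> I ==> p i \<in> mat_polys"
 shows "jet X (%A. \<Sum>i\<in>I. p i A) = (\<Sum>i\<in>I. jet X (p i))" using assms
proof (induction I rule: finite_induct)
 case empty
 have "(Dx X ^^ k) (%_. 0) = (%_. 0)" for k by (induction k) (simp_all add: Dx_const)
 thus ?case by (simp add: jet_def fps_eq_iff)
next
 case (insert i I)
 thus ?case by (simp add: jet_add poly_funs_sum)
qed

lemma power_entry_poly: "(%A. mpow (A - mat 1) m $ i $ j) \<in> mat_polys"
proof (induction m arbitrary: i j)
 case 0
 show ?case by (simp add: poly_funs.const)
next
 case (Suc m)
 have "(%A. (A - mat 1) $ l $ j) \<in> mat_polys" for l
  using poly_funs.add[OF poly_funs.linear[OF linear_form_entry] poly_funs.const, of l j "- (mat 1 $ l $ j)"] by simp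
 thus ?case unfolding mpow_Suc matrix_matrix_mult_def vec_lambda_beta by (intro poly_funs_sum poly_funs.mult Suc finite)
qed

text \<open>Formally \<open>exp (s X)\<close> minus the identity starts with \<open>s X\<close>, so
  its power \<open>m\<close> starts with the power \<open>m\<close> of \<open>X\<close>. This lets
  equations of the group detect the nilpotency of tangent vectors.\<close>

lemma jet_power_entry:
 "(k < m --> fps_nth (jet X (%A. mpow (A - mat 1) m $ i $ j)) k = 0) &
 fps_nth (jet X (%A. mpow (A - mat 1) m $ i $ j)) m = mpow X m $ i $ j"
proof (induction m arbitrary: i j k)
 case 0
 show ?case by (simp add: jet_def)
next
 case (Suc m)
 let ?P = "%m i j A. mpow (A - mat 1) m $ i $ j"
 have P1: "(%A. (A - mat 1) $ l $ j) \<in> mat_polys" for l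
  using poly_funs.add[OF poly_funs.linear[OF linear_form_entry] poly_funs.const, of l j "- (mat 1 $ l $ j)"] by simp
 have e: "?P (Suc m) i j = (%A. \<Sum>l\<in>UNIV. ?P m i l A * (A - mat 1) $ l $ j)" by (simp add: mpow_Suc matrix_matrix_mult_def)
 have J: "jet X (?P (Suc m) i j) = (\<Sum>l\<in>UNIV. jet X (?P m i l) * jet X (%A. (A - mat 1) $ l $ j))"
 proof -
  have "jet X (?P (Suc m) i j) = (\<Sum>l\<in>UNIV. jet X (%A. ?P m i l A * (A - mat 1) $ l $ j))"
   unfolding e by (rule jet_sum) (intro finite, rule poly_funs.mult[OF power_entry_poly P1])
  also have "\<dots> = (\<Sum>l\<in>UNIV. jet X (?P m i l) * jet X (%A. (A - mat 1) $ l $ j))"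
   by (intro sum.cong refl jet_mult[OF power_entry_poly P1])
  finally show ?thesis .
 qed
 have j0: "fps_nth (jet X (%A. (A - mat 1) $ l $ j)) 0 = 0" for l by (simp add: jet_def)
 have j1: "fps_nth (jet X (%A. (A - mat 1) $ l $ j)) (Suc 0) = X $ l $ j" for l
 proof -
  have "der (%A. (A - mat 1) $ l $ j) A Y = Y $ l $ j" for A Y
   using der_add[OF poly_funs.linear[OF linear_form_entry] poly_funs.const, of l j "- (mat 1 $ l $ j)" A Y]
    der_linear[OF linear_form_entry, of l j A Y] by simp
  thus ?thesis by (simp add: jet_def Dx_def)
 qed
 have term0: "fps_nth (jet X (?P m i l) * jet X (%A. (A - mat 1) $ l $ j)) k = 0" if "k < Suc m" for k l unfolding fps_mult_nth
 proof (rule sum.neutral, intro ballI)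
  fix a assume "a \<in> {0..k}"
  thus "fps_nth (jet X (?P m i l)) a * fps_nth (jet X (%A. (A - mat 1) $ l $ j)) (k - a) = 0" using that Suc[of a i l] j0 by (cases "a < m") auto
 qed
 have term1: "fps_nth (jet X (?P m i l) * jet X (%A. (A - mat 1) $ l $ j)) (Suc m) = mpow X m $ i $ l * X $ l $ j" for l
 proof -
  have "fps_nth (jet X (?P m i l) * jet X (%A. (A - mat 1) $ l $ j)) (Suc m) =
   (\<Sum>a\<in>{m}. fps_nth (jet X (?P m i l)) a * fps_nth (jet X (%A. (A - mat 1) $ l $ j)) (Suc m - a))" unfolding fps_mult_nth
  proof (rule sum.mono_neutral_right)
   show "ALL a:{0..Suc m} - {m}. fps_nth (jet X (?P m i l)) a * fps_nth (jet X (%A. (A - mat 1) $ l $ j)) (Suc m - a) = 0"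
   proof
    fix a assume "a \<in> {0..Suc m} - {m}"
    then consider "a < m" | "a = Suc m" by fastforce
    thus "fps_nth (jet X (?P m i l)) a * fps_nth (jet X (%A. (A - mat 1) $ l $ j)) (Suc m - a) = 0" using Suc[of a i l] j0 by cases auto
   qed
  qed auto
  thus ?thesis using Suc[of _ i l] j1 by simp
 qed
 show ?case unfolding J fps_sum_nth using term0 term1 by (auto simp: mpow_Suc matrix_matrix_mult_def)
qed

section \<open>Exponentials and one-parameter groups as polynomial flows\<close>

lemma polycurve_mult: "polycurve ga ==> polycurve dl ==> polycurve (%s. ga s ** dl s)"
 unfolding polycurve_def matrix_matrix_mult_def by (auto intro!: polyfun_sum polyfun_mult)

lemma polycurve_const [simp]: "polycurve (%_. A)" by (simp add: polycurve_def)

lemma polycurve_entry: "polycurve ga ==> polyfun (%s. ga s $ i $ j)" by (simp add: polycurve_def)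

lemma cderiv_const [simp]: "cderiv (%_. A) s = 0" by (simp add: cderiv_def vec_eq_iff)

lemma cderiv_mult:
 assumes "polycurve ga" "polycurve dl"
 shows "cderiv (%s. ga s ** dl s) s = cderiv ga s ** dl s + ga s ** cderiv dl s"
proof -
 have "deriv (%s. \<Sum>l\<in>UNIV. ga s $ i $ l * dl s $ l $ j) s =
   (\<Sum>l\<in>UNIV. deriv (%s. ga s $ i $ l) s * dl s $ l $ j + ga s $ i $ l * deriv (%s. dl s $ l $ j) s)" for i j
  using assms by (subst chain_sum) (auto intro!: polyfun_mult sum.cong chain_mult simp: polycurve_entry)
 thus ?thesis by (simp add: cderiv_def matrix_matrix_mult_def vec_eq_iff sum.distrib)
qed

lemma polycurve_compose_affine:
 assumes "polycurve ga" shows "polycurve (%s. ga (a * s + b))" unfolding polycurve_def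
proof (intro allI)
 fix i j
 obtain p where "(%s. ga s $ i $ j) = poly p" using assms by (auto simp: polycurve_def polyfun_def)
 hence "ga s $ i $ j = poly p s" for s by metis
 thus "polyfun (%s. ga (a * s + b) $ i $ j)" using polyfun_compose[of "%s. a * s + b" p] by (simp add: polyfun_add polyfun_mult)
qed

lemma deriv_shift:
 assumes "polyfun f" shows "deriv (%s. f (a * s + b)) s = a * deriv f (a * s + b)"
proof (rule DERIV_imp_deriv)
 have "((%s. f (a * s + b)) has_field_derivative deriv f (a * s + b) * a) (at s)"
  by (rule DERIV_chain2[OF polyfun_has_derivative[OF assms]]) (auto intro!: derivative_eq_intros)
 thus "((%s. f (a * s + b)) has_field_derivative a * deriv f (a * s + b)) (at s)" by (simp add: mult.commute)
qed

lemma cderiv_shift: "polycurve ga ==> cderiv (%s. ga (a * s + b)) s = mat_scale a (cderiv ga (a * s + b))"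
 using deriv_shift[OF polycurve_entry, of ga] by (simp add: cderiv_def vec_eq_iff)

lemma mexp_0 [simp]: "mexp 0 = (mat 1 :: complex ^ 'n ^ 'n)"
proof -
 have "mpow (0 :: complex ^ 'n ^ 'n) (Suc 0) = 0" by simp
 from mexp_eq[OF this] show ?thesis by (simp add: vec_eq_iff)
qed

text \<open>The entries of the differences, multiplied on the right by all powers of
  \<open>X\<close>, form a family that is closed under differentiation and vanishes at 0.\<close>

lemma flow_unique:
 assumes "polycurve ga" "polycurve dl" "!!s. cderiv ga s = ga s ** X" "!!s. cderiv dl s = dl s ** X" "ga 0 = dl 0"
 shows "ga s = dl s"
proof -
 let ?F = "{%s. (ga s ** mpow X k) $ i $ j - (dl s ** mpow X k) $ i $ j |k i j. True}"
 have z: "f s = 0" if "f \<in> ?F" for f s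
 proof (rule polyfun_zero_by_derivatives[OF _ that])
  fix f assume "f \<in> ?F"
  then obtain k i j where f: "f = (%s. (ga s ** mpow X k) $ i $ j - (dl s ** mpow X k) $ i $ j)" by blast
  have p: "polycurve (%s. ga s ** mpow X k)" "polycurve (%s. dl s ** mpow X k)" using assms by (auto intro: polycurve_mult)
  have d: "deriv (%s. (ga s ** mpow X k) $ i $ j) s = (ga s ** mpow X (Suc k)) $ i $ j"
   "deriv (%s. (dl s ** mpow X k) $ i $ j) s = (dl s ** mpow X (Suc k)) $ i $ j" for s
   using arg_cong[OF cderiv_mult[OF assms(1) polycurve_const, of "mpow X k" s], of "%A. A $ i $ j"]
    arg_cong[OF cderiv_mult[OF assms(2) polycurve_const, of "mpow X k" s], of "%A. A $ i $ j"] assms(3,4)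
   by (simp_all add: cderiv_def matrix_mul_assoc[symmetric] mpow_Suc2)
  have "deriv f = (%s. (ga s ** mpow X (Suc k)) $ i $ j - (dl s ** mpow X (Suc k)) $ i $ j)"
  proof
   fix s
   have "(f has_field_derivative (deriv (%s. (ga s ** mpow X k) $ i $ j) s - deriv (%s. (dl s ** mpow X k) $ i $ j) s)) (at s)"
    unfolding f by (intro DERIV_diff polyfun_has_derivative polycurve_entry p)
   thus "deriv f s = (ga s ** mpow X (Suc k)) $ i $ j - (dl s ** mpow X (Suc k)) $ i $ j" using d DERIV_imp_deriv by metis
  qed
  hence "deriv f \<in> ?F" by blast
  moreover have "polyfun f" unfolding f by (intro polyfun_diff polycurve_entry p)
  ultimately show "polyfun f & f 0 = 0 & deriv f \<in> ?F" using assms(5) by (simp add: f)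
 qed
 have "(ga s ** mpow X 0) $ i $ j - (dl s ** mpow X 0) $ i $ j = 0" for i j
  by (rule z[of "%s. (ga s ** mpow X 0) $ i $ j - (dl s ** mpow X 0) $ i $ j"]) blast
 thus ?thesis by (simp add: vec_eq_iff)
qed

context
 fixes X :: "complex ^ 'n ^ 'n" and K
 assumes nil: "mpow X K = 0"
begin

lemma mexp_curve_entry: "mexp (mat_scale s X) $ i $ j = (\<Sum>k<K. s ^ k * (mpow X k $ i $ j / fact k))"
 unfolding mexp_scale_eq[OF nil] by (simp add: sum_component)

lemma mexp_polycurve: "polycurve (%s. mexp (mat_scale s X))"
 unfolding polycurve_def mexp_curve_entry by (intro allI polyfun_sum polyfun_mult polyfun_power) auto

lemma mexp_cderiv: "cderiv (%s. mexp (mat_scale s X)) s = mexp (mat_scale s X) ** X"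
proof -
 have nil': "mpow X (Suc K) = 0" using mpow_zero_mono[OF nil] by simp
 have "deriv (%s. mexp (mat_scale s X) $ i $ j) s = (\<Sum>k<K. s ^ k * (mpow X (Suc k) $ i $ j / fact k))" for i j
 proof -
  have e: "(%s. mexp (mat_scale s X) $ i $ j) = (%s. \<Sum>k<Suc K. s ^ k * (mpow X k $ i $ j / fact k))"
   unfolding mexp_scale_eq[OF nil'] by (simp add: sum_component)
  have "((%s. \<Sum>k<Suc K. s ^ k * (mpow X k $ i $ j / fact k)) has_field_derivative
    (\<Sum>k<Suc K. of_nat k * s ^ (k - 1) * (mpow X k $ i $ j / fact k))) (at s)" by (rule DERIV_sum) (auto intro!: derivative_eq_intros)
  from DERIV_imp_deriv[OF this] have "deriv (%s. mexp (mat_scale s X) $ i $ j) s =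
    (\<Sum>k<Suc K. of_nat k * s ^ (k - 1) * (mpow X k $ i $ j / fact k))" unfolding e .
  also have "(\<Sum>k<Suc K. of_nat k * s ^ (k - 1) * (mpow X k $ i $ j / fact k)) =
    (\<Sum>k<K. s ^ k * (mpow X (Suc k) $ i $ j / fact k))"
   by (subst sum.lessThan_Suc_shift) (auto intro!: sum.cong simp: field_simps simp del: of_nat_Suc)
  finally show ?thesis .
 qed
 moreover have "(mexp (mat_scale s X) ** X) $ i $ j = (\<Sum>k<K. s ^ k * (mpow X (Suc k) $ i $ j / fact k))" for i j
  unfolding mexp_scale_eq[OF nil] matrix_sum_left by (simp add: mat_scale_mult_left mpow_Suc sum_component)
 ultimately show ?thesis by (simp add: cderiv_def vec_eq_iff)
qed

lemma mexp_add: "mexp (mat_scale (r + s) X) = mexp (mat_scale r X) ** mexp (mat_scale s X)"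
proof (rule flow_unique[where ga = "%s. mexp (mat_scale (r + s) X)" and dl = "%s. mexp (mat_scale r X) ** mexp (mat_scale s X)" and X = X])
 show "polycurve (%s. mexp (mat_scale (r + s) X))" using polycurve_compose_affine[OF mexp_polycurve, of 1 r] by (simp add: add.commute)
 show "cderiv (%s. mexp (mat_scale (r + s) X)) s = mexp (mat_scale (r + s) X) ** X" for s
  using cderiv_shift[OF mexp_polycurve, of 1 r s] by (simp add: add.commute mexp_cderiv vec_eq_iff)
 show "cderiv (%s. mexp (mat_scale r X) ** mexp (mat_scale s X)) s = mexp (mat_scale r X) ** mexp (mat_scale s X) ** X" for s
  by (subst cderiv_mult) (simp_all add: mexp_polycurve mexp_cderiv matrix_mul_assoc)
qed (auto intro: polycurve_mult mexp_polycurve)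

lemma mexp_inverse: "mexp (mat_scale s X) ** mexp (mat_scale (- s) X) = mat 1" using mexp_add[of s "- s"] by simp

end

text \<open>The homomorphism property gives the flow equation with generator \<open>X\<close>. The
  entries of \<open>ga s\<close> times the power \<open>k\<close> of \<open>X\<close> are then the
  derivatives of order \<open>k\<close> of polynomials, so they vanish for large \<open>k\<close>;
  at \<open>s = 0\<close> this is nilpotency. The exponential formula is uniqueness of the
  flow.\<close>

lemma one_parameter_group:
 assumes ga: "polycurve ga" and hom: "!!s r. ga (s + r) = ga s ** ga r" and one: "ga 0 = mat 1"
 shows "EX K. mpow (cderiv ga 0) K = 0" and "ga s = mexp (mat_scale s (cderiv ga 0))"
proof -
 define X where "X = cderiv ga 0"
 have D: "cderiv ga s = ga s ** X" for s
 proof -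
  have "cderiv (%r. ga (1 * r + s)) 0 = mat_scale 1 (cderiv ga (1 * 0 + s))" by (rule cderiv_shift[OF ga])
  moreover have "(%r. ga (1 * r + s)) = (%r. ga s ** ga r)" by (rule ext) (simp only: mult_1_left add.commute[of _ s] hom)
  moreover have "cderiv (%r. ga s ** ga r) 0 = ga s ** X" by (subst cderiv_mult) (auto simp: ga X_def)
  ultimately show ?thesis by simp
 qed
 define P where "P i j = (SOME p. (%s. ga s $ i $ j) = poly p)" for i j
 have P: "ga s $ i $ j = poly (P i j) s" for i j s
 proof -
  have "EX p. (%s. ga s $ i $ j) = poly p" using ga by (auto simp: polycurve_def polyfun_def)
  from fun_cong[OF someI_ex[OF this], of s] show ?thesis by (simp add: P_def)
 qed
 have it: "(ga s ** mpow X k) $ i $ j = poly ((pderiv ^^ k) (P i j)) s" for k i j s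
 proof (induction k arbitrary: s)
  case 0
  show ?case by (simp add: P)
 next
  case (Suc k)
  have p: "polycurve (%s. ga s ** mpow X k)" by (intro polycurve_mult ga) simp
  have "deriv (%s. (ga s ** mpow X k) $ i $ j) s = cderiv (%s. ga s ** mpow X k) s $ i $ j" by (simp add: cderiv_def)
  also have "cderiv (%s. ga s ** mpow X k) s = ga s ** mpow X (Suc k)"
   by (simp add: cderiv_mult[OF ga polycurve_const] D matrix_mul_assoc[symmetric] mpow_Suc2)
  finally have "deriv (%s. (ga s ** mpow X k) $ i $ j) s = (ga s ** mpow X (Suc k)) $ i $ j" .
  moreover have "(%s. (ga s ** mpow X k) $ i $ j) = poly ((pderiv ^^ k) (P i j))" using Suc by (simp add: fun_eq_iff)
  moreover have "deriv (poly ((pderiv ^^ k) (P i j))) s = poly ((pderiv ^^ Suc k) (P i j)) s" by (simp add: DERIV_imp_deriv[OF poly_DERIV])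
  ultimately show ?case by simp
 qed
 have pd: "(pderiv ^^ Suc (degree p)) p = 0" for p :: "complex poly"
 proof -
  have "degree ((pderiv ^^ k) p) \<le> degree p - k" for k by (induction k) (auto simp: degree_pderiv)
  hence "degree ((pderiv ^^ degree p) p) = 0" by (metis diff_self_eq_0 le_zero_eq)
  hence "pderiv ((pderiv ^^ degree p) p) = 0" by (metis degree_eq_zeroE pderiv_pCons pderiv_0 add_0 pCons_0_0 pderiv_singleton)
  thus ?thesis by simp
 qed
 have pdz: "(pderiv ^^ k) p = 0" if "Suc (degree p) \<le> k" for k and p :: "complex poly"
 proof -
  have "(pderiv ^^ k) p = (pderiv ^^ (k - Suc (degree p))) ((pderiv ^^ Suc (degree p)) p)"
   using that by (metis funpow_add comp_apply le_add_diff_inverse2)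
  also have "\<dots> = 0" unfolding pd
  proof -
   show "(pderiv ^^ m) (0 :: complex poly) = 0" for m by (induction m) simp_all
  qed
  finally show ?thesis .
 qed
 \<comment> \<open>One more than the largest degree among the entries of the curve.\<close>
 let ?K = "Max (range (%(i, j). Suc (degree (P i j))))"
 have "Suc (degree (P i j)) \<le> ?K" for i j by (rule Max_ge) (auto intro!: image_eqI[of _ _ "(i, j)"])
 hence "(ga 0 ** mpow X ?K) $ i $ j = 0" for i j using pdz it by simp
 hence K: "mpow X ?K = 0" by (simp add: one vec_eq_iff)
 thus "EX K. mpow (cderiv ga 0) K = 0" unfolding X_def by blast
 show "ga s = mexp (mat_scale s (cderiv ga 0))" unfolding X_def[symmetric]
  by (rule flow_unique[OF ga mexp_polycurve[OF K] D mexp_cderiv[OF K]]) (simp add: one)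
qed

text \<open>Take a global presentation with denominator of least degree. A nonconstant denominator
  has a root over the complex numbers; the local presentation at this root shows that the numerator
  vanishes there too, so a linear factor cancels.\<close>

lemma polyfun_local_quotient:
 assumes loc: "!!s0. EX P Q. poly Q s0 ~= 0 & (ALL s. poly Q s ~= 0 --> h s = poly P s / poly Q s)"
 shows "polyfun h"
proof -
 let ?ok = "%(P, Q). Q ~= 0 & (ALL s. poly Q s ~= 0 --> h s = poly P s / poly Q s)"
 obtain P0 Q0 where "poly Q0 0 ~= 0" "ALL s. poly Q0 s ~= 0 --> h s = poly P0 s / poly Q0 s" using loc[of 0] by blast
 hence "?ok (P0, Q0)" by auto
 from ex_has_least_nat[of ?ok "(P0, Q0)" "%PQ. degree (snd PQ)", OF this]
 obtain PQ where PQ: "?ok PQ" and min0: "ALL PQ'. ?ok PQ' --> degree (snd PQ) \<le> degree (snd PQ')" by (elim exE conjE)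
 note min = min0[rule_format]
 obtain P Q where e: "PQ = (P, Q)" by (cases PQ)
 have Q: "Q ~= 0" and hPQ: "!!s. poly Q s ~= 0 ==> h s = poly P s / poly Q s" using PQ e by auto
 have "constant (poly Q)"
 proof (rule ccontr)
  assume "\<not> constant (poly Q)"
  then obtain s0 where s0: "poly Q s0 = 0" using fundamental_theorem_of_algebra by blast
  obtain P1 Q1 where 1: "poly Q1 s0 ~= 0" "!!s. poly Q1 s ~= 0 ==> h s = poly P1 s / poly Q1 s" using loc by blast
  have eq: "P * Q1 = P1 * Q"
  proof -
   have "poly (Q * Q1 * (P * Q1 - P1 * Q)) s = 0" for s
   proof (cases "poly Q s = 0 \<or> poly Q1 s = 0")
    case False
    hence "poly P s / poly Q s = poly P1 s / poly Q1 s" using hPQ[of s] 1(2)[of s] by simp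
    hence "poly P s * poly Q1 s = poly P1 s * poly Q s" using False by (simp add: frac_eq_eq)
    thus ?thesis by simp
   qed auto
   hence "Q * Q1 * (P * Q1 - P1 * Q) = 0" using poly_all_0_iff_0 by blast
   moreover have "Q1 ~= 0" using 1(1) by auto
   ultimately show ?thesis using Q by simp
  qed
  have "poly P s0 = 0" using arg_cong[OF eq, of "%p. poly p s0"] s0 1(1) by simp
  then obtain P' where P': "P = [:- s0, 1:] * P'" using poly_eq_0_iff_dvd by (metis dvdE)
  obtain Q' where Q': "Q = [:- s0, 1:] * Q'" using s0 poly_eq_0_iff_dvd by (metis dvdE)
  have Q'0: "Q' ~= 0" using Q Q' by auto
  have "[:- s0, 1:] * (P' * Q1) = [:- s0, 1:] * (P1 * Q')" using eq unfolding P' Q' by (simp only: ac_simps)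
  hence eq': "P' * Q1 = P1 * Q'" by (subst (asm) mult_cancel_left) auto
  have "h s = poly P' s / poly Q' s" if "poly Q' s ~= 0" for s
  proof (cases "s = s0")
   case True
   have "poly P' s * poly Q1 s = poly P1 s * poly Q' s" using arg_cong[OF eq', of "%p. poly p s"] by simp
   hence "poly P1 s / poly Q1 s = poly P' s / poly Q' s" using 1(1) True that by (subst frac_eq_eq) auto
   thus ?thesis using 1(2)[of s] 1(1) True by simp
  next
   case False
   hence "poly Q s ~= 0" using that by (simp add: Q')
   have l: "poly [:- s0, 1:] s ~= 0" using False by simp
   have "h s = (poly [:- s0, 1:] s * poly P' s) / (poly [:- s0, 1:] s * poly Q' s)"
    using hPQ[OF \<open>poly Q s \<noteq> 0\<close>] unfolding P' Q' poly_mult .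
   thus ?thesis using nonzero_mult_divide_mult_cancel_left[OF l] by (rule trans)
  qed
  hence "degree Q \<le> degree Q'" using min[of "(P', Q')"] Q'0 e by auto
  moreover have "degree Q = Suc (degree Q')" unfolding Q' using Q'0 by (subst degree_mult_eq) auto
  ultimately show False by simp
 qed
 hence "degree Q = 0" by (rule constant_degree[THEN iffD1])
 then obtain c where c: "Q = [:c:]" by (rule degree_eq_zeroE)
 hence "c ~= 0" using Q by simp
 hence "h = (%s. inverse c * poly P s)" using hPQ c by (auto simp: divide_inverse mult.commute)
 thus ?thesis by (simp add: polyfun_mult)
qed

lemma polyfun_prod: "(!!i. i \<in> I ==> polyfun (f i)) ==> polyfun (%t. \<Prod>i\<in>I. f i t)"
 by (induction I rule: infinite_finite_induct) (auto intro: polyfun_mult)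

section \<open>Complex powers of unipotent matrices\<close>

lemma mpow_binomial:
 assumes nil: "mpow N K = 0"
 shows "mpow (mat 1 + N) m = (\<Sum>k<K. mat_scale (of_nat (m choose k)) (mpow N k))"
proof (induction m)
 case 0
 show ?case
 proof (cases K)
  case 0
  have "(mat 1 :: complex ^ 'a ^ 'a) = 0" using nil 0 by simp
  thus ?thesis using 0 by simp
 next
  case (Suc K')
  show ?thesis unfolding Suc by (subst sum.lessThan_Suc_shift) (simp add: vec_eq_iff)
 qed
next
 case (Suc m)
 let ?c = "%m k. mat_scale (of_nat (m choose k)) (mpow N k)"
 have "mpow (mat 1 + N) (Suc m) = (\<Sum>k<K. ?c m k) + (\<Sum>k<K. mat_scale (of_nat (m choose k)) (mpow N (Suc k)))"
  by (simp add: mpow_Suc Suc matrix_add_ldistrib matrix_sum_left mat_scale_mult_left)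
 also have "(\<Sum>k<K. ?c m k) = (\<Sum>k<Suc K. ?c m k)" using nil by (simp add: vec_eq_iff)
 also have "\<dots> = mat 1 + (\<Sum>k<K. ?c m (Suc k))" by (subst sum.lessThan_Suc_shift) (simp add: vec_eq_iff)
 also have "mat 1 + (\<Sum>k<K. ?c m (Suc k)) + (\<Sum>k<K. mat_scale (of_nat (m choose k)) (mpow N (Suc k))) =
   mat 1 + (\<Sum>k<K. ?c (Suc m) (Suc k))" unfolding add.assoc sum.distrib[symmetric]
  by (intro arg_cong2[of _ _ _ _ "(+)"] refl sum.cong) (simp add: vec_eq_iff distrib_right)
 also have "\<dots> = (\<Sum>k<Suc K. ?c (Suc m) k)" unfolding sum.lessThan_Suc_shift by (simp add: vec_eq_iff)
 also have "\<dots> = (\<Sum>k<K. ?c (Suc m) k)" using nil by (simp add: vec_eq_iff)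
 finally show ?case .
qed

text \<open>The binomial series for the power \<open>s\<close> of \<open>A\<close>. Truncation at
  the matrix size is exact for unipotent \<open>A\<close>, and the result is polynomial in
  \<open>s\<close>.\<close>

definition upow :: "complex ^ 'n ^ 'n => complex => complex ^ 'n ^ 'n" where
 "upow A s = (\<Sum>k<CARD('n). mat_scale (s gchoose k) (mpow (A - mat 1) k))"

lemma upow_polycurve: "polycurve (upow A)"
proof -
 have "polyfun (%s. s gchoose k)" for k unfolding gbinomial_prod_rev divide_inverse
  by (intro polyfun_mult polyfun_prod polyfun_diff polyfun_id polyfun_const)
 thus ?thesis unfolding polycurve_def upow_def by (auto simp: sum_component intro!: polyfun_sum polyfun_mult)
qed

lemma upow_nat:
 fixes A :: "complex ^ 'n ^ 'n"
 assumes "mpow (A - mat 1) m = 0"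
 shows "upow A (of_nat n) = mpow A n" using mpow_binomial[OF nilpotent_index[OF assms], of n] by (simp add: upow_def binomial_gbinomial)

text \<open>Both sides are polynomial in each exponent and agree on natural numbers; the identity is
  extended to complex values one variable at a time.\<close>

lemma upow_add:
 assumes "mpow (A - mat 1) m = 0"
 shows "upow A (s + r) = upow A s ** upow A r"
proof -
 have 1: "upow A (s + of_nat n) = upow A s ** upow A (of_nat n)" for s n
 proof -
  have "upow A (s + of_nat n) $ i $ j = (upow A s ** upow A (of_nat n)) $ i $ j" for i j
  proof (rule polyfun_eq_nat[where f = "%s. upow A (s + of_nat n) $ i $ j" and g = "%s. (upow A s ** upow A (of_nat n)) $ i $ j"])
   show "polyfun (%s. upow A (s + of_nat n) $ i $ j)"
    using polycurve_entry[OF polycurve_compose_affine[OF upow_polycurve, of A 1 "of_nat n"]] by simp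
   show "polyfun (%s. (upow A s ** upow A (of_nat n)) $ i $ j)" by (intro polycurve_entry polycurve_mult upow_polycurve polycurve_const)
   show "upow A (of_nat k + of_nat n) $ i $ j = (upow A (of_nat k) ** upow A (of_nat n)) $ i $ j" for k
    using upow_nat[OF assms, of "k + n"] by (simp add: upow_nat[OF assms] mpow_add)
  qed
  thus ?thesis by (simp add: vec_eq_iff)
 qed
 have "upow A (s + r) $ i $ j = (upow A s ** upow A r) $ i $ j" for i j
 proof (rule polyfun_eq_nat[where f = "%r. upow A (s + r) $ i $ j" and g = "%r. (upow A s ** upow A r) $ i $ j"])
  show "polyfun (%r. upow A (s + r) $ i $ j)"
   using polycurve_entry[OF polycurve_compose_affine[OF upow_polycurve, of A 1 s]] by (simp add: add.commute)
  show "polyfun (%r. (upow A s ** upow A r) $ i $ j)" by (intro polycurve_entry polycurve_mult upow_polycurve polycurve_const)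
 qed (simp add: 1)
 thus ?thesis by (simp add: vec_eq_iff)
qed

text \<open>Difference quotients of the curve stay in the subspace, and a subspace of a finite
  dimensional space is closed.\<close>

lemma cderiv_in_subspace:
 fixes S :: "(complex ^ 'n ^ 'n) set"
 assumes add: "!!A B. A \<in> S ==> B \<in> S ==> A + B \<in> S" and scale: "!!c A. A \<in> S ==> mat_scale c A \<in> S"
  and ga: "polycurve ga" "!!s. ga s \<in> S"
 shows "cderiv ga 0 \<in> S"
proof -
 have sc: "r *\<^sub>R A = mat_scale (of_real r) A" for r and A :: "complex ^ 'n ^ 'n"
  unfolding vec_eq_iff by (simp add: scaleR_conv_of_real[where 'a = complex])
 have "subspace S" using add scale scale[OF ga(2), of 0 0] by (auto simp: subspace_def sc)
 hence "closed S" by (rule closed_subspace)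
 let ?d = "%h. mat_scale (1 / h) (ga h - ga 0)"
 have "((%h. ?d h $ i $ j) \<longlongrightarrow> cderiv ga 0 $ i $ j) (at 0)" for i j
  using polyfun_has_derivative[OF polycurve_entry[OF ga(1)], of i j 0]
  by (simp add: cderiv_def DERIV_def divide_inverse mult.commute del: mats.scale_minus_left)
 hence "(?d \<longlongrightarrow> cderiv ga 0) (at 0)" by (intro vec_tendstoI)
 thus ?thesis
  by (rule Lim_in_closed_set[OF \<open>closed S\<close> always_eventually, rotated 2]) (simp_all add: scale ga(2) subspace_diff[OF \<open>subspace S\<close>])
qed

section \<open>Representations of unipotent groups\<close>

lemma matrix_inv_mult:
 fixes A :: "complex ^ 'n ^ 'n"
 assumes "invertible A" shows "A ** matrix_inv A = mat 1 & matrix_inv A ** A = mat 1"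
 unfolding matrix_inv_def by (rule someI_ex) (use assms in \<open>simp add: invertible_def\<close>)

lemma matrix_inv_eqI:
 fixes A :: "complex ^ 'n ^ 'n"
 assumes "A ** B = mat 1" "B ** A = mat 1" shows "matrix_inv A = B"
proof -
 have "invertible A" using assms by (auto simp: invertible_def)
 hence "matrix_inv A ** A = mat 1" using matrix_inv_mult by blast
 hence "matrix_inv A ** (A ** B) = B" by (simp add: matrix_mul_assoc)
 thus ?thesis using assms by simp
qed

locale unipotent_rep =
 fixes G :: "(complex ^ 'n ^ 'n) set" and \<rho> :: "complex ^ 'n ^ 'n => complex ^ 'm ^ 'm"
 assumes unip: "unipotent_group G" and rat: "rational_rep G \<rho>"
begin

definition vanishing :: "(complex ^ 'n ^ 'n => complex) set" where
 "vanishing = {p \<in> mat_polys. ALL A:G. p A = 0}"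

lemma lie_iff: "X \<in> lie_algebra G \<longleftrightarrow> (ALL p:vanishing. der p (mat 1) X = 0)"
 unfolding lie_algebra_def der_def vanishing_def by blast

text \<open>The group is closed relative to the invertible matrices, hence the assumption on
  \<open>A\<close>. A basic open neighbourhood of a point outside that avoids the group would
  provide an equation of the group that does not vanish at the point.\<close>

lemma G_closed:
 assumes "invertible A" "!!p. p \<in> vanishing ==> p A = 0"
 shows "A \<in> G"
proof (rule ccontr)
 assume A: "A \<notin> G"
 let ?Z = "{A :: complex ^ 'n ^ 'n. invertible A}"
 interpret gfun "%_. mat_polys" ?Z by (rule gfun_poly_funs)
 have "closedin (gtop (%_. mat_polys) ?Z) G" using unip by (simp add: unipotent_group_def affine_space_on_eq)
 hence "openin (gtop (%_. mat_polys) ?Z) (?Z - G)" by (simp add: closedin_def)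
 then obtain h where h: "h \<in> mat_polys" "h A ~= 0" "ALL y:?Z. h y ~= 0 --> y \<in> ?Z - G" unfolding openin_gtop_iff using A assms(1) by blast
 have "G \<subseteq> ?Z" using unip by (simp add: unipotent_group_def affine_space_on_eq closedin_def)
 hence "h \<in> vanishing" using h by (auto simp: vanishing_def)
 thus False using assms(2) h(2) by blast
qed

lemma one_G: "mat 1 \<in> G" and mult_G: "A \<in> G ==> B \<in> G ==> A ** B \<in> G"
 and inv_G: "A \<in> G ==> matrix_inv A \<in> G" and unip_G: "A \<in> G ==> EX k. mpow (A - mat 1) k = 0"
 using unip by (auto simp: unipotent_group_def mpow_def)

lemma invertible_G: "A \<in> G ==> invertible A"
proof -
 interpret gfun "%_. mat_polys" "{A :: complex ^ 'n ^ 'n. invertible A}" by (rule gfun_poly_funs)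
 have "G \<subseteq> {A. invertible A}" using unip by (simp add: unipotent_group_def affine_space_on_eq closedin_def)
 thus "A \<in> G ==> invertible A" by blast
qed

lemma rho_one: "\<rho> (mat 1) = mat 1" and rho_mult: "A \<in> G ==> B \<in> G ==> \<rho> (A ** B) = \<rho> A ** \<rho> B"
 and rho_regular: "(%A. \<rho> A $ i $ j) \<in> regular (affine_space_on mat_space G) G" using rat by (auto simp: rational_rep_def)

lemma linear_vanishing:
 assumes p: "p \<in> vanishing" and L: "!!A B. L (A + B) = L A + L B" "!!c A. L (mat_scale c A) = mat_scale c (L A)"
  and G: "!!A. A \<in> G ==> L A \<in> G"
 shows "(%A. p (L A)) \<in> vanishing" using poly_funs_linear_map(1)[of p L, OF _ L] p G by (simp add: vanishing_def)

text \<open>Left translation by a group element preserves the ideal of the group, so the tangency of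
  \<open>X\<close> at the identity spreads to tangency of the invariant field at every group
  element.\<close>

lemma Dx_vanishing:
 assumes X: "X \<in> lie_algebra G" and p: "p \<in> vanishing"
 shows "Dx X p \<in> vanishing"
proof -
 have pp: "p \<in> mat_polys" using p by (simp add: vanishing_def)
 have "Dx X p B = 0" if B: "B \<in> G" for B
 proof -
  have L: "B ** (A + A') = B ** A + B ** A'" "B ** mat_scale c A = mat_scale c (B ** A)" for A A' :: "complex ^ 'n ^ 'n" and c
   by (simp_all add: matrix_add_ldistrib mat_scale_mult_right)
  have "(%A. p (B ** A)) \<in> vanishing" by (rule linear_vanishing[OF p L]) (rule mult_G[OF B])
  hence "der (%A. p (B ** A)) (mat 1) X = 0" using X unfolding lie_iff by (rule bspec[rotated])
  thus ?thesis using poly_funs_linear_map(2)[of p "%A. B ** A" "mat 1" X, OF pp L] by (simp add: Dx_def)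
 qed
 thus ?thesis using Dx_poly[OF pp, of X] by (simp add: vanishing_def)
qed

text \<open>Elements of the group are unipotent, so the entries of the power \<open>CARD('n)\<close>
  of \<open>A\<close> minus the identity are equations of the group. Their jets along
  \<open>X\<close> vanish, and the leading coefficients of these are the entries of the
  corresponding power of \<open>X\<close>.\<close>

lemma lie_nilpotent:
 assumes X: "X \<in> lie_algebra G" shows "mpow X CARD('n) = 0"
proof -
 let ?p = "%i j A. mpow (A - mat 1) CARD('n) $ i $ j"
 have v: "?p i j \<in> vanishing" for i j using nilpotent_index unip_G power_entry_poly unfolding vanishing_def by fastforce
 have "(Dx X ^^ k) (?p i j) \<in> vanishing" for k i j by (induction k) (use v Dx_vanishing[OF X] in auto)
 hence "(Dx X ^^ k) (?p i j) (mat 1) = 0" for k i j using one_G by (simp add: vanishing_def)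
 hence "fps_nth (jet X (?p i j)) CARD('n) = 0" for i j by (simp add: jet_def)
 thus ?thesis using jet_power_entry[where X = X and m = "CARD('n)", THEN conjunct2] by (simp add: vec_eq_iff)
qed

text \<open>The restrictions of all equations of the group to the exponential curve form a family
  closed under differentiation, with every member zero at the identity.\<close>

lemma mexp_in_G:
 assumes X: "X \<in> lie_algebra G" shows "mexp (mat_scale s X) \<in> G"
proof (rule G_closed)
 note nil = lie_nilpotent[OF X]
 show "invertible (mexp (mat_scale s X))"
  unfolding invertible_def using mexp_inverse[OF nil, of s] mexp_inverse[OF nil, of "- s"] by (auto simp del: mats.scale_minus_left)
 fix p assume p: "p \<in> vanishing"
 let ?F = "{%s. q (mexp (mat_scale s X)) |q. q \<in> vanishing}"
 show "p (mexp (mat_scale s X)) = 0"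
 proof (rule polyfun_zero_by_derivatives[where F = ?F and f = "%s. p (mexp (mat_scale s X))"])
  show "(%s. p (mexp (mat_scale s X))) \<in> ?F" using p by blast
  fix f assume "f \<in> ?F"
  then obtain q where f: "f = (%s. q (mexp (mat_scale s X)))" and q: "q \<in> vanishing" by blast
  have qp: "q \<in> mat_polys" using q by (simp add: vanishing_def)
  have "polyfun f" unfolding f by (rule polyfun_polycurve[OF qp mexp_polycurve[OF nil]])
  moreover have "f 0 = 0" using q one_G by (simp add: f vanishing_def)
  moreover have "deriv f = (%s. Dx X q (mexp (mat_scale s X)))"
   unfolding f by (rule ext) (simp add: der_chain[OF qp mexp_polycurve[OF nil]] mexp_cderiv[OF nil] Dx_def)
  ultimately show "polyfun f & f 0 = 0 & deriv f \<in> ?F" using Dx_vanishing[OF X q] by auto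
 qed
qed

text \<open>The natural powers of \<open>A\<close> lie in the group. An equation of the group
  restricted to \<open>upow A\<close> is polynomial in the exponent and vanishes at natural numbers,
  hence identically. Thus the velocity at 0 is a tangent vector, and its exponential is
  \<open>A\<close>.\<close>

lemma logarithm:
 assumes A: "A \<in> G" shows "EX X:lie_algebra G. mexp X = A"
proof -
 obtain m where m: "mpow (A - mat 1) m = 0" using unip_G[OF A] by blast
 define X where "X = cderiv (upow A) 0"
 have pw: "mpow A k \<in> G" for k by (induction k) (use A one_G mult_G in \<open>auto simp: mpow_Suc\<close>)
 have 0: "upow A 0 = mat 1" using upow_nat[OF m, of 0] by simp
 have "upow A s = mexp (mat_scale s X)" for s unfolding X_def by (rule one_parameter_group(2)[OF upow_polycurve upow_add[OF m] 0])
 from this[of 1] have e: "mexp X = A" using upow_nat[OF m, of 1] by simp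
 have "der p (mat 1) X = 0" if p: "p \<in> vanishing" for p
 proof -
  have pp: "p \<in> mat_polys" using p by (simp add: vanishing_def)
  have "p (upow A s) = 0" for s by (rule polyfun_eq_nat[where g = "%_. 0", OF polyfun_polycurve[OF pp upow_polycurve]])
    (use p pw in \<open>auto simp: upow_nat[OF m] vanishing_def\<close>)
  hence "deriv (%s. p (upow A s)) 0 = 0" by simp
  thus ?thesis using der_chain[OF pp upow_polycurve, of A 0] by (simp add: 0 X_def)
 qed
 thus ?thesis using e lie_iff by blast
qed

lemma regular_along_exp:
 assumes h: "h \<in> regular (affine_space_on mat_space G) G" and X: "X \<in> lie_algebra G"
 shows "polyfun (%s. h (mexp (mat_scale s X)))"
proof (rule polyfun_local_quotient)
 fix s0
 interpret gfun "%_. mat_polys" G by (rule gfun_poly_funs)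
 have o: "openin (gtop (%_. mat_polys) G) G" using openin_topspace[of "gtop (%_. mat_polys) G"] by simp
 obtain p q where pq: "p \<in> mat_polys" "q \<in> mat_polys" "q (mexp (mat_scale s0 X)) ~= 0"
  "ALL y:G. q y ~= 0 --> h y = p y / q y" using h mexp_in_G[OF X, of s0] unfolding affine_space_on_eq regular_iff[OF o] by blast
 have curve: "EX P. (%s. p (mexp (mat_scale s X))) = poly P" if "p \<in> mat_polys" for p
  using polyfun_polycurve[OF that mexp_polycurve[OF lie_nilpotent[OF X]]] by (auto simp: polyfun_def)
 obtain P where P: "!!s. p (mexp (mat_scale s X)) = poly P s" using curve[OF pq(1)] by metis
 obtain Q where Q: "!!s. q (mexp (mat_scale s X)) = poly Q s" using curve[OF pq(2)] by metis
 show "EX P Q. poly Q s0 ~= 0 & (ALL s. poly Q s ~= 0 --> h (mexp (mat_scale s X)) = poly P s / poly Q s)"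
  using pq(3,4) mexp_in_G[OF X] P Q by (intro exI[of _ P] exI[of _ Q]) auto
qed

text \<open>The straight line through the identity leaves the group, so \<open>h\<close> cannot be
  differentiated along it, only its presentation. The two values agree because \<open>p\<close> and
  \<open>q\<close> have the same first derivative along the line and along the exponential curve,
  which stays in the group.\<close>

lemma derivative_along_exp:
 assumes h: "h \<in> regular (affine_space_on mat_space G) G" and X: "X \<in> lie_algebra G"
  and W: "opn (affine_space_on mat_space G) W" "mat 1 \<in> W"
  and p: "p \<in> mat_polys" and q: "q \<in> mat_polys"
  and pq: "!!A. A \<in> W ==> q A ~= 0 & h A = p A / q A"
 shows "deriv (%s. h (mexp (mat_scale s X))) 0 = (der p (mat 1) X * q (mat 1) - p (mat 1) * der q (mat 1) X) / (q (mat 1) * q (mat 1))"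
  and "deriv (%s. p (mat 1 + mat_scale s X) / q (mat 1 + mat_scale s X)) 0 =
   (der p (mat 1) X * q (mat 1) - p (mat 1) * der q (mat 1) X) / (q (mat 1) * q (mat 1))"
proof -
 interpret gfun "%_. mat_polys" G by (rule gfun_poly_funs)
 obtain w where w: "w \<in> mat_polys" "w (mat 1) ~= 0" "!!y. y \<in> G ==> w y ~= 0 ==> y \<in> W"
  using W unfolding affine_space_on_eq zar_gspace openin_gtop_iff by blast
 note nil = lie_nilpotent[OF X]
 let ?g = "%s. mexp (mat_scale s X)"
 have pc: "polyfun (%s. r (?g s))" if "r \<in> mat_polys" for r by (rule polyfun_polycurve[OF that mexp_polycurve[OF nil]])
 have dr: "deriv (%s. r (?g s)) 0 = der r (mat 1) X" if "r \<in> mat_polys" for r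
  using der_chain[OF that mexp_polycurve[OF nil], of 0] by (simp add: mexp_cderiv[OF nil])
 have hph: "polyfun (%s. h (?g s))" by (rule regular_along_exp[OF h X])
 obtain D where D: "!!s. h (?g s) * q (?g s) - p (?g s) = poly D s"
  using polyfun_diff[OF polyfun_mult[OF hph pc[OF q]] pc[OF p]] unfolding polyfun_def image_iff by (auto simp: fun_eq_iff)
 obtain E where E: "!!s. w (?g s) = poly E s" using pc[OF w(1)] unfolding polyfun_def by (metis imageE)
 \<comment> \<open>The presentation of \<open>h\<close> is valid only where \<open>w\<close> is
   nonzero. Multiplying by \<open>E\<close> gives an identity for all \<open>s\<close>, and
   \<open>E\<close> is not the zero polynomial, so \<open>D\<close> is.\<close>
 have "poly (D * E) s = 0" for s
 proof (cases "w (?g s) = 0")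
  case True
  thus ?thesis using E[of s] by simp
 next
  case False
  hence "?g s \<in> W" using w(3) mexp_in_G[OF X] by blast
  thus ?thesis using pq[of "?g s"] D[of s] by simp
 qed
 hence "D * E = 0" using poly_all_0_iff_0 by blast
 moreover have "E ~= 0" using E[of 0] w(2) by auto
 ultimately have "D = 0" by simp
 hence hq: "(%s. h (?g s) * q (?g s)) = (%s. p (?g s))" using D by auto
 have q1: "q (mat 1) ~= 0" and h1: "h (mat 1) = p (mat 1) / q (mat 1)" using pq[OF W(2)] by auto
 have "deriv (%s. h (?g s)) 0 * q (mat 1) + h (mat 1) * der q (mat 1) X = der p (mat 1) X"
  using chain_mult[OF hph pc[OF q], of 0] unfolding hq by (simp add: dr p q)
 hence e: "deriv (%s. h (?g s)) 0 = (der p (mat 1) X - h (mat 1) * der q (mat 1) X) / q (mat 1)" using q1 by (simp add: field_simps)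
 show "deriv (%s. h (?g s)) 0 = (der p (mat 1) X * q (mat 1) - p (mat 1) * der q (mat 1) X) / (q (mat 1) * q (mat 1))"
  unfolding e h1 using q1 by (simp add: divide_simps)
 have "((%s. r (mat 1 + mat_scale s X)) has_field_derivative der r (mat 1) X) (at 0)" if "r \<in> mat_polys" for r
  unfolding der_def by (rule polyfun_has_derivative[OF polyfun_polycurve[OF that polycurve_line]])
 from DERIV_divide[OF this[OF p] this[OF q]] q1
 show "deriv (%s. p (mat 1 + mat_scale s X) / q (mat 1 + mat_scale s X)) 0 =
   (der p (mat 1) X * q (mat 1) - p (mat 1) * der q (mat 1) X) / (q (mat 1) * q (mat 1))" by (intro DERIV_imp_deriv) simp
qed

lemma regular_at_one:
 assumes h: "h \<in> regular (affine_space_on mat_space G) G"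
 obtains W p q where "opn (affine_space_on mat_space G) W" "mat 1 \<in> W"
  "p \<in> mat_polys" "q \<in> mat_polys" "!!A. A \<in> W ==> q A ~= 0 & h A = p A / q A"
proof -
 have "ALL x:G. EX W p q. opn (affine_space_on mat_space G) W & x \<in> W & W \<subseteq> G &
      p \<in> mat_polys & q \<in> mat_polys & (ALL y:W. q y ~= 0 & h y = p y / q y)" using h by (simp add: affine_space_on_def Let_def)
 from bspec[OF this one_G] obtain W p q where "opn (affine_space_on mat_space G) W" "mat 1 \<in> W"
  "p \<in> mat_polys" "q \<in> mat_polys" "ALL A:W. q A ~= 0 & h A = p A / q A" by (elim exE conjE)
 thus thesis by (intro that[of W p q]) (assumption | erule (1) bspec)+
qed

lemma differential_eq:
 assumes h: "h \<in> regular (affine_space_on mat_space G) G" and X: "X \<in> lie_algebra G"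
 shows "differential G h X = deriv (%s. h (mexp (mat_scale s X))) 0" unfolding differential_def
proof (rule the_equality)
 show "ALL W p q. opn (affine_space_on mat_space G) W --> mat 1 \<in> W -->
    p \<in> mat_polys --> q \<in> mat_polys -->
    (ALL A:W. q A ~= 0 & h A = p A / q A) -->
    deriv (%s. h (mexp (mat_scale s X))) 0 = deriv (%s. p (mat 1 + mat_scale s X) / q (mat 1 + mat_scale s X)) 0"
 proof (intro allI impI)
  fix W p q
  assume a: "opn (affine_space_on mat_space G) W" "mat 1 \<in> W" "p \<in> mat_polys" "q \<in> mat_polys"
   and b: "ALL A:W. q A ~= 0 & h A = p A / q A"
  show "deriv (%s. h (mexp (mat_scale s X))) 0 = deriv (%s. p (mat 1 + mat_scale s X) / q (mat 1 + mat_scale s X)) 0"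
   using derivative_along_exp[OF h X a b[rule_format]] by (rule trans_sym)
 qed
next
 fix d
 assume d: "ALL W p q. opn (affine_space_on mat_space G) W --> mat 1 \<in> W -->
    p \<in> mat_polys --> q \<in> mat_polys -->
    (ALL A:W. q A ~= 0 & h A = p A / q A) -->
    d = deriv (%s. p (mat 1 + mat_scale s X) / q (mat 1 + mat_scale s X)) 0"
 obtain W p q where W: "opn (affine_space_on mat_space G) W" "mat 1 \<in> W"
  "p \<in> mat_polys" "q \<in> mat_polys" and b: "!!A. A \<in> W ==> q A ~= 0 & h A = p A / q A"
  by (rule regular_at_one[OF h], rule that; assumption)
 have "d = deriv (%s. p (mat 1 + mat_scale s X) / q (mat 1 + mat_scale s X)) 0" using d[rule_format, of W p q] W b by blast
 thus "d = deriv (%s. h (mexp (mat_scale s X))) 0" using derivative_along_exp[OF h X W b] by metis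
qed

lemma lie_zero: "0 \<in> lie_algebra G" and lie_add: "X \<in> lie_algebra G ==> Y \<in> lie_algebra G ==> X + Y \<in> lie_algebra G"
 and lie_scale: "X \<in> lie_algebra G ==> mat_scale c X \<in> lie_algebra G"
proof -
 have p: "p \<in> mat_polys" if "p \<in> vanishing" for p using that by (simp add: vanishing_def)
 show "X \<in> lie_algebra G ==> Y \<in> lie_algebra G ==> X + Y \<in> lie_algebra G" by (simp add: lie_iff der_linear_arg(1)[OF p])
 show sc: "X \<in> lie_algebra G ==> mat_scale c X \<in> lie_algebra G" for c X by (simp add: lie_iff der_linear_arg(2)[OF p])
 have "der p (mat 1) 0 = 0" for p :: "complex ^ 'n ^ 'n => complex" by (simp add: der_def)
 thus "0 \<in> lie_algebra G" by (simp add: lie_iff)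
qed

lemma lie_rep_linear:
 assumes X: "X \<in> lie_algebra G" and Y: "Y \<in> lie_algebra G"
 shows "lie_rep G \<rho> (X + Y) = lie_rep G \<rho> X + lie_rep G \<rho> Y" "lie_rep G \<rho> (mat_scale c X) = mat_scale c (lie_rep G \<rho> X)"
proof -
 have "differential G h (X + Y) = differential G h X + differential G h Y & differential G h (mat_scale c X) = c * differential G h X"
  if h: "h \<in> regular (affine_space_on mat_space G) G" for h
 proof -
  obtain W p q where W: "opn (affine_space_on mat_space G) W" "mat 1 \<in> W"
   "p \<in> mat_polys" "q \<in> mat_polys" and b: "!!A. A \<in> W ==> q A ~= 0 & h A = p A / q A"
   by (rule regular_at_one[OF h], rule that; assumption)
  have f: "differential G h Z = (der p (mat 1) Z * q (mat 1) - p (mat 1) * der q (mat 1) Z) / (q (mat 1) * q (mat 1))"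
   if Z: "Z \<in> lie_algebra G" for Z unfolding differential_eq[OF h Z] by (rule derivative_along_exp(1)[OF h Z W b])
  show ?thesis unfolding f[OF X] f[OF Y] f[OF lie_add[OF X Y]] f[OF lie_scale[OF X]] der_linear_arg[OF W(3)] der_linear_arg[OF W(4)]
   by (simp add: algebra_simps add_divide_distrib diff_divide_distrib)
 qed
 thus "lie_rep G \<rho> (X + Y) = lie_rep G \<rho> X + lie_rep G \<rho> Y" "lie_rep G \<rho> (mat_scale c X) = mat_scale c (lie_rep G \<rho> X)"
  using rho_regular by (simp_all add: lie_rep_def vec_eq_iff)
qed

lemma lie_rep_eq: "X \<in> lie_algebra G ==> lie_rep G \<rho> X = cderiv (%s. \<rho> (mexp (mat_scale s X))) 0"
 by (simp add: lie_rep_def cderiv_def differential_eq[OF rho_regular])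

lemma rho_curve: "X \<in> lie_algebra G ==> polycurve (%s. \<rho> (mexp (mat_scale s X)))"
 unfolding polycurve_def by (intro allI regular_along_exp rho_regular)

text \<open>The image of the exponential curve is a polynomial one-parameter group, since regular
  functions restrict to polynomials along it. Nilpotency of the Lie algebra operators comes
  along.\<close>

lemma rho_mexp:
 assumes X: "X \<in> lie_algebra G"
 shows "mpow (lie_rep G \<rho> X) CARD('m) = 0" "\<rho> (mexp (mat_scale s X)) = mexp (mat_scale s (lie_rep G \<rho> X))"
proof -
 have hom: "\<rho> (mexp (mat_scale (s + r) X)) = \<rho> (mexp (mat_scale s X)) ** \<rho> (mexp (mat_scale r X))" for s r
  using mexp_add[OF lie_nilpotent[OF X], of s r] rho_mult[OF mexp_in_G[OF X] mexp_in_G[OF X]] by simp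
 have one: "\<rho> (mexp (mat_scale 0 X)) = mat 1" by (simp add: rho_one)
 note o = one_parameter_group[OF rho_curve[OF X] hom one]
 show "mpow (lie_rep G \<rho> X) CARD('m) = 0" using o(1) nilpotent_index unfolding lie_rep_eq[OF X] by blast
 show "\<rho> (mexp (mat_scale s X)) = mexp (mat_scale s (lie_rep G \<rho> X))" unfolding lie_rep_eq[OF X] by (rule o(2))
qed

text \<open>The adjoint action: conjugation is linear and preserves the group, hence its tangent
  space; the formula for the operator is the derivative of \<open>\<rho>\<close> along the
  conjugated exponential curve.\<close>

lemma conj_lie:
 assumes g: "g \<in> G" and Y: "Y \<in> lie_algebra G"
 shows "g ** Y ** matrix_inv g \<in> lie_algebra G" "lie_rep G \<rho> (g ** Y ** matrix_inv g) = \<rho> g ** lie_rep G \<rho> Y ** \<rho> (matrix_inv g)"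
proof -
 have gi: "g ** matrix_inv g = mat 1" "matrix_inv g ** g = mat 1" using matrix_inv_mult[OF invertible_G[OF g]] by auto
 have L: "g ** (A + A') ** matrix_inv g = g ** A ** matrix_inv g + g ** A' ** matrix_inv g"
  "g ** mat_scale c A ** matrix_inv g = mat_scale c (g ** A ** matrix_inv g)" for A A' :: "complex ^ 'n ^ 'n" and c
  by (simp_all add: matrix_add_ldistrib matrix_add_rdistrib mat_scale_mult_right mat_scale_mult_left)
 have "der p (mat 1) (g ** Y ** matrix_inv g) = 0" if p: "p \<in> vanishing" for p
 proof -
  have "(%A. p (g ** A ** matrix_inv g)) \<in> vanishing" by (rule linear_vanishing[OF p L]) (intro mult_G g inv_G)
  hence "der (%A. p (g ** A ** matrix_inv g)) (mat 1) Y = 0" using Y unfolding lie_iff by (rule bspec[rotated])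
  moreover have "p \<in> mat_polys" using p by (simp add: vanishing_def)
  ultimately show ?thesis using poly_funs_linear_map(2)[of p "%A. g ** A ** matrix_inv g" "mat 1" Y, OF _ L] by (simp add: gi)
 qed
 thus c: "g ** Y ** matrix_inv g \<in> lie_algebra G" by (simp add: lie_iff)
 have pw: "mpow (g ** Y ** matrix_inv g) k = g ** mpow Y k ** matrix_inv g" for k
 proof (induction k)
  case (Suc k)
  have "mpow (g ** Y ** matrix_inv g) (Suc k) = g ** mpow Y k ** (matrix_inv g ** g) ** Y ** matrix_inv g"
   by (simp only: mpow_Suc Suc matrix_mul_assoc)
  thus ?case by (simp add: gi mpow_Suc matrix_mul_assoc)
 qed (simp add: gi)
 have e: "mexp (mat_scale s (g ** Y ** matrix_inv g)) = g ** mexp (mat_scale s Y) ** matrix_inv g" for s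
  unfolding mexp_scale_eq[OF lie_nilpotent[OF c]] mexp_scale_eq[OF lie_nilpotent[OF Y]] pw
  by (simp add: matrix_sum_left matrix_sum_right mat_scale_mult_left mat_scale_mult_right)
 have "\<rho> (mexp (mat_scale s (g ** Y ** matrix_inv g))) = \<rho> g ** \<rho> (mexp (mat_scale s Y)) ** \<rho> (matrix_inv g)" for s
  unfolding e using g Y by (simp add: rho_mult mult_G inv_G mexp_in_G)
 hence "lie_rep G \<rho> (g ** Y ** matrix_inv g) = cderiv (%s. \<rho> g ** \<rho> (mexp (mat_scale s Y)) ** \<rho> (matrix_inv g)) 0"
  by (simp add: lie_rep_eq[OF c])
 also have "\<dots> = \<rho> g ** lie_rep G \<rho> Y ** \<rho> (matrix_inv g)"
  by (simp add: cderiv_mult polycurve_mult rho_curve[OF Y] lie_rep_eq[OF Y])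
 finally show "lie_rep G \<rho> (g ** Y ** matrix_inv g) = \<rho> g ** lie_rep G \<rho> Y ** \<rho> (matrix_inv g)" .
qed

text \<open>The commutator is the derivative at 0 of the conjugates of \<open>B\<close> by the
  exponentials of \<open>s A\<close>. These conjugates represent conjugated Lie algebra elements, so
  the curve stays in the space of operators, and so does its derivative.\<close>

lemma bracket_closed:
 assumes "A \<in> lie_rep G \<rho> ` lie_algebra G" "B \<in> lie_rep G \<rho> ` lie_algebra G"
 shows "A ** B - B ** A \<in> lie_rep G \<rho> ` lie_algebra G"
proof -
 let ?L = "lie_rep G \<rho> ` lie_algebra G"
 obtain X Y where X: "X \<in> lie_algebra G" "A = lie_rep G \<rho> X" and Y: "Y \<in> lie_algebra G" "B = lie_rep G \<rho> Y" using assms by blast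
 note nil = rho_mexp(1)[OF X(1), folded X(2)]
 \<comment> \<open>The inverse exponential is written with \<open>- 1 * s + 0\<close> to match the
   affine reparametrisation rules for polynomial curves.\<close>
 let ?g = "%s. mexp (mat_scale s A) ** B ** mexp (mat_scale (- 1 * s + 0) A)"
 have p: "polycurve (%s. mexp (mat_scale (- 1 * s + 0) A))" by (rule polycurve_compose_affine[OF mexp_polycurve[OF nil]])
 have "cderiv ?g 0 \<in> ?L"
 proof (rule cderiv_in_subspace)
  show "U + V \<in> ?L" if UV: "U \<in> ?L" "V \<in> ?L" for U V
  proof -
   obtain U' V' where "U' \<in> lie_algebra G" "U = lie_rep G \<rho> U'" "V' \<in> lie_algebra G" "V = lie_rep G \<rho> V'" using UV by blast
   thus ?thesis using lie_rep_linear(1)[of U' V'] lie_add[of U' V'] by (intro image_eqI[of _ _ "U' + V'"]) auto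
  qed
  show "mat_scale c U \<in> ?L" if U: "U \<in> ?L" for U c
  proof -
   obtain U' where "U' \<in> lie_algebra G" "U = lie_rep G \<rho> U'" using U by blast
   thus ?thesis using lie_rep_linear(2)[of U' U' c] lie_scale[of U' c] by (intro image_eqI[of _ _ "mat_scale c U'"]) auto
  qed
  show "polycurve ?g" by (intro polycurve_mult mexp_polycurve[OF nil] polycurve_const p)
  show "?g s \<in> ?L" for s
  proof -
   let ?x = "mexp (mat_scale s X)"
   have nX: "mpow X CARD('n) = 0" by (rule lie_nilpotent[OF X(1)])
   have "mexp (mat_scale (- s) X) ** ?x = mat 1" "?x ** mexp (mat_scale (- s) X) = mat 1"
    using mexp_inverse[OF nX, of s] mexp_inverse[OF nX, of "- s"] by (simp_all del: mats.scale_minus_left)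
   hence "matrix_inv ?x = mexp (mat_scale (- s) X)" by (intro matrix_inv_eqI) auto
   hence "lie_rep G \<rho> (?x ** Y ** matrix_inv ?x) = ?g s"
    using conj_lie(2)[OF mexp_in_G[OF X(1)] Y(1), of s] rho_mexp(2)[OF X(1), of s] rho_mexp(2)[OF X(1), of "- s"] X(2) Y(2)
    by (simp del: mats.scale_minus_left)
   thus ?thesis using conj_lie(1)[OF mexp_in_G[OF X(1)] Y(1), of s] by (metis imageI)
  qed
 qed
 moreover have "cderiv ?g 0 = A ** B - B ** A"
 proof -
  have "cderiv (%s. mexp (mat_scale (- 1 * s + 0) A)) 0 = mat_scale (- 1) (mexp (mat_scale (- 1 * 0 + 0) A) ** A)"
   by (subst cderiv_shift[OF mexp_polycurve[OF nil]]) (simp only: mexp_cderiv[OF nil])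
  hence d: "cderiv (%s. mexp (mat_scale (- 1 * s + 0) A)) 0 = mat_scale (- 1) A" by (simp del: mats.scale_minus_left)
  have "cderiv (%s. mexp (mat_scale s A) ** B) 0 = A ** B" by (subst cderiv_mult) (simp_all add: mexp_polycurve[OF nil] mexp_cderiv[OF nil])
  hence "cderiv ?g 0 = A ** B + B ** mat_scale (- 1) A"
   using d by (subst cderiv_mult[OF polycurve_mult[OF mexp_polycurve[OF nil] polycurve_const] p]) (simp del: mats.scale_minus_left)
  also have "\<dots> = A ** B - B ** A" by (simp add: mat_scale_mult_right vec_eq_iff del: mats.scale_minus_left)
  finally show ?thesis .
 qed
 ultimately show ?thesis by simp
qed

text \<open>Every group element has a logarithm in the Lie algebra, and \<open>\<rho>\<close>
  intertwines the exponential maps.\<close>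

lemma orbit_eq: "\<rho> ` G = mexp ` (lie_rep G \<rho> ` lie_algebra G)"
proof -
 have "\<rho> ` G = \<rho> ` mexp ` lie_algebra G"
 proof -
  have "mexp X \<in> G" if "X \<in> lie_algebra G" for X using mexp_in_G[OF that, of 1] by simp
  hence "G = mexp ` lie_algebra G" using logarithm by blast
  thus ?thesis by metis
 qed
 also have "\<dots> = mexp ` (lie_rep G \<rho> ` lie_algebra G)" using rho_mexp(2)[where s = 1] by (simp add: image_image)
 finally show ?thesis .
qed

lemma lie_rep_coordinates:
 assumes "ordered_basis (lie_algebra G) N f"
 shows "lie_rep G \<rho> ` lie_algebra G = {\<Sum>i=1..N. mat_scale (c i) ((lie_rep G \<rho> \<circ> f) i) |c. True}"
proof -
 have inj: "inj_on f {1..N}" and sp: "mats.span (f ` {1..N}) = lie_algebra G" using assms by (auto simp: ordered_basis_def)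
 have fl: "f i \<in> lie_algebra G" if "i \<in> {1..N}" for i using sp mats.span_superset[of "f ` {1..N}"] that by blast
 have lin: "lie_rep G \<rho> (\<Sum>i\<in>I. mat_scale (c i) (f i)) = (\<Sum>i\<in>I. mat_scale (c i) (lie_rep G \<rho> (f i))) &
   (\<Sum>i\<in>I. mat_scale (c i) (f i)) \<in> lie_algebra G" if "finite I" "I \<subseteq> {1..N}" for I c using that
 proof (induction I rule: finite_induct)
  case empty
  show ?case using lie_rep_linear(2)[OF lie_zero lie_zero, of 0] lie_zero by (simp add: vec_eq_iff)
 next
  case (insert i I)
  thus ?case using lie_rep_linear(1)[of "mat_scale (c i) (f i)"] lie_rep_linear(2)[of "f i" "f i" "c i"] lie_add lie_scale fl by simp
 qed
 have "lie_algebra G = {\<Sum>i=1..N. mat_scale (c i) (f i) |c. True}"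
 proof
  show "{\<Sum>i=1..N. mat_scale (c i) (f i) |c. True} \<subseteq> lie_algebra G" using lin by auto
  show "lie_algebra G \<subseteq> {\<Sum>i=1..N. mat_scale (c i) (f i) |c. True}"
  proof
   fix X assume "X \<in> lie_algebra G"
   then obtain u where "X = (\<Sum>x\<in>f ` {1..N}. mat_scale (u x) x)"
    unfolding sp[symmetric] mats.span_finite[OF finite_imageI[OF finite_atLeastAtMost]] by blast
   hence "X = (\<Sum>i=1..N. mat_scale (u (f i)) (f i))" unfolding sum.reindex[OF inj] comp_def .
   thus "X \<in> {\<Sum>i=1..N. mat_scale (c i) (f i) |c. True}" by (intro CollectI exI[of _ "%i. u (f i)"]) simp
  qed
 qed
 hence "lie_rep G \<rho> ` lie_algebra G = lie_rep G \<rho> ` {\<Sum>i=1..N. mat_scale (c i) (f i) |c. True}" by (rule arg_cong)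
 also have "\<dots> = {lie_rep G \<rho> (\<Sum>i=1..N. mat_scale (c i) (f i)) |c. True}" by blast
 finally show ?thesis using lin[OF finite_atLeastAtMost order_refl] by simp
qed

end

section \<open>Weights inducing a monomial order on finitely many exponents\<close>

lemma between_finite:
 fixes A B :: "rat set"
 assumes "finite A" "finite B" "!!a b. a \<in> A ==> b \<in> B ==> a < b"
 obtains c where "!!a. a \<in> A ==> a < c" "!!b. b \<in> B ==> c < b"
proof (cases "A = {}")
 case True
 show thesis
 proof (cases "B = {}")
  case False
  show thesis
  proof (rule that[of "Min B - 1"])
   show "Min B - 1 < b" if "b \<in> B" for b using Min_le[OF assms(2) that] by simp
  qed (use True in simp)
 qed (use True that in blast)
next
 case A: False
 show thesis
 proof (cases "B = {}")
  case True
  show thesis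
  proof (rule that[of "Max A + 1"])
   show "a < Max A + 1" if "a \<in> A" for a using Max_ge[OF assms(1) that] by simp
  qed (use True in simp)
 next
  case False
  hence "Max A < Min B" using A assms by simp
  then obtain c where c: "Max A < c" "c < Min B" using dense by blast
  show thesis
  proof (rule that[of c])
   show "a < c" if "a \<in> A" for a using Max_ge[OF assms(1) that] c by simp
   show "c < b" if "b \<in> B" for b using Min_le[OF assms(2) that] c by simp
  qed
 qed
qed

text \<open>Gordan's theorem for a positive cone \<open>P\<close>, by Fourier-Motzkin elimination of the last coordinate.\<close>

lemma gordan:
 fixes P :: "(nat => int) set"
 assumes add: "!!c d. c \<in> P ==> d \<in> P ==> (%i. c i + d i) \<in> P" and zero: "(%_. 0) \<notin> P"
 shows "finite D ==> D \<subseteq> P ==> (!!d i. d \<in> D ==> n \<le> i ==> d i = 0) ==>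
  EX w :: nat => rat. ALL d:D. 0 < (\<Sum>i<n. w i * of_int (d i))"
proof (induction n arbitrary: D)
 case 0
 have "d = (%_. 0)" if "d \<in> D" for d using 0(3)[OF that] by auto
 hence "D = {}" using zero 0(2) by blast
 thus ?case by simp
next
 case (Suc n)
 have mult: "(%i. int (Suc m) * d i) \<in> P" if "d \<in> P" for m d
 proof (induction m)
  case 0
  thus ?case using that by simp
 next
  case (Suc m)
  thus ?case using add[OF Suc that] by (simp add: algebra_simps)
 qed
 have pmult: "(%i. m * d i) \<in> P" if "d \<in> P" "0 < m" for m d using mult[OF that(1), of "nat m - 1"] that(2) by simp
 let ?pos = "{d \<in> D. 0 < d n}" and ?neg = "{d \<in> D. d n < 0}" and ?zer = "{d \<in> D. d n = 0}"
 \<comment> \<open>A vector with positive and one with negative last coordinate are combined with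
   positive multipliers so that this coordinate cancels; the combination remains in
   \<open>P\<close>.\<close>
 let ?comb = "%(c, d). %i. (- d n) * c i + c n * d i"
 let ?D = "?zer \<union> ?comb ` (?pos \<times> ?neg)"
 have "EX w :: nat => rat. ALL d:?D. 0 < (\<Sum>i<n. w i * of_int (d i))"
 proof (rule Suc.IH)
  show "finite ?D" using Suc.prems(1) by simp
  show "?D \<subseteq> P"
  proof
   fix e assume "e \<in> ?D"
   then consider "e \<in> D" | c d where "c \<in> ?pos" "d \<in> ?neg" "e = ?comb (c, d)" by blast
   thus "e \<in> P"
   proof cases
    case 2
    have "(%i. (- d n) * c i + c n * d i) \<in> P" by (intro add pmult) (use 2 Suc.prems(2) in auto)
    thus ?thesis using 2(3) by simp
   qed (use Suc.prems(2) in blast)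
  qed
  fix e i assume e: "e \<in> ?D" and i: "n \<le> i"
  show "e i = 0"
  proof (cases "i = n")
   case True
   thus ?thesis using e by auto
  next
   case False
   hence "Suc n \<le> i" using i by simp
   hence z: "d i = 0" if "d \<in> D" for d using Suc.prems(3)[OF that] by blast
   consider "e \<in> D" | c d where "c \<in> ?pos" "d \<in> ?neg" "e = ?comb (c, d)" using e by blast
   thus ?thesis
   proof cases
    case (2 c d)
    hence "c i = 0" "d i = 0" using z by auto
    thus ?thesis by (simp add: 2(3))
   qed (rule z)
  qed
 qed
 then obtain w :: "nat => rat" where w: "!!d. d \<in> ?D ==> 0 < (\<Sum>i<n. w i * of_int (d i))" by blast
 let ?s = "%d. \<Sum>i<n. w i * of_int (d i)"
 \<comment> \<open>Vectors with positive last coordinate bound the missing weight from below, those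
   with negative one from above. That each lower bound is smaller than each upper bound is
   positivity on the combined vector.\<close>
 obtain c where c: "!!a. a \<in> (%d. - ?s d / of_int (d n)) ` ?pos ==> a < c"
  "!!a. a \<in> (%d. ?s d / of_int (- d n)) ` ?neg ==> c < a"
 proof (rule between_finite[of "(%d. - ?s d / of_int (d n)) ` ?pos" "(%d. ?s d / of_int (- d n)) ` ?neg"])
  fix a b assume "a \<in> (%d. - ?s d / of_int (d n)) ` ?pos" "b \<in> (%d. ?s d / of_int (- d n)) ` ?neg"
  then obtain x y where x: "x \<in> ?pos" "a = - ?s x / of_int (x n)" and y: "y \<in> ?neg" "b = ?s y / of_int (- y n)" by blast
  have "0 < ?s (?comb (x, y))" by (rule w) (use x y in blast)
  also have "?s (?comb (x, y)) = of_int (- y n) * ?s x + of_int (x n) * ?s y"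
   by (simp add: sum_distrib_left sum.distrib[symmetric] sum_subtractf[symmetric] algebra_simps)
  finally have "0 < of_int (- y n) * ?s x + of_int (x n) * ?s y" .
  moreover have "(0 :: rat) < of_int (- y n)" "(0 :: rat) < of_int (x n)" using x y by auto
  ultimately show "a < b" unfolding x(2) y(2) by (simp add: field_simps)
 qed (use Suc.prems(1) in auto)
 let ?w = "w(n := c)"
 have "0 < (\<Sum>i<Suc n. ?w i * of_int (d i))" if d: "d \<in> D" for d
 proof -
  have e: "(\<Sum>i<Suc n. ?w i * of_int (d i)) = ?s d + c * of_int (d n)" by simp
  consider "d \<in> ?pos" | "d \<in> ?neg" | "d \<in> ?zer" using d by fastforce
  thus ?thesis
  proof cases
   case 1
   hence "- ?s d / of_int (d n) < c" using c(1) by blast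
   moreover have "(0 :: rat) < of_int (d n)" using 1 by simp
   ultimately show ?thesis unfolding e by (simp add: field_simps)
  next
   case 2
   hence "c < ?s d / of_int (- d n)" using c(2) by blast
   moreover have "(0 :: rat) < of_int (- d n)" using 2 by simp
   ultimately have "c * of_int (- d n) < ?s d" using pos_less_divide_eq by blast
   thus ?thesis unfolding e by simp
  next
   case 3
   thus ?thesis unfolding e using w[of d] by simp
  qed
 qed
 thus ?case by blast
qed

lemma common_denominator:
 fixes w :: "nat => rat"
 shows "EX m > 0 :: nat. ALL i<n. EX z :: int. of_nat m * w i = of_int z"
proof (induction n)
 case (Suc n)
 then obtain m :: nat where m: "m > 0" "ALL i<n. EX z :: int. of_nat m * w i = of_int z" by blast
 obtain a b where ab: "b > 0" "w n = of_int a / of_int b" by (metis quotient_of_denom_pos' quotient_of_div surjective_pairing)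
 have "EX z :: int. of_nat (m * nat b) * w i = of_int z" if "i < Suc n" for i
 proof (cases "i = n")
  case True
  have "of_nat (m * nat b) * w i = (of_int (int m * a) :: rat)" using ab True by (simp add: of_nat_nat)
  thus ?thesis by blast
 next
  case False
  hence "i < n" using \<open>i < Suc n\<close> by simp
  then obtain z :: int where "of_nat m * w i = of_int z" using m(2) by blast
  hence "of_nat (m * nat b) * w i = (of_int (z * b) :: rat)" using ab(1) by (simp add: of_nat_nat mult.commute mult.left_commute)
  thus ?thesis by blast
 qed
 thus ?case using m(1) ab(1) by (intro exI[of _ "m * nat b"]) auto
qed auto

definition deg :: "nat => (nat => nat) => (nat => nat) => nat" where
 "deg N w p = (\<Sum>i=1..N. w i * p i)"

lemma deg_add: "deg N w (p + q) = deg N w p + deg N w q" by (simp add: deg_def algebra_simps sum.distrib)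

locale monomial_order =
 fixes N :: nat and lt :: "(nat => nat) => (nat => nat) => bool"
 assumes ord: "homogeneous_monomial_order N lt"
begin

lemma lt_irrefl: "p \<in> exponents N ==> \<not> lt p p"
 and lt_trans: "p \<in> exponents N ==> q \<in> exponents N ==> r \<in> exponents N ==> lt p q ==> lt q r ==> lt p r"
 and lt_total: "p \<in> exponents N ==> q \<in> exponents N ==> p ~= q ==> lt p q \<or> lt q p"
 and lt_add: "p \<in> exponents N ==> q \<in> exponents N ==> r \<in> exponents N ==> lt p q ==> lt (p + r) (q + r)"
 and lt_deg: "p \<in> exponents N ==> q \<in> exponents N ==> deg N (%_. Suc 0) p < deg N (%_. Suc 0) q ==> lt p q"
proof -
 note o = ord[unfolded homogeneous_monomial_order_def]
 show "p \<in> exponents N ==> \<not> lt p p" by (rule o[THEN conjunct1, rule_format])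
 show "p \<in> exponents N ==> q \<in> exponents N ==> r \<in> exponents N ==> lt p q ==> lt q r ==> lt p r"
  by (rule o[THEN conjunct2, THEN conjunct1, rule_format, of p q r]; assumption)
 show "p \<in> exponents N ==> q \<in> exponents N ==> p ~= q ==> lt p q \<or> lt q p"
  by (rule o[THEN conjunct2, THEN conjunct2, THEN conjunct1, rule_format, of p q]; assumption)
 show "p \<in> exponents N ==> q \<in> exponents N ==> r \<in> exponents N ==> lt p q ==> lt (p + r) (q + r)"
  by (rule o[THEN conjunct2, THEN conjunct2, THEN conjunct2, THEN conjunct1, rule_format, of p q r]; assumption)
 show "p \<in> exponents N ==> q \<in> exponents N ==> deg N (%_. Suc 0) p < deg N (%_. Suc 0) q ==> lt p q"
  using o[THEN conjunct2, THEN conjunct2, THEN conjunct2, THEN conjunct2, THEN conjunct2] by (simp add: deg_def)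
qed

lemma exponents_add: "p \<in> exponents N ==> q \<in> exponents N ==> p + q \<in> exponents N" by (simp add: exponents_def)

lemma lt_add2:
 assumes "p \<in> exponents N" "q \<in> exponents N" "p' \<in> exponents N" "q' \<in> exponents N" "lt p q" "lt p' q'"
 shows "lt (p + p') (q + q')" using lt_trans[of "p + p'" "q + p'" "q + q'"] lt_add[of p q p'] lt_add[of p' q' q] assms exponents_add
 by (simp add: add.commute)

text \<open>Differences \<open>q - p\<close> of comparable exponents form an additive cone, by
  compatibility of the order with addition, and it avoids zero by irreflexivity. Gordan's theorem
  then yields rational weights, and a common denominator makes them integral.\<close>

theorem weights:
 assumes E: "finite E" "E \<subseteq> exponents N"
 shows "EX w. ALL p:E. ALL q:E. lt p q --> deg N w p < deg N w q"
proof -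
 define P where "P = {(%i. int (q i) - int (p i)) |p q. p \<in> exponents N & q \<in> exponents N & lt p q}"
 \<comment> \<open>The pairs of the zero exponent with the unit exponents are added to force every
   weight to be positive, so that the weights can be natural numbers.\<close>
 define D where "D = (%(p, q). %i. int (q i) - int (p i)) ` ({(p, q) \<in> E \<times> E. lt p q} \<union> (%i. ((%_. 0), unit_exp i)) ` {1..N})"
 have u: "unit_exp i \<in> exponents N" "lt (%_. 0) (unit_exp i)" if "i \<in> {1..N}" for i
 proof -
  show e: "unit_exp i \<in> exponents N" using that by (simp add: unit_exp_def exponents_def)
  have "deg N (%_. Suc 0) (unit_exp i) = 1" using that by (simp add: deg_def unit_exp_def)
  thus "lt (%_. 0) (unit_exp i)" by (intro lt_deg e) (simp_all add: exponents_def deg_def)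
 qed
 have D: "EX p q. d = (%i. int (q i) - int (p i)) &
   (p, q) \<in> {(p, q) \<in> E \<times> E. lt p q} \<union> (%i. ((%_. 0), unit_exp i)) ` {1..N}" if "d \<in> D" for d
 proof -
  have "EX pq: {(p, q) \<in> E \<times> E. lt p q} \<union> (%i. ((%_. 0), unit_exp i)) ` {1..N}. d = (%(p, q). %i. int (q i) - int (p i)) pq"
   using that unfolding D_def by blast
  then obtain pq where pq: "pq \<in> {(p, q) \<in> E \<times> E. lt p q} \<union> (%i. ((%_. 0), unit_exp i)) ` {1..N}"
   "d = (%(p, q). %i. int (q i) - int (p i)) pq" by (rule bexE)
  show ?thesis by (rule exI[of _ "fst pq"], rule exI[of _ "snd pq"]) (use pq in \<open>simp add: case_prod_unfold\<close>)
 qed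
 \<comment> \<open>Exponents live on indices 1 to \<open>N\<close>, whereas the sums in
   \<open>gordan\<close> start at index 0. Hence the bound \<open>Suc N\<close>; index 0 contributes
   nothing.\<close>
 have "EX w :: nat => rat. ALL d:D. 0 < (\<Sum>i<Suc N. w i * of_int (d i))"
 proof (rule gordan)
  show "(%i. c i + d i) \<in> P" if "c \<in> P" "d \<in> P" for c d
  proof -
   obtain p q p' q' where c: "c = (%i. int (q i) - int (p i))" "p \<in> exponents N" "q \<in> exponents N" "lt p q"
    and d: "d = (%i. int (q' i) - int (p' i))" "p' \<in> exponents N" "q' \<in> exponents N" "lt p' q'"
    using \<open>c \<in> P\<close> \<open>d \<in> P\<close> unfolding P_def by blast
   have "(%i. c i + d i) = (%i. int ((q + q') i) - int ((p + p') i))" by (simp add: c d fun_eq_iff)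
   thus ?thesis unfolding P_def using lt_add2[of p q p' q'] c d exponents_add by blast
  qed
  show "(%_. 0) \<notin> P"
  proof
   assume "(%_. 0) \<in> P"
   then obtain p q where pq: "(%_. 0) = (%i. int (q i) - int (p i))" "p \<in> exponents N" "lt p q" unfolding P_def by blast
   have "p = q" using fun_cong[OF pq(1)] by (intro ext) simp
   thus False using pq lt_irrefl by blast
  qed
  have "finite {(p, q) \<in> E \<times> E. lt p q}" by (rule finite_subset[of _ "E \<times> E"]) (use E in auto)
  thus "finite D" unfolding D_def by blast
  show "D \<subseteq> P"
  proof
   fix d assume "d \<in> D"
   from D[OF this] obtain p q where d: "d = (%i. int (q i) - int (p i))"
    and pq: "(p, q) \<in> {(p, q) \<in> E \<times> E. lt p q} \<union> (%i. ((%_. 0), unit_exp i)) ` {1..N}" by (elim exE conjE)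
   have "(%_. 0) \<in> exponents N" by (simp add: exponents_def)
   hence "p \<in> exponents N & q \<in> exponents N & lt p q" using pq E u by auto
   thus "d \<in> P" unfolding P_def d by blast
  qed
  fix d i assume d: "d \<in> D" and i: "Suc N \<le> i"
  have z: "p i = 0" if "p \<in> E" for p using E(2) that i by (auto simp: exponents_def)
  obtain p q where pq: "d = (%i. int (q i) - int (p i))"
   "(p, q) \<in> {(p, q) \<in> E \<times> E. lt p q} \<union> (%i. ((%_. 0), unit_exp i)) ` {1..N}" using D[OF d] by (elim exE conjE)
  have "p i = 0" "q i = 0" using pq(2) z i by (auto simp: unit_exp_def)
  thus "d i = 0" by (simp add: pq(1))
 qed
 then obtain w :: "nat => rat" where w: "!!d. d \<in> D ==> 0 < (\<Sum>i<Suc N. w i * of_int (d i))" by blast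
 have split: "(\<Sum>i<Suc N. w i * of_int (int (q i) - int (p i))) = (\<Sum>i=1..N. w i * of_nat (q i)) - (\<Sum>i=1..N. w i * of_nat (p i))"
  if "p \<in> exponents N" "q \<in> exponents N" for p q
 proof -
  have "(\<Sum>i<Suc N. w i * of_int (int (q i) - int (p i))) = (\<Sum>i=1..N. w i * of_int (int (q i) - int (p i)))"
   by (rule sum.mono_neutral_right) (use that in \<open>auto simp: exponents_def\<close>)
  thus ?thesis by (simp add: sum_subtractf[symmetric] right_diff_distrib)
 qed
 have pos: "0 < w i" if i: "i \<in> {1..N}" for i
 proof -
  have "(%j. int (unit_exp i j) - int 0) \<in> D" unfolding D_def using i by (intro image_eqI[of _ _ "((%_. 0), unit_exp i)"]) auto
  from w[OF this] have "0 < (\<Sum>j<Suc N. w j * of_int (int (unit_exp i j) - int ((%_. 0) j)))" by simp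
  also have "\<dots> = (\<Sum>j=1..N. w j * of_nat (unit_exp i j)) - (\<Sum>j=1..N. w j * of_nat 0)"
   by (rule split) (use u i in \<open>auto simp: exponents_def\<close>)
  also have "\<dots> = (\<Sum>j=1..N. if j = i then w j else 0)" by (simp add: unit_exp_def if_distrib cong: if_cong)
  finally show ?thesis using i by simp
 qed
 obtain m :: nat where m: "m > 0" "!!i. i < Suc N ==> EX z :: int. of_nat m * w i = of_int z" using common_denominator[of "Suc N" w] by blast
 define W where "W i = nat \<lfloor>of_nat m * w i\<rfloor>" for i
 have W: "of_nat (W i) = of_nat m * w i" if i: "i \<in> {1..N}" for i
 proof -
  obtain z :: int where z: "of_nat m * w i = of_int z" using m(2)[of i] i by auto
  have "0 < of_nat m * w i" using pos[OF i] m(1) by simp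
  hence "0 < z" using z by simp
  thus ?thesis using z by (simp add: W_def)
 qed
 have degW: "of_nat (deg N W p) = of_nat m * (\<Sum>i=1..N. w i * of_nat (p i))" for p
  unfolding deg_def of_nat_sum sum_distrib_left by (rule sum.cong) (simp_all add: W)
 have "deg N W p < deg N W q" if "p \<in> E" "q \<in> E" "lt p q" for p q
 proof -
  have "(%i. int (q i) - int (p i)) \<in> D" unfolding D_def using that by (intro image_eqI[of _ _ "(p, q)"]) auto
  from w[OF this] have "(\<Sum>i=1..N. w i * of_nat (p i)) < (\<Sum>i=1..N. w i * of_nat (q i))"
  proof -
   have "p \<in> exponents N" "q \<in> exponents N" using that E by auto
   from split[OF this] \<open>0 < (\<Sum>i<Suc N. w i * of_int (int (q i) - int (p i)))\<close> show ?thesis by linarith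
  qed
  hence "(of_nat (deg N W p) :: rat) < of_nat (deg N W q)" unfolding degW using m(1) by simp
  thus ?thesis by simp
 qed
 thus ?thesis by blast
qed

end

section \<open>Straightening of words and the essential basis\<close>

text \<open>The tail of \<open>xs\<close> is rearranged first; then the leading letter is moved by
  neighbouring swaps to its position in \<open>ys\<close>. The fixed prefix \<open>a\<close> lets
  the induction continue behind letters already placed.\<close>

lemma adjacent_swaps:
 assumes refl: "!!xs. R xs xs" and trans: "!!xs ys zs. R xs ys ==> R ys zs ==> R xs zs"
  and swap: "!!a i j b. R (a @ i # j # b) (a @ j # i # b)"
 shows "mset xs = mset ys ==> R (a @ xs) (a @ ys)"
proof (induction xs arbitrary: a ys)
 case Nil
 thus ?case using refl by simp
next
 case (Cons x xs)
 have "x \<in> set ys" using Cons.prems by (metis list.set_intros(1) set_mset_mset)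
 then obtain y b where ys: "ys = y @ x # b" by (meson split_list)
 have "mset xs = mset (y @ b)" using Cons.prems ys by simp
 from Cons.IH[OF this, of "a @ [x]"] have "R (a @ x # xs) (a @ x # y @ b)" by simp
 moreover have "R (a @ x # y @ b) (a @ y @ x # b)" 
 proof -
  have "R (a @ x # y @ b) (a @ y @ x # b)" for y b
  proof (induction y arbitrary: b rule: rev_induct)
   case Nil
   show ?case using refl by simp
  next
   case (snoc z y)
   show ?case using trans[OF snoc[of "z # b"]] swap[of "a @ y" x z b] by simp
  qed
  thus ?thesis .
 qed
 ultimately show ?case using trans ys by blast
qed

locale pbw = monomial_order N lt for N lt +
 fixes F :: "nat => complex ^ 'm ^ 'm" and v :: "complex ^ 'm" and \<LL> :: "(complex ^ 'm ^ 'm) set"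
 assumes L_eq: "\<LL> = {\<Sum>i=1..N. mat_scale (c i) (F i) |c. True}"
  and bracket: "A \<in> \<LL> ==> B \<in> \<LL> ==> A ** B - B ** A \<in> \<LL>"
  and cyc: "cyclic_vector \<LL> v"
begin

definition word :: "nat list => complex ^ 'm => complex ^ 'm" where
 "word is x = foldr (%i. (*v) (F i)) is x"

lemma word_Nil [simp]: "word [] x = x" and word_Cons [simp]: "word (i # is) x = F i *v word is x" by (simp_all add: word_def)

lemma word_append: "word (is @ js) x = word is (word js x)" by (simp add: word_def)

lemma word_zero [simp]: "word is 0 = 0" and word_add: "word is (x + y) = word is x + word is y"
 and word_diff: "word is (x - y) = word is x - word is y" and word_scale: "word is (c *s x) = c *s word is x"
 by (induction "is") (simp_all add: matrix_vector_right_distrib matrix_vector_mult_diff_distrib vector_scalar_commute)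

lemma word_sum: "word is (\<Sum>i\<in>I. f i) = (\<Sum>i\<in>I. word is (f i))" by (induction I rule: infinite_finite_induct) (simp_all add: word_add)

lemma lincomb_vector: "(\<Sum>i\<in>I. mat_scale (c i) (A i)) *v x = (\<Sum>i\<in>I. c i *s (A i *v x))"
proof -
 have 1: "mat_scale c A *v x = c *s (A *v x)" for c A by (simp add: vec_eq_iff matrix_vector_mult_def sum_distrib_left mult.assoc)
 show ?thesis by (induction I rule: infinite_finite_induct) (simp_all add: matrix_vector_mult_add_rdistrib 1)
qed

lemma F_in_L: "i \<in> {1..N} ==> F i \<in> \<LL>"
proof -
 assume i: "i \<in> {1..N}"
 have "(\<Sum>j=1..N. mat_scale (if j = i then 1 else 0) (F j)) = (\<Sum>j=1..N. if j = i then F j else 0)"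
  by (rule sum.cong[OF refl]) (simp add: vec_eq_iff)
 also have "\<dots> = F i" using i by simp
 finally show ?thesis unfolding L_eq by (intro CollectI exI[of _ "%j. if j = i then 1 else 0"]) simp
qed

definition cont :: "nat list => nat => nat" where
 "cont is i = count_list is i"

abbreviation size_exp :: "(nat => nat) => nat" where
 "size_exp == deg N (%_. Suc 0)"

lemma cont_exponents: "set is \<subseteq> {1..N} ==> cont is \<in> exponents N" by (auto simp: cont_def exponents_def count_list_0_iff)

lemma deg_cont: "set is \<subseteq> {1..N} ==> deg N w (cont is) = sum_list (map w is)"
proof (induction "is")
 case (Cons i "is")
 have "deg N w (cont (i # is)) = (\<Sum>j=1..N. (if j = i then w j else 0) + w j * cont is j)"
  unfolding deg_def by (rule sum.cong) (auto simp: cont_def)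
 also have "\<dots> = w i + deg N w (cont is)" using Cons.prems by (simp add: sum.distrib deg_def)
 finally show ?case using Cons by simp
qed (simp add: deg_def cont_def)

lemma size_cont: "set is \<subseteq> {1..N} ==> size_exp (cont is) = length is" using deg_cont[of "is" "%_. Suc 0"] by (simp add: sum_list_triv)

abbreviation bvec :: "(nat => nat) => complex ^ 'm" where
 "bvec p == monomial_vec N F v p"

definition std :: "(nat => nat) => nat list" where
 "std p = concat (map (%i. replicate (p i) i) [1..<Suc N])"

lemma bvec_word: "bvec p = word (std p) v"
proof -
 have r: "word (replicate n i) x = ((*v) (F i) ^^ n) x" for n i x by (induction n) simp_all
 have "word (concat (map (%i. replicate (p i) i) xs)) v = foldr (%i w. (((*v) (F i)) ^^ p i) w) xs v" for xs
  by (induction xs) (simp_all add: word_append r)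
 thus ?thesis unfolding monomial_vec_def std_def by metis
qed

lemma cont_std: "p \<in> exponents N ==> cont (std p) = p"
proof -
 assume p: "p \<in> exponents N"
 have r: "count_list (replicate n i) j = (if i = j then n else 0)" for n and i j :: nat by (induction n) auto
 have "distinct xs ==> count_list (concat (map (%i. replicate (p i) i) xs)) i = (if i \<in> set xs then p i else 0)" for xs i
  by (induction xs) (auto simp: r)
 from this[of "[1..<Suc N]"] show ?thesis using p by (intro ext) (auto simp: cont_def std_def exponents_def less_Suc_eq_le simp del: upt_Suc)
qed

lemma set_std: "set (std p) \<subseteq> {1..N}" by (auto simp: std_def)

lemma mset_std: "set is \<subseteq> {1..N} ==> mset is = mset (std (cont is))"
 using cont_std[OF cont_exponents, of "is"] by (intro multiset_eqI) (metis count_mset cont_def)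

text \<open>The bound is strict, so that \<open>low (Suc s)\<close> and \<open>low s\<close> are the
  steps \<open>s\<close> and \<open>s - 1\<close> of the degree filtration and \<open>low 0\<close>
  is the zero space.\<close>

definition low :: "nat => (complex ^ 'm) set" where
 "low s = vec.span {bvec q |q. q \<in> exponents N & size_exp q < s}"

lemma low_mono: "s \<le> t ==> low s \<subseteq> low t" unfolding low_def by (rule vec.span_mono) auto

lemma low_bvec: "q \<in> exponents N ==> size_exp q < s ==> bvec q \<in> low s" unfolding low_def by (rule vec.span_base) blast

lemma low_subspace: "vec.subspace (low s)" unfolding low_def by (rule vec.subspace_span)

text \<open>Swapping two neighbouring letters changes a word by a commutator, which is a linear
  combination of single letters. The error is a combination of words shorter by one, and those are
  of lower degree by induction.\<close>

theorem straighten: "set is \<subseteq> {1..N} ==> word is v - bvec (cont is) \<in> low (length is)"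
proof (induction "length is" arbitrary: "is" rule: less_induct)
 case less
 let ?n = "length is"
 have low: "word js v \<in> low ?n" if js: "length js < ?n" "set js \<subseteq> {1..N}" for js
 proof -
  have "word js v - bvec (cont js) \<in> low ?n" using less.hyps[OF js] low_mono[of "length js" ?n] js by auto
  moreover have "bvec (cont js) \<in> low ?n" using js by (intro low_bvec cont_exponents) (simp_all add: size_cont)
  ultimately have "(word js v - bvec (cont js)) + bvec (cont js) \<in> low ?n" using vec.subspace_add[OF low_subspace] by blast
  thus ?thesis by simp
 qed
 \<comment> \<open>Equality of multisets is part of the relation, so that the conditions on length
   and letters pass along a chain of swaps and transitivity holds.\<close>
 define R where "R xs ys \<longleftrightarrow> mset xs = mset ys & (length xs = ?n & set xs \<subseteq> {1..N} --> word xs v - word ys v \<in> low ?n)" for xs ys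
 have "R ([] @ is) ([] @ std (cont is))"
 proof (rule adjacent_swaps[where R = R])
  show "R xs xs" for xs using vec.subspace_0[OF low_subspace] by (simp add: R_def)
  show "R xs zs" if r: "R xs ys" "R ys zs" for xs ys zs
  proof -
   have m: "mset xs = mset ys" using r by (simp add: R_def)
   hence "length xs = length ys" "set xs = set ys" by (metis size_mset, metis set_mset_mset)
   moreover have "word xs v - word zs v = (word xs v - word ys v) + (word ys v - word zs v)" by simp
   ultimately show ?thesis using r vec.subspace_add[OF low_subspace] unfolding R_def by metis
  qed
  show "R (a @ i # j # b) (a @ j # i # b)" for a i j b unfolding R_def
  proof (intro conjI impI)
   assume *: "length (a @ i # j # b) = ?n & set (a @ i # j # b) \<subseteq> {1..N}"
   have "F i ** F j - F j ** F i \<in> \<LL>" by (intro bracket F_in_L) (use * in auto)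
   then obtain c where c: "F i ** F j - F j ** F i = (\<Sum>k=1..N. mat_scale (c k) (F k))" unfolding L_eq by blast
   have "word (a @ i # j # b) v - word (a @ j # i # b) v = word a ((F i ** F j - F j ** F i) *v word b v)"
    by (simp add: word_append word_diff[symmetric] matrix_vector_mult_diff_rdistrib matrix_vector_mul_assoc)
   also have "\<dots> = (\<Sum>k=1..N. c k *s word (a @ k # b) v)" unfolding c lincomb_vector by (simp add: word_sum word_scale word_append)
   also have "\<dots> \<in> low ?n" by (intro vec.subspace_sum[OF low_subspace] vec.subspace_scale[OF low_subspace] low) (use * in auto)
   finally show "word (a @ i # j # b) v - word (a @ j # i # b) v \<in> low ?n" .
  qed simp
  show "mset is = mset (std (cont is))" by (rule mset_std[OF less.prems])
 qed
 thus ?case using less.prems by (simp add: R_def bvec_word)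
qed

lemma word_low: "set is \<subseteq> {1..N} ==> word is v \<in> low (Suc (length is))"
proof -
 assume i: "set is \<subseteq> {1..N}"
 have "word is v - bvec (cont is) \<in> low (Suc (length is))" using straighten[OF i] low_mono[of "length is" "Suc (length is)"] by auto
 moreover have "bvec (cont is) \<in> low (Suc (length is))" using i by (intro low_bvec cont_exponents) (simp_all add: size_cont)
 ultimately have "(word is v - bvec (cont is)) + bvec (cont is) \<in> low (Suc (length is))" using vec.subspace_add[OF low_subspace] by blast
 thus ?thesis by simp
qed

lemma operators_word: "set xs \<subseteq> \<LL> ==> foldr (*v) xs v \<in> vec.span {word is v |is. set is \<subseteq> {1..N} & length is = length xs}"
proof (induction xs)
 case Nil
 have "v = word [] v" by simp
 thus ?case by (intro vec.span_base) force
next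
 case (Cons A xs)
 let ?W = "%n. {word is v |is. set is \<subseteq> {1..N} & length is = n}"
 obtain c where A: "A = (\<Sum>i=1..N. mat_scale (c i) (F i))" using Cons.prems unfolding L_eq by auto
 have "{u. A *v u \<in> vec.span (?W (Suc (length xs)))} \<supseteq> vec.span (?W (length xs))"
 proof (rule vec.span_minimal)
  show "?W (length xs) \<subseteq> {u. A *v u \<in> vec.span (?W (Suc (length xs)))}"
  proof clarify
   fix "is" assume i: "set is \<subseteq> {1..N}" "length is = length xs"
   have "(\<Sum>k=1..N. c k *s word (k # is) v) \<in> vec.span (?W (Suc (length xs)))"
   proof (intro vec.span_sum vec.span_scale vec.span_base CollectI)
    fix k assume "k \<in> {1..N}"
    thus "EX js. word (k # is) v = word js v & set js \<subseteq> {1..N} & length js = Suc (length xs)" using i by (intro exI[of _ "k # is"]) simp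
   qed
   thus "A *v word is v \<in> vec.span (?W (Suc (length xs)))" unfolding A lincomb_vector by simp
  qed
  show "vec.subspace {u. A *v u \<in> vec.span (?W (Suc (length xs)))}"
   by (rule vec.subspaceI) (auto simp: matrix_vector_right_distrib vector_scalar_commute vec.span_zero vec.span_add vec.span_scale)
 qed
 thus ?case using Cons by auto
qed

lemma PBW_low: "PBW_filtration \<LL> v s = low (Suc s)"
proof
 show "PBW_filtration \<LL> v s \<subseteq> low (Suc s)" unfolding PBW_filtration_def
 proof (rule vec.span_minimal[OF _ low_subspace])
  show "{foldr (*v) xs v |xs. set xs \<subseteq> \<LL> & length xs \<le> s} \<subseteq> low (Suc s)"
  proof clarify
   fix xs assume xs: "set xs \<subseteq> \<LL>" "length xs \<le> s"
   have "vec.span {word is v |is. set is \<subseteq> {1..N} & length is = length xs} \<subseteq> low (Suc s)"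
    by (rule vec.span_minimal[OF _ low_subspace]) (use word_low low_mono[of "Suc (length xs)" "Suc s"] xs in force)
   thus "foldr (*v) xs v \<in> low (Suc s)" using operators_word[OF xs(1)] by blast
  qed
 qed
 show "low (Suc s) \<subseteq> PBW_filtration \<LL> v s" unfolding low_def PBW_filtration_def
 proof (rule vec.span_mono, clarify)
  fix q assume q: "q \<in> exponents N" "size_exp q < Suc s"
  have "length (std q) \<le> s" using size_cont[OF set_std, of q] cont_std[OF q(1)] q(2) by simp
  moreover have "word is v = foldr (*v) (map F is) v" for "is" by (simp add: word_def foldr_map comp_def)
  moreover have "set (map F (std q)) \<subseteq> \<LL>" using set_std[of q] F_in_L by auto
  ultimately show "EX xs. bvec q = foldr (*v) xs v & set xs \<subseteq> \<LL> & length xs \<le> s"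
   unfolding bvec_word by (intro exI[of _ "map F (std q)"]) simp
 qed
qed

lemma PBW_lower_low: "PBW_lower \<LL> v s = low s"
proof (cases s)
 case 0
 have "low 0 = {0}" by (simp add: low_def)
 thus ?thesis by (simp add: PBW_lower_def 0)
qed (simp add: PBW_lower_def PBW_low)

section \<open>The essential monomials as a basis adapted to both filtrations\<close>

lemma lt_not_sym: "p \<in> exponents N ==> q \<in> exponents N ==> lt p q ==> \<not> lt q p" using lt_trans[of p q p] lt_irrefl by blast

lemma lt_size: "p \<in> exponents N ==> q \<in> exponents N ==> lt p q ==> size_exp p \<le> size_exp q"
 using lt_deg[of q p] lt_not_sym[of p q] by (meson not_le)

lemma finite_below: "q \<in> exponents N ==> finite {p \<in> exponents N. lt p q}"
proof -
 assume q: "q \<in> exponents N"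
 have "finite {p. ALL i. (i \<in> {1..N} --> p i \<in> {..size_exp q}) & (i \<notin> {1..N} --> p i = 0)}" by (rule finite_set_of_finite_funs) auto
 moreover have "p i \<le> size_exp q" if "p \<in> exponents N" "lt p q" "i \<in> {1..N}" for p i
 proof -
  have "p i \<le> size_exp p" unfolding deg_def using member_le_sum[of i "{1..N}" p] that by simp
  thus ?thesis using lt_size[OF that(1) q that(2)] by simp
 qed
 ultimately show ?thesis by (rule_tac finite_subset) (auto simp: exponents_def)
qed

text \<open>The position in the order. It is a true measure because a homogeneous order has only
  finitely many exponents below a given one.\<close>

definition rank :: "(nat => nat) => nat" where
 "rank q = card {p \<in> exponents N. lt p q}"

lemma rank_less: "p \<in> exponents N ==> q \<in> exponents N ==> lt p q ==> rank p < rank q" unfolding rank_def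
proof (rule psubset_card_mono)
 assume pq: "p \<in> exponents N" "q \<in> exponents N" "lt p q"
 show "finite {p \<in> exponents N. lt p q}" by (rule finite_below[OF pq(2)])
 show "{r \<in> exponents N. lt r p} \<subset> {r \<in> exponents N. lt r q}" using lt_trans[OF _ pq(1,2)] pq lt_irrefl by blast
qed

definition S :: "(nat => nat) set" where "S = essential_exps N lt F v"

lemma S_exponents: "p \<in> S ==> p \<in> exponents N" and S_less: "p \<in> S ==> bvec p \<notin> F_less N lt F v p"
 by (auto simp: S_def essential_exps_def)

text \<open>A monomial vector that is not essential lies, by definition, in the span of strictly
  smaller ones, and induction on the position in the order replaces these by essential ones.\<close>

lemma bvec_essential: "p \<in> exponents N ==> bvec p \<in> vec.span {bvec q |q. q \<in> S & (lt q p \<or> q = p)}"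
proof (induction "rank p" arbitrary: p rule: less_induct)
 case less
 show ?case
 proof (cases "p \<in> S")
  case True
  thus ?thesis by (intro vec.span_base) blast
 next
  case False
  hence "bvec p \<in> vec.span {bvec q |q. q \<in> exponents N & lt q p}" using less.prems by (simp add: S_def essential_exps_def F_less_def)
  also have "\<dots> \<subseteq> vec.span {bvec q |q. q \<in> S & (lt q p \<or> q = p)}"
  proof (rule vec.span_minimal[OF _ vec.subspace_span], clarify)
   fix q assume q: "q \<in> exponents N" "lt q p"
   have "bvec q \<in> vec.span {bvec r |r. r \<in> S & (lt r q \<or> r = q)}" using less.hyps[OF rank_less[OF q(1) less.prems q(2)] q(1)] .
   also have "\<dots> \<subseteq> vec.span {bvec q |q. q \<in> S & (lt q p \<or> q = p)}"
    by (rule vec.span_mono) (use lt_trans[OF _ q(1) less.prems _ q(2)] q(2) S_exponents in blast)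
   finally show "bvec q \<in> vec.span {bvec q |q. q \<in> S & (lt q p \<or> q = p)}" .
  qed
  finally show ?thesis .
 qed
qed

text \<open>The largest exponent occurring with nonzero coefficient in a relation would be expressed
  by smaller ones, so it would not be essential.\<close>

lemma essential_independent:
 assumes J: "finite J" "J \<subseteq> S" and z: "(\<Sum>p\<in>J. c p *s bvec p) = 0" and p: "p \<in> J"
 shows "c p = 0"
proof (rule ccontr)
 assume "c p ~= 0"
 define K where "K = (nz J c)"
 have K: "finite K" "p \<in> K" using J p \<open>c p \<noteq> 0\<close> by (auto simp: K_def)
 hence "Max (rank ` K) \<in> rank ` K" by (intro Max_in) auto
 then obtain m where m: "m \<in> K" "rank m = Max (rank ` K)" by (metis imageE)
 have max: "q = m \<or> lt q m" if "q \<in> K" for q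
 proof -
  have "rank q \<le> rank m" using that K(1) m(2) by simp
  thus ?thesis using lt_total[of q m] rank_less[of m q] that m(1) J S_exponents unfolding K_def by force
 qed
 have "0 = (\<Sum>p\<in>K. c p *s bvec p)" unfolding z[symmetric] using J by (intro sum.mono_neutral_right) (auto simp: K_def)
 also have "\<dots> = c m *s bvec m + (\<Sum>p\<in>K - {m}. c p *s bvec p)" using sum.remove[OF K(1) m(1)] .
 finally have "c m *s bvec m = - (\<Sum>p\<in>K - {m}. c p *s bvec p)" by (simp add: eq_neg_iff_add_eq_0)
 hence "(1 / c m) *s (c m *s bvec m) = (1 / c m) *s - (\<Sum>p\<in>K - {m}. c p *s bvec p)" by simp
 hence "bvec m = (1 / c m) *s - (\<Sum>p\<in>K - {m}. c p *s bvec p)" using m(1) by (simp add: K_def)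
 moreover have "(1 / c m) *s - (\<Sum>p\<in>K - {m}. c p *s bvec p) \<in> F_less N lt F v m" unfolding F_less_def
 proof (intro vec.span_scale vec.span_neg vec.span_sum vec.span_base CollectI)
  fix q assume q: "q \<in> K - {m}"
  hence "lt q m" "q \<in> exponents N" using max J S_exponents by (auto simp: K_def)
  thus "EX r. bvec q = bvec r & r \<in> exponents N & lt r m" by blast
 qed
 ultimately have "bvec m \<in> F_less N lt F v m" by metis
 moreover have "m \<in> S" using m(1) J by (auto simp: K_def)
 ultimately show False using S_less by blast
qed

lemma inj_bvec: "inj_on bvec S"
proof (rule inj_onI, rule ccontr)
 fix p q assume pq: "p \<in> S" "q \<in> S" "bvec p = bvec q" and ne: "p ~= q"
 have "(\<Sum>r\<in>{p, q}. (if r = p then 1 else - 1) *s bvec r) = 0" using pq ne by simp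
 from essential_independent[OF _ _ this, of p] pq show False by simp
qed

lemma finite_S: "finite S" 
proof (rule ccontr)
 assume "infinite S"
 then obtain J where J: "finite J" "card J = Suc CARD('m)" "J \<subseteq> S" using infinite_arbitrarily_large by blast
 have inj: "inj_on bvec J" using inj_bvec J by (meson inj_on_subset)
 have "vec.independent (bvec ` J)"
 proof -
  have "\<not> vec.dependent (bvec ` J)"
  proof
   assume "vec.dependent (bvec ` J)"
   then obtain u where u: "EX x:bvec ` J. u x ~= 0" "(\<Sum>x\<in>bvec ` J. u x *s x) = 0" using J by (auto simp: vec.dependent_finite)
   have "(\<Sum>p\<in>J. u (bvec p) *s bvec p) = 0" using u(2) by (simp add: sum.reindex[OF inj])
   thus False using essential_independent[OF J(1,3), of "%p. u (bvec p)"] u(1) by blast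
  qed
  thus ?thesis by simp
 qed
 hence "card (bvec ` J) \<le> vec.dim (UNIV :: (complex ^ 'm) set)" by (intro vec.independent_card_le_dim) auto
 thus False using inj J by (simp add: card_image card_cart_basis)
qed

lemma independent_S: "vec.independent (bvec ` S)"
proof
 assume "vec.dependent (bvec ` S)"
 then obtain u where u: "EX x:bvec ` S. u x ~= 0" "(\<Sum>x\<in>bvec ` S. u x *s x) = 0" using finite_S by (auto simp: vec.dependent_finite)
 have "(\<Sum>p\<in>S. u (bvec p) *s bvec p) = 0" using u(2) by (simp add: sum.reindex[OF inj_bvec])
 thus False using essential_independent[OF finite_S order_refl, of "%p. u (bvec p)"] u(1) by blast
qed

lemma span_S: "vec.span (bvec ` S) = UNIV"
proof -
 have b: "bvec q \<in> vec.span (bvec ` S)" if "q \<in> exponents N" for q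
  using bvec_essential[OF that] vec.span_mono[of "{bvec r |r. r \<in> S & (lt r q \<or> r = q)}" "bvec ` S"] by blast
 have "low s \<subseteq> vec.span (bvec ` S)" for s unfolding low_def by (rule vec.span_minimal[OF _ vec.subspace_span]) (use b in blast)
 hence "PBW_filtration \<LL> v s \<subseteq> vec.span (bvec ` S)" for s unfolding PBW_low by blast
 hence "foldr (*v) xs v \<in> vec.span (bvec ` S)" if "set xs \<subseteq> \<LL>" for xs
  using that vec.span_base[of "foldr (*v) xs v" "{foldr (*v) ys v |ys. set ys \<subseteq> \<LL> & length ys \<le> length xs}"]
  unfolding PBW_filtration_def by blast
 hence "vec.span {foldr (*v) xs v |xs. set xs \<subseteq> \<LL>} \<subseteq> vec.span (bvec ` S)"
  by (intro vec.span_minimal[OF _ vec.subspace_span]) blast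
 thus ?thesis using cyc by (auto simp: cyclic_vector_def)
qed

definition coord :: "(nat => nat) => complex ^ 'm => complex" where
 "coord p x = vec.representation (bvec ` S) x (bvec p)"

lemma coord_add: "coord p (x + y) = coord p x + coord p y"
 and coord_scale: "coord p (c *s x) = c * coord p x"
 unfolding coord_def using vec.representation_add[OF independent_S] vec.representation_scale[OF independent_S] span_S by simp_all

lemma coord_zero [simp]: "coord p 0 = 0" using coord_scale[of p 0 0] by simp

lemma coord_diff: "coord p (x - y) = coord p x - coord p y" using coord_add[of p "x - y" y] by simp

lemma coord_sum: "coord p (\<Sum>i\<in>I. f i) = (\<Sum>i\<in>I. coord p (f i))"
 by (induction I rule: infinite_finite_induct) (simp_all add: coord_add)

lemma coord_bvec: "p \<in> S ==> q \<in> S ==> coord p (bvec q) = (if p = q then 1 else 0)"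
 unfolding coord_def using vec.representation_basis[OF independent_S, of "bvec q"] inj_bvec by (auto simp: inj_on_def)

lemma coord_expand: "x = (\<Sum>p\<in>S. coord p x *s bvec p)"
proof -
 have "x = (\<Sum>y\<in>bvec ` S. vec.representation (bvec ` S) x y *s y)"
  using vec.sum_representation_eq[OF independent_S, of x "bvec ` S"] span_S finite_S by simp
 thus ?thesis unfolding coord_def sum.reindex[OF inj_bvec] comp_def .
qed

lemma coord_ext: "(!!p. p \<in> S ==> coord p x = coord p y) ==> x = y"
 using coord_expand[of x] coord_expand[of y] by (metis (no_types, lifting) sum.cong)

lemma span_coord: "x \<in> vec.span {bvec q |q. q \<in> S & Q q} \<longleftrightarrow> (ALL p:S. \<not> Q p --> coord p x = 0)"
proof
 have "vec.span {bvec q |q. q \<in> S & Q q} \<subseteq> {x. ALL p:S. \<not> Q p --> coord p x = 0}"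
  by (rule vec.span_minimal) (auto simp: coord_bvec coord_add coord_scale intro!: vec.subspaceI)
 thus "x \<in> vec.span {bvec q |q. q \<in> S & Q q} ==> ALL p:S. \<not> Q p --> coord p x = 0" by blast
 assume *: "ALL p:S. \<not> Q p --> coord p x = 0"
 have "coord p x *s bvec p \<in> vec.span {bvec q |q. q \<in> S & Q q}" if "p \<in> S" for p
 proof (cases "Q p")
  case True
  thus ?thesis using that by (intro vec.span_scale vec.span_base) blast
 next
  case False
  thus ?thesis using that * by (simp add: vec.span_zero)
 qed
 hence "(\<Sum>p\<in>S. coord p x *s bvec p) \<in> vec.span {bvec q |q. q \<in> S & Q q}" by (rule vec.span_sum)
 thus "x \<in> vec.span {bvec q |q. q \<in> S & Q q}" using coord_expand[of x] by simp
qed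

text \<open>For an initial segment of the order the essential monomials in it already span. This
  turns every filtration step into a coordinate subspace.\<close>

lemma down_closed_span:
 assumes "!!p q. p \<in> exponents N ==> q \<in> exponents N ==> lt p q ==> Q q ==> Q p"
 shows "vec.span {bvec q |q. q \<in> exponents N & Q q} = vec.span {bvec q |q. q \<in> S & Q q}"
proof
 show "vec.span {bvec q |q. q \<in> S & Q q} \<subseteq> vec.span {bvec q |q. q \<in> exponents N & Q q}"
  by (rule vec.span_mono) (use S_exponents in blast)
 show "vec.span {bvec q |q. q \<in> exponents N & Q q} \<subseteq> vec.span {bvec q |q. q \<in> S & Q q}"
 proof (rule vec.span_minimal[OF _ vec.subspace_span], clarify)
  fix q assume q: "q \<in> exponents N" "Q q"
  have "vec.span {bvec r |r. r \<in> S & (lt r q \<or> r = q)} \<subseteq> vec.span {bvec q |q. q \<in> S & Q q}"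
   by (rule vec.span_mono) (use assms q S_exponents in blast)
  thus "bvec q \<in> vec.span {bvec q |q. q \<in> S & Q q}" using bvec_essential[OF q(1)] by blast
 qed
qed

lemma low_iff: "x \<in> low s \<longleftrightarrow> (ALL p:S. \<not> size_exp p < s --> coord p x = 0)"
proof -
 have "low s = vec.span {bvec q |q. q \<in> S & size_exp q < s}" unfolding low_def by (rule down_closed_span) (use lt_size in fastforce)
 thus ?thesis by (simp only: span_coord)
qed

lemma F_less_iff: "q \<in> exponents N ==> x \<in> F_less N lt F v q \<longleftrightarrow> (ALL p:S. \<not> lt p q --> coord p x = 0)"
proof -
 assume q: "q \<in> exponents N"
 have "F_less N lt F v q = vec.span {bvec p |p. p \<in> S & lt p q}"
  unfolding F_less_def by (rule down_closed_span[where Q = "%p. lt p q"]) (use lt_trans q in blast)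
 thus ?thesis by (simp only: span_coord)
qed

lemma F_le_iff: "q \<in> exponents N ==> x \<in> F_le N lt F v q \<longleftrightarrow> (ALL p:S. \<not> (lt p q \<or> p = q) --> coord p x = 0)"
proof -
 assume q: "q \<in> exponents N"
 have "F_le N lt F v q = vec.span {bvec p |p. p \<in> S & (lt p q \<or> p = q)}"
  unfolding F_le_def by (rule down_closed_span[where Q = "%p. lt p q \<or> p = q"]) (use lt_trans q in blast)
 thus ?thesis by (simp only: span_coord)
qed

text \<open>Triangularity, the source of all weight estimates. Straightening changes a word only by
  terms of smaller degree, so coordinates of degree at least the length agree with those of the
  sorted monomial, while exponents of smaller degree are smaller in the order anyway.\<close>

lemma coord_word:
 assumes p: "p \<in> S" and i: "set is \<subseteq> {1..N}"
 shows "cont is = p ==> coord p (word is v) = 1"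
  and "coord p (word is v) ~= 0 ==> lt p (cont is) \<or> p = cont is"
proof -
 note e = cont_exponents[OF i]
 have l: "coord p (word is v) = coord p (bvec (cont is))" if "\<not> size_exp p < length is"
  using straighten[OF i] p that unfolding low_iff by (simp add: coord_diff)
 show "coord p (word is v) = 1" if c: "cont is = p" using l size_cont[OF i] coord_bvec[OF p p] c by simp
 assume nz: "coord p (word is v) ~= 0"
 show "lt p (cont is) \<or> p = cont is"
 proof (cases "size_exp p < length is")
  case True
  thus ?thesis using lt_deg[OF S_exponents[OF p] e] size_cont[OF i] by simp
 next
  case False
  have "bvec (cont is) \<in> F_le N lt F v (cont is)" unfolding F_le_def by (rule vec.span_base) (use e in blast)
  thus ?thesis using l[OF False] nz p unfolding F_le_iff[OF e] by auto
 qed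
qed

lemma zero_S: "(%_. 0) \<in> S"
proof -
 have z: "(%_. 0) \<in> exponents N" by (simp add: exponents_def)
 have "\<not> lt q (%_. 0)" if q: "q \<in> exponents N" for q
 proof
  assume l: "lt q (%_. 0)"
  hence "size_exp q \<le> 0" using lt_size[OF q z] by (simp add: deg_def)
  hence "q i = 0" for i using q by (cases "i \<in> {1..N}") (auto simp: deg_def exponents_def)
  hence "q = (%_. 0)" by auto
  thus False using l lt_irrefl[OF z] by simp
 qed
 hence "F_less N lt F v (%_. 0) = {0}" by (simp add: F_less_def cong: conj_cong)
 moreover have "bvec (%_. 0) = v" by (simp add: bvec_word std_def map_replicate_const)
 ultimately show ?thesis using z cyc by (simp add: S_def essential_exps_def cyclic_vector_def)
qed

end

section \<open>Coordinates on the associated graded modules\<close>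

context lin_coords
begin

lemma ka_ext: "x \<in> carrier V ==> y \<in> carrier V ==> ka x = ka y ==> x = y" using bij by (auto simp: bij_betw_def inj_on_def)

lemma abelian_monoid: "abelian_monoid V"
 by (rule abelian_monoidI) (auto intro!: ka_ext simp: zero_closed add_closed ka_add ka_zero add.assoc add.commute)

lemma ka_finsum:
 assumes "finite A" "!!a. a \<in> A ==> f a \<in> carrier V"
 shows "finsum V f A \<in> carrier V & ka (finsum V f A) = (%i. \<Sum>a\<in>A. ka (f a) i)" using assms
proof (induction A rule: finite_induct)
 case empty
 interpret abelian_monoid V by (rule abelian_monoid)
 show ?case by (simp add: ka_zero zero_closed)
next
 case (insert a A)
 interpret abelian_monoid V by (rule abelian_monoid)
 have "finsum V f (insert a A) = f a \<oplus>\<^bsub>V\<^esub> finsum V f A" using insert by (intro finsum_insert) auto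
 thus ?case using insert by (simp add: add_closed ka_add)
qed

end

context pbw
begin

definition letters :: "nat => nat list set" where
 "letters n = {is. set is \<subseteq> {1..N} & length is = n}"

lemma finite_letters [simp]: "finite (letters n)" unfolding letters_def using finite_lists_length_eq[of "{1..N}" n] by simp

lemma letters_0: "letters 0 = {[]}" by (auto simp: letters_def)

lemma sum_letters_Suc: "(\<Sum>is\<in>letters (Suc n). f is) = (\<Sum>j=1..N. \<Sum>is\<in>letters n. f (j # is))"
proof -
 let ?h = "%x. fst x # snd x :: nat list"
 have b: "bij_betw ?h ({1..N} \<times> letters n) (letters (Suc n))"
  unfolding bij_betw_def letters_def by (auto simp: inj_on_def length_Suc_conv image_iff)
 have "(\<Sum>j=1..N. \<Sum>is\<in>letters n. f (j # is)) = (\<Sum>x\<in>{1..N} \<times> letters n. f (?h x))"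
  unfolding sum.cartesian_product by (simp only: case_prod_unfold)
 also have "\<dots> = (\<Sum>is\<in>letters (Suc n). f is)" by (rule sum.reindex_bij_betw[OF b])
 finally show ?thesis by simp
qed

end

text \<open>A common frame for both graded modules. The basis vector with exponent \<open>p\<close>
  survives in piece \<open>gr p\<close>; \<open>below i\<close> selects the basis vectors spanning
  \<open>B i\<close>; \<open>grade\<close> is the piece reached by a word; \<open>pre j i\<close> is
  the piece from which \<open>F j\<close> maps into piece \<open>i\<close>.\<close>

locale graded_flag = pbw N lt F v \<LL> for N lt and F :: "nat => complex ^ 'm ^ 'm" and v \<LL> +
 fixes I :: "'i set" and A B :: "'i => (complex ^ 'm) set" and gr :: "(nat => nat) => 'i"
  and below :: "'i => (nat => nat) => bool" and grade :: "nat list => 'i" and pre :: "nat => 'i => 'i option"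
  and k :: nat and e :: "nat => nat => nat"
 assumes gr_I: "p \<in> S ==> gr p \<in> I"
  and A_iff: "i \<in> I ==> x \<in> A i \<longleftrightarrow> (ALL p:S. \<not> (below i p \<or> gr p = i) --> coord p x = 0)"
  and B_iff: "i \<in> I ==> x \<in> B i \<longleftrightarrow> (ALL p:S. \<not> below i p --> coord p x = 0)"
  and gr_below: "p \<in> S ==> \<not> below (gr p) p"
  and grade_I: "set is \<subseteq> {1..N} ==> grade is \<in> I"
  and grade_Cons: "j \<in> {1..N} ==> set is \<subseteq> {1..N} ==> i \<in> I ==> grade (j # is) = i \<longleftrightarrow> pre j i = Some (grade is)"
  and pre_I: "j \<in> {1..N} ==> i \<in> I ==> pre j i = Some i' ==> i' \<in> I"
  and pre_A: "j \<in> {1..N} ==> i \<in> I ==> pre j i = Some i' ==> x \<in> A i' ==> F j *v x \<in> A i"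
  and pre_B: "j \<in> {1..N} ==> i \<in> I ==> pre j i = Some i' ==> x \<in> B i' ==> F j *v x \<in> B i"
  and v_A: "v \<in> A (grade [])"
  and grade_size: "set is \<subseteq> {1..N} ==> p \<in> S ==> grade is = gr p ==> length is = size_exp p"
  and e: "bij_betw e {..<k} S"
begin

abbreviation V :: "(complex, 'i => (complex ^ 'm) set) module" where
 "V == graded_space I A B"

definition cls :: "('i => complex ^ 'm) => 'i => (complex ^ 'm) set" where
 "cls u = (\<lambda>i\<in>I. (+) (u i) ` B i)"

definition reps :: "('i => complex ^ 'm) set" where
 "reps = {u. ALL i:I. u i \<in> A i}"

lemma B_zero: "i \<in> I ==> 0 \<in> B i" and B_add: "i \<in> I ==> x \<in> B i ==> y \<in> B i ==> x + y \<in> B i"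
 and B_diff: "i \<in> I ==> x \<in> B i ==> y \<in> B i ==> x - y \<in> B i" and B_scale: "i \<in> I ==> x \<in> B i ==> c *s x \<in> B i"
 by (simp_all add: B_iff coord_add coord_diff coord_scale)

lemma A_zero: "i \<in> I ==> 0 \<in> A i" and A_add: "i \<in> I ==> x \<in> A i ==> y \<in> A i ==> x + y \<in> A i"
 and A_scale: "i \<in> I ==> x \<in> A i ==> c *s x \<in> A i" by (simp_all add: A_iff coord_add coord_scale)

lemma A_sum: "i \<in> I ==> (!!j. j \<in> J ==> f j \<in> A i) ==> (\<Sum>j\<in>J. f j) \<in> A i"
 by (induction J rule: infinite_finite_induct) (simp_all add: A_zero A_add)

lemma coset_iff: "y \<in> (+) a ` B i \<longleftrightarrow> y - a \<in> B i"
 by (auto simp: image_iff) (metis add_diff_cancel_left' diff_add_cancel add.commute)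

lemma coset_eq: "i \<in> I ==> (+) a ` B i = (+) b ` B i \<longleftrightarrow> a - b \<in> B i"
proof
 assume i: "i \<in> I" and "(+) a ` B i = (+) b ` B i"
 moreover have "a \<in> (+) a ` B i" using B_zero[OF i] by (simp add: coset_iff)
 ultimately show "a - b \<in> B i" by (simp add: coset_iff)
next
 assume i: "i \<in> I" and ab: "a - b \<in> B i"
 have "y - a \<in> B i \<longleftrightarrow> y - b \<in> B i" for y using B_add[OF i, of "y - a" "a - b"] B_diff[OF i, of "y - b" "a - b"] ab by auto
 thus "(+) a ` B i = (+) b ` B i" by (auto simp only: coset_iff Set.set_eq_iff)
qed

lemma cls_eq: "cls u = cls u' \<longleftrightarrow> (ALL i:I. u i - u' i \<in> B i)"
proof -
 have "cls u = cls u' \<longleftrightarrow> (ALL i:I. (+) (u i) ` B i = (+) (u' i) ` B i)" unfolding cls_def by (auto simp: restrict_def fun_eq_iff)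
 thus ?thesis using coset_eq by simp
qed

lemma A_eq_B: "i \<in> I ==> i \<notin> gr ` S ==> a \<in> A i ==> a \<in> B i" by (auto simp: A_iff B_iff)

lemma carrier_iff: "x \<in> carrier V \<longleftrightarrow> (EX u:reps. x = cls u)"
proof
 assume "x \<in> carrier V"
 hence x: "x \<in> (\<Pi>\<^sub>E i\<in>I. {(+) a ` B i |a. a \<in> A i})" by (simp add: graded_space_def mk_space_simps)
 have "EX a. a \<in> A i & x i = (+) a ` B i" if "i \<in> I" for i using PiE_mem[OF x that] by blast
 then obtain u where u: "!!i. i \<in> I ==> u i \<in> A i & x i = (+) (u i) ` B i" by metis
 have "x = cls u" using u PiE_arb[OF x] by (auto simp: cls_def fun_eq_iff)
 thus "EX u:reps. x = cls u" using u by (auto simp: reps_def)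
next
 assume "EX u:reps. x = cls u"
 then obtain u where u: "!!i. i \<in> I ==> u i \<in> A i" and x: "x = cls u" by (auto simp: reps_def)
 have "{i \<in> I. cls u i ~= B i} \<subseteq> gr ` S"
 proof
  fix i assume i: "i \<in> {i \<in> I. cls u i ~= B i}"
  show "i \<in> gr ` S"
  proof (rule ccontr)
   assume "i \<notin> gr ` S"
   hence "u i - 0 \<in> B i" using A_eq_B u i by simp
   hence "(+) (u i) ` B i = (+) 0 ` B i" using coset_eq i by blast
   moreover have "(+) 0 ` B i = B i" by simp
   ultimately show False using i by (auto simp: cls_def)
  qed
 qed
 hence "finite {i \<in> I. cls u i ~= B i}" using finite_S finite_subset by blast
 thus "x \<in> carrier V" using u unfolding x graded_space_def mk_space_simps by (auto simp: cls_def)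
qed

lemma zero_cls: "\<zero>\<^bsub>V\<^esub> = cls (%_. 0)" by (simp add: graded_space_def mk_space_simps cls_def image_def)

lemma add_cls: "cls u \<oplus>\<^bsub>V\<^esub> cls u' = cls (%i. u i + u' i)"
proof -
 have "{a + b |a b. a \<in> (+) (u i) ` B i & b \<in> (+) (u' i) ` B i} = (+) (u i + u' i) ` B i" if i: "i \<in> I" for i
 proof (intro Set.set_eqI iffI)
  fix y assume "y \<in> {a + b |a b. a \<in> (+) (u i) ` B i & b \<in> (+) (u' i) ` B i}"
  then obtain a b where y: "y = a + b" "a - u i \<in> B i" "b - u' i \<in> B i" by (auto simp only: coset_iff)
  have "y - (u i + u' i) = (a - u i) + (b - u' i)" by (simp add: y)
  thus "y \<in> (+) (u i + u' i) ` B i" unfolding coset_iff using B_add[OF i y(2,3)] by metis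
 next
  fix y assume "y \<in> (+) (u i + u' i) ` B i"
  hence "y - (u i + u' i) \<in> B i" by (simp only: coset_iff)
  thus "y \<in> {a + b |a b. a \<in> (+) (u i) ` B i & b \<in> (+) (u' i) ` B i}"
   using B_zero[OF i] unfolding coset_iff by (intro CollectI exI[of _ "y - u' i"] exI[of _ "u' i"]) (simp add: algebra_simps)
 qed
 thus ?thesis by (simp add: graded_space_def mk_space_simps cls_def restrict_def fun_eq_iff)
qed

lemma smult_cls: "c \<odot>\<^bsub>V\<^esub> cls u = cls (%i. c *s u i)"
proof -
 have "{c *s a + b |a b. a \<in> (+) (u i) ` B i & b \<in> B i} = (+) (c *s u i) ` B i" if i: "i \<in> I" for i
 proof (intro Set.set_eqI iffI)
  fix y assume "y \<in> {c *s a + b |a b. a \<in> (+) (u i) ` B i & b \<in> B i}"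
  then obtain a b where y: "y = c *s a + b" "a - u i \<in> B i" "b \<in> B i" by (auto simp only: coset_iff)
  have "y - c *s u i = c *s (a - u i) + b" by (simp add: y vec.scale_right_diff_distrib)
  thus "y \<in> (+) (c *s u i) ` B i" unfolding coset_iff using B_add[OF i B_scale[OF i y(2)] y(3)] by metis
 next
  fix y assume "y \<in> (+) (c *s u i) ` B i"
  hence "y - c *s u i \<in> B i" by (simp only: coset_iff)
  thus "y \<in> {c *s a + b |a b. a \<in> (+) (u i) ` B i & b \<in> B i}"
   using B_zero[OF i] unfolding coset_iff by (intro CollectI exI[of _ "u i"] exI[of _ "y - c *s u i"]) simp
 qed
 thus ?thesis by (simp add: graded_space_def mk_space_simps cls_def restrict_def fun_eq_iff)
qed

definition step :: "nat => ('i => complex ^ 'm) => 'i => complex ^ 'm" where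
 "step j u i = (case pre j i of None => 0 | Some i' => F j *v u i')"

lemma graded_map_cls:
 assumes j: "j \<in> {1..N}" shows "graded_map I B (pre j) (F j) (cls u) = cls (step j u)"
proof -
 have "(case pre j i of None => B i | Some i' => {F j *v a + b |a b. a \<in> cls u i' & b \<in> B i}) = (+) (step j u i) ` B i"
  if i: "i \<in> I" for i
 proof (cases "pre j i")
  case None
  thus ?thesis by (simp add: step_def image_def)
 next
  case (Some i')
  have i': "i' \<in> I" by (rule pre_I[OF j i Some])
  have "{F j *v a + b |a b. a \<in> (+) (u i') ` B i' & b \<in> B i} = (+) (F j *v u i') ` B i"
  proof (intro Set.set_eqI iffI)
   fix y assume "y \<in> {F j *v a + b |a b. a \<in> (+) (u i') ` B i' & b \<in> B i}"
   then obtain a b where y: "y = F j *v a + b" "a - u i' \<in> B i'" "b \<in> B i" by (auto simp only: coset_iff)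
   have "y - F j *v u i' = F j *v (a - u i') + b" by (simp add: y matrix_vector_mult_diff_distrib)
   thus "y \<in> (+) (F j *v u i') ` B i" unfolding coset_iff using B_add[OF i pre_B[OF j i Some y(2)] y(3)] by metis
  next
   fix y assume "y \<in> (+) (F j *v u i') ` B i"
   hence "y - F j *v u i' \<in> B i" by (simp only: coset_iff)
   thus "y \<in> {F j *v a + b |a b. a \<in> (+) (u i') ` B i' & b \<in> B i}"
    using B_zero[OF i'] unfolding coset_iff by (intro CollectI exI[of _ "u i'"] exI[of _ "y - F j *v u i'"]) simp
  qed
  thus ?thesis using i' by (simp add: step_def cls_def Some)
 qed
 thus ?thesis unfolding graded_map_def cls_def[of "step j u"] by (intro restrict_ext) simp
qed

lemma step_reps: "j \<in> {1..N} ==> u \<in> reps ==> step j u \<in> reps"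
proof -
 assume j: "j \<in> {1..N}" and u: "u \<in> reps"
 have "step j u i \<in> A i" if i: "i \<in> I" for i
 proof (cases "pre j i")
  case None
  thus ?thesis using A_zero[OF i] by (simp add: step_def)
 next
  case (Some i')
  have "u i' \<in> A i'" using u pre_I[OF j i Some] by (simp add: reps_def)
  thus ?thesis using pre_A[OF j i Some] by (simp add: step_def Some)
 qed
 thus "step j u \<in> reps" by (simp add: reps_def)
qed

lemma e_S: "j < k ==> e j \<in> S" using e by (auto simp: bij_betw_def)

text \<open>Coordinate \<open>j\<close> is read off from an arbitrary element of the coset in piece
  \<open>gr (e j)\<close>. The choice does not matter, as elements of \<open>B\<close> in this piece
  have coordinate zero at \<open>e j\<close>.\<close>

definition kap :: "('i => (complex ^ 'm) set) => nat => complex" where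
 "kap x j = (if j < k then coord (e j) (SOME a. a \<in> x (gr (e j))) else 0)"

lemma kap_cls: "kap (cls u) j = (if j < k then coord (e j) (u (gr (e j))) else 0)"
proof (cases "j < k")
 case True
 let ?i = "gr (e j)"
 have i: "?i \<in> I" by (rule gr_I[OF e_S[OF True]])
 have "EX a. a \<in> cls u ?i" using i B_zero[OF i] by (auto simp: cls_def)
 hence "(SOME a. a \<in> cls u ?i) \<in> cls u ?i" by (rule someI_ex)
 hence "(SOME a. a \<in> cls u ?i) - u ?i \<in> B ?i" using i by (simp add: cls_def coset_iff)
 hence "coord (e j) ((SOME a. a \<in> cls u ?i) - u ?i) = 0" using B_iff[OF i] gr_below[OF e_S[OF True]] e_S[OF True] by blast
 thus ?thesis using True by (simp add: kap_def coord_diff)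
qed (simp add: kap_def)

sublocale lin: lin_coords V k kap
proof
 show "bij_betw kap (carrier V) (carrier (coord_space k))"
 proof (rule bij_betw_imageI)
  show "inj_on kap (carrier V)"
  proof (rule inj_onI)
   fix x y assume "x \<in> carrier V" "y \<in> carrier V" and eq: "kap x = kap y"
   then obtain u u' where u: "u \<in> reps" "x = cls u" and u': "u' \<in> reps" "y = cls u'" by (auto simp: carrier_iff)
   have "u i - u' i \<in> B i" if i: "i \<in> I" for i unfolding B_iff[OF i]
   proof (intro ballI impI)
    fix p assume p: "p \<in> S" "\<not> below i p"
    show "coord p (u i - u' i) = 0"
    proof (cases "gr p = i")
     case True
     have "p \<in> e ` {..<k}" using p(1) bij_betw_imp_surj_on[OF e] by simp
     then obtain j where j: "j < k" "e j = p" by blast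
     show ?thesis using fun_cong[OF eq, of j] j True by (simp add: u u' kap_cls coord_diff)
    next
     case False
     hence "coord p (u i) = 0" "coord p (u' i) = 0" using u(1) u'(1) i p by (auto simp: reps_def A_iff)
     thus ?thesis by (simp add: coord_diff)
    qed
   qed
   thus "x = y" unfolding u u' cls_eq by blast
  qed
  show "kap ` carrier V = carrier (coord_space k)"
  proof
   show "kap ` carrier V \<subseteq> carrier (coord_space k)" by (auto simp: carrier_coord_space kap_def)
   show "carrier (coord_space k) \<subseteq> kap ` carrier V"
   proof
    fix z assume z: "z \<in> carrier (coord_space k)"
    let ?u = "%i. \<Sum>l | l < k & gr (e l) = i. z l *s bvec (e l)"
    have c: "coord p (?u i) = (\<Sum>l | l < k & gr (e l) = i. if p = e l then z l else 0)" if "p \<in> S" for p i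
     unfolding coord_sum coord_scale by (rule sum.cong) (auto simp: coord_bvec[OF that] e_S)
    have "?u \<in> reps" unfolding reps_def
    proof (intro CollectI ballI)
     fix i assume i: "i \<in> I"
     show "?u i \<in> A i" unfolding A_iff[OF i] using c by (auto intro!: sum.neutral)
    qed
    moreover have "kap (cls ?u) j = z j" for j
    proof (cases "j < k")
     case True
     have "coord (e j) (?u (gr (e j))) = (\<Sum>l | l < k & gr (e l) = gr (e j). if e j = e l then z l else 0)" by (rule c[OF e_S[OF True]])
     also have "\<dots> = (\<Sum>l | l < k & gr (e l) = gr (e j). if l = j then z l else 0)"
      using e True by (intro sum.cong) (auto simp: bij_betw_def inj_on_def)
     also have "\<dots> = z j" using True by simp
     finally show ?thesis using True by (simp add: kap_cls)
    next
     case False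
     thus ?thesis using z by (simp add: kap_cls carrier_coord_space)
    qed
    hence "z = kap (cls ?u)" by (intro ext) simp
    ultimately show "z \<in> kap ` carrier V" by (intro image_eqI[of z kap "cls ?u"]) (auto simp: carrier_iff)
   qed
  qed
 qed
 show "\<zero>\<^bsub>V\<^esub> \<in> carrier V" unfolding zero_cls carrier_iff by (intro bexI[of _ "%_. 0"]) (auto simp: reps_def A_zero)
 show "kap \<zero>\<^bsub>V\<^esub> = (%_. 0)" by (simp add: zero_cls kap_cls fun_eq_iff)
 fix x assume x: "x \<in> carrier V"
 obtain u where u: "u \<in> reps" "x = cls u" using x by (auto simp: carrier_iff)
 show "c \<odot>\<^bsub>V\<^esub> x \<in> carrier V" for c
  unfolding u smult_cls carrier_iff using u(1) by (intro bexI[of _ "%i. c *s u i"]) (auto simp: reps_def A_scale)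
 show "kap (c \<odot>\<^bsub>V\<^esub> x) = (%i. c * kap x i)" for c unfolding u smult_cls by (simp add: kap_cls coord_scale fun_eq_iff)
 fix y assume y: "y \<in> carrier V"
 obtain u' where u': "u' \<in> reps" "y = cls u'" using y by (auto simp: carrier_iff)
 show "x \<oplus>\<^bsub>V\<^esub> y \<in> carrier V"
  unfolding u u' add_cls carrier_iff using u(1) u'(1) by (intro bexI[of _ "%i. u i + u' i"]) (auto simp: reps_def A_add)
 show "kap (x \<oplus>\<^bsub>V\<^esub> y) = (%i. kap x i + kap y i)" unfolding u u' add_cls by (simp add: kap_cls coord_add fun_eq_iff)
qed

lemma cls_carrier: "u \<in> reps ==> cls u \<in> carrier V" by (auto simp: carrier_iff)

definition oper :: "(nat => complex) => ('i => (complex ^ 'm) set) => 'i => (complex ^ 'm) set" where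
 "oper c x = finsum V (%j. c j \<odot>\<^bsub>V\<^esub> graded_map I B (pre j) (F j) x) {1..N}"

lemma oper_cls:
 assumes u: "u \<in> reps"
 shows "oper c (cls u) = cls (%i. \<Sum>j=1..N. c j *s step j u i)" and "(%i. \<Sum>j=1..N. c j *s step j u i) \<in> reps"
proof -
 have s: "step j u i \<in> A i" if "j \<in> {1..N}" "i \<in> I" for i j using step_reps[OF that(1) u] that(2) by (simp add: reps_def)
 show r: "(%i. \<Sum>j=1..N. c j *s step j u i) \<in> reps" unfolding reps_def by (intro CollectI ballI A_sum A_scale s)
 have eq: "c j \<odot>\<^bsub>V\<^esub> graded_map I B (pre j) (F j) (cls u) = cls (%i. c j *s step j u i)" if "j \<in> {1..N}" for j
  by (simp only: graded_map_cls[OF that] smult_cls)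
 have rj: "(%i. c j *s step j u i) \<in> reps" if "j \<in> {1..N}" for j unfolding reps_def by (intro CollectI ballI A_scale s that)
 have f: "c j \<odot>\<^bsub>V\<^esub> graded_map I B (pre j) (F j) (cls u) \<in> carrier V" if "j \<in> {1..N}" for j
  unfolding eq[OF that] by (rule cls_carrier[OF rj[OF that]])
 have fs: "finsum V (%j. c j \<odot>\<^bsub>V\<^esub> graded_map I B (pre j) (F j) (cls u)) {1..N} \<in> carrier V &
   kap (finsum V (%j. c j \<odot>\<^bsub>V\<^esub> graded_map I B (pre j) (F j) (cls u)) {1..N}) =
   (%l. \<Sum>j=1..N. kap (c j \<odot>\<^bsub>V\<^esub> graded_map I B (pre j) (F j) (cls u)) l)"
  by (rule lin.ka_finsum[OF finite_atLeastAtMost f])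
 show "oper c (cls u) = cls (%i. \<Sum>j=1..N. c j *s step j u i)" unfolding oper_def
 proof (rule lin.ka_ext[OF fs[THEN conjunct1] cls_carrier[OF r]], unfold fs[THEN conjunct2], rule ext)
  fix l
  have "(\<Sum>j=1..N. kap (c j \<odot>\<^bsub>V\<^esub> graded_map I B (pre j) (F j) (cls u)) l) = (\<Sum>j=1..N. kap (cls (%i. c j *s step j u i)) l)"
   by (rule sum.cong[OF refl]) (simp only: eq)
  also have "\<dots> = kap (cls (%i. \<Sum>j=1..N. c j *s step j u i)) l" by (simp add: kap_cls coord_sum)
  finally show "(\<Sum>j=1..N. kap (c j \<odot>\<^bsub>V\<^esub> graded_map I B (pre j) (F j) (cls u)) l) = kap (cls (%i. \<Sum>j=1..N. c j *s step j u i)) l" .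
 qed
qed

text \<open>The expansion of the power \<open>n\<close> of a general Lie algebra element on
  \<open>v\<close> into words, each word being sent to the piece of its own grade.\<close>

definition power_rep :: "(nat => complex) => nat => 'i => complex ^ 'm" where
 "power_rep c n i = (\<Sum>is\<in>letters n. if grade is = i then wmon is c *s word is v else 0)"

abbreviation gvec :: "'i => (complex ^ 'm) set" where
 "gvec == graded_class I B (grade []) v"

lemma oper_power: "(oper c ^^ n) gvec = cls (power_rep c n) & power_rep c n \<in> reps"
proof (induction n)
 case 0
 have p: "power_rep c 0 = (%i. if i = grade [] then v else 0)" by (auto simp: power_rep_def letters_0 wmon_def fun_eq_iff)
 have "gvec = cls (power_rep c 0)" unfolding p graded_class_def cls_def by (intro restrict_ext) (simp add: image_def)
 moreover have "power_rep c 0 \<in> reps" unfolding p reps_def using v_A A_zero by auto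
 ultimately show ?case by simp
next
 case (Suc n)
 hence r: "power_rep c n \<in> reps" by simp
 have "(\<Sum>j=1..N. c j *s step j (power_rep c n) i) = power_rep c (Suc n) i" if i: "i \<in> I" for i
 proof -
  have "c j *s step j (power_rep c n) i = (\<Sum>is\<in>letters n. if grade (j # is) = i then wmon (j # is) c *s word (j # is) v else 0)"
   if j: "j \<in> {1..N}" for j
  proof (cases "pre j i")
   case None
   hence "grade (j # is) ~= i" if "is \<in> letters n" for "is" using grade_Cons[OF j _ i, of "is"] that by (simp add: letters_def)
   thus ?thesis by (simp add: step_def None)
  next
   case (Some i')
   have g: "grade (j # is) = i \<longleftrightarrow> grade is = i'" if "is \<in> letters n" for "is"
    using grade_Cons[OF j _ i, of "is"] that Some by (auto simp: letters_def)
   have "c j *s step j (power_rep c n) i = c j *s (word [j] (power_rep c n i'))" by (simp add: step_def Some)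
   also have "\<dots> = (\<Sum>is\<in>letters n. c j *s (word [j] (if grade is = i' then wmon is c *s word is v else 0)))"
    unfolding power_rep_def word_sum vec.scale_sum_right ..
   also have "\<dots> = (\<Sum>is\<in>letters n. if grade (j # is) = i then wmon (j # is) c *s word (j # is) v else 0)"
    by (rule sum.cong[OF refl]) (simp add: g wmon_def vector_scalar_commute)
   finally show ?thesis .
  qed
  thus ?thesis unfolding power_rep_def sum_letters_Suc by simp
 qed
 hence "cls (%i. \<Sum>j=1..N. c j *s step j (power_rep c n) i) = cls (power_rep c (Suc n))" unfolding cls_def by (intro restrict_ext) simp
 moreover have "power_rep c (Suc n) \<in> reps"
  using oper_cls(2)[OF r, of c] \<open>\<And>i. i \<in> I \<Longrightarrow> _ = power_rep c (Suc n) i\<close> by (simp add: reps_def)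
 ultimately show ?case using oper_cls(1)[OF r, of c] Suc by simp
qed

text \<open>In the graded module only words of grade \<open>gr (e j)\<close> reach coordinate
  \<open>j\<close>, so the orbit in the graded module has the coordinates of the original
  exponential with all other words deleted.\<close>

theorem exp_coordinates:
 assumes K: "!!p. p \<in> S ==> size_exp p < K" and j: "j < k"
 shows "exp_action V (oper c) gvec \<in> carrier V"
  and "kap (exp_action V (oper c) gvec) j =
   (\<Sum>n<K. \<Sum>is\<in>letters n. if grade is = gr (e j) then coord (e j) (word is v) / fact n * wmon is c else 0)"
proof -
 have kp: "kap ((oper c ^^ n) gvec) l = (if l < k then (\<Sum>is\<in>letters n. if grade is = gr (e l) then coord (e l) (word is v) * wmon is c else 0) else 0)" for n l
  unfolding oper_power[THEN conjunct1] kap_cls power_rep_def coord_sum by (auto intro!: sum.cong simp: coord_scale)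
 have cp: "(oper c ^^ n) gvec \<in> carrier V" for n using oper_power[where c = c and n = n] cls_carrier by simp
 \<comment> \<open>A word of the grade of an essential exponent has the degree of this exponent as
   its length, which is below \<open>K\<close>; so powers from \<open>K\<close> on have all
   coordinates zero.\<close>
 have z: "(oper c ^^ n) gvec = \<zero>\<^bsub>V\<^esub>" if n: "K \<le> n" for n
 proof (rule lin.ka_ext[OF cp lin.zero_closed], unfold lin.ka_zero, rule ext)
  fix l
  have "grade is ~= gr (e l)" if "l < k" "is \<in> letters n" for "is"
   using grade_size[of "is" "e l"] K[OF e_S[OF that(1)]] e_S[OF that(1)] that(2) n by (auto simp: letters_def)
  thus "kap ((oper c ^^ n) gvec) l = 0" unfolding kp by (auto intro!: sum.neutral)
 qed
 let ?N = "{n. (oper c ^^ n) gvec ~= \<zero>\<^bsub>V\<^esub>}"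
 have sub: "?N \<subseteq> {..<K}" using z by (auto simp: not_le[symmetric])
 hence fin: "finite ?N" by (rule finite_subset) simp
 have cl: "(1 / fact n) \<odot>\<^bsub>V\<^esub> (oper c ^^ n) gvec \<in> carrier V" for n by (rule lin.smult_closed[OF cp])
 have fs: "finsum V (%n. (1 / fact n) \<odot>\<^bsub>V\<^esub> (oper c ^^ n) gvec) ?N \<in> carrier V &
   kap (finsum V (%n. (1 / fact n) \<odot>\<^bsub>V\<^esub> (oper c ^^ n) gvec) ?N) =
   (%l. \<Sum>n\<in>?N. kap ((1 / fact n) \<odot>\<^bsub>V\<^esub> (oper c ^^ n) gvec) l)" by (rule lin.ka_finsum[OF fin cl])
 show "exp_action V (oper c) gvec \<in> carrier V" unfolding exp_action_def by (rule fs[THEN conjunct1])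
 have "kap (exp_action V (oper c) gvec) j = (\<Sum>n\<in>?N. kap ((1 / fact n) \<odot>\<^bsub>V\<^esub> (oper c ^^ n) gvec) j)"
  unfolding exp_action_def by (simp only: fs[THEN conjunct2])
 also have "\<dots> = (\<Sum>n\<in>?N. 1 / fact n * kap ((oper c ^^ n) gvec) j)" by (simp only: lin.ka_smult[OF cp])
 also have "\<dots> = (\<Sum>n<K. 1 / fact n * kap ((oper c ^^ n) gvec) j)" by (rule sum.mono_neutral_left) (use sub lin.ka_zero in auto)
 also have "\<dots> = (\<Sum>n<K. \<Sum>is\<in>letters n. if grade is = gr (e j) then coord (e j) (word is v) / fact n * wmon is c else 0)"
  unfolding kp using j by (intro sum.cong refl) (auto simp: sum_distrib_left intro!: sum.cong)
 finally show "kap (exp_action V (oper c) gvec) j =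
   (\<Sum>n<K. \<Sum>is\<in>letters n. if grade is = gr (e j) then coord (e j) (word is v) / fact n * wmon is c else 0)" .
qed

end

section \<open>Hilbert functions\<close>

text \<open>The exchange argument in the space of functions: independent functions lying in a space
  generated by no more functions than there are of them must span it.\<close>

lemma span_by_cardinality:
 fixes f :: "'j => 'x => complex" and a :: "'t => 'x => complex"
 assumes fin: "finite J" "finite T" "card T \<le> card J"
  and f: "!!j. j \<in> J ==> EX ga. ALL x. f j x = (\<Sum>t\<in>T. ga t * a t x)"
  and indep: "!!c j. (!!x. (\<Sum>j\<in>J. c j * f j x) = 0) ==> j \<in> J ==> c j = 0"
  and g: "EX ga. ALL x. g x = (\<Sum>t\<in>T. ga t * a t x)"
 shows "EX ga. ALL x. g x = (\<Sum>j\<in>J. ga j * f j x)"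
proof -
 interpret funs: vector_space "%c (f :: 'x => complex) x. c * f x" by unfold_locales (simp_all add: fun_eq_iff algebra_simps)
 have sum_app: "(\<Sum>i\<in>I. h i) x = (\<Sum>i\<in>I. h i x)" for I :: "'i set" and h :: "'i => 'x => complex" and x
  by (induction I rule: infinite_finite_induct) simp_all
 have sp: "h \<in> funs.span (a ` T)" if h: "EX ga. ALL x. h x = (\<Sum>t\<in>T. ga t * a t x)" for h
 proof -
  from h obtain ga where "ALL x. h x = (\<Sum>t\<in>T. ga t * a t x)" by (rule exE)
  hence "h = (\<Sum>t\<in>T. (%x. ga t * a t x))" by (simp add: fun_eq_iff sum_app)
  also have "\<dots> \<in> funs.span (a ` T)" by (intro funs.span_sum funs.span_scale funs.span_base) auto
  finally show ?thesis .
 qed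
 have inj: "inj_on f J"
 proof (rule inj_onI, rule ccontr)
  fix i j assume ij: "i \<in> J" "j \<in> J" "f i = f j" and ne: "i ~= j"
  let ?c = "%l. (if l = i then 1 else 0) - (if l = j then 1 else 0) :: complex"
  have "(\<Sum>l\<in>J. ?c l * f l x) = 0" for x
  proof -
   have "(\<Sum>l\<in>J. ?c l * f l x) = (\<Sum>l\<in>J. if l = i then f l x else 0) - (\<Sum>l\<in>J. if l = j then f l x else 0)"
    unfolding sum_subtractf[symmetric] by (rule sum.cong) auto
   thus ?thesis using ij fin(1) by simp
  qed
  from indep[where c = ?c, OF this ij(1)] ne show False by simp
 qed
 have ind: "\<not> funs.dependent (f ` J)"
 proof
  assume "funs.dependent (f ` J)"
  then obtain u where u: "EX h:f ` J. u h ~= 0" "(\<Sum>h\<in>f ` J. (%x. u h * h x)) = 0" using fin(1) by (auto simp: funs.dependent_finite)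
  have "(\<Sum>j\<in>J. u (f j) * f j x) = 0" for x
  proof -
   have "(\<Sum>j\<in>J. u (f j) * f j x) = (\<Sum>h\<in>f ` J. (%x. u h * h x)) x" unfolding sum_app by (simp add: sum.reindex[OF inj])
   thus ?thesis unfolding u(2) by simp
  qed
  from indep[where c = "%j. u (f j)", OF this] u(1) show False by blast
 qed
 have "g \<in> funs.span (f ` J)"
 proof (rule ccontr)
  assume g': "g \<notin> funs.span (f ` J)"
  hence i: "\<not> funs.dependent (insert g (f ` J))" using ind by (simp add: funs.dependent_insertD funs.independent_insertI)
  have "insert g (f ` J) \<subseteq> funs.span (a ` T)" using sp f g by auto
  from funs.independent_span_bound[OF finite_imageI[OF fin(2)] i this]
  have "card (insert g (f ` J)) \<le> card T" using card_image_le[OF fin(2), of a] by (elim conjE) (rule le_trans)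
  moreover have "g \<notin> f ` J" using g' funs.span_base[of g "f ` J"] by auto
  ultimately have "Suc (card J) \<le> card T" using fin(1) inj by (simp add: card_image)
  thus False using fin(3) by simp
 qed
 then obtain u where "g = (\<Sum>h\<in>f ` J. (%x. u h * h x))" unfolding funs.span_finite[OF finite_imageI[OF fin(1)]] by (rule rangeE)
 hence "g x = (\<Sum>j\<in>J. u (f j) * f j x)" for x by (simp add: sum_app sum.reindex[OF inj])
 thus ?thesis by (intro exI[of _ "%j. u (f j)"]) simp
qed

section \<open>Exponentials inside Cartan powers\<close>

lemma tensor_action_add: "tensor_action A (S + T) = tensor_action A S + tensor_action A T"
 and tensor_action_scale: "tensor_action A (tensor_scale c T) = tensor_scale c (tensor_action A T)"
 by (simp_all add: tensor_action_def tensor_scale_def fun_eq_iff sum_distrib_left sum.distrib algebra_simps)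

lemma tensor_action_zero: "tensor_action A 0 = 0" by (simp add: tensor_action_def fun_eq_iff)

lemma cartan_power_closed:
 assumes A: "A \<in> \<LL>" and T: "T \<in> cartan_power \<LL> v n"
 shows "tensor_action A T \<in> cartan_power \<LL> v n"
proof -
 let ?G = "{foldr tensor_action xs (tensor_power n v) |xs. set xs \<subseteq> \<LL>}"
 have "tensors.span ?G \<subseteq> {T. tensor_action A T \<in> tensors.span ?G}"
 proof (rule tensors.span_minimal)
  show "?G \<subseteq> {T. tensor_action A T \<in> tensors.span ?G}"
  proof clarify
   fix xs assume "set xs \<subseteq> \<LL>"
   thus "tensor_action A (foldr tensor_action xs (tensor_power n v)) \<in> tensors.span ?G"
    using A by (intro tensors.span_base CollectI exI[of _ "A # xs"]) simp
  qed
  show "tensors.subspace {T. tensor_action A T \<in> tensors.span ?G}" by (rule tensors.subspaceI)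
    (auto simp: tensor_action_add tensor_action_scale tensor_action_zero tensors.span_zero intro: tensors.span_add tensors.span_scale)
 qed
 thus ?thesis using T by (auto simp: cartan_power_def)
qed

lemma cartan_power_base: "tensor_power n v \<in> cartan_power \<LL> v n"
proof -
 have "tensor_power n v = foldr tensor_action [] (tensor_power n v)" by simp
 thus ?thesis unfolding cartan_power_def by (intro tensors.span_base CollectI exI[of _ "[]"]) auto
qed

text \<open>The tensor power of \<open>exp (s Y) v\<close> is polynomial in \<open>s\<close>. By the
  flow equation its coefficient tensors satisfy: \<open>m + 1\<close> times coefficient
  \<open>m + 1\<close> is \<open>Y\<close> applied to coefficient \<open>m\<close>. Starting from
  the power of \<open>v\<close>, all coefficients lie in the submodule, and so does the value at
  \<open>s = 1\<close>.\<close>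

lemma exp_tensor_power:
 fixes Y :: "complex ^ 'm ^ 'm"
 assumes Y: "Y \<in> \<LL>" and nil: "mpow Y K = 0"
 shows "tensor_power n (mexp Y *v v) \<in> cartan_power \<LL> v n"
proof -
 let ?u = "%s. mexp (mat_scale s Y) *v v"
 have comm: "mexp (mat_scale s Y) ** Y = Y ** mexp (mat_scale s Y)" for s unfolding mexp_scale_eq[OF nil] matrix_sum_left matrix_sum_right
  by (simp add: mat_scale_mult_left mat_scale_mult_right mpow_Suc[symmetric] mpow_Suc2[symmetric])
 have uj: "?u s $ j = (\<Sum>l\<in>UNIV. mexp (mat_scale s Y) $ j $ l * v $ l)" for s j by (simp add: matrix_vector_mult_def)
 have pc: "polyfun (%s. mexp (mat_scale s Y) $ j $ l)" for j l by (rule polycurve_entry[OF mexp_polycurve[OF nil]])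
 have pu: "polyfun (%s. ?u s $ j)" for j unfolding uj by (intro polyfun_sum polyfun_mult pc polyfun_const)
 define P where "P j = (SOME p. (%s. ?u s $ j) = poly p)" for j
 have P: "(%s. ?u s $ j) = poly (P j)" for j
 proof -
  have "EX p. (%s. ?u s $ j) = poly p" using pu[of j] unfolding polyfun_def image_iff by blast
  from someI_ex[OF this] show ?thesis by (simp add: P_def)
 qed
 have dP: "pderiv (P j) = (\<Sum>l\<in>UNIV. [:Y $ j $ l:] * P l)" for j
 proof -
  have "poly (pderiv (P j)) s = poly (\<Sum>l\<in>UNIV. [:Y $ j $ l:] * P l) s" for s
  proof -
   have "poly (pderiv (P j)) s = deriv (%s. ?u s $ j) s" unfolding P by (simp add: DERIV_imp_deriv[OF poly_DERIV])
   also have "\<dots> = (\<Sum>l\<in>UNIV. deriv (%s. mexp (mat_scale s Y) $ j $ l * v $ l) s)"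
    unfolding uj by (intro chain_sum polyfun_mult pc polyfun_const)
   also have "\<dots> = (\<Sum>l\<in>UNIV. cderiv (%s. mexp (mat_scale s Y)) s $ j $ l * v $ l)"
    by (intro sum.cong refl) (simp add: chain_mult[OF pc polyfun_const] cderiv_def)
   also have "\<dots> = (cderiv (%s. mexp (mat_scale s Y)) s *v v) $ j" by (simp add: matrix_vector_mult_def)
   also have "\<dots> = (Y *v ?u s) $ j" by (simp add: mexp_cderiv[OF nil] comm matrix_vector_mul_assoc)
   also have "\<dots> = (\<Sum>l\<in>UNIV. Y $ j $ l * ?u s $ l)" by (simp add: matrix_vector_mult_def)
   also have "\<dots> = (\<Sum>l\<in>UNIV. Y $ j $ l * poly (P l) s)" using fun_cong[OF P] by simp
   finally show ?thesis by (simp add: poly_sum)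
  qed
  thus ?thesis using poly_eq_poly_eq_iff by blast
 qed
 define Q where "Q w = (if length w = n then \<Prod>i<n. P (w ! i) else 0)" for w
 have Q: "poly (Q w) s = tensor_power n (?u s) w" for w s using fun_cong[OF P] by (simp add: Q_def tensor_power_def poly_prod)
 \<comment> \<open>The product rule reproduces the action on tensors: each factor is differentiated
   in turn, which replaces one letter of the word \<open>w\<close>.\<close>
 have dQ: "pderiv (Q w) = (\<Sum>i<length w. \<Sum>j\<in>UNIV. [:Y $ (w ! i) $ j:] * Q (w[i := j]))" for w
 proof (cases "length w = n")
  case True
  have upd: "Q (w[i := j]) = P j * (\<Prod>l\<in>{..<n} - {i}. P (w ! l))" if "i < n" for i j
  proof -
   have "Q (w[i := j]) = (\<Prod>l<n. P (w[i := j] ! l))" using True by (simp add: Q_def)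
   also have "\<dots> = P (w[i := j] ! i) * (\<Prod>l\<in>{..<n} - {i}. P (w[i := j] ! l))" using that by (intro prod.remove) auto
   also have "(\<Prod>l\<in>{..<n} - {i}. P (w[i := j] ! l)) = (\<Prod>l\<in>{..<n} - {i}. P (w ! l))" by (rule prod.cong) auto
   finally show ?thesis using that True by simp
  qed
  have "pderiv (Q w) = (\<Sum>i<n. (\<Prod>l\<in>{..<n} - {i}. P (w ! l)) * pderiv (P (w ! i)))" using True by (simp add: Q_def pderiv_prod)
  also have "\<dots> = (\<Sum>i<n. \<Sum>j\<in>UNIV. [:Y $ (w ! i) $ j:] * Q (w[i := j]))"
  proof (rule sum.cong[OF refl])
   fix i assume "i \<in> {..<n}"
   hence i: "i < n" by simp
   show "(\<Prod>l\<in>{..<n} - {i}. P (w ! l)) * pderiv (P (w ! i)) = (\<Sum>j\<in>UNIV. [:Y $ (w ! i) $ j:] * Q (w[i := j]))"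
    unfolding dP sum_distrib_left upd[OF i] by (intro sum.cong refl) (simp only: ac_simps)
  qed
  finally show ?thesis using True by simp
 qed (simp add: Q_def)
 define C where "C m = (%w. coeff (Q w) m)" for m
 have step: "tensor_scale (of_nat (Suc m)) (C (Suc m)) = tensor_action Y (C m)" for m
 proof
  fix w
  have "of_nat (Suc m) * coeff (Q w) (Suc m) = coeff (pderiv (Q w)) m" by (simp add: coeff_pderiv)
  also have "\<dots> = (\<Sum>i<length w. \<Sum>j\<in>UNIV. Y $ (w ! i) $ j * coeff (Q (w[i := j])) m)" unfolding dQ by (simp add: coeff_sum)
  finally show "tensor_scale (of_nat (Suc m)) (C (Suc m)) w = tensor_action Y (C m) w" by (simp only: tensor_scale_def tensor_action_def C_def)
 qed
 have CC: "C m \<in> cartan_power \<LL> v n" for m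
 proof (induction m)
  case 0
  have "C 0 = tensor_power n v"
  proof
   fix w
   show "C 0 w = tensor_power n v w" using Q[of w 0] by (simp add: C_def poly_0_coeff_0)
  qed
  thus ?case using cartan_power_base by metis
 next
  case (Suc m)
  have "tensor_scale (1 / of_nat (Suc m)) (tensor_scale (of_nat (Suc m)) (C (Suc m))) \<in> cartan_power \<LL> v n"
   unfolding step using cartan_power_closed[OF Y Suc] tensors.span_scale unfolding cartan_power_def by blast
  moreover have "tensor_scale (1 / of_nat (Suc m)) (tensor_scale (of_nat (Suc m)) (C (Suc m))) = C (Suc m)"
   by (simp add: tensor_scale_def del: of_nat_Suc)
  ultimately show ?case by metis
 qed
 have fin: "finite {w :: 'm list. length w = n}" using finite_lists_length_eq[of "UNIV :: 'm set" n] by simp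
 define M where "M = Suc (Max ((%w. degree (Q w)) ` {w. length w = n}))"
 have M: "degree (Q w) < M" for w
 proof (cases "length w = n")
  case True
  hence "degree (Q w) \<le> Max ((%w. degree (Q w)) ` {w. length w = n})" using fin by (intro Max_ge) auto
  thus ?thesis by (simp add: M_def)
 qed (simp add: Q_def M_def)
 have sum_app: "(\<Sum>i\<in>I. h i) w = (\<Sum>i\<in>I. h i w)" for I :: "nat set" and h :: "nat => 'm list => complex" and w
  by (induction I rule: infinite_finite_induct) simp_all
 have "tensor_power n (mexp Y *v v) = (\<Sum>m<M. C m)"
 proof
  fix w
  have "tensor_power n (mexp Y *v v) w = poly (Q w) 1" using Q[of w 1] by simp
  also have "\<dots> = (\<Sum>m\<le>degree (Q w). coeff (Q w) m)" by (simp add: poly_altdef)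
  also have "\<dots> = (\<Sum>m<M. coeff (Q w) m)" by (rule sum.mono_neutral_left) (use M[of w] in \<open>auto simp: coeff_eq_0\<close>)
  finally show "tensor_power n (mexp Y *v v) w = (\<Sum>m<M. C m) w" by (simp add: sum_app C_def)
 qed
 also have "\<dots> \<in> cartan_power \<LL> v n" using CC unfolding cartan_power_def by (intro tensors.span_sum) auto
 finally show ?thesis .
qed

text \<open>A product of \<open>d\<close> linear forms at \<open>x\<close> is one linear functional
  at the tensor power of \<open>x\<close>. In this way forms of degree \<open>d\<close> on the orbit
  become functionals on the Cartan power.\<close>

lemma product_of_linear_forms:
 fixes l :: "nat => complex ^ 'm => complex"
 assumes l: "!!j x. j \<in> set js ==> l j x = (\<Sum>a\<in>UNIV. b j a * x $ a)"
 shows "EX \<mu>. ALL x. wmon js (%j. l j x) = (\<Sum>w | length w = length js. \<mu> w * tensor_power (length js) x w)" using l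
proof (induction js)
 case Nil
 have "{w :: 'm list. length w = 0} = {[]}" by auto
 thus ?case by (intro exI[of _ "%_. 1"]) (simp add: wmon_def tensor_power_def)
next
 case (Cons j js)
 then obtain \<mu> where \<mu>: "!!x. wmon js (%j. l j x) = (\<Sum>w | length w = length js. \<mu> w * tensor_power (length js) x w)" by force
 let ?W = "%n. {w :: 'm list. length w = n}" and ?h = "%x. fst x # snd x :: 'm list"
 have b: "bij_betw ?h (UNIV \<times> ?W n) (?W (Suc n))" for n unfolding bij_betw_def by (auto simp: inj_on_def length_Suc_conv image_iff)
 have t: "tensor_power (Suc n) x (a # w) = x $ a * tensor_power n x w" for n x a and w :: "'m list"
  by (simp add: tensor_power_def prod.lessThan_Suc_shift del: prod.lessThan_Suc)
 \<comment> \<open>The first letter carries the coefficient of the new linear form, the remaining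
   letters those of the product already expanded.\<close>
 let ?L = "%w. b j (hd w) * \<mu> (tl w)"
 have "wmon (j # js) (%j. l j x) = (\<Sum>w\<in>?W (Suc (length js)). ?L w * tensor_power (Suc (length js)) x w)" for x
 proof -
  have "(\<Sum>w\<in>?W (Suc (length js)). ?L w * tensor_power (Suc (length js)) x w) =
    (\<Sum>y\<in>UNIV \<times> ?W (length js). ?L (?h y) * tensor_power (Suc (length js)) x (?h y))"
   by (rule sum.reindex_bij_betw[OF b, symmetric])
  also have "\<dots> = (\<Sum>a\<in>UNIV. \<Sum>w\<in>?W (length js). (b j a * x $ a) * (\<mu> w * tensor_power (length js) x w))"
   unfolding sum.cartesian_product by (rule sum.cong[OF refl]) (simp add: t case_prod_unfold)
  also have "\<dots> = (\<Sum>a\<in>UNIV. b j a * x $ a) * (\<Sum>w\<in>?W (length js). \<mu> w * tensor_power (length js) x w)"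
   by (simp only: sum_product)
  also have "\<dots> = l j x * wmon js (%j. l j x)" using Cons.prems[of j x] \<mu>[of x] by simp
  finally show ?thesis by (simp add: wmon_def)
 qed
 thus ?case by (intro exI[of _ ?L]) simp
qed

text \<open>\<open>K\<close> bounds both the degrees of the essential exponents and the nilpotency
  of the operators, so that the words of length below \<open>K\<close> suffice for the exponentials
  in all three modules.\<close>

locale flag_degeneration = pbw N lt F v \<LL> for N lt and F :: "nat => complex ^ 'm ^ 'm" and v \<LL> +
 fixes k :: nat and e :: "nat => nat => nat" and K :: nat
 assumes e: "bij_betw e {..<k} S" and K: "p \<in> S ==> size_exp p < K"
  and nil: "Y \<in> \<LL> ==> mpow Y K = 0"
  and dim: "tensors.dim (cartan_power \<LL> v n) = card (minkowski_multiple n S)"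
begin

lemma e_in_S: "j < k ==> e j \<in> S" using e by (auto simp: bij_betw_def)

definition W :: "nat list set" where
 "W = {is. set is \<subseteq> {1..N} & length is < K}"

lemma W_letters: "W = (\<Union>n<K. letters n)" by (auto simp: W_def letters_def)

lemma finite_W [simp]: "finite W" unfolding W_letters by simp

lemma sum_W: "(\<Sum>n<K. \<Sum>is\<in>letters n. h is) = (\<Sum>is\<in>W. h is)"
 unfolding W_letters by (rule sum.UNION_disjoint[symmetric]) (simp_all, auto simp: letters_def)

definition coef :: "(nat => nat) => nat list => complex" where
 "coef p is = coord p (word is v) / fact (length is)"

text \<open>The three orbits are parametrised by keeping all words, those of length \<open>|p|\<close>, or those of
 content \<open>p\<close> in the coordinate \<open>p\<close> of the exponential.\<close>

definition phi :: "((nat => nat) => nat list => bool) => (nat => nat) => complex => (nat => complex) => nat => complex" where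
 "phi sel w t c j = (\<Sum>is\<in>W. if sel (e j) is then coef (e j) is * t ^ (deg N w (cont is) - deg N w (e j)) * wmon is c else 0)"

definition psi :: "((nat => nat) => nat list => bool) => (nat => complex) => nat => complex" where
 "psi sel c j = (\<Sum>is\<in>W. if sel (e j) is then coef (e j) is * wmon is c else 0)"

abbreviation sel_all where "sel_all == %(p :: nat => nat) (is :: nat list). True"
abbreviation sel_size where "sel_size == %p (is :: nat list). length is = size_exp p"
abbreviation sel_cont where "sel_cont == %p is. cont is = p"

lemma phi_1: "phi sel w 1 = psi sel" by (intro ext) (auto simp: phi_def psi_def intro!: sum.cong)

text \<open>Ensures that the truncated subtraction in the exponent of \<open>t\<close> in
  \<open>phi\<close> is a true difference wherever the coefficient is nonzero.\<close>

definition weight_ok :: "((nat => nat) => nat list => bool) => (nat => nat) => bool" where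
 "weight_ok sel w \<longleftrightarrow> (ALL p:S. ALL is:W. sel p is --> coord p (word is v) ~= 0 --> deg N w p \<le> deg N w (cont is))"

lemma phi_0:
 assumes w: "weight_ok sel w"
  and sel': "!!p is. p \<in> S ==> is \<in> W ==> coord p (word is v) ~= 0 ==> sel' p is \<longleftrightarrow> sel p is & deg N w (cont is) = deg N w p"
  and j: "j < k"
 shows "phi sel w 0 c j = psi sel' c j" unfolding phi_def psi_def
proof (rule sum.cong[OF refl])
 fix "is" assume i: "is \<in> W"
 show "(if sel (e j) is then coef (e j) is * 0 ^ (deg N w (cont is) - deg N w (e j)) * wmon is c else 0) =
   (if sel' (e j) is then coef (e j) is * wmon is c else 0)"
 proof (cases "coord (e j) (word is v) = 0")
  case True
  thus ?thesis by (simp add: coef_def)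
 next
  case False
  have "sel (e j) is ==> deg N w (e j) \<le> deg N w (cont is)" using w[unfolded weight_ok_def] e_in_S[OF j] i False by blast
  thus ?thesis using sel'[OF e_in_S[OF j] i False] by (auto simp: power_0_left)
 qed
qed

text \<open>Quasi-homogeneity: rescaling the parameters by their weights multiplies each word by
  \<open>t\<close> to its weight, and the part belonging to the weight of \<open>e j\<close> factors
  out of coordinate \<open>j\<close>.\<close>

lemma phi_scale:
 assumes w: "weight_ok sel w" and j: "j < k"
 shows "phi sel w 1 (%i. t ^ w i * c i) j = t ^ deg N w (e j) * phi sel w t c j" unfolding phi_def sum_distrib_left
proof (rule sum.cong[OF refl])
 fix "is" assume i: "is \<in> W"
 have s: "set is \<subseteq> {1..N}" using i by (simp add: W_def)
 have m: "wmon is (%i. t ^ w i * c i) = t ^ deg N w (cont is) * wmon is c" by (simp add: wmon_mult wmon_power deg_cont[OF s])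
 show "(if sel (e j) is then coef (e j) is * 1 ^ (deg N w (cont is) - deg N w (e j)) * wmon is (%i. t ^ w i * c i) else 0) =
   t ^ deg N w (e j) * (if sel (e j) is then coef (e j) is * t ^ (deg N w (cont is) - deg N w (e j)) * wmon is c else 0)"
 proof (cases "coord (e j) (word is v) = 0 \<or> \<not> sel (e j) is")
  case True
  thus ?thesis by (auto simp: coef_def)
 next
  case False
  hence "deg N w (e j) \<le> deg N w (cont is)" using w[unfolded weight_ok_def] e_in_S[OF j] i by blast
  hence "t ^ deg N w (cont is) = t ^ deg N w (e j) * t ^ (deg N w (cont is) - deg N w (e j))" by (simp add: power_add[symmetric])
  thus ?thesis unfolding m by simp
 qed
qed

text \<open>The exponent of the product of essential monomials named by the word; its values on
  words of length \<open>d\<close> are the \<open>d\<close>-fold Minkowski sums.\<close>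

definition expo :: "nat list => nat => nat" where
 "expo js i = sum_list (map (%j. e j i) js)"

lemma minkowski_expo: "minkowski_multiple d S = expo ` words k d"
proof
 show "minkowski_multiple d S \<subseteq> expo ` words k d"
 proof
  fix q assume "q \<in> minkowski_multiple d S"
  then obtain s where q: "q = (%i. \<Sum>l<d. s l i)" and s: "!!l. l < d ==> s l \<in> S" by (auto simp: minkowski_multiple_def)
  have "EX j. j < k & e j = s l" if "l < d" for l
  proof -
   have "s l \<in> e ` {..<k}" using s[OF that] bij_betw_imp_surj_on[OF e] by simp
   thus ?thesis by auto
  qed
  then obtain g where g: "!!l. l < d ==> g l < k & e (g l) = s l" by metis
  have "map g [0..<d] \<in> words k d" using g by (auto simp: words_def)
  moreover have "expo (map g [0..<d]) = q"
  proof
   fix i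
   have "expo (map g [0..<d]) i = (\<Sum>l<d. e (g l) i)" by (simp add: expo_def comp_def interv_sum_list_conv_sum_set_nat atLeast0LessThan)
   thus "expo (map g [0..<d]) i = q i" using g by (simp add: q)
  qed
  ultimately show "q \<in> expo ` words k d" by blast
 qed
 show "expo ` words k d \<subseteq> minkowski_multiple d S"
 proof clarify
  fix js assume js: "js \<in> words k d"
  have "expo js = (%i. \<Sum>l<d. e (js ! l) i)" using js by (intro ext) (simp add: expo_def words_def sum_list_sum_nth atLeast0LessThan)
  moreover have "e (js ! l) \<in> S" if "l < d" for l
  proof (rule e_in_S)
   have "js ! l \<in> set js" using js that by (simp add: words_def)
   thus "js ! l < k" using js by (auto simp: words_def)
  qed
  ultimately show "expo js \<in> minkowski_multiple d S" unfolding minkowski_multiple_def by (intro CollectI exI[of _ "%l. e (js ! l)"]) simp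
 qed
qed

text \<open>One decomposition is chosen for every element of the Minkowski sum. The chosen words
  have pairwise different exponents and are as many as the dimension of the Cartan power.\<close>

definition pick :: "nat => (nat => nat) => nat list" where
 "pick d q = (SOME js. js \<in> words k d & expo js = q)"

lemma pick: "q \<in> minkowski_multiple d S ==> pick d q \<in> words k d & expo (pick d q) = q"
 unfolding pick_def minkowski_expo by (rule someI_ex) auto

definition basis_words :: "nat => nat list set" where
 "basis_words d = pick d ` minkowski_multiple d S"

lemma basis_words_sub: "basis_words d \<subseteq> words k d" using pick by (auto simp: basis_words_def)

lemma expo_inj: "inj_on expo (basis_words d)" using pick by (auto simp: basis_words_def inj_on_def)

lemma card_basis_words: "card (basis_words d) = card (minkowski_multiple d S)" unfolding basis_words_def
proof (rule card_image)
 show "inj_on (pick d) (minkowski_multiple d S)" using pick by (metis inj_onI)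
qed

lemma expo_exponents: "js \<in> words k d ==> expo js \<in> exponents N"
proof -
 assume js: "js \<in> words k d"
 have "e j i = 0" if "j \<in> set js" "i \<notin> {1..N}" for j i using S_exponents[OF e_in_S, of j] js that by (auto simp: words_def exponents_def)
 thus ?thesis by (auto simp: exponents_def expo_def intro!: sum_list_0)
qed

lemma deg_expo: "deg N w (expo js) = sum_list (map (%j. deg N w (e j)) js)"
proof (induction js)
 case Nil
 show ?case by (simp add: deg_def expo_def)
next
 case (Cons j js)
 have "expo (j # js) = e j + expo js" by (simp add: expo_def fun_eq_iff)
 thus ?case unfolding Cons list.map sum_list.Cons by (simp only: deg_add Cons)
qed

text \<open>All words of content \<open>p\<close> are rearrangements of the sorted one, so they give
  the same monomial in the parameters, and each has coordinate 1 at \<open>p\<close>. The multiplier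
  is their number divided by a factorial, hence nonzero.\<close>

lemma psi_cont: "j < k ==> EX \<beta>. \<beta> ~= 0 & (ALL c. psi sel_cont c j = \<beta> * wmon (std (e j)) c)"
proof -
 assume j: "j < k"
 let ?p = "e j"
 have p: "?p \<in> S" "?p \<in> exponents N" using e_in_S[OF j] S_exponents by auto
 let ?A = "{is \<in> W. cont is = ?p}" and ?b = "of_nat (card {is \<in> W. cont is = ?p}) / fact (size_exp ?p) :: complex"
 have "std ?p \<in> ?A" using set_std cont_std[OF p(2)] K[OF p(1)] size_cont[OF set_std, of ?p] by (simp add: W_def)
 moreover have fin: "finite ?A" by simp
 ultimately have "card ?A ~= 0" by auto
 hence "?b ~= 0" by simp
 moreover have "psi sel_cont c j = ?b * wmon (std ?p) c" for c
 proof -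
  have t: "coef ?p is * wmon is c = 1 / fact (size_exp ?p) * wmon (std ?p) c" if i: "is \<in> ?A" for "is"
  proof -
   have s: "set is \<subseteq> {1..N}" "cont is = ?p" using i by (auto simp: W_def)
   have "mset is = mset (std ?p)" using mset_std[OF s(1)] s(2) by simp
   hence "wmon is c = wmon (std ?p) c" unfolding wmon_def by (metis mset_map prod_mset_prod_list)
   thus ?thesis using coord_word(1)[OF p(1) s] size_cont[OF s(1)] s(2) by (simp add: coef_def)
  qed
  have "psi sel_cont c j = (\<Sum>is\<in>?A. coef ?p is * wmon is c)" unfolding psi_def by (simp add: sum.inter_filter)
  also have "\<dots> = (\<Sum>is\<in>?A. 1 / fact (size_exp ?p) * wmon (std ?p) c)" by (rule sum.cong[OF refl t])
  finally show ?thesis by simp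
 qed
 ultimately show ?thesis by blast
qed

text \<open>The products indexed by \<open>basis_words d\<close> are nonzero multiples of monomials
  with distinct exponents. Substituting \<open>x ^ w i\<close> for the parameters, with weights that
  separate these finitely many exponents, reduces independence to coefficients of a polynomial in
  one variable.\<close>

lemma indep_cont:
 assumes z: "!!xi. (\<Sum>js\<in>basis_words d. c js * wmon js (psi sel_cont xi)) = 0" and js: "js \<in> basis_words d"
 shows "c js = 0"
proof -
 have fin: "finite (basis_words d)" using finite_subset[OF basis_words_sub] by simp
 have E: "finite (minkowski_multiple d S)" "minkowski_multiple d S \<subseteq> exponents N" unfolding minkowski_expo using expo_exponents by auto
 obtain w where w: "!!p q. p \<in> minkowski_multiple d S ==> q \<in> minkowski_multiple d S ==> lt p q ==> deg N w p < deg N w q"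
  using weights[OF E] by blast
 have inj: "inj_on (%js. deg N w (expo js)) (basis_words d)"
 proof (rule inj_onI)
  fix x y assume xy: "x \<in> basis_words d" "y \<in> basis_words d" "deg N w (expo x) = deg N w (expo y)"
  have "expo x \<in> minkowski_multiple d S" "expo y \<in> minkowski_multiple d S" unfolding minkowski_expo using xy basis_words_sub by auto
  hence "expo x = expo y" using w[of "expo x" "expo y"] w[of "expo y" "expo x"] lt_total E(2) xy(3) by (metis less_irrefl subsetD)
  thus "x = y" using expo_inj xy by (auto simp: inj_on_def)
 qed
 have "ALL j. EX \<beta>. j < k --> \<beta> ~= 0 & (ALL c. psi sel_cont c j = \<beta> * wmon (std (e j)) c)" using psi_cont by blast
 then obtain \<beta> where \<beta>: "!!j. j < k ==> \<beta> j ~= 0" "!!j c. j < k ==> psi sel_cont c j = \<beta> j * wmon (std (e j)) c" by metis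
 let ?P = "\<Sum>js\<in>basis_words d. Polynomial.monom (c js * wmon js \<beta>) (deg N w (expo js))"
 have "poly ?P x = 0" for x
 proof -
  have "wmon js (psi sel_cont (%i. x ^ w i)) = wmon js \<beta> * x ^ deg N w (expo js)" if "js \<in> basis_words d" for js
  proof -
   have "wmon js (psi sel_cont (%i. x ^ w i)) = wmon js (%j. \<beta> j * x ^ deg N w (e j))"
   proof (rule wmon_cong)
    show "js \<in> words k d" using that basis_words_sub by blast
    fix j assume j: "j < k"
    have "wmon (std (e j)) (%i. x ^ w i) = x ^ deg N w (e j)"
     using deg_cont[OF set_std, of w "e j"] cont_std[OF S_exponents[OF e_in_S[OF j]]] by (simp add: wmon_power)
    thus "psi sel_cont (%i. x ^ w i) j = \<beta> j * x ^ deg N w (e j)" using \<beta>(2)[OF j] by simp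
   qed
   thus ?thesis by (simp add: wmon_mult wmon_power deg_expo)
  qed
  hence "poly ?P x = (\<Sum>js\<in>basis_words d. c js * wmon js (psi sel_cont (%i. x ^ w i)))" by (simp add: poly_sum poly_monom mult.assoc)
  thus ?thesis using z by simp
 qed
 hence "?P = 0" using poly_all_0_iff_0 by blast
 hence "0 = coeff ?P (deg N w (expo js))" by simp
 also have "\<dots> = (\<Sum>is\<in>basis_words d. if is = js then c js * wmon js \<beta> else 0)"
  unfolding coeff_sum using inj js by (intro sum.cong) (auto simp: inj_on_def)
 also have "\<dots> = c js * wmon js \<beta>" using fin js by simp
 finally have "c js * wmon js \<beta> = 0" by simp
 moreover have "wmon js \<beta> ~= 0"
 proof -
  have "js \<in> words k d" using js basis_words_sub by blast
  thus ?thesis unfolding wmon_def using \<beta>(1) by (auto simp: words_def prod_list_zero_iff)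
 qed
 ultimately show ?thesis by simp
qed

lemma degeneration_dataI:
 assumes w: "weight_ok sel w"
  and indep: "!!d c js. (!!xi. (\<Sum>js\<in>basis_words d. c js * wmon js (phi sel w 0 xi)) = 0) ==> js \<in> basis_words d ==> c js = 0"
 shows "degeneration_data k (phi sel w) (%j. deg N w (e j)) basis_words"
proof
 show "polyfun (%t. phi sel w t xi i)" for xi i unfolding phi_def
 proof (rule polyfun_sum)
  fix js
  show "polyfun (%t. if sel (e i) js then coef (e i) js * t ^ (deg N w (cont js) - deg N w (e i)) * wmon js xi else 0)"
   by (cases "sel (e i) js") (auto intro!: polyfun_mult polyfun_power)
 qed
 show "EX xi'. ALL i<k. phi sel w 1 xi' i = t ^ deg N w (e i) * phi sel w t xi i" for t xi using phi_scale[OF w] by blast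
 show "EX xi'. ALL i<k. t ^ deg N w (e i) * phi sel w t xi' i = phi sel w 1 xi i" if t: "t ~= 0" for t xi
 proof (intro exI[of _ "%i. inverse t ^ w i * xi i"] allI impI)
  fix i assume i: "i < k"
  have "(%i. t ^ w i * (inverse t ^ w i * xi i)) = xi" using t by (simp add: fun_eq_iff power_inverse)
  thus "t ^ deg N w (e i) * phi sel w t (%i. inverse t ^ w i * xi i) i = phi sel w 1 xi i"
   using phi_scale[OF w i, of t "%i. inverse t ^ w i * xi i"] by simp
 qed
 show "basis_words d \<subseteq> words k d" for d by (rule basis_words_sub)
qed (use indep in blast)

text \<open>With all parameters zero the exponential is the identity: only the empty word
  contributes, and \<open>v\<close> itself has coordinate 1 at the zero exponent.\<close>

lemma phi_nonzero:
 assumes "sel (%_. 0) []" shows "EX xi. EX i<k. phi sel w a xi i ~= 0"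
proof -
 have "(%_. 0) \<in> e ` {..<k}" using zero_S bij_betw_imp_surj_on[OF e] by simp
 then obtain j where j: "j < k" "e j = (%_. 0)" by auto
 have n: "[] \<in> W" using K[OF zero_S] by (simp add: W_def)
 have c0: "cont [] = (%_. 0)" by (simp add: cont_def fun_eq_iff)
 have c1: "coef (%_. 0) [] = 1" using coord_word(1)[OF zero_S, of "[]"] c0 by (simp add: coef_def)
 have "phi sel w a (%_. 0) j = (\<Sum>is\<in>W. if is = [] then 1 else 0)" unfolding phi_def j(2)
 proof (rule sum.cong[OF refl])
  fix "is" :: "nat list"
  show "(if sel (%_. 0) is then coef (%_. 0) is * a ^ (deg N w (cont is) - deg N w (%_. 0)) * wmon is (%_. 0) else 0) = (if is = [] then 1 else 0)"
   using assms c1 by (cases "is") (auto simp: wmon_def c0 deg_def)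
 qed
 also have "\<dots> = 1" using n by simp
 finally show ?thesis using j(1) by (intro exI[of _ "%_. 0"] exI[of _ j]) simp
qed

end

section \<open>Hilbert functions of the three orbits and the resulting families\<close>

context flag_degeneration
begin

lemma operator_power:
 "mpow (\<Sum>i=1..N. mat_scale (c i) (F i)) n *v v = (\<Sum>is\<in>letters n. wmon is c *s word is v)"
proof (induction n)
 case 0
 show ?case by (simp add: letters_0 wmon_def)
next
 case (Suc n)
 let ?Y = "\<Sum>i=1..N. mat_scale (c i) (F i)"
 have "mpow ?Y (Suc n) *v v = ?Y *v (mpow ?Y n *v v)" by (simp only: mpow_Suc2 matrix_vector_mul_assoc)
 also have "\<dots> = (\<Sum>i=1..N. c i *s word [i] (\<Sum>is\<in>letters n. wmon is c *s word is v))" unfolding Suc lincomb_vector by simp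
 also have "\<dots> = (\<Sum>i=1..N. \<Sum>is\<in>letters n. wmon (i # is) c *s word (i # is) v)"
  unfolding word_sum vec.scale_sum_right by (intro sum.cong refl) (simp add: wmon_def vector_scalar_commute)
 also have "\<dots> = (\<Sum>is\<in>letters (Suc n). wmon is c *s word is v)" by (rule sum_letters_Suc[symmetric])
 finally show ?case .
qed

lemma exp_coord:
 assumes j: "j < k"
 shows "coord (e j) (mexp (\<Sum>i=1..N. mat_scale (c i) (F i)) *v v) = psi sel_all c j"
proof -
 let ?Y = "\<Sum>i=1..N. mat_scale (c i) (F i)"
 have "?Y \<in> \<LL>" unfolding L_eq by blast
 hence "mexp ?Y *v v = (\<Sum>n<K. mat_scale (1 / fact n) (mpow ?Y n)) *v v" using mexp_eq[OF nil] by simp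
 also have "\<dots> = (\<Sum>n<K. (1 / fact n) *s (\<Sum>is\<in>letters n. wmon is c *s word is v))" unfolding lincomb_vector operator_power ..
 finally have "coord (e j) (mexp ?Y *v v) = (\<Sum>n<K. \<Sum>is\<in>letters n. coord (e j) (word is v) / fact n * wmon is c)"
  by (simp add: coord_sum coord_scale sum_distrib_left mult_ac)
 also have "\<dots> = (\<Sum>n<K. \<Sum>is\<in>letters n. coef (e j) is * wmon is c)" by (intro sum.cong refl) (simp add: letters_def coef_def)
 finally show ?thesis unfolding sum_W by (simp add: psi_def)
qed

lemma minkowski_finite: "finite (minkowski_multiple d S)" and minkowski_nonempty: "minkowski_multiple d S ~= {}"
proof -
 show "finite (minkowski_multiple d S)" unfolding minkowski_expo by simp
 have "(%i. \<Sum>l<d. (%_ _. 0) l i) \<in> minkowski_multiple d S"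
  unfolding minkowski_multiple_def using zero_S by (intro CollectI exI[of _ "%_ _. 0"]) simp
 thus "minkowski_multiple d S ~= {}" by blast
qed

text \<open>The upper bound on the Hilbert function. Monomials of degree \<open>d\<close> on the
  orbit are functionals on the Cartan power, so they lie in a space generated by as many functions
  as there are basis words; independence then forces the basis words to span.\<close>

lemma span_all:
 assumes "is": "is \<in> words k d"
  and indep: "!!c js. (!!xi. (\<Sum>js\<in>basis_words d. c js * wmon js (psi sel_all xi)) = 0) ==> js \<in> basis_words d ==> c js = 0"
 shows "EX ga. ALL xi. wmon is (psi sel_all xi) = (\<Sum>js\<in>basis_words d. ga js * wmon js (psi sel_all xi))"
proof -
 let ?Y = "%c. \<Sum>i=1..N. mat_scale (c i) (F i)"
 obtain T where T: "tensors.independent T" "cartan_power \<LL> v d \<subseteq> tensors.span T" "card T = tensors.dim (cartan_power \<LL> v d)"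
  using tensors.basis_exists[of "cartan_power \<LL> v d"] by metis
 have cT: "card T = card (minkowski_multiple d S)" using T(3) dim by simp
 \<comment> \<open>Its cardinality is nonzero, which rules out the convention that infinite sets
   have cardinality zero.\<close>
 hence fT: "finite T" using minkowski_finite[of d] minkowski_nonempty[of d] by (metis card_eq_0_iff)
 have sum_app: "(\<Sum>i\<in>I. h i) w = (\<Sum>i\<in>I. h i w)" for I and h :: "('m list => complex) => 'm list => complex" and w
  by (induction I rule: infinite_finite_induct) simp_all
 define a where "a t c = tensors.representation T (tensor_power d (mexp (?Y c) *v v)) t" for t c
 have tp: "tensor_power d (mexp (?Y c) *v v) w = (\<Sum>t\<in>T. a t c * t w)" for c w
 proof -
  have Y: "?Y c \<in> \<LL>" unfolding L_eq by blast
  have "tensor_power d (mexp (?Y c) *v v) \<in> tensors.span T" using exp_tensor_power[OF Y nil[OF Y]] T(2) by blast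
  from tensors.sum_representation_eq[OF T(1) this fT order_refl]
  have "tensor_power d (mexp (?Y c) *v v) = (\<Sum>t\<in>T. tensor_scale (a t c) t)" by (simp add: a_def)
  thus ?thesis by (simp add: sum_app tensor_scale_def)
 qed
 have lin: "coord p x = (\<Sum>b\<in>UNIV. coord p (axis b 1) * x $ b)" for p x
 proof -
  have "coord p x = coord p (\<Sum>b\<in>UNIV. x $ b *s axis b 1)" by (simp add: basis_expansion)
  thus ?thesis by (simp add: coord_sum coord_scale mult.commute)
 qed
 have expand: "EX ga. ALL xi. wmon js (psi sel_all xi) = (\<Sum>t\<in>T. ga t * a t xi)" if js: "js \<in> words k d" for js
 proof -
  obtain \<mu> where \<mu>: "!!x. wmon js (%j. coord (e j) x) = (\<Sum>w | length w = length js. \<mu> w * tensor_power (length js) x w)"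
   using product_of_linear_forms[where js = js and l = "%j. coord (e j)" and b = "%j b. coord (e j) (axis b 1)", OF lin] by blast
  have "wmon js (psi sel_all xi) = (\<Sum>t\<in>T. (\<Sum>w | length w = d. \<mu> w * t w) * a t xi)" for xi
  proof -
   have "wmon js (psi sel_all xi) = wmon js (%j. coord (e j) (mexp (?Y xi) *v v))" by (rule wmon_cong[OF js]) (rule exp_coord[symmetric])
   also have "\<dots> = (\<Sum>w | length w = d. \<mu> w * (\<Sum>t\<in>T. a t xi * t w))"
    using js unfolding \<mu> words_def by (simp only: mem_Collect_eq tp)
   also have "\<dots> = (\<Sum>w | length w = d. \<Sum>t\<in>T. \<mu> w * t w * a t xi)" by (simp add: sum_distrib_left mult_ac)
   also have "\<dots> = (\<Sum>t\<in>T. (\<Sum>w | length w = d. \<mu> w * t w) * a t xi)" unfolding sum_distrib_right by (rule sum.swap)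
   finally show ?thesis .
  qed
  thus ?thesis by (intro exI[of _ "%t. \<Sum>w | length w = d. \<mu> w * t w"]) simp
 qed
 show ?thesis
 proof (rule span_by_cardinality[where J = "basis_words d" and T = T and a = a and f = "%js xi. wmon js (psi sel_all xi)"])
  show "finite (basis_words d)" using finite_subset[OF basis_words_sub] by simp
  show "card T \<le> card (basis_words d)" by (simp add: cT card_basis_words)
  show "EX ga. ALL x. wmon j (psi sel_all x) = (\<Sum>t\<in>T. ga t * a t x)" if "j \<in> basis_words d" for j
   using expand that basis_words_sub by blast
  show "EX ga. ALL x. wmon is (psi sel_all x) = (\<Sum>t\<in>T. ga t * a t x)" by (rule expand[OF "is"])
 qed (use fT indep in blast)+
qed

definition wt_order :: "nat => nat" where
 "wt_order = (SOME w. ALL p:S \<union> cont ` W. ALL q:S \<union> cont ` W. lt p q --> deg N w p < deg N w q)"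

lemma wt_order: "p \<in> S ==> is \<in> W ==> lt p (cont is) ==> deg N wt_order p < deg N wt_order (cont is)"
proof -
 have "S \<union> cont ` W \<subseteq> exponents N" using S_exponents cont_exponents by (auto simp: W_def)
 from weights[OF _ this] have "EX w. ALL p:S \<union> cont ` W. ALL q:S \<union> cont ` W. lt p q --> deg N w p < deg N w q" using finite_S by simp
 from someI_ex[OF this] show "p \<in> S ==> is \<in> W ==> lt p (cont is) ==> deg N wt_order p < deg N wt_order (cont is)"
  unfolding wt_order_def by blast
qed

abbreviation wt_size :: "nat => nat" where "wt_size == %_. Suc 0"

lemma coord_lt: "p \<in> S ==> is \<in> W ==> coord p (word is v) ~= 0 ==> lt p (cont is) \<or> p = cont is" using coord_word(2) by (simp add: W_def)

lemma weight_ok_order: "weight_ok sel wt_order" unfolding weight_ok_def using coord_lt wt_order by (metis le_less order_refl)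

lemma weight_ok_size: "weight_ok sel wt_size" unfolding weight_ok_def
proof (intro ballI impI)
 fix p "is" assume p: "p \<in> S" and i: "is \<in> W" and "coord p (word is v) ~= 0"
 have "cont is \<in> exponents N" using i cont_exponents by (simp add: W_def)
 thus "size_exp p \<le> size_exp (cont is)"
  using coord_lt[OF p i \<open>coord p (word is v) \<noteq> 0\<close>] lt_size[OF S_exponents[OF p]] by auto
qed

text \<open>Where the coefficient is nonzero, the exponent \<open>p\<close> is either the content of
  the word or strictly smaller, and \<open>wt_order\<close> increases strictly in the second case.
  Equal weight thus singles out content \<open>p\<close>; for \<open>wt_size\<close> it singles out
  length.\<close>

lemma phi_order_0: "j < k ==> phi sel_all wt_order 0 c j = psi sel_cont c j"
 and phi_size_order_0: "j < k ==> phi sel_size wt_order 0 c j = psi sel_cont c j"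
 and phi_size_0: "j < k ==> phi sel_all wt_size 0 c j = psi sel_size c j"
proof -
 have eq: "cont is = p \<longleftrightarrow> deg N wt_order (cont is) = deg N wt_order p"
  if "p \<in> S" "is \<in> W" "coord p (word is v) ~= 0" for p "is" using coord_lt[OF that] wt_order[OF that(1,2)] by auto
 show "j < k ==> phi sel_all wt_order 0 c j = psi sel_cont c j" by (rule phi_0[OF weight_ok_order]) (simp_all add: eq)
 have s: "length is = size_exp (cont is)" if "is \<in> W" for "is" using size_cont[of "is"] that by (simp add: W_def)
 show "j < k ==> phi sel_size wt_order 0 c j = psi sel_cont c j" by (rule phi_0[OF weight_ok_order]) (use eq s in auto)
 show "j < k ==> phi sel_all wt_size 0 c j = psi sel_size c j" by (rule phi_0[OF weight_ok_size]) (use s in auto)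
qed

lemma indep_transfer:
 assumes "!!xi j. j < k ==> f xi j = g xi j"
  and "!!xi. (\<Sum>js\<in>basis_words d. c js * wmon js (f xi)) = 0"
 shows "(\<Sum>js\<in>basis_words d. c js * wmon js (g xi)) = 0"
proof -
 have "wmon js (f xi) = wmon js (g xi)" if "js \<in> basis_words d" for js using assms(1) that basis_words_sub by (intro wmon_cong) auto
 thus ?thesis using assms(2)[of xi] by simp
qed

lemma data_order: "degeneration_data k (phi sel_all wt_order) (%j. deg N wt_order (e j)) basis_words"
 by (rule degeneration_dataI[OF weight_ok_order], rule indep_cont[OF indep_transfer[OF phi_order_0]]) auto

lemma data_size_order: "degeneration_data k (phi sel_size wt_order) (%j. deg N wt_order (e j)) basis_words"
 by (rule degeneration_dataI[OF weight_ok_order], rule indep_cont[OF indep_transfer[OF phi_size_order_0]]) auto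

text \<open>The orbit in \<open>M^a\<close> is the fibre over 1 of a family whose fibre over 0 is
  the orbit in \<open>M^t\<close>, where independence is known. The same device with all words
  serves for \<open>M\<close> next.\<close>

lemma indep_size:
 assumes "!!xi. (\<Sum>js\<in>basis_words d. c js * wmon js (psi sel_size xi)) = 0" "js \<in> basis_words d"
 shows "c js = 0" using degeneration_data.indep[OF data_size_order, where a = 1 and d = d and c = c and js = js] assms by (simp add: phi_1)

lemma indep_all:
 assumes "!!xi. (\<Sum>js\<in>basis_words d. c js * wmon js (psi sel_all xi)) = 0" "js \<in> basis_words d"
 shows "c js = 0" using degeneration_data.indep[OF data_order, where a = 1 and d = d and c = c and js = js] assms by (simp add: phi_1)

lemma data_size: "degeneration_data k (phi sel_all wt_size) (%j. deg N wt_size (e j)) basis_words"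
 by (rule degeneration_dataI[OF weight_ok_size], rule indep_size[OF indep_transfer[OF phi_size_0]]) auto

lemma family_order: "family k (phi sel_all wt_order) (%j. deg N wt_order (e j)) basis_words"
proof (intro family.intro data_order family_axioms.intro)
 show "EX ga. ALL xi. wmon is (phi sel_all wt_order 1 xi) = (\<Sum>js\<in>basis_words d. ga js * wmon js (phi sel_all wt_order 1 xi))"
  if "is \<in> words k d" for "is" d unfolding phi_1 by (rule span_all[OF that]) (rule indep_all)
 show "EX xi. EX i<k. phi sel_all wt_order a xi i ~= 0" for a by (rule phi_nonzero) (simp add: deg_def)
qed

lemma family_size: "family k (phi sel_all wt_size) (%j. deg N wt_size (e j)) basis_words"
proof (intro family.intro data_size family_axioms.intro)
 show "EX ga. ALL xi. wmon is (phi sel_all wt_size 1 xi) = (\<Sum>js\<in>basis_words d. ga js * wmon js (phi sel_all wt_size 1 xi))"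
  if "is \<in> words k d" for "is" d unfolding phi_1 by (rule span_all[OF that]) (rule indep_all)
 show "EX xi. EX i<k. phi sel_all wt_size a xi i ~= 0" for a by (rule phi_nonzero) (simp add: deg_def)
qed

text \<open>Spanning passes to the limit: the orbit in \<open>M^a\<close> is the fibre over 0 of the
  family starting at \<open>M\<close>, and \<open>relations\<close> remain valid at
  \<open>t = 0\<close>.\<close>

lemma span_size:
 assumes "is": "is \<in> words k d"
 shows "EX ga. ALL xi. wmon is (psi sel_size xi) = (\<Sum>js\<in>basis_words d. ga js * wmon js (psi sel_size xi))"
proof -
 interpret family k "phi sel_all wt_size" "%j. deg N wt_size (e j)" basis_words by (rule family_size)
 have c: "wmon js (phi sel_all wt_size 0 xi) = wmon js (psi sel_size xi)" if "js \<in> words k d" for js xi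
  by (rule wmon_cong[OF that]) (rule phi_size_0)
 obtain ga where ga: "!!t xi. wmon is (phi sel_all wt_size t xi) =
   (\<Sum>js\<in>basis_words d. ga js * t ^ (wt js - wt is) * wmon js (phi sel_all wt_size t xi))" by (rule relations[OF "is"]) (rule that)
 have "wmon is (psi sel_size xi) = (\<Sum>js\<in>basis_words d. ga js * 0 ^ (wt js - wt is) * wmon js (psi sel_size xi))" for xi
  using ga[of 0 xi] c[OF "is"] c basis_words_sub by (simp add: subset_iff)
 thus ?thesis by (intro exI[of _ "%js. ga js * 0 ^ (wt js - wt is)"]) simp
qed

lemma family_size_order: "family k (phi sel_size wt_order) (%j. deg N wt_order (e j)) basis_words"
proof (intro family.intro data_size_order family_axioms.intro)
 show "EX ga. ALL xi. wmon is (phi sel_size wt_order 1 xi) = (\<Sum>js\<in>basis_words d. ga js * wmon js (phi sel_size wt_order 1 xi))"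
  if "is \<in> words k d" for "is" d unfolding phi_1 by (rule span_size[OF that])
 show "EX xi. EX i<k. phi sel_size wt_order a xi i ~= 0" for a by (rule phi_nonzero) (simp add: deg_def)
qed

definition kvec :: "complex ^ 'm => nat => complex" where
 "kvec x j = (if j < k then coord (e j) x else 0)"

lemma lin_coords_vec: "lin_coords vec_space k kvec"
proof
 show "bij_betw kvec (carrier vec_space) (carrier (coord_space k))"
 proof (rule bij_betw_imageI)
  show "inj_on kvec (carrier vec_space)"
  proof (rule inj_onI)
   fix x y assume eq: "kvec x = kvec y"
   show "x = y"
   proof (rule coord_ext)
    fix p assume "p \<in> S"
    hence "p \<in> e ` {..<k}" using bij_betw_imp_surj_on[OF e] by simp
    then obtain j where "j < k" "p = e j" by blast
    thus "coord p x = coord p y" using fun_cong[OF eq, of j] by (simp add: kvec_def)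
   qed
  qed
  show "kvec ` carrier vec_space = carrier (coord_space k)"
  proof
   show "kvec ` carrier vec_space \<subseteq> carrier (coord_space k)" by (auto simp: carrier_coord_space kvec_def)
   show "carrier (coord_space k) \<subseteq> kvec ` carrier vec_space"
   proof
    fix z assume z: "z \<in> carrier (coord_space k)"
    let ?x = "\<Sum>l<k. z l *s bvec (e l)"
    have "kvec ?x j = z j" for j
    proof (cases "j < k")
     case True
     have "coord (e j) ?x = (\<Sum>l<k. if l = j then z l else 0)" unfolding coord_sum coord_scale using e True
      by (intro sum.cong) (auto simp: coord_bvec e_in_S bij_betw_def inj_on_def)
     thus ?thesis using True by (simp add: kvec_def)
    next
     case False
     thus ?thesis using z by (simp add: kvec_def carrier_coord_space)
    qed
    hence "z = kvec ?x" by (intro ext) simp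
    thus "z \<in> kvec ` carrier vec_space" by (rule image_eqI) (simp add: vec_space_def mk_space_simps)
   qed
  qed
 qed
qed (auto simp: vec_space_def mk_space_simps kvec_def coord_add coord_scale fun_eq_iff)

end

section \<open>Compatibility of the operators with the filtrations, and the six
  degenerations\<close>

context flag_degeneration
begin

lemma word_F_le: "set is \<subseteq> {1..N} ==> word is v \<in> F_le N lt F v (cont is)"
proof -
 assume i: "set is \<subseteq> {1..N}"
 have "lt p (cont is) \<or> p = cont is" if "p \<in> S" "coord p (word is v) ~= 0" for p using coord_word(2)[OF that(1) i that(2)] .
 thus ?thesis unfolding F_le_iff[OF cont_exponents[OF i]] by blast
qed

lemma F_le_mono: "p \<in> exponents N ==> q \<in> exponents N ==> lt p q ==> F_le N lt F v p \<subseteq> F_less N lt F v q"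
 unfolding F_le_def F_less_def using lt_trans by (intro vec.span_mono) blast

lemma image_span:
 assumes "!!q. Q q ==> A *v bvec q \<in> U" and U: "vec.subspace U" and x: "x \<in> vec.span {bvec q |q. Q q}"
 shows "A *v x \<in> U"
proof -
 have "vec.span {bvec q |q. Q q} \<subseteq> {x. A *v x \<in> U}" by (rule vec.span_minimal)
   (use assms(1) U in \<open>auto intro!: vec.subspaceI simp: matrix_vector_right_distrib vector_scalar_commute
     vec.subspace_0 vec.subspace_add vec.subspace_scale\<close>)
 thus ?thesis using x by blast
qed

lemma F_bvec: "F j *v bvec q = word (j # std q) v" by (simp add: bvec_word)

lemma F_low: "j \<in> {1..N} ==> x \<in> low s ==> F j *v x \<in> low (Suc s)"
proof -
 assume j: "j \<in> {1..N}" and x: "x \<in> low s"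
 show ?thesis
 proof (rule image_span[OF _ low_subspace x[unfolded low_def]])
  fix q assume q: "q \<in> exponents N & size_exp q < s"
  have "length (std q) < s" using size_cont[OF set_std, of q] cont_std q by simp
  moreover have "word (j # std q) v \<in> low (Suc (length (j # std q)))" using j set_std by (intro word_low) (simp del: One_nat_def)
  ultimately show "F j *v bvec q \<in> low (Suc s)" unfolding F_bvec using low_mono[of "Suc (length (j # std q))" "Suc s"] by auto
 qed
qed

lemma cont_Cons: "cont (j # is) = cont is + unit_exp j" by (auto simp: cont_def unit_exp_def fun_eq_iff)

lemma unit_exponents: "j \<in> {1..N} ==> unit_exp j \<in> exponents N" by (auto simp: unit_exp_def exponents_def)

lemma F_bvec_le: "j \<in> {1..N} ==> q \<in> exponents N ==> F j *v bvec q \<in> F_le N lt F v (q + unit_exp j)"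
 using word_F_le[of "j # std q"] set_std[of q] cont_std[of q] unfolding F_bvec cont_Cons by auto

lemma F_F_less:
 assumes j: "j \<in> {1..N}" and q: "q \<in> exponents N" and x: "x \<in> F_less N lt F v q"
 shows "F j *v x \<in> F_less N lt F v (q + unit_exp j)"
proof (rule image_span[OF _ _ x[unfolded F_less_def]])
 show "vec.subspace (F_less N lt F v (q + unit_exp j))" unfolding F_less_def by (rule vec.subspace_span)
 fix r assume r: "r \<in> exponents N & lt r q"
 thus "F j *v bvec r \<in> F_less N lt F v (q + unit_exp j)"
  using F_bvec_le[OF j, of r] F_le_mono[of "r + unit_exp j" "q + unit_exp j"] lt_add[of r q "unit_exp j"]
   exponents_add[of _ "unit_exp j"] unit_exponents[OF j] q by blast
qed

lemma F_F_le:
 assumes j: "j \<in> {1..N}" and q: "q \<in> exponents N" and x: "x \<in> F_le N lt F v q"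
 shows "F j *v x \<in> F_le N lt F v (q + unit_exp j)"
proof (rule image_span[OF _ _ x[unfolded F_le_def]])
 let ?q = "q + unit_exp j"
 show "vec.subspace (F_le N lt F v ?q)" unfolding F_le_def by (rule vec.subspace_span)
 fix r assume r: "r \<in> exponents N & (lt r q \<or> r = q)"
 have "F_le N lt F v (r + unit_exp j) \<subseteq> F_le N lt F v ?q" unfolding F_le_def
  using r lt_add[of r q "unit_exp j"] lt_trans[of _ "r + unit_exp j" ?q] exponents_add unit_exponents[OF j] q by (intro vec.span_mono) blast
 thus "F j *v bvec r \<in> F_le N lt F v ?q" using F_bvec_le[OF j, of r] r by blast
qed

lemma graded_size:
 "graded_flag N lt F v \<LL> UNIV (PBW_filtration \<LL> v) (PBW_lower \<LL> v) size_exp (%s p. size_exp p < s) length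
  (%j s. if s = 0 then None else Some (s - 1)) k e"
proof unfold_locales
 fix x and i :: nat
 show "x \<in> PBW_filtration \<LL> v i \<longleftrightarrow> (ALL p:S. \<not> (size_exp p < i \<or> size_exp p = i) --> coord p x = 0)"
  unfolding PBW_low low_iff by (simp add: less_Suc_eq)
 show "x \<in> PBW_lower \<LL> v i \<longleftrightarrow> (ALL p:S. \<not> size_exp p < i --> coord p x = 0)" unfolding PBW_lower_low low_iff ..
next
 fix j i i' :: nat and x assume j: "j \<in> {1..N}" and p: "(if i = 0 then None else Some (i - 1)) = Some i'"
 hence i: "i = Suc i'" by (auto split: if_splits)
 show "x \<in> PBW_filtration \<LL> v i' ==> F j *v x \<in> PBW_filtration \<LL> v i" unfolding PBW_low i by (rule F_low[OF j])
 show "x \<in> PBW_lower \<LL> v i' ==> F j *v x \<in> PBW_lower \<LL> v i" unfolding PBW_lower_low i by (rule F_low[OF j])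
next
 show "v \<in> PBW_filtration \<LL> v (length [])" unfolding PBW_low using word_low[of "[]"] by simp
 show "bij_betw e {..<k} S" by (rule e)
qed auto

lemma graded_cont:
 "graded_flag N lt F v \<LL> (exponents N) (F_le N lt F v) (F_less N lt F v) (%p. p) (%q p. lt p q) cont
  (%j p. if p j = 0 then None else Some (p(j := p j - 1))) k e"
proof unfold_locales
 show "p \<in> exponents N" "\<not> lt p p" if "p \<in> S" for p using S_exponents[OF that] lt_irrefl by auto
 fix x i assume i: "i \<in> exponents N"
 show "x \<in> F_le N lt F v i \<longleftrightarrow> (ALL p:S. \<not> (lt p i \<or> p = i) --> coord p x = 0)" by (rule F_le_iff[OF i])
 show "x \<in> F_less N lt F v i \<longleftrightarrow> (ALL p:S. \<not> lt p i --> coord p x = 0)" by (rule F_less_iff[OF i])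
next
 show "set is \<subseteq> {1..N} ==> cont is \<in> exponents N" for "is" by (rule cont_exponents)
 show "cont (j # is) = i \<longleftrightarrow> (if i j = 0 then None else Some (i(j := i j - 1))) = Some (cont is)" for j "is" i
  unfolding cont_Cons by (auto simp: fun_eq_iff unit_exp_def split: if_splits)
next
 fix j i i' x assume j: "j \<in> {1..N}" and i: "i \<in> exponents N"
  and p: "(if i j = 0 then None else Some (i(j := i j - 1))) = Some i'"
 show i': "i' \<in> exponents N" using p i by (auto simp: exponents_def split: if_splits)
 have "i = i' + unit_exp j" using p by (auto simp: unit_exp_def fun_eq_iff split: if_splits)
 thus "x \<in> F_le N lt F v i' ==> F j *v x \<in> F_le N lt F v i" "x \<in> F_less N lt F v i' ==> F j *v x \<in> F_less N lt F v i"
  using F_F_le[OF j i'] F_F_less[OF j i'] by auto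
next
 show "v \<in> F_le N lt F v (cont [])" using word_F_le[of "[]"] by simp
 show "length is = size_exp p" if "set is \<subseteq> {1..N}" "cont is = p" for "is" p using size_cont[OF that(1)] that(2) by simp
 show "bij_betw e {..<k} S" by (rule e)
qed

theorem flag_degenerations:
 assumes orbit: "Orb = {mexp Y *v v |Y. Y \<in> \<LL>}"
 defines "Fl == orbit_closure vec_space Orb" and "Fa == flag_var_a \<LL> N F v" and "Ft == flag_var_t N lt F v"
  and "Ma == Ma_space \<LL> v" and "Mt == Mt_space N lt F v"
 shows "degenerates_to (cone_variety vec_space Fl) (cone_variety Ma Fa)"
  and "degenerates_to (cone_variety vec_space Fl) (cone_variety Mt Ft)"
  and "degenerates_to (cone_variety Ma Fa) (cone_variety Mt Ft)"
  and "degenerates_to (proj_space_on vec_space Fl) (proj_space_on Ma Fa)"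
  and "degenerates_to (proj_space_on vec_space Fl) (proj_space_on Mt Ft)"
  and "degenerates_to (proj_space_on Ma Fa) (proj_space_on Mt Ft)"
proof -
 interpret a: graded_flag N lt F v \<LL> UNIV "PBW_filtration \<LL> v" "PBW_lower \<LL> v" size_exp "%s p. size_exp p < s" length
  "%j s. if s = 0 then None else Some (s - 1)" k e by (rule graded_size)
 interpret t: graded_flag N lt F v \<LL> "exponents N" "F_le N lt F v" "F_less N lt F v" "%p. p" "%q p. lt p q" cont
  "%j p. if p j = 0 then None else Some (p(j := p j - 1))" k e by (rule graded_cont)
 define Oa where "Oa = abelian_orbit Ma N (%i. Ma_action \<LL> v (F i)) (Ma_vec \<LL> v)"
 define Ot where "Ot = abelian_orbit Mt N (Mt_action N lt F v) (Mt_vec N lt F v)"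
 have Ma: "Ma = a.V" and Mt: "Mt = t.V" by (simp_all add: Ma_def Mt_def Ma_space_def Mt_space_def)
 have Fa: "Fa = orbit_closure Ma Oa" and Ft: "Ft = orbit_closure Mt Ot"
  by (simp_all add: Fa_def Ft_def flag_var_a_def flag_var_t_def Oa_def Ot_def Ma_def Mt_def)
 have c0: "cont [] = (%_. 0)" by (simp add: cont_def fun_eq_iff)
 have Oa: "Oa = {exp_action Ma (a.oper c) a.gvec |c. True}" unfolding Oa_def abelian_orbit_def a.oper_def Ma_vec_def Ma_action_def Ma by simp
 have Ot: "Ot = {exp_action Mt (t.oper c) t.gvec |c. True}" unfolding Ot_def abelian_orbit_def t.oper_def Mt_vec_def Mt_action_def Mt c0 by simp
 have sums: "(\<Sum>n<K. \<Sum>is\<in>letters n. if sel is then coord (e j) (word is v) / fact n * wmon is c else 0) =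
   (\<Sum>is\<in>W. if sel is then coef (e j) is * wmon is c else 0)" for sel j c
  unfolding sum_W[symmetric] by (intro sum.cong refl) (simp add: letters_def coef_def)
 have kaa: "exp_action Ma (a.oper c) a.gvec \<in> carrier Ma" "a.kap (exp_action Ma (a.oper c) a.gvec) j = psi sel_size c j"
  if "j < k" for c j using a.exp_coordinates[OF K that, of c] unfolding Ma sums by (simp_all add: psi_def)
 have kt: "exp_action Mt (t.oper c) t.gvec \<in> carrier Mt" "t.kap (exp_action Mt (t.oper c) t.gvec) j = psi sel_cont c j"
  if "j < k" for c j using t.exp_coordinates[OF K that, of c] unfolding Mt sums by (simp_all add: psi_def)
 \<comment> \<open>The membership part of \<open>exp_coordinates\<close> is stated for an index
   below \<open>k\<close>, so at least one such index must exist; the zero exponent provides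
   it.\<close>
 have k0: "0 < k" using bij_betw_imp_surj_on[OF e] zero_S by (cases k) auto
 have kv: "kvec (mexp (\<Sum>i=1..N. mat_scale (c i) (F i)) *v v) j = psi sel_all c j" if "j < k" for c j
  using exp_coord[OF that, of c] that by (simp add: kvec_def)
 have O: "Orb = {mexp (\<Sum>i=1..N. mat_scale (c i) (F i)) *v v |c. True}" unfolding orbit L_eq by blast
 have la: "lin_coords Ma k a.kap" and lt: "lin_coords Mt k t.kap" unfolding Ma Mt by (rule a.lin.lin_coords_axioms t.lin.lin_coords_axioms)+
 have Ov: "!!x. x \<in> Orb ==> x \<in> carrier vec_space" "!!x. x \<in> Orb ==> EX xi. ALL j<k. kvec x j = psi sel_all xi j"
  "!!xi. EX x:Orb. ALL j<k. kvec x j = psi sel_all xi j" unfolding O using kv by (auto simp: vec_space_def mk_space_simps)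
 have Oa': "!!x. x \<in> Oa ==> x \<in> carrier Ma" "!!x. x \<in> Oa ==> EX xi. ALL j<k. a.kap x j = psi sel_size xi j"
  "!!xi. EX x:Oa. ALL j<k. a.kap x j = psi sel_size xi j" unfolding Oa using kaa k0 by blast+
 have Ot': "!!x. x \<in> Ot ==> x \<in> carrier Mt" "!!x. x \<in> Ot ==> EX xi. ALL j<k. t.kap x j = psi sel_cont xi j"
  "!!xi. EX x:Ot. ALL j<k. t.kap x j = psi sel_cont xi j" unfolding Ot using kt k0 by blast+
 note va = family.degenerations[OF family_size lin_coords_vec la, where Orb = Orb and ?Orb0.0 = Oa, unfolded phi_1]
 note vt = family.degenerations[OF family_order lin_coords_vec lt, where Orb = Orb and ?Orb0.0 = Ot, unfolded phi_1]
 note at = family.degenerations[OF family_size_order la lt, where Orb = Oa and ?Orb0.0 = Ot, unfolded phi_1]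
 have pa: "!!x. x \<in> Oa ==> EX xi. ALL j<k. a.kap x j = phi sel_all wt_size 0 xi j" "!!xi. EX x:Oa. ALL j<k. a.kap x j = phi sel_all wt_size 0 xi j"
  using Oa'(2,3) phi_size_0 by (simp_all cong: conj_cong imp_cong)
 have pt: "!!x. x \<in> Ot ==> EX xi. ALL j<k. t.kap x j = phi sel_all wt_order 0 xi j" "!!xi. EX x:Ot. ALL j<k. t.kap x j = phi sel_all wt_order 0 xi j"
  using Ot'(2,3) phi_order_0 by (simp_all cong: conj_cong imp_cong)
 have pst: "!!x. x \<in> Ot ==> EX xi. ALL j<k. t.kap x j = phi sel_size wt_order 0 xi j" "!!xi. EX x:Ot. ALL j<k. t.kap x j = phi sel_size wt_order 0 xi j"
  using Ot'(2,3) phi_size_order_0 by (simp_all cong: conj_cong imp_cong)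
 show "degenerates_to (cone_variety vec_space Fl) (cone_variety Ma Fa)" unfolding Fl_def Fa by (rule va(1)[OF Ov Oa'(1) pa])
 show "degenerates_to (cone_variety vec_space Fl) (cone_variety Mt Ft)" unfolding Fl_def Ft by (rule vt(1)[OF Ov Ot'(1) pt])
 show "degenerates_to (cone_variety Ma Fa) (cone_variety Mt Ft)" unfolding Fa Ft by (rule at(1)[OF Oa' Ot'(1) pst])
 show "degenerates_to (proj_space_on vec_space Fl) (proj_space_on Ma Fa)" unfolding Fl_def Fa by (rule va(2)[OF Ov Oa'(1) pa])
 show "degenerates_to (proj_space_on vec_space Fl) (proj_space_on Mt Ft)" unfolding Fl_def Ft by (rule vt(2)[OF Ov Ot'(1) pt])
 show "degenerates_to (proj_space_on Ma Fa) (proj_space_on Mt Ft)" unfolding Fa Ft by (rule at(2)[OF Oa' Ot'(1) pst])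
qed

end

theorem theorem8p1:
  fixes G :: "(complex ^ 'n ^ 'n) set"
    and \<rho> :: "complex ^ 'n ^ 'n \<Rightarrow> complex ^ 'm ^ 'm"
    and v :: "complex ^ 'm"
    and N :: nat
    and f :: "nat \<Rightarrow> complex ^ 'n ^ 'n"
    and lt :: "(nat \<Rightarrow> nat) \<Rightarrow> (nat \<Rightarrow> nat) \<Rightarrow> bool"
  defines "\<LL> \<equiv> lie_rep G \<rho> ` lie_algebra G"
    and "F \<equiv> lie_rep G \<rho> \<circ> f"
  defines "Ma \<equiv> Ma_space \<LL> v"
    and "Mt \<equiv> Mt_space N lt F v"
  assumes "unipotent_group G"
    and "rational_rep G \<rho>"
    and "cyclic_vector \<LL> v"
    and "favourable_for G \<rho> v N f lt"
  shows
    "(degenerates_to (cone_variety vec_space (flag_var G \<rho> v)) (cone_variety Ma (flag_var_a \<LL> N F v)) \<and>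
      degenerates_to (cone_variety vec_space (flag_var G \<rho> v)) (cone_variety Mt (flag_var_t N lt F v)) \<and>
      degenerates_to (cone_variety Ma (flag_var_a \<LL> N F v)) (cone_variety Mt (flag_var_t N lt F v))) \<and>
     (degenerates_to (proj_space_on vec_space (flag_var G \<rho> v)) (proj_space_on Ma (flag_var_a \<LL> N F v)) \<and>
      degenerates_to (proj_space_on vec_space (flag_var G \<rho> v)) (proj_space_on Mt (flag_var_t N lt F v)) \<and>
      degenerates_to (proj_space_on Ma (flag_var_a \<LL> N F v)) (proj_space_on Mt (flag_var_t N lt F v)))"
proof -
 interpret rep: unipotent_rep G \<rho> by unfold_locales (fact assms)+
 have fav: "ordered_basis (lie_algebra G) N f" "homogeneous_monomial_order N lt"
  "!!n. tensors.dim (cartan_power \<LL> v n) = card (minkowski_multiple n (essential_exps N lt F v))"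
  using assms(8) by (simp_all add: favourable_for_def Let_def \<LL>_def F_def)
 interpret pbw N lt F v \<LL>
 proof
  show "homogeneous_monomial_order N lt" by (rule fav(2))
  show "\<LL> = {\<Sum>i=1..N. mat_scale (c i) (F i) |c. True}" unfolding \<LL>_def F_def by (rule rep.lie_rep_coordinates[OF fav(1)])
  show "A ** B - B ** A \<in> \<LL>" if "A \<in> \<LL>" "B \<in> \<LL>" for A B using rep.bracket_closed that unfolding \<LL>_def by blast
 qed (fact assms)
 obtain e where e: "bij_betw e {0..<card S} S" using ex_bij_betw_nat_finite[OF finite_S] by blast
 \<comment> \<open>The first summand annihilates every operator of the Lie algebra, the second
   exceeds every degree occurring in \<open>S\<close>.\<close>
 define K where "K = CARD('m) + Suc (Max (size_exp ` S))"
 have fd: "flag_degeneration N lt F v \<LL> (card S) e K"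
 proof unfold_locales
  show "bij_betw e {..<card S} S" using e by (simp add: atLeast0LessThan)
  show "size_exp p < K" if "p \<in> S" for p using Max_ge[OF finite_imageI[OF finite_S], of "size_exp p" size_exp] that by (simp add: K_def)
  show "mpow Y K = 0" if "Y \<in> \<LL>" for Y
  proof (rule mpow_zero_mono)
   show "mpow Y CARD('m) = 0" using that rep.rho_mexp(1) by (auto simp: \<LL>_def)
  qed (simp add: K_def)
  show "tensors.dim (cartan_power \<LL> v n) = card (minkowski_multiple n S)" for n unfolding S_def by (rule fav(3))
 qed
 have "{\<rho> A *v v |A. A \<in> G} = (%B. B *v v) ` (\<rho> ` G)" by blast
 also have "\<dots> = {mexp Y *v v |Y. Y \<in> \<LL>}" unfolding rep.orbit_eq \<LL>_def by blast
 finally have orb: "{\<rho> A *v v |A. A \<in> G} = {mexp Y *v v |Y. Y \<in> \<LL>}" .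
 show ?thesis unfolding flag_var_def Ma_def Mt_def using flag_degeneration.flag_degenerations[OF fd orb] by blast
qed

end
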